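(* Let $\mathcal M$ be a smooth (at least $C^3$), closed, compact immersed surface in $\mathbb R^N$, $N\ge 3$ (not assumed oriented). Let $\mathbf c:[0,L]\to\mathcal M$ be a rectifiable curve with $\mathrm{TC}_{\mathcal M}(\mathbf c)<\infty$, parameterized by arc length, $I_L=(0,L)$, and let $\Theta\in\mathrm{BV}(I_L)$ be the optimal angle function of a weak parallel transport $X$ along $\mathbf c$. Then $$|D^a\Theta|(I_L)=\int_0^L|\dot{\mathbf t}\bullet\mathbf u|\,ds,\qquad |D^C\Theta|(I_L)=|D^C\mathbf t|(I_L),\qquad |D^J\Theta|(I_L)=\sum_{s\in J_{\mathbf t}}d_{\mathbb S^{N-1}}(\mathbf t(s+),\mathbf t(s-)),$$ where $\bullet$ is the scalar product in $\mathbb R^N$, $\mathbf t(s\pm)$ denote the right and left limits of $\mathbf t$ at $s$, and $d_{\mathbb S^{N-1}}$ is the geodesic distance on the unit sphere.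
   Context: Polygonals and total intrinsic curvature. A polygonal in $\mathcal M$ is a finite concatenation of geodesic arcs of $\mathcal M$; its rotation $\mathbf k_{\mathcal M}(P)$ is the sum of the (non-negative) turning angles between consecutive geodesic arcs. $P$ is inscribed in a curve $\mathbf c:[a,b]\to\mathcal M$ if it is obtained by choosing $a\le t_0<t_1<\dots<t_n\le b$ and connecting the consecutive points $\mathbf c(t_i)$ by (length-minimizing) geodesic segments of $\mathcal M$; $\mathcal P_{\mathcal M}(\mathbf c)$ is the class of such polygonals. The modulus $\mu_{\mathbf c}(P)$ is the maximum of the geodesic diameters in $\mathcal M$ of the arcs of $\mathbf c$ determined by consecutive vertices of $P$. The total intrinsic curvature of $\mathbf c$ is $$\mathrm{TC}_{\mathcal M}(\mathbf c):=\lim_{\varepsilon\to0^+}\sup\{\mathbf k_{\mathcal M}(P)\mid P\in\mathcal P_{\mathcal M}(\mathbf c),\ \mu_{\mathbf c}(P)<\varepsilon\}.$$ Frame. $\mathbf t:=\dot{\mathbf c}$ is the tantrix; for rectifiable $\mathbf c$ with $\mathrm{TC}_{\mathcal M}(\mathbf c)<\infty$ it is a function of bounded variation with values in $\mathbb S^{N-1}$, and $\mathbf t(0)$ is its right limit at $0$. $\mathbf u$ is the unit conormal: the unit vector of $T_{\mathbf c(s)}\mathcal M$ orthogonal to $\mathbf t(s)$ obtained by a positive rotation (by $\pi/2$) of $\mathbf t(s)$, with respect to an orientation of the tangent planes chosen continuously along $\mathbf c$. BV notation. For $f\in\mathrm{BV}(I_L,\mathbb R^k)$, $Df=D^af+D^Cf+D^Jf$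 is the decomposition of the distributional derivative into absolutely continuous, Cantor and Jump parts, $D^af=\dot f\,\mathcal L^1$ with $\dot f$ the a.e. derivative, $J_f$ is the (at most countable) Jump set, and $|\mu|(I_L)$ denotes total variation of a measure $\mu$. Weak parallel transport and optimal angle. Along a piecewise smooth curve $P:[0,L]\to\mathcal M$, a parallel transport is a continuous, piecewise smooth $X:[0,L]\to\mathbb R^N$ with $X(s)\in T_{P(s)}\mathcal M$ and $\dot X(s)\perp T_{P(s)}\mathcal M$ away from corner points. Let $\{P_h\}$ be inscribed polygonals from $\mathbf c(0)$ to $\mathbf c(L)$ with $\mu_{\mathbf c}(P_h)\to0$, parameterized on $[0,L]$ with constant velocity, and $X_h$ the parallel transport along $P_h$ with $X_h(0)=\mathbf t(0)$. A subsequence of $\{X_h\}$ converges strongly in $W^{1,1}$ to some $X\in W^{1,1}(I_L,\mathbb R^N)$ of the form $X=\cos\Theta\,\mathbf t-\sin\Theta\,\mathbf u$ a.e. on $I_L$ with $\Theta\in\mathrm{BV}(I_L)$; any such limit $X$ is a weak parallel transport along $\mathbf c$. The angle function $\Theta$ is optimal if, without changing $\cos\Theta,\sin\Theta$ a.e. (i.e. modifying $\Theta$ only by integer multiples of $2\pi$), it is chosen in $\mathrm{BV}(I_L)$ so that $|\Theta(s+)-\Theta(s-)|\le\pi$ at every Jump point $s\in J_\Theta$. *)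

theory Defs
  imports "HOL-Analysis.Analysis"
begin

section \<open>Closed immersed surfaces\<close>

text \<open>\<open>Ck k f S\<close>: class \<open>C\<^sup>k\<close> on the open set \<open>S\<close>.\<close>

primrec Ck :: "nat \<Rightarrow> ('a::real_normed_vector \<Rightarrow> 'b::real_normed_vector) \<Rightarrow> 'a set \<Rightarrow> bool" where
  "Ck 0 f S \<longleftrightarrow> continuous_on S f"
| "Ck (Suc k) f S \<longleftrightarrow> (\<forall>x\<in>S. f differentiable (at x)) \<and>
     (\<forall>v. Ck k (\<lambda>x. frechet_derivative f (at x) v) S)"

text \<open>The abstract surface is the whole type \<open>'m\<close>; its \<open>C\<^sup>3\<close> structure is an atlas \<open>\<A>\<close> of local
  parametrizations \<open>(D, \<phi>)\<close>, and \<open>F\<close> is the immersion. Keeping points of \<open>'m\<close> apart from their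
  images under \<open>F\<close> makes the tangent planes well defined at self-intersections. Curves in the
  surface are maps into \<open>'m\<close>, which \<open>F\<close> sends to curves in \<open>\<real>\<^sup>N\<close>.\<close>

type_synonym 'm atlas = "((real^2) set \<times> (real^2 \<Rightarrow> 'm)) set"

definition C3_atlas :: "'m::topological_space atlas \<Rightarrow> bool" where
  "C3_atlas \<A> \<longleftrightarrow>
     (\<forall>(D, \<phi>)\<in>\<A>. open D \<and> open (\<phi> ` D) \<and> (\<exists>\<psi>. homeomorphism D (\<phi> ` D) \<phi> \<psi>)) \<and>
     (\<Union>(D, \<phi>)\<in>\<A>. \<phi> ` D) = UNIV \<and>
     (\<forall>(D\<^sub>1, \<phi>\<^sub>1)\<in>\<A>. \<forall>(D\<^sub>2, \<phi>\<^sub>2)\<in>\<A>.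
        Ck 3 (inv_into D\<^sub>2 \<phi>\<^sub>2 \<circ> \<phi>\<^sub>1) {x\<in>D\<^sub>1. \<phi>\<^sub>1 x \<in> \<phi>\<^sub>2 ` D\<^sub>2})"

definition closed_immersed_surface :: "'m::t2_space atlas \<Rightarrow> ('m \<Rightarrow> real^'n) \<Rightarrow> bool" where
  "closed_immersed_surface \<A> F \<longleftrightarrow>
     compact (UNIV :: 'm set) \<and> C3_atlas \<A> \<and>
     (\<forall>(D, \<phi>)\<in>\<A>. Ck 3 (F \<circ> \<phi>) D \<and> (\<forall>x\<in>D. inj (frechet_derivative (F \<circ> \<phi>) (at x))))"

definition tangent_plane :: "'m atlas \<Rightarrow> ('m \<Rightarrow> real^'n) \<Rightarrow> 'm \<Rightarrow> (real^'n) set" where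
  "tangent_plane \<A> F p =
     {v. \<exists>(D, \<phi>)\<in>\<A>. \<exists>x\<in>D. \<phi> x = p \<and> v \<in> range (frechet_derivative (F \<circ> \<phi>) (at x))}"


section \<open>Length and geodesics\<close>

definition curve_length :: "real \<Rightarrow> real \<Rightarrow> (real \<Rightarrow> 'a::metric_space) \<Rightarrow> ennreal" where
  "curve_length a b g =
     (SUP (n, s) \<in> {(n::nat, s::nat \<Rightarrow> real). (\<forall>i<n. s i \<le> s (Suc i)) \<and> s ` {..n} \<subseteq> {a..b}}.
        \<Sum>i<n. ennreal (dist (g (s i)) (g (s (Suc i)))))"

definition geodesic_dist :: "('m::topological_space \<Rightarrow> real^'n) \<Rightarrow> 'm \<Rightarrow> 'm \<Rightarrow> ennreal" where
  "geodesic_dist F p q =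
     (INF \<gamma> \<in> {\<gamma>. continuous_on {0..1} \<gamma> \<and> \<gamma> 0 = p \<and> \<gamma> 1 = q}. curve_length 0 1 (F \<circ> \<gamma>))"

definition sphere_dist :: "real^'n \<Rightarrow> real^'n \<Rightarrow> ennreal" where
  "sphere_dist p q =
     (INF \<gamma> \<in> {\<gamma>. continuous_on {0..1} \<gamma> \<and> \<gamma> ` {0..1} \<subseteq> sphere 0 1 \<and> \<gamma> 0 = p \<and> \<gamma> 1 = q}.
        curve_length 0 1 \<gamma>)"

text \<open>The acceleration of a geodesic of an isometrically immersed surface is normal to the surface.
  Constant curves are excluded, so that turning angles between consecutive arcs make sense.\<close>

definition geodesic_arc ::
    "'m::topological_space atlas \<Rightarrow> ('m \<Rightarrow> real^'n) \<Rightarrow> (real \<Rightarrow> 'm) \<Rightarrow> real \<Rightarrow> real \<Rightarrow> bool" where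
  "geodesic_arc \<A> F \<gamma> a b \<longleftrightarrow> a < b \<and> continuous_on {a..b} \<gamma> \<and>
     (\<exists>v w. continuous_on {a..b} w \<and>
        (\<forall>s\<in>{a..b}. (F \<circ> \<gamma> has_vector_derivative v s) (at s within {a..b}) \<and>
                    (v has_vector_derivative w s) (at s within {a..b}) \<and>
                    v s \<noteq> 0 \<and> (\<forall>z\<in>tangent_plane \<A> F (\<gamma> s). w s \<bullet> z = 0)))"

definition minimizing :: "('m::topological_space \<Rightarrow> real^'n) \<Rightarrow> (real \<Rightarrow> 'm) \<Rightarrow> real \<Rightarrow> real \<Rightarrow> bool" where
  "minimizing F \<gamma> a b \<longleftrightarrow> curve_length a b (F \<circ> \<gamma>) = geodesic_dist F (\<gamma> a) (\<gamma> b)"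


section \<open>Polygonals and total intrinsic curvature\<close>

text \<open>The polygonal \<open>P\<close> has the geodesic arcs \<open>P\<close> restricted to \<open>[\<tau> i, \<tau> (i+1)]\<close>, \<open>i < n\<close>.\<close>

definition polygonal ::
    "'m::topological_space atlas \<Rightarrow> ('m \<Rightarrow> real^'n) \<Rightarrow> nat \<Rightarrow> (nat \<Rightarrow> real) \<Rightarrow> (real \<Rightarrow> 'm) \<Rightarrow> bool" where
  "polygonal \<A> F n \<tau> P \<longleftrightarrow> 1 \<le> n \<and> (\<forall>i<n. geodesic_arc \<A> F P (\<tau> i) (\<tau> (Suc i)))"

definition angle :: "real^'n \<Rightarrow> real^'n \<Rightarrow> real" where
  "angle v w = arccos (v \<bullet> w / (norm v * norm w))"

definition rotation ::
    "('m \<Rightarrow> real^'n) \<Rightarrow> nat \<Rightarrow> (nat \<Rightarrow> real) \<Rightarrow> (real \<Rightarrow> 'm) \<Rightarrow> real" where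
  "rotation F n \<tau> P =
     (\<Sum>i=1..<n. angle (vector_derivative (F \<circ> P) (at (\<tau> i) within {\<tau> (i - 1)..\<tau> i}))
                       (vector_derivative (F \<circ> P) (at (\<tau> i) within {\<tau> i..\<tau> (Suc i)})))"

text \<open>\<open>P\<close> is inscribed in \<open>c : [a, b] \<rightarrow> \<M>\<close>, with vertices \<open>c (t 0), \<dots>, c (t n)\<close> attained by \<open>P\<close> at the
  parameters \<open>\<tau> 0, \<dots>, \<tau> n\<close>.\<close>

definition inscribed ::
    "'m::topological_space atlas \<Rightarrow> ('m \<Rightarrow> real^'n) \<Rightarrow> (real \<Rightarrow> 'm) \<Rightarrow> real \<Rightarrow> real \<Rightarrow>
     nat \<Rightarrow> (nat \<Rightarrow> real) \<Rightarrow> (nat \<Rightarrow> real) \<Rightarrow> (real \<Rightarrow> 'm) \<Rightarrow> bool" where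
  "inscribed \<A> F c a b n t \<tau> P \<longleftrightarrow>
     polygonal \<A> F n \<tau> P \<and> a \<le> t 0 \<and> (\<forall>i<n. t i < t (Suc i)) \<and> t n \<le> b \<and>
     (\<forall>i\<le>n. P (\<tau> i) = c (t i)) \<and> (\<forall>i<n. minimizing F P (\<tau> i) (\<tau> (Suc i)))"

definition geodesic_diameter :: "('m::topological_space \<Rightarrow> real^'n) \<Rightarrow> 'm set \<Rightarrow> ennreal" where
  "geodesic_diameter F S = (SUP (p, q) \<in> S \<times> S. geodesic_dist F p q)"

definition modulus ::
    "('m::topological_space \<Rightarrow> real^'n) \<Rightarrow> (real \<Rightarrow> 'm) \<Rightarrow> nat \<Rightarrow> (nat \<Rightarrow> real) \<Rightarrow> ennreal" where
  "modulus F c n t = Max ((\<lambda>i. geodesic_diameter F (c ` {t i..t (Suc i)})) ` {..<n})"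

definition total_intrinsic_curvature ::
    "'m::topological_space atlas \<Rightarrow> ('m \<Rightarrow> real^'n) \<Rightarrow> (real \<Rightarrow> 'm) \<Rightarrow> real \<Rightarrow> real \<Rightarrow> ennreal" where
  "total_intrinsic_curvature \<A> F c a b =
     Lim (at_right 0) (\<lambda>\<epsilon>::real.
       Sup {ennreal (rotation F n \<tau> P) | n t \<tau> P.
              inscribed \<A> F c a b n t \<tau> P \<and> modulus F c n t < ennreal \<epsilon>})"


section \<open>Test functions, weak derivatives and one-sided limits\<close>

text \<open>Functions on an open interval \<open>I\<close> are considered up to null sets.\<close>

definition test_function :: "real set \<Rightarrow> (real \<Rightarrow> real) \<Rightarrow> bool" where
  "test_function I \<phi> \<longleftrightarrow> (\<forall>k. Ck k \<phi> UNIV) \<and> (\<exists>K. compact K \<and> K \<subseteq> I \<and> (\<forall>x. x \<notin> K \<longrightarrow> \<phi> x = 0))"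

definition weak_deriv :: "real set \<Rightarrow> (real \<Rightarrow> 'b::euclidean_space) \<Rightarrow> (real \<Rightarrow> 'b) \<Rightarrow> bool" where
  "weak_deriv I f g \<longleftrightarrow>
     integrable (lebesgue_on I) f \<and> integrable (lebesgue_on I) g \<and>
     (\<forall>\<phi>. test_function I \<phi> \<longrightarrow>
        (LINT x|lebesgue_on I. deriv \<phi> x *\<^sub>R f x) = - (LINT x|lebesgue_on I. \<phi> x *\<^sub>R g x))"

text \<open>Strong convergence in \<open>W\<^sup>1\<^sup>,\<^sup>1(I)\<close>; this includes that \<open>f\<close> and all \<open>fs h\<close> belong to it.\<close>

definition W11_tendsto ::
    "real set \<Rightarrow> (nat \<Rightarrow> real \<Rightarrow> 'b::euclidean_space) \<Rightarrow> (real \<Rightarrow> 'b) \<Rightarrow> bool" where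
  "W11_tendsto I fs f \<longleftrightarrow>
     (\<exists>gs g. (\<forall>h. weak_deriv I (fs h) (gs h)) \<and> weak_deriv I f g \<and>
        (\<lambda>h. (LINT x|lebesgue_on I. norm (fs h x - f x)) +
             (LINT x|lebesgue_on I. norm (gs h x - g x))) \<longlonglongrightarrow> 0)"

text \<open>One-sided limits that do not depend on the representative of \<open>f\<close>; for a function of bounded
  variation they are the one-sided limits of any good representative.\<close>

definition ess_right_lim :: "(real \<Rightarrow> 'b::metric_space) \<Rightarrow> real \<Rightarrow> 'b \<Rightarrow> bool" where
  "ess_right_lim f s l \<longleftrightarrow>
     (\<forall>\<epsilon>>0. \<exists>\<delta>>0. AE r in lebesgue. s < r \<and> r < s + \<delta> \<longrightarrow> dist (f r) l < \<epsilon>)"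

definition ess_left_lim :: "(real \<Rightarrow> 'b::metric_space) \<Rightarrow> real \<Rightarrow> 'b \<Rightarrow> bool" where
  "ess_left_lim f s l \<longleftrightarrow>
     (\<forall>\<epsilon>>0. \<exists>\<delta>>0. AE r in lebesgue. s - \<delta> < r \<and> r < s \<longrightarrow> dist (f r) l < \<epsilon>)"

definition rlim :: "(real \<Rightarrow> 'b::metric_space) \<Rightarrow> real \<Rightarrow> 'b" where
  "rlim f s = (THE l. ess_right_lim f s l)"

definition llim :: "(real \<Rightarrow> 'b::metric_space) \<Rightarrow> real \<Rightarrow> 'b" where
  "llim f s = (THE l. ess_left_lim f s l)"

definition jump_set :: "real set \<Rightarrow> (real \<Rightarrow> 'b::metric_space) \<Rightarrow> real set" where
  "jump_set I f = {s\<in>I. \<exists>l r. ess_left_lim f s l \<and> ess_right_lim f s r \<and> l \<noteq> r}"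

text \<open>The a.e. derivative of a function of bounded variation, computed on its right-continuous
  representative.\<close>

definition ae_deriv :: "(real \<Rightarrow> 'b::real_normed_vector) \<Rightarrow> real \<Rightarrow> 'b" where
  "ae_deriv f s = vector_derivative (rlim f) (at s)"


section \<open>Functions of bounded variation\<close>

text \<open>Vector measures on the Borel subsets of \<open>I\<close>; for definiteness they vanish on all other sets.\<close>

definition vector_measure :: "real set \<Rightarrow> (real set \<Rightarrow> 'b::euclidean_space) \<Rightarrow> bool" where
  "vector_measure I \<mu> \<longleftrightarrow>
     (\<forall>A. A \<notin> sets (restrict_space borel I) \<longrightarrow> \<mu> A = 0) \<and>
     (\<forall>A::nat \<Rightarrow> real set. range A \<subseteq> sets (restrict_space borel I) \<and> disjoint_family A \<longrightarrow>
        (\<lambda>n. \<mu> (A n)) sums \<mu> (\<Union>n. A n))"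

definition total_variation :: "(real set \<Rightarrow> 'b::euclidean_space) \<Rightarrow> real set \<Rightarrow> ennreal" where
  "total_variation \<mu> B =
     (SUP A \<in> {A::nat \<Rightarrow> real set. range A \<subseteq> sets borel \<and> disjoint_family A \<and> (\<Union>n. A n) = B}.
        \<Sum>n. ennreal (norm (\<mu> (A n))))"

text \<open>\<open>\<integral> \<phi> d\<mu> = y\<close>, through a density \<open>\<mu> = \<sigma> m\<close> with respect to a finite positive measure \<open>m\<close>, such
  as the polar decomposition with \<open>m = |\<mu>|\<close>; \<open>y\<close> does not depend on the choice of \<open>m\<close> and \<open>\<sigma>\<close>.\<close>

definition has_vm_integral ::
    "real set \<Rightarrow> (real set \<Rightarrow> 'b::euclidean_space) \<Rightarrow> (real \<Rightarrow> real) \<Rightarrow> 'b \<Rightarrow> bool" where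
  "has_vm_integral I \<mu> \<phi> y \<longleftrightarrow>
     (\<exists>m \<sigma>. finite_measure m \<and> sets m = sets (restrict_space borel I) \<and> integrable m \<sigma> \<and>
        (\<forall>A\<in>sets m. \<mu> A = (LINT x:A|m. \<sigma> x)) \<and>
        integrable m (\<lambda>x. \<phi> x *\<^sub>R \<sigma> x) \<and> y = (LINT x|m. \<phi> x *\<^sub>R \<sigma> x))"

definition is_distr_deriv ::
    "real set \<Rightarrow> (real \<Rightarrow> 'b::euclidean_space) \<Rightarrow> (real set \<Rightarrow> 'b) \<Rightarrow> bool" where
  "is_distr_deriv I f \<mu> \<longleftrightarrow> vector_measure I \<mu> \<and>
     (\<forall>\<phi>. test_function I \<phi> \<longrightarrow>
        has_vm_integral I \<mu> \<phi> (- (LINT x|lebesgue_on I. deriv \<phi> x *\<^sub>R f x)))"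

definition BV :: "real set \<Rightarrow> (real \<Rightarrow> 'b::euclidean_space) \<Rightarrow> bool" where
  "BV I f \<longleftrightarrow> integrable (lebesgue_on I) f \<and> (\<exists>\<mu>. is_distr_deriv I f \<mu>)"

definition distr_deriv :: "real set \<Rightarrow> (real \<Rightarrow> 'b::euclidean_space) \<Rightarrow> real set \<Rightarrow> 'b" where
  "distr_deriv I f = (THE \<mu>. is_distr_deriv I f \<mu>)"

definition vm_abs_cont :: "(real set \<Rightarrow> 'b::euclidean_space) \<Rightarrow> bool" where
  "vm_abs_cont \<nu> \<longleftrightarrow> (\<forall>A\<in>null_sets lborel. \<nu> A = 0)"

definition vm_singular :: "real set \<Rightarrow> (real set \<Rightarrow> 'b::euclidean_space) \<Rightarrow> bool" where
  "vm_singular I \<nu> \<longleftrightarrow>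
     (\<exists>N\<in>null_sets lborel. \<forall>A\<in>sets (restrict_space borel I). \<nu> A = \<nu> (A \<inter> N))"

text \<open>\<open>D\<^sup>af\<close> is the absolutely continuous part of \<open>Df\<close> in its Lebesgue decomposition; the singular part
  is split into its restrictions to the jump set and to the complement of the jump set.\<close>

definition D_ac :: "real set \<Rightarrow> (real \<Rightarrow> 'b::euclidean_space) \<Rightarrow> real set \<Rightarrow> 'b" where
  "D_ac I f = (THE \<nu>. vector_measure I \<nu> \<and> vm_abs_cont \<nu> \<and>
                      vm_singular I (\<lambda>A. distr_deriv I f A - \<nu> A))"

definition D_sing :: "real set \<Rightarrow> (real \<Rightarrow> 'b::euclidean_space) \<Rightarrow> real set \<Rightarrow> 'b" where
  "D_sing I f A = distr_deriv I f A - D_ac I f A"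

definition D_jump :: "real set \<Rightarrow> (real \<Rightarrow> 'b::euclidean_space) \<Rightarrow> real set \<Rightarrow> 'b" where
  "D_jump I f A = D_sing I f (A \<inter> jump_set I f)"

definition D_cantor :: "real set \<Rightarrow> (real \<Rightarrow> 'b::euclidean_space) \<Rightarrow> real set \<Rightarrow> 'b" where
  "D_cantor I f A = D_sing I f (A - jump_set I f)"


section \<open>Tantrix, conormal, weak parallel transport and angle function\<close>

definition arc_length_curve ::
    "('m::topological_space \<Rightarrow> real^'n) \<Rightarrow> (real \<Rightarrow> 'm) \<Rightarrow> real \<Rightarrow> bool" where
  "arc_length_curve F c L \<longleftrightarrow> 0 < L \<and> continuous_on {0..L} c \<and>
     (\<forall>s\<in>{0..L}. curve_length 0 s (F \<circ> c) = ennreal s)"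

definition tantrix :: "('m \<Rightarrow> real^'n) \<Rightarrow> (real \<Rightarrow> 'm) \<Rightarrow> real \<Rightarrow> real^'n" where
  "tantrix F c s = vector_derivative (F \<circ> c) (at s)"

text \<open>An orientation of the tangent planes chosen continuously along \<open>c : [0, L] \<rightarrow> \<M>\<close> is given by a
  continuous orthonormal frame \<open>(e\<^sub>1, e\<^sub>2)\<close>, declared to be positively oriented. The surface itself need
  not be orientable.\<close>

definition orienting_frame ::
    "'m atlas \<Rightarrow> ('m \<Rightarrow> real^'n) \<Rightarrow> (real \<Rightarrow> 'm) \<Rightarrow> real \<Rightarrow>
     (real \<Rightarrow> real^'n) \<Rightarrow> (real \<Rightarrow> real^'n) \<Rightarrow> bool" where
  "orienting_frame \<A> F c L e\<^sub>1 e\<^sub>2 \<longleftrightarrow> continuous_on {0..L} e\<^sub>1 \<and> continuous_on {0..L} e\<^sub>2 \<and>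
     (\<forall>s\<in>{0..L}. norm (e\<^sub>1 s) = 1 \<and> norm (e\<^sub>2 s) = 1 \<and> e\<^sub>1 s \<bullet> e\<^sub>2 s = 0 \<and>
                 span {e\<^sub>1 s, e\<^sub>2 s} = tangent_plane \<A> F (c s))"

text \<open>Rotation of the tantrix by \<open>\<pi>/2\<close>, taking \<open>e\<^sub>1\<close> to \<open>e\<^sub>2\<close> and \<open>e\<^sub>2\<close> to \<open>-e\<^sub>1\<close>.\<close>

definition conormal ::
    "('m \<Rightarrow> real^'n) \<Rightarrow> (real \<Rightarrow> 'm) \<Rightarrow> (real \<Rightarrow> real^'n) \<Rightarrow> (real \<Rightarrow> real^'n) \<Rightarrow> real \<Rightarrow> real^'n" where
  "conormal F c e\<^sub>1 e\<^sub>2 s = (tantrix F c s \<bullet> e\<^sub>1 s) *\<^sub>R e\<^sub>2 s - (tantrix F c s \<bullet> e\<^sub>2 s) *\<^sub>R e\<^sub>1 s"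

text \<open>The finite set \<open>S\<close> contains the corner points.\<close>

definition parallel_transport ::
    "'m atlas \<Rightarrow> ('m \<Rightarrow> real^'n) \<Rightarrow> real \<Rightarrow> (real \<Rightarrow> 'm) \<Rightarrow> (real \<Rightarrow> real^'n) \<Rightarrow> bool" where
  "parallel_transport \<A> F L P X \<longleftrightarrow> continuous_on {0..L} X \<and>
     (\<forall>s\<in>{0..L}. X s \<in> tangent_plane \<A> F (P s)) \<and>
     (\<exists>S. finite S \<and> X C1_differentiable_on ({0..L} - S) \<and>
        (\<forall>s\<in>{0..L} - S. \<forall>z\<in>tangent_plane \<A> F (P s). vector_derivative X (at s) \<bullet> z = 0))"

definition const_velocity :: "('m \<Rightarrow> real^'n) \<Rightarrow> nat \<Rightarrow> (nat \<Rightarrow> real) \<Rightarrow> (real \<Rightarrow> 'm) \<Rightarrow> bool" where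
  "const_velocity F n \<tau> P \<longleftrightarrow>
     (\<exists>v. \<forall>i<n. \<forall>s\<in>{\<tau> i..\<tau> (Suc i)}.
        norm (vector_derivative (F \<circ> P) (at s within {\<tau> i..\<tau> (Suc i)})) = v)"

definition weak_parallel_transport ::
    "'m::topological_space atlas \<Rightarrow> ('m \<Rightarrow> real^'n) \<Rightarrow> (real \<Rightarrow> 'm) \<Rightarrow> real \<Rightarrow>
     (real \<Rightarrow> real^'n) \<Rightarrow> bool" where
  "weak_parallel_transport \<A> F c L X \<longleftrightarrow>
     (\<exists>n t \<tau> P Xs r.
        (\<forall>h. inscribed \<A> F c 0 L (n h) (t h) (\<tau> h) (P h) \<and> t h 0 = 0 \<and> t h (n h) = L \<and>
             \<tau> h 0 = 0 \<and> \<tau> h (n h) = L \<and> const_velocity F (n h) (\<tau> h) (P h) \<and>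
             parallel_transport \<A> F L (P h) (Xs h) \<and> Xs h 0 = rlim (tantrix F c) 0) \<and>
        (\<lambda>h. modulus F c (n h) (t h)) \<longlonglongrightarrow> 0 \<and>
        strict_mono (r :: nat \<Rightarrow> nat) \<and> W11_tendsto {0<..<L} (\<lambda>h. Xs (r h)) X)"

definition angle_function ::
    "('m \<Rightarrow> real^'n) \<Rightarrow> (real \<Rightarrow> 'm) \<Rightarrow> real \<Rightarrow> (real \<Rightarrow> real^'n) \<Rightarrow> (real \<Rightarrow> real^'n) \<Rightarrow>
     (real \<Rightarrow> real^'n) \<Rightarrow> (real \<Rightarrow> real) \<Rightarrow> bool" where
  "angle_function F c L e\<^sub>1 e\<^sub>2 X \<Theta> \<longleftrightarrow> BV {0<..<L} \<Theta> \<and>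
     (AE s in lebesgue_on {0<..<L}.
        X s = cos (\<Theta> s) *\<^sub>R tantrix F c s - sin (\<Theta> s) *\<^sub>R conormal F c e\<^sub>1 e\<^sub>2 s)"

definition optimal_angle_function ::
    "('m \<Rightarrow> real^'n) \<Rightarrow> (real \<Rightarrow> 'm) \<Rightarrow> real \<Rightarrow> (real \<Rightarrow> real^'n) \<Rightarrow> (real \<Rightarrow> real^'n) \<Rightarrow>
     (real \<Rightarrow> real^'n) \<Rightarrow> (real \<Rightarrow> real) \<Rightarrow> bool" where
  "optimal_angle_function F c L e\<^sub>1 e\<^sub>2 X \<Theta> \<longleftrightarrow> angle_function F c L e\<^sub>1 e\<^sub>2 X \<Theta> \<and>
     (\<forall>s\<in>jump_set {0<..<L} \<Theta>. \<bar>rlim \<Theta> s - llim \<Theta> s\<bar> \<le> pi)"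

end

theory Submission
  imports Defs
begin

text \<open>
  The rotation by \<open>\<pi>/2\<close> in the tangent planes along \<open>c\<close> is a Lipschitz function of the parameter: in a
  chart it is obtained from the derivative of the immersion at a Lipschitz curve of coordinates.
  The limit \<open>X\<close> is absolutely continuous, and \<open>X'\<close> is normal to the surface because the polygonals
  converge uniformly to \<open>c\<close> with almost the same parametrization. Hence \<open>X\<close> and the rotated field \<open>Y\<close>
  form an absolutely continuous orthonormal frame of the tangent planes whose derivatives are a.e.
  normal to both, and \<open>t = cos \<Theta> X + sin \<Theta> Y\<close>, \<open>u = cos \<Theta> Y - sin \<Theta> X\<close>.

  With \<open>D\<Theta> = \<sigma> M\<close>, the product and chain rules for BV functions give a density of \<open>Dt\<close> with respect
  to \<open>M\<close>. Its absolutely continuous part has component \<open>\<sigma>\<close> along \<open>u\<close>, its Cantor part has norm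
  \<open>\<bar>\<sigma>\<bar>\<close>, and at a jump \<open>t(s\<plusminus>)\<close> lie on a great circle at the angles \<open>\<Theta>(s\<plusminus>)\<close>, so that their spherical
  distance is \<open>\<bar>\<Theta>(s+) - \<Theta>(s-)\<bar>\<close> because this is at most \<open>\<pi>\<close>.
\<close>

section \<open>Test functions\<close>

text \<open>The orienting frame is only continuous, so fields along the curve cannot be
  differentiated in it. The quarter turn composed with the projection onto the tangent plane depends
  only on the oriented plane and not on the frame; it can therefore be computed in a chart, where
  the given frame only decides the sign of a determinant. This is how \<open>Y\<close> becomes
  absolutely continuous.

  A second obstacle is that the immersion may have self-intersections: closeness of images under
  \<open>F\<close> does not place two points in the same chart. Connected sets joining the
  polygonals to the curve carry this information into the limit of the tangent planes.

  The bound on the jumps of \<open>\<Theta>\<close> matters not only for the spherical distance: it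
  excludes jumps by multiples of 2\<pi>, which \<open>t\<close> would not see, so that
  \<open>t\<close> and \<open>\<Theta>\<close> have the same jump set.

  Derivatives, their parts and one-sided limits are given by unique description, so uniqueness of
  distributional derivatives, of Lebesgue decompositions and of essential limits comes before any
  computation.\<close>

lemma Ck_cmult:
  fixes f :: "real \<Rightarrow> real"
  assumes "Ck k f UNIV" shows "Ck k (\<lambda>x. f x * c) UNIV"
  using assms
proof (induction k arbitrary: f)
  case 0 then show ?case by (auto intro: continuous_intros)
next
  case (Suc k)
  have d: "((\<lambda>x. f x * c) has_derivative (\<lambda>v. frechet_derivative f (at x) v * c)) (at x)" for x
    using Suc.prems by (auto intro!: derivative_eq_intros simp: frechet_derivative_works)
  then have "frechet_derivative (\<lambda>x. f x * c) (at x) = (\<lambda>v. frechet_derivative f (at x) v * c)" for x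
    by (metis frechet_derivative_at)
  then show ?case using Suc d by (auto simp: differentiable_def)
qed

text \<open>A directional derivative on the line is a scalar times the one in direction 1, so a
  single function \<open>f'\<close> can replace the family over all \<open>v\<close> in the
  definition of \<open>Ck\<close>. The closure properties below then go by induction on
  \<open>k\<close>.\<close>

lemma Ck_Suc_real:
  fixes f :: "real \<Rightarrow> real"
  shows "Ck (Suc k) f UNIV \<longleftrightarrow> (\<exists>f'. (\<forall>x. (f has_real_derivative f' x) (at x)) \<and> Ck k f' UNIV)"
proof
  assume *: "Ck (Suc k) f UNIV"
  have "(f has_real_derivative frechet_derivative f (at x) 1) (at x)" for x
  proof -
    have "(f has_derivative frechet_derivative f (at x)) (at x)"
      using * by (simp add: frechet_derivative_works)
    moreover have "frechet_derivative f (at x) = (*) (frechet_derivative f (at x) 1)"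
      using linear_frechet_derivative[of f "at x"] *
      by (auto simp: fun_eq_iff linear_times_of_real linear_iff)
        (metis mult.commute mult.right_neutral real_scaleR_def)
    ultimately show ?thesis by (simp add: has_field_derivative_def)
  qed
  then show "\<exists>f'. (\<forall>x. (f has_real_derivative f' x) (at x)) \<and> Ck k f' UNIV"
    using * by (intro exI[of _ "\<lambda>x. frechet_derivative f (at x) 1"]) auto
next
  assume "\<exists>f'. (\<forall>x. (f has_real_derivative f' x) (at x)) \<and> Ck k f' UNIV"
  then obtain f' where f': "\<And>x. (f has_real_derivative f' x) (at x)" "Ck k f' UNIV" by auto
  have "frechet_derivative f (at x) = (\<lambda>v. f' x * v)" for x
    using f'(1)[of x] by (metis frechet_derivative_at has_field_derivative_def)
  then show "Ck (Suc k) f UNIV"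
    using f' by (auto intro!: Ck_cmult simp: differentiable_def has_field_derivative_def)
qed

lemma Ck_add:
  fixes f g :: "real \<Rightarrow> real"
  assumes "Ck k f UNIV" "Ck k g UNIV" shows "Ck k (\<lambda>x. f x + g x) UNIV"
  using assms
proof (induction k arbitrary: f g)
  case 0 then show ?case by (auto intro: continuous_intros)
next
  case (Suc k)
  obtain f' g' where *: "\<And>x. (f has_real_derivative f' x) (at x)" "Ck k f' UNIV"
      "\<And>x. (g has_real_derivative g' x) (at x)" "Ck k g' UNIV"
    using Suc.prems unfolding Ck_Suc_real by blast
  show ?case unfolding Ck_Suc_real
    by (rule exI[of _ "\<lambda>x. f' x + g' x"]) (auto intro!: Suc.IH * derivative_eq_intros)
qed

lemma Ck_SucD:
  fixes f :: "real \<Rightarrow> real"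
  shows "Ck (Suc k) f UNIV \<Longrightarrow> Ck k f UNIV"
proof (induction k arbitrary: f)
  case 0 then show ?case
    by (metis Ck.simps(1) Ck_Suc_real DERIV_isCont continuous_at_imp_continuous_on)
next
  case (Suc k) then show ?case by (metis Ck_Suc_real)
qed

lemma Ck_mult:
  fixes f g :: "real \<Rightarrow> real"
  assumes "Ck k f UNIV" "Ck k g UNIV" shows "Ck k (\<lambda>x. f x * g x) UNIV"
  using assms
proof (induction k arbitrary: f g)
  case 0 then show ?case by (auto intro: continuous_intros)
next
  case (Suc k)
  obtain f' g' where *: "\<And>x. (f has_real_derivative f' x) (at x)" "Ck k f' UNIV"
      "\<And>x. (g has_real_derivative g' x) (at x)" "Ck k g' UNIV"
    using Suc.prems unfolding Ck_Suc_real by blast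
  show ?case unfolding Ck_Suc_real
    by (rule exI[of _ "\<lambda>x. f x * g' x + f' x * g x"])
      (use Suc.prems[THEN Ck_SucD] in \<open>auto intro!: Ck_add Suc.IH * derivative_eq_intros\<close>)
qed

lemma Ck_affine:
  fixes f :: "real \<Rightarrow> real"
  assumes "Ck k f UNIV" shows "Ck k (\<lambda>x. f (m * x + c)) UNIV"
  using assms
proof (induction k arbitrary: f)
  case 0 then show ?case
    by (auto intro!: continuous_intros continuous_on_compose2[of UNIV f])
next
  case (Suc k)
  obtain f' where *: "\<And>x. (f has_real_derivative f' x) (at x)" "Ck k f' UNIV"
    using Suc.prems unfolding Ck_Suc_real by blast
  show ?case unfolding Ck_Suc_real
    by (rule exI[of _ "\<lambda>x. f' (m * x + c) * m"])
      (auto intro!: Ck_cmult Suc.IH * derivative_eq_intros DERIV_chain2[of f])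
qed

text \<open>The functions x^(-n) exp (-1/x), extended by 0. The exponent \<open>n\<close> is there
  because their span is closed under differentiation; \<open>n = 0\<close> is the classical smooth
  function that is flat at the origin.\<close>

definition flat_exp :: "nat \<Rightarrow> real \<Rightarrow> real" where
  "flat_exp n x = (if x > 0 then (1/x)^n * exp (- (1/x)) else 0)"

lemma tendsto_flat_exp_0: "(flat_exp n \<longlongrightarrow> 0) (at 0)"
proof (rule filterlim_split_at)
  show "(flat_exp n \<longlongrightarrow> 0) (at_left 0)"
    by (rule tendsto_eventually) (auto simp: flat_exp_def eventually_at_filter)
  have "((\<lambda>y::real. y^n / exp y) \<longlongrightarrow> 0) at_top" by (rule tendsto_power_div_exp_0)
  moreover have "LIM x at_right 0. 1/x :> (at_top :: real filter)"
    by (simp add: filterlim_inverse_at_top_right divide_inverse)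
  ultimately have "((\<lambda>x::real. (1/x)^n / exp (1/x)) \<longlongrightarrow> 0) (at_right 0)"
    by (rule filterlim_compose)
  then show "(flat_exp n \<longlongrightarrow> 0) (at_right 0)"
    by (rule Lim_transform_eventually)
      (auto simp: flat_exp_def eventually_at_filter exp_minus divide_inverse)
qed

lemma flat_exp_has_derivative:
  "(flat_exp n has_real_derivative (flat_exp (n+1) x * (- real n) + flat_exp (n+2) x)) (at x)"
proof -
  consider "x > 0" | "x < 0" | "x = 0" by linarith
  then show ?thesis
  proof cases
    case 1
    define y where "y = 1/x"
    have d1: "((\<lambda>x. 1/x) has_real_derivative (- (y^2))) (at x)"
      using 1 by (auto intro!: derivative_eq_intros simp: y_def power2_eq_square)
    have d2: "((\<lambda>x. exp (- (1/x))) has_real_derivative exp (- y) * y^2) (at x)"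
      using DERIV_fun_exp[OF DERIV_minus[OF d1]] by (simp add: y_def)
    have "real n * (- (y^2) * y ^ (n - Suc 0)) * exp (- y) + exp (- y) * y^2 * y^n
        = y^(n+1) * exp (- y) * (- real n) + y^(n+2) * exp (- y)"
      by (cases n) (simp_all add: algebra_simps power2_eq_square)
    moreover have "flat_exp m x = y^m * exp (- y)" for m using 1 by (simp add: flat_exp_def y_def)
    ultimately have "((\<lambda>x. (1/x)^n * exp (- (1/x))) has_real_derivative
        (flat_exp (n+1) x * (- real n) + flat_exp (n+2) x)) (at x)"
      by (intro DERIV_cong[OF DERIV_mult'[OF DERIV_power[OF d1, of n] d2]])
        (simp add: algebra_simps flip: y_def)
    then show ?thesis
      by (rule has_field_derivative_transform_within_open[where S="{0<..}"])
        (use 1 in \<open>auto simp: flat_exp_def\<close>)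
  next
    case 2
    have "((\<lambda>x. 0) has_real_derivative (flat_exp (n+1) x * (- real n) + flat_exp (n+2) x)) (at x)"
      using 2 by (simp add: flat_exp_def)
    then show ?thesis
      by (rule has_field_derivative_transform_within_open[where S="{..<0}"])
        (use 2 in \<open>auto simp: flat_exp_def\<close>)
  next
    case 3
    \<comment> \<open>The difference quotient of \<open>flat_exp n\<close> at the origin is
      \<open>flat_exp (Suc n)\<close>.\<close>
    have "((\<lambda>y. (flat_exp n y - flat_exp n 0) / (y - 0)) \<longlongrightarrow> 0) (at 0)"
      by (rule Lim_transform_eventually[OF tendsto_flat_exp_0[of "Suc n"]])
        (auto simp: flat_exp_def eventually_at_filter)
    then show ?thesis using 3 by (simp add: has_field_derivative_iff flat_exp_def)
  qed
qed

lemma Ck_flat_exp: "Ck k (flat_exp n) UNIV"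
proof (induction k arbitrary: n)
  case 0 show ?case
    by (auto intro!: continuous_at_imp_continuous_on DERIV_isCont[OF flat_exp_has_derivative])
next
  case (Suc k) show ?case unfolding Ck_Suc_real
    by (rule exI[of _ "\<lambda>x. flat_exp (n+1) x * (- real n) + flat_exp (n+2) x"])
      (intro conjI allI flat_exp_has_derivative Ck_add Ck_cmult Suc)
qed

text \<open>Since exp (-1/y) tends to 1 for large y, the dilation by \<open>Suc n\<close> makes
  these test functions converge to the indicator of \<open>{a<..<b}\<close> while staying below it.
  This lets weak identities be tested on intervals.\<close>

definition bump :: "real \<Rightarrow> real \<Rightarrow> nat \<Rightarrow> real \<Rightarrow> real" where
  "bump a b n x = flat_exp 0 (real (Suc n) * (x - a)) * flat_exp 0 (real (Suc n) * (b - x))"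

lemma test_function_bump:
  assumes "{a..b} \<subseteq> I" shows "test_function I (bump a b n)"
proof -
  have "Ck k (bump a b n) UNIV" for k
    using Ck_mult[OF Ck_affine[OF Ck_flat_exp, of k 0 "real (Suc n)" "- real (Suc n) * a"]
        Ck_affine[OF Ck_flat_exp, of k 0 "- real (Suc n)" "real (Suc n) * b"]]
    unfolding bump_def by (simp add: algebra_simps)
  moreover have "bump a b n x = 0" if "x \<notin> {a..b}" for x
    using that by (auto simp: bump_def flat_exp_def zero_less_mult_iff)
  ultimately show ?thesis
    unfolding test_function_def using assms by blast
qed

lemma bump_nonneg: "0 \<le> bump a b n x" and bump_le: "bump a b n x \<le> indicator {a<..<b} x"
proof -
  have *: "0 \<le> flat_exp 0 y" "flat_exp 0 y \<le> 1" for y by (auto simp: flat_exp_def)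
  show "0 \<le> bump a b n x" using * by (simp add: bump_def)
  show "bump a b n x \<le> indicator {a<..<b} x"
    using * by (auto simp: bump_def indicator_def mult_le_one) (auto simp: flat_exp_def zero_less_mult_iff)
qed

lemma bump_tendsto: "(\<lambda>n. bump a b n x) \<longlonglongrightarrow> indicator {a<..<b} x"
proof (cases "x \<in> {a<..<b}")
  case True
  have *: "(\<lambda>n. flat_exp 0 (real (Suc n) * d)) \<longlonglongrightarrow> 1" if "d > 0" for d
  proof -
    have "(\<lambda>n. exp (- (inverse (real (Suc n)) * (1/d)))) \<longlonglongrightarrow> exp (- (0 * (1/d)))"
      by (intro tendsto_intros LIMSEQ_inverse_real_of_nat)
    then show ?thesis using that by (simp add: flat_exp_def divide_inverse)
  qed
  show ?thesis using tendsto_mult[OF *[of "x - a"] *[of "b - x"]] True by (simp add: bump_def)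
next
  case False
  then have "bump a b n x = 0" for n
    using bump_nonneg[of a b n x] bump_le[of a b n x] by simp
  then show ?thesis using False by simp
qed

lemma test_functionD:
  assumes "test_function I \<phi>"
  shows "(\<phi> has_real_derivative deriv \<phi> x) (at x)" "continuous_on UNIV \<phi>" "continuous_on UNIV (deriv \<phi>)"
proof -
  have "Ck (Suc 0) \<phi> UNIV" using assms by (auto simp: test_function_def)
  then obtain f' where f': "\<And>x. (\<phi> has_real_derivative f' x) (at x)" "Ck 0 f' UNIV"
    unfolding Ck_Suc_real by blast
  then have "f' = deriv \<phi>" by (auto simp: fun_eq_iff intro!: DERIV_imp_deriv[symmetric])
  then show "(\<phi> has_real_derivative deriv \<phi> x) (at x)" "continuous_on UNIV \<phi>"
    "continuous_on UNIV (deriv \<phi>)"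
    using f' by (auto intro!: continuous_at_imp_continuous_on DERIV_isCont)
qed

text \<open>The compact support is enclosed in a nondegenerate closed interval, even when it is
  empty, so that later proofs can split on membership in \<open>{l..r}\<close>.\<close>

lemma test_function_support:
  assumes "test_function {a<..<b} \<phi>" "a < b"
  obtains l r where "a < l" "l < r" "r < b" "\<And>x. x \<notin> {l..r} \<Longrightarrow> \<phi> x = 0"
    "\<And>x. x \<notin> {l..r} \<Longrightarrow> deriv \<phi> x = 0"
proof -
  obtain K where K: "compact K" "K \<subseteq> {a<..<b}" "\<And>x. x \<notin> K \<Longrightarrow> \<phi> x = 0"
    using assms by (auto simp: test_function_def)
  obtain l r where lr: "a < l" "l < r" "r < b" "K \<subseteq> {l..r}"
  proof (cases "K = {}")
    case True
    obtain l where "a < l" "l < b" using dense assms(2) by blast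
    moreover then obtain r where "l < r" "r < b" using dense by blast
    ultimately show ?thesis using that True by blast
  next
    case False
    obtain p q where "p \<in> K" "q \<in> K" "\<And>x. x \<in> K \<Longrightarrow> p \<le> x \<and> x \<le> q"
      using compact_attains_inf[OF K(1) False] compact_attains_sup[OF K(1) False] by blast
    moreover then have "a < p" "p \<le> q" "q < b" using K(2) by auto
    moreover obtain r where "q < r" "r < b" using dense \<open>q < b\<close> by blast
    ultimately show ?thesis using that[of p r] by fastforce
  qed
  have 1: "\<phi> x = 0" if "x \<notin> {l..r}" for x using K(3) lr(4) that by blast
  have "deriv \<phi> x = 0" if "x \<notin> {l..r}" for x
  proof -
    have "((\<lambda>x. 0) has_real_derivative 0) (at x)" by simp
    then have "(\<phi> has_real_derivative 0) (at x)"
      by (rule has_field_derivative_transform_within_open[where S="- {l..r}"])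
        (use that 1 in \<open>auto simp: open_Compl\<close>)
    then show ?thesis by (rule DERIV_imp_deriv)
  qed
  with 1 lr that show ?thesis by blast
qed

section \<open>Differentiation of indefinite integrals\<close>

lemma integrable_imp_set_integrable:
  fixes f :: "'a \<Rightarrow> 'b::{banach, second_countable_topology}"
  shows "integrable M f \<Longrightarrow> A \<in> sets M \<Longrightarrow> set_integrable M A f"
  unfolding set_integrable_def by (rule integrable_mult_indicator)

lemma has_vector_derivative_epsI:
  assumes "\<And>e. 0 < e \<Longrightarrow> \<exists>d>0. \<forall>y. \<bar>y - x\<bar> < d \<longrightarrow> norm (f y - f x - (y - x) *\<^sub>R l) \<le> e * \<bar>y - x\<bar>"
  shows "(f has_vector_derivative l) (at x)"
  unfolding has_vector_derivative_def has_derivative_within_alt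
  using assms by (auto intro: bounded_linear_scaleR_left)

text \<open>Lebesgue differentiation without division by \<open>h\<close> and on half-open
  intervals, the shape in which averages combine with increments of an indefinite integral.\<close>

lemma lborel_right_average:
  fixes f :: "real \<Rightarrow> 'b::euclidean_space"
  assumes f: "integrable lborel f"
  shows "AE x in lborel. \<forall>e>0. \<exists>d>0. \<forall>h. 0 < h \<and> h < d \<longrightarrow>
           norm ((LINT y:{x<..x + h}|lborel. f y) - h *\<^sub>R f x) \<le> e * h"
proof -
  have "f integrable_on cbox a b" for a b
    using f by (meson integrable_completion absolutely_integrable_on_def set_integrable_subset
        absolutely_integrable_on_subcbox integrable_on_lborel integrable_on_subcbox subset_UNIV)
  then obtain T where T: "negligible T" "\<And>x e. \<lbrakk>x \<notin> T; 0 < e\<rbrakk> \<Longrightarrow> \<exists>d>0. \<forall>h. 0 < h \<and> h < d \<longrightarrow>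
      norm (integral (cbox x (x + h *\<^sub>R One)) f /\<^sub>R h ^ DIM(real) - f x) < e"
    using integrable_ccontinuous_explicit[of f] by blast
  have "AE x in lebesgue. x \<notin> T" using T(1)
    by (simp add: negligible_iff_null_sets AE_not_in)
  moreover have "\<forall>e>0. \<exists>d>0. \<forall>h. 0 < h \<and> h < d \<longrightarrow>
           norm ((LINT y:{x<..x + h}|lborel. f y) - h *\<^sub>R f x) \<le> e * h" if x: "x \<notin> T" for x
  proof (intro allI impI)
    fix e :: real assume "0 < e"
    obtain d where d: "d > 0" "\<And>h. 0 < h \<Longrightarrow> h < d \<Longrightarrow> norm (integral {x..x + h} f /\<^sub>R h - f x) < e"
      using T(2)[OF x \<open>0 < e\<close>] by auto
    have "norm ((LINT y:{x<..x + h}|lborel. f y) - h *\<^sub>R f x) \<le> e * h" if h: "0 < h" "h < d" for h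
    proof -
      have "(LINT y:{x<..x + h}|lborel. f y) = (LINT y:{x..x + h}|lborel. f y)"
        by (rule set_integral_discrete_difference[where X="{x}"]) auto
      also have "\<dots> = integral {x..x + h} f"
        by (rule set_borel_integral_eq_integral)
          (use f in \<open>simp add: integrable_imp_set_integrable\<close>)
      finally have "(LINT y:{x<..x + h}|lborel. f y) - h *\<^sub>R f x = h *\<^sub>R (integral {x..x + h} f /\<^sub>R h - f x)"
        using h by (simp add: scaleR_diff_right)
      then show ?thesis using d(2)[OF h] h by (simp add: less_imp_le)
    qed
    then show "\<exists>d>0. \<forall>h. 0 < h \<and> h < d \<longrightarrow>
           norm ((LINT y:{x<..x + h}|lborel. f y) - h *\<^sub>R f x) \<le> e * h" using d(1) by blast
  qed
  ultimately have "AE x in lebesgue. \<forall>e>0. \<exists>d>0. \<forall>h. 0 < h \<and> h < d \<longrightarrow>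
           norm ((LINT y:{x<..x + h}|lborel. f y) - h *\<^sub>R f x) \<le> e * h" by auto
  then show ?thesis by (simp add: AE_completion_iff)
qed

text \<open>The reflection of the line exchanges left and right averages; it moves the closed end of
  the interval to the other side, which changes the integrals only by null sets.\<close>

lemma lborel_left_average:
  fixes f :: "real \<Rightarrow> 'b::euclidean_space"
  assumes f: "integrable lborel f"
  shows "AE x in lborel. \<forall>e>0. \<exists>d>0. \<forall>h. 0 < h \<and> h < d \<longrightarrow>
           norm ((LINT y:{x - h<..x}|lborel. f y) - h *\<^sub>R f x) \<le> e * h"
proof -
  have f': "integrable lborel (\<lambda>x. f (- x))"
    using lborel_integrable_real_affine[OF f, of "-1" 0] by simp
  have eq: "(LINT y:{x<..x + h}|lborel. f (- y)) = (LINT y:{- x - h<..- x}|lborel. f y)" if "0 < h" for x h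
  proof -
    have "(LINT y:{- x - h<..- x}|lborel. f y) = (LINT y|lborel. indicator {- x - h<..- x} (-y) *\<^sub>R f (-y))"
      unfolding set_lebesgue_integral_def
      using lborel_integral_real_affine[of "-1" "\<lambda>y. indicator {- x - h<..- x} y *\<^sub>R f y" 0] by simp
    also have "\<dots> = (LINT y:{x..<x + h}|lborel. f (- y))"
      unfolding set_lebesgue_integral_def by (rule Bochner_Integration.integral_cong) (auto simp: indicator_def)
    also have "\<dots> = (LINT y:{x<..x + h}|lborel. f (- y))"
      by (rule set_integral_discrete_difference[where X="{x, x+h}"]) (use that in auto)
    finally show ?thesis ..
  qed
  define P where "P x \<longleftrightarrow> (\<forall>e>0. \<exists>d>0. \<forall>h. 0 < h \<and> h < d \<longrightarrow>
           norm ((LINT y:{x - h<..x}|lborel. f y) - h *\<^sub>R f x) \<le> e * h)" for x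
  have "AE x in lborel. P (- x)"
    using lborel_right_average[OF f'] unfolding P_def by (simp add: eq cong: conj_cong)
  then obtain T where T: "T \<in> null_sets lborel" "{x. \<not> P (- x)} \<subseteq> T"
    by (auto simp: eventually_ae_filter)
  have "emeasure lborel (uminus -` T) = emeasure (distr lborel borel uminus) T"
    using T(1) by (subst emeasure_distr) auto
  then have "uminus -` T \<in> null_sets lborel"
    using T(1) by (auto simp: lborel_distr_uminus null_sets_def intro!: measurable_sets_borel[of uminus borel])
  moreover have "{x. \<not> P x} \<subseteq> uminus -` T" using T(2) by force
  ultimately show ?thesis unfolding P_def[symmetric] by (auto simp: eventually_ae_filter)
qed

lemma AE_has_vector_derivative_lborel:
  fixes f :: "real \<Rightarrow> 'b::euclidean_space"
  assumes f: "integrable lborel f" and "open I"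
    and F: "\<And>x y. x \<in> I \<Longrightarrow> y \<in> I \<Longrightarrow> x \<le> y \<Longrightarrow> F y - F x = (LINT s:{x<..y}|lborel. f s)"
  shows "AE x in lborel. x \<in> I \<longrightarrow> (F has_vector_derivative f x) (at x)"
  using lborel_right_average[OF f] lborel_left_average[OF f]
proof eventually_elim
  case (elim x)
  show ?case
  proof (intro impI has_vector_derivative_epsI)
    fix e :: real assume "x \<in> I" "0 < e"
    obtain d1 where d1: "d1 > 0" "\<And>h. 0 < h \<Longrightarrow> h < d1 \<Longrightarrow>
        norm ((LINT y:{x<..x + h}|lborel. f y) - h *\<^sub>R f x) \<le> e * h" using elim(1)[rule_format, OF \<open>0 < e\<close>] by auto
    obtain d2 where d2: "d2 > 0" "\<And>h. 0 < h \<Longrightarrow> h < d2 \<Longrightarrow>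
        norm ((LINT y:{x - h<..x}|lborel. f y) - h *\<^sub>R f x) \<le> e * h" using elim(2)[rule_format, OF \<open>0 < e\<close>] by auto
    obtain d3 where d3: "d3 > 0" "\<And>y. \<bar>y - x\<bar> < d3 \<Longrightarrow> y \<in> I"
      using \<open>open I\<close> \<open>x \<in> I\<close> by (metis dist_real_def open_dist)
    have "norm (F y - F x - (y - x) *\<^sub>R f x) \<le> e * \<bar>y - x\<bar>" if y: "\<bar>y - x\<bar> < min d1 (min d2 d3)" for y
    proof -
      consider "y = x" | "x < y" | "y < x" by linarith
      then show ?thesis
      proof cases
        case 2
        then have "F y - F x = (LINT s:{x<..y}|lborel. f s)" using F \<open>x \<in> I\<close> d3(2) y by auto
        then show ?thesis using 2 d1(2)[of "y - x"] y by simp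
      next
        case 3
        then have "F x - F y = (LINT s:{y<..x}|lborel. f s)" using F \<open>x \<in> I\<close> d3(2) y by auto
        then have "F y - F x - (y - x) *\<^sub>R f x = - ((LINT s:{y<..x}|lborel. f s) - (x - y) *\<^sub>R f x)"
          by (simp add: algebra_simps)
        then show ?thesis using 3 d2(2)[of "x - y"] y by (simp add: norm_minus_commute)
      qed simp
    qed
    then show "\<exists>d>0. \<forall>y. \<bar>y - x\<bar> < d \<longrightarrow> norm (F y - F x - (y - x) *\<^sub>R f x) \<le> e * \<bar>y - x\<bar>"
      using d1(1) d2(1) d3(1) by (intro exI[of _ "min d1 (min d2 d3)"]) auto
  qed
qed

lemma AE_lborelI_negligible:
  assumes "negligible {x. \<not> P x}" shows "AE x in lborel. P x"
proof -
  have "AE x in lebesgue. P x"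
    using assms by (auto simp: eventually_ae_filter negligible_iff_null_sets intro!: bexI[of _ "{x. \<not> P x}"])
  then show ?thesis by (simp add: AE_completion_iff)
qed

text \<open>Suppose that around every point of \<open>A e\<close> arbitrarily small balls have
  \<open>\<nu>\<close> measure above \<open>e\<close> times the radius. Outer regularity puts
  \<open>E\<close> into an open \<open>U\<close> of small \<open>\<nu>\<close> measure, and Vitali's
  theorem covers almost all of \<open>A e\<close> by disjoint balls in \<open>U\<close>, each of
  length at most \<open>2 / e\<close> times its \<open>\<nu>\<close> measure. So \<open>A e\<close>
  is null.\<close>

lemma AE_measure_cball_small:
  fixes \<nu> :: "real measure"
  assumes "finite_measure \<nu>" and sets: "sets \<nu> = sets borel" and E: "E \<in> sets borel" "emeasure \<nu> E = 0"
  shows "AE x in lborel. x \<in> E \<longrightarrow> (\<forall>e>0. \<exists>d>0. \<forall>r. 0 < r \<and> r < d \<longrightarrow> measure \<nu> (cball x r) \<le> e * r)"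
proof -
  interpret finite_measure \<nu> by fact
  define A where "A e = {x\<in>E. \<forall>d>0. \<exists>r. 0 < r \<and> r < d \<and> measure \<nu> (cball x r) > e * r}" for e :: real
  have A: "negligible (A e)" if e: "e > 0" for e
    unfolding negligible_outer_le
  proof (intro allI impI)
    fix \<epsilon> :: real assume "\<epsilon> > 0"
    have "emeasure \<nu> E = (INF U\<in>{U. E \<subseteq> U \<and> open U}. emeasure \<nu> U)"
      by (rule outer_regular) (use sets E in auto)
    \<comment> \<open>A ball of radius r has length 2r, whence the factor \<open>2 / e\<close>
      below; the bound \<open>e * \<epsilon> / 2\<close> makes the total length at most
      \<open>\<epsilon>\<close>.\<close>
    then have "(INF U\<in>{U. E \<subseteq> U \<and> open U}. emeasure \<nu> U) < ennreal (e * \<epsilon> / 2)"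
      using E e \<open>\<epsilon> > 0\<close> by (simp add: ennreal_zero_less_mult_iff)
    then obtain U where U: "E \<subseteq> U" "open U" "emeasure \<nu> U < ennreal (e * \<epsilon> / 2)"
      by (auto simp: Inf_less_iff)
    have \<nu>U: "measure \<nu> U < e * \<epsilon> / 2" using U(3) e \<open>\<epsilon> > 0\<close>
      by (simp add: emeasure_eq_measure ennreal_less_iff)
    define K where "K = {(x::real,r::real). x \<in> A e \<and> 0 < r \<and> cball x r \<subseteq> U \<and> measure \<nu> (cball x r) > e * r}"
    obtain C where C: "countable C" "C \<subseteq> K"
       "pairwise (\<lambda>i j. disjnt (cball (fst i) (snd i)) (cball (fst j) (snd j))) C"
       "negligible (A e - (\<Union>i\<in>C. cball (fst i) (snd i)))"
    proof (rule Vitali_covering_theorem_cballs[of K snd "A e" fst])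
      show "0 < snd i" if "i \<in> K" for i using that by (auto simp: K_def)
      show "\<exists>i. i \<in> K \<and> x \<in> cball (fst i) (snd i) \<and> snd i < d" if "x \<in> A e" "0 < d" for x d
      proof -
        have "x \<in> U" using U(1) that(1) by (auto simp: A_def)
        then obtain d' where d': "d' > 0" "cball x d' \<subseteq> U"
          using open_contains_cball_eq[OF U(2)] by auto
        then have "0 < min d d'" using that(2) by simp
        moreover have "\<forall>d>0. \<exists>r. 0 < r \<and> r < d \<and> measure \<nu> (cball x r) > e * r"
          using that(1) by (simp add: A_def)
        ultimately obtain r where r: "0 < r" "r < min d d'" "measure \<nu> (cball x r) > e * r"
          by metis
        moreover have "cball x r \<subseteq> U" using d' r by fastforce
        ultimately show ?thesis using that(1) by (intro exI[of _ "(x, r)"]) (auto simp: K_def)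
      qed
    qed blast
    let ?B = "\<lambda>i. cball (fst i) (snd i) :: real set"
    have dis: "disjoint_family_on ?B C" using C(3) by (auto simp: disjoint_family_on_def pairwise_def disjnt_def)
    have "emeasure lborel (\<Union>i\<in>C. ?B i) = (\<integral>\<^sup>+i. emeasure lborel (?B i) \<partial>count_space C)"
      by (rule emeasure_UN_countable) (use C dis in auto)
    also have "\<dots> \<le> (\<integral>\<^sup>+i. ennreal (2 / e) * emeasure \<nu> (?B i) \<partial>count_space C)"
    proof (rule nn_integral_mono)
      fix i assume "i \<in> space (count_space C)"
      then have i: "0 < snd i" "measure \<nu> (?B i) > e * snd i" using C(2) by (auto simp: K_def)
      have "emeasure lborel (?B i) = ennreal (2 * snd i)" using i(1) by (simp add: cball_eq_atLeastAtMost)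
      also have "\<dots> \<le> ennreal (2 / e * measure \<nu> (?B i))"
        using i e by (intro ennreal_leI) (simp add: field_simps)
      also have "\<dots> = ennreal (2 / e) * emeasure \<nu> (?B i)"
        unfolding emeasure_eq_measure by (rule ennreal_mult) (use e in simp_all)
      finally show "emeasure lborel (?B i) \<le> ennreal (2 / e) * emeasure \<nu> (?B i)" .
    qed
    also have "\<dots> = ennreal (2 / e) * (\<integral>\<^sup>+i. emeasure \<nu> (?B i) \<partial>count_space C)"
      by (rule nn_integral_cmult) simp
    finally have l1: "emeasure lborel (\<Union>i\<in>C. ?B i) \<le> ennreal (2 / e) * (\<integral>\<^sup>+i. emeasure \<nu> (?B i) \<partial>count_space C)" .
    have l2: "(\<integral>\<^sup>+i. emeasure \<nu> (?B i) \<partial>count_space C) = emeasure \<nu> (\<Union>i\<in>C. ?B i)"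
      by (rule emeasure_UN_countable[symmetric]) (use C dis sets in auto)
    have "(\<Union>i\<in>C. ?B i) \<subseteq> U" using C(2) by (fastforce simp: K_def)
    then have l3: "emeasure \<nu> (\<Union>i\<in>C. ?B i) \<le> emeasure \<nu> U"
      by (rule emeasure_mono) (use U(2) sets in auto)
    have l4: "ennreal (2 / e) * emeasure \<nu> U \<le> ennreal \<epsilon>"
    proof -
      have "ennreal (2 / e) * emeasure \<nu> U = ennreal (2 / e * measure \<nu> U)"
        unfolding emeasure_eq_measure by (rule ennreal_mult[symmetric]) (use e in simp_all)
      also have "\<dots> \<le> ennreal \<epsilon>" using \<nu>U e by (intro ennreal_leI) (simp add: field_simps)
      finally show ?thesis .
    qed
    have le: "emeasure lborel (\<Union>i\<in>C. ?B i) \<le> ennreal \<epsilon>"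
      using order_trans[OF l1[unfolded l2] order_trans[OF mult_left_mono[OF l3 zero_le] l4]] .
    have B: "(\<Union>i\<in>C. ?B i) \<in> sets borel" using C(1) by auto
    let ?T = "(\<Union>i\<in>C. ?B i) \<union> (A e - (\<Union>i\<in>C. ?B i))"
    have 1: "(\<Union>i\<in>C. ?B i) \<in> lmeasurable"
    proof (rule fmeasurableI)
      show "emeasure lebesgue (\<Union>i\<in>C. ?B i) < \<infinity>"
        using le_less_trans[OF le ennreal_less_top] B by simp
    qed (use B in simp)
    have 2: "measure lebesgue (\<Union>i\<in>C. ?B i) \<le> \<epsilon>"
      using le B \<open>\<epsilon> > 0\<close> by (simp add: measure_def enn2real_leI)
    have "?T \<in> lmeasurable" using 1 C(4) by (intro fmeasurable.Un) (auto simp: negligible_imp_measurable)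
    moreover have "measure lebesgue ?T \<le> \<epsilon>"
      using 2 measure_Un_le[of "\<Union>i\<in>C. ?B i" lebesgue "A e - (\<Union>i\<in>C. ?B i)"] 1 C(4)
      by (simp add: negligible_imp_measure0 fmeasurableD negligible_imp_measurable)
    moreover have "A e \<subseteq> ?T" by blast
    ultimately show "\<exists>T. A e \<subseteq> T \<and> T \<in> lmeasurable \<and> measure lebesgue T \<le> \<epsilon>" by blast
  qed
  have "negligible (\<Union>k. A (1 / real (Suc k)))"
    by (rule negligible_countable_Union[of "range (\<lambda>k. A (1 / real (Suc k)))"]) (auto intro!: A)
  moreover have "{x. \<not> (x \<in> E \<longrightarrow> (\<forall>e>0. \<exists>d>0. \<forall>r. 0 < r \<and> r < d \<longrightarrow> measure \<nu> (cball x r) \<le> e * r))}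
      \<subseteq> (\<Union>k. A (1 / real (Suc k)))"
  proof clarsimp
    fix x e assume x: "x \<in> E" "0 < (e::real)" "\<forall>d>0. \<exists>r>0. r < d \<and> \<not> measure \<nu> (cball x r) \<le> e * r"
    obtain k where k: "1 / real (Suc k) < e" using x(2) nat_approx_posE by blast
    have "\<exists>r. 0 < r \<and> r < d \<and> measure \<nu> (cball x r) > 1 / real (Suc k) * r" if d: "d > 0" for d
    proof -
      obtain r where r: "r > 0" "r < d" "measure \<nu> (cball x r) > e * r" using x(3) d by fastforce
      moreover have "1 / real (Suc k) * r \<le> e * r" using k r(1) by (intro mult_right_mono) auto
      ultimately show ?thesis by (intro exI[of _ r]) linarith
    qed
    then show "\<exists>k. x \<in> A (1 / (1 + real k))" using x(1) by (auto simp: A_def intro!: exI[of _ k])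
  qed
  ultimately show ?thesis by (intro AE_lborelI_negligible) (rule negligible_subset)
qed

section \<open>Densities with respect to a dominating measure\<close>

text \<open>A finite measure dominating Lebesgue measure on \<open>(0, L)\<close>, with singular part carried by \<open>N\<close>. Every
  BV function on \<open>(0, L)\<close> has a density with respect to some such \<open>M\<close>, and products and compositions
  keep \<open>M\<close>, so measure identities become pointwise identities between densities.\<close>

locale bv_measure = finite_measure M for M :: "real measure" +
  fixes L :: real and N :: "real set"
  assumes L_pos: "0 < L"
    and sets_M [measurable_cong, simp]: "sets M = sets borel"
    and N_null: "N \<in> null_sets lborel" and N_subset: "N \<subseteq> {0<..<L}"
    and M_off_N: "\<And>A. A \<in> sets borel \<Longrightarrow> emeasure M (A - N) = emeasure lborel (A \<inter> {0<..<L})"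
begin

abbreviation "I \<equiv> {0<..<L}"

lemma space_M [simp]: "space M = UNIV"
  using sets_eq_imp_space_eq[OF sets_M] by simp

lemma N_borel [measurable, simp]: "N \<in> sets borel"
  using N_null by auto

text \<open>The convention \<open>{a<..b}\<close> singles out a right-continuous representative of a
  BV function with derivative \<open>\<sigma> M\<close> on the open interval. Values at 0, at
  \<open>L\<close> and outside are left free.\<close>

definition has_density :: "(real \<Rightarrow> 'b::euclidean_space) \<Rightarrow> (real \<Rightarrow> 'b) \<Rightarrow> bool" where
  "has_density \<sigma> f \<longleftrightarrow> integrable M \<sigma> \<and>
     (\<forall>a b. 0 < a \<longrightarrow> a \<le> b \<longrightarrow> b < L \<longrightarrow> f b - f a = (LINT s:{a<..b}|M. \<sigma> s))"

lemma has_densityD: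
  assumes "has_density \<sigma> f"
  shows "integrable M \<sigma>" "\<sigma> \<in> borel_measurable borel"
    "0 < a \<Longrightarrow> a \<le> b \<Longrightarrow> b < L \<Longrightarrow> f b - f a = (LINT s:{a<..b}|M. \<sigma> s)"
  using assms by (auto simp: has_density_def cong: measurable_cong_sets dest: borel_measurable_integrable)

lemma density_M_eq: "density M (indicator (- N)) = density lborel (indicator I)"
proof (rule measure_eqI)
  fix A assume "A \<in> sets (density M (indicator (- N)))"
  then have A: "A \<in> sets borel" by simp
  have "emeasure (density M (indicator (- N))) A = emeasure M (A - N)"
    using A by (subst emeasure_density) (auto simp: indicator_inter_arith[symmetric] Diff_eq Int_commute)
  moreover have "emeasure (density lborel (indicator I)) A = emeasure lborel (A \<inter> I)"
    using A by (subst emeasure_density) (auto simp: indicator_inter_arith[symmetric] Int_commute)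
  ultimately show "emeasure (density M (indicator (- N))) A = emeasure (density lborel (indicator I)) A"
    using M_off_N[OF A] by simp
qed simp

lemma density_M_eq_real:
  "density M (\<lambda>x. ennreal (indicator (- N) x)) = density lborel (\<lambda>x. ennreal (indicator I x))"
  using density_M_eq by (simp add: ennreal_indicator)

lemma
  fixes \<sigma> :: "real \<Rightarrow> 'b::euclidean_space"
  assumes "integrable M \<sigma>"
  shows set_integrable_I: "set_integrable lborel I \<sigma>"
    and integral_off_N: "A \<in> sets borel \<Longrightarrow> (LINT x:A - N|M. \<sigma> x) = (LINT x:A \<inter> I|lborel. \<sigma> x)"
proof -
  have m [measurable]: "\<sigma> \<in> borel_measurable borel"
    using assms by (auto cong: measurable_cong_sets dest: borel_measurable_integrable)
  have "integrable (density M (\<lambda>x. ennreal (indicator (- N) x))) \<sigma>"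
    by (subst integrable_density) (auto intro!: integrable_mult_indicator assms)
  then show "set_integrable lborel I \<sigma>"
    unfolding density_M_eq_real set_integrable_def by (subst (asm) integrable_density) auto
  assume A [measurable]: "A \<in> sets borel"
  have "(LINT x:A - N|M. \<sigma> x) = (LINT x|density M (\<lambda>x. ennreal (indicator (- N) x)). indicator A x *\<^sub>R \<sigma> x)"
    unfolding set_lebesgue_integral_def
    by (subst integral_density) (auto intro!: Bochner_Integration.integral_cong simp: indicator_def)
  also have "\<dots> = (LINT x:A \<inter> I|lborel. \<sigma> x)"
    unfolding set_lebesgue_integral_def density_M_eq_real
    by (subst integral_density) (auto intro!: Bochner_Integration.integral_cong simp: indicator_def)
  finally show "(LINT x:A - N|M. \<sigma> x) = (LINT x:A \<inter> I|lborel. \<sigma> x)" .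
qed

lemma set_integrable_M:
  fixes \<sigma> :: "real \<Rightarrow> 'b::euclidean_space"
  shows "integrable M \<sigma> \<Longrightarrow> A \<in> sets borel \<Longrightarrow> set_integrable M A \<sigma>"
  by (rule integrable_imp_set_integrable) auto

lemma integral_split_N:
  fixes \<sigma> :: "real \<Rightarrow> 'b::euclidean_space"
  assumes "integrable M \<sigma>" "A \<in> sets borel"
  shows "(LINT x:A|M. \<sigma> x) = (LINT x:A \<inter> I|lborel. \<sigma> x) + (LINT x:A \<inter> N|M. \<sigma> x)"
proof -
  have "(LINT x:A|M. \<sigma> x) = (LINT x:(A - N) \<union> (A \<inter> N)|M. \<sigma> x)" by (simp add: Diff_partition Un_commute Int_commute Un_Diff_Int)
  also have "\<dots> = (LINT x:A - N|M. \<sigma> x) + (LINT x:A \<inter> N|M. \<sigma> x)"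
    by (rule set_integral_Un) (use assms in \<open>auto intro!: set_integrable_M\<close>)
  finally show ?thesis using integral_off_N[OF assms] by simp
qed

text \<open>The restriction of \<open>M\<close> to the null set \<open>N\<close> does not contribute, by \<open>AE_measure_cball_small\<close>.\<close>

lemma has_density_vector_derivative:
  fixes \<sigma> :: "real \<Rightarrow> 'b::euclidean_space"
  assumes d: "has_density \<sigma> f"
  shows "AE x in lborel. x \<in> I \<longrightarrow> (f has_vector_derivative \<sigma> x) (at x)"
proof -
  note \<sigma> = has_densityD[OF d]
  note [measurable] = \<sigma>(2)
  have int: "integrable lborel (\<lambda>x. indicator I x *\<^sub>R \<sigma> x)"
    using set_integrable_I[OF \<sigma>(1)] by (simp add: set_integrable_def)
  \<comment> \<open>\<open>G\<close> integrates the Lebesgue part of the density and has the desired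
    derivative a.e., so only \<open>f - G\<close> remains to be shown to have derivative 0.\<close>
  define G where "G x = (LINT s:{0<..x}|lborel. indicator I s *\<^sub>R \<sigma> s)" for x
  have G: "G y - G x = (LINT s:{x<..y}|lborel. indicator I s *\<^sub>R \<sigma> s)" if "x \<in> I" "y \<in> I" "x \<le> y" for x y
  proof -
    have "(LINT s:{0<..x} \<union> {x<..y}|lborel. indicator I s *\<^sub>R \<sigma> s)
        = G x + (LINT s:{x<..y}|lborel. indicator I s *\<^sub>R \<sigma> s)"
      unfolding G_def by (rule set_integral_Un) (auto intro!: integrable_imp_set_integrable int)
    moreover have "{0<..x} \<union> {x<..y} = {0<..y}" using that by auto
    ultimately show ?thesis by (simp add: G_def)
  qed
  define \<nu> where "\<nu> = density M (\<lambda>x. ennreal (indicator N x * norm (\<sigma> x)))"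
  have \<nu>int: "integrable M (\<lambda>x. indicator N x * norm (\<sigma> x))"
    using integrable_mult_indicator[of N M "\<lambda>x. norm (\<sigma> x)"] \<sigma>(1) by simp
  interpret \<nu>: finite_measure \<nu>
  proof (rule finite_measureI)
    have "emeasure \<nu> (space \<nu>) = (\<integral>\<^sup>+x. ennreal (indicator N x * norm (\<sigma> x)) \<partial>M)"
      unfolding \<nu>_def by (subst emeasure_density) auto
    also have "\<dots> = ennreal (LINT x|M. indicator N x * norm (\<sigma> x))"
      by (rule nn_integral_eq_integral[OF \<nu>int]) auto
    finally show "emeasure \<nu> (space \<nu>) \<noteq> \<infinity>" by simp
  qed
  have \<nu>meas: "measure \<nu> A = (LINT x:A|M. indicator N x * norm (\<sigma> x))" if [measurable]: "A \<in> sets borel" for A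
  proof -
    have "emeasure \<nu> A = (\<integral>\<^sup>+x. ennreal (indicator A x *\<^sub>R (indicator N x * norm (\<sigma> x))) \<partial>M)"
      unfolding \<nu>_def by (subst emeasure_density) (auto intro!: nn_integral_cong simp: indicator_def)
    also have "\<dots> = ennreal (LINT x:A|M. indicator N x * norm (\<sigma> x))"
      unfolding set_lebesgue_integral_def
      by (rule nn_integral_eq_integral) (use integrable_mult_indicator[OF _ \<nu>int, of A] in auto)
    finally show ?thesis
      by (simp add: measure_def set_lebesgue_integral_def Bochner_Integration.integral_nonneg)
  qed
  have "emeasure \<nu> (- N) = 0"
    unfolding \<nu>_def by (subst emeasure_density) (auto simp: nn_integral_0_iff_AE indicator_def)
  then have "AE x in lborel. x \<in> - N \<longrightarrow> (\<forall>e>0. \<exists>d>0. \<forall>r. 0 < r \<and> r < d \<longrightarrow> measure \<nu> (cball x r) \<le> e * r)"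
    by (intro AE_measure_cball_small) (auto simp: \<nu>_def intro: \<nu>.finite_measure_axioms[unfolded \<nu>_def])
  moreover have "AE x in lborel. x \<in> I \<longrightarrow> (G has_vector_derivative indicator I x *\<^sub>R \<sigma> x) (at x)"
    by (rule AE_has_vector_derivative_lborel[OF int _ G]) auto
  moreover have "AE x in lborel. x \<notin> N" using N_null by (rule AE_not_in)
  ultimately show ?thesis
  proof eventually_elim
    case (elim x)
    show ?case
    proof
      assume x: "x \<in> I"
      have "((\<lambda>y. f y - G y) has_vector_derivative 0) (at x)"
      proof (rule has_vector_derivative_epsI)
        fix e :: real assume "0 < e"
        then obtain d where d: "d > 0" "\<And>r. 0 < r \<Longrightarrow> r < d \<Longrightarrow> measure \<nu> (cball x r) \<le> e * r"
          using elim(1,3) by auto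
        have main: "norm ((f b - G b) - (f a - G a)) \<le> measure \<nu> {a<..b}" if "a \<in> I" "b \<in> I" "a \<le> b" for a b
        proof -
          have 1: "{a<..b} \<inter> I = {a<..b}" using that by auto
          have "f b - f a = (LINT s:{a<..b}|lborel. \<sigma> s) + (LINT x:{a<..b} \<inter> N|M. \<sigma> x)"
            using \<sigma>(3)[of a b] that integral_split_N[OF \<sigma>(1), of "{a<..b}"] by (simp add: 1)
          moreover have "G b - G a = (LINT s:{a<..b}|lborel. \<sigma> s)"
            unfolding G[OF that] set_lebesgue_integral_def
            by (rule Bochner_Integration.integral_cong) (use that in \<open>auto simp: indicator_def\<close>)
          ultimately have "(f b - G b) - (f a - G a) = (LINT x:{a<..b} \<inter> N|M. \<sigma> x)"
            by (simp add: algebra_simps)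
          also have "norm \<dots> \<le> (LINT x:{a<..b} \<inter> N|M. norm (\<sigma> x))"
            by (rule set_integral_norm_bound) (auto intro!: set_integrable_M \<sigma>)
          also have "\<dots> = measure \<nu> {a<..b}"
            by (subst \<nu>meas) (auto simp: set_lebesgue_integral_def indicator_def intro!: Bochner_Integration.integral_cong)
          finally show ?thesis .
        qed
        obtain d' where d': "d' > 0" "\<And>y. \<bar>y - x\<bar> < d' \<Longrightarrow> y \<in> I"
          using x open_greaterThanLessThan[of 0 L] by (metis dist_real_def open_dist)
        have "norm (f y - G y - (f x - G x)) \<le> e * \<bar>y - x\<bar>" if y: "\<bar>y - x\<bar> < min d d'" for y
        proof (cases "y = x")
          case False
          have "y \<in> I" using d' y by auto
          have "norm (f y - G y - (f x - G x)) \<le> measure \<nu> {min x y<..max x y}"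
            using main[of x y] main[of y x] x \<open>y \<in> I\<close> by (cases "x \<le> y") (auto simp: norm_minus_commute min_def max_def)
          also have "\<dots> \<le> measure \<nu> (cball x \<bar>y - x\<bar>)"
            by (rule \<nu>.finite_measure_mono) (auto simp: dist_real_def \<nu>_def)
          also have "\<dots> \<le> e * \<bar>y - x\<bar>" using d(2) y False by auto
          finally show ?thesis .
        qed simp
        then show "\<exists>d>0. \<forall>y. \<bar>y - x\<bar> < d \<longrightarrow> norm (f y - G y - (f x - G x) - (y - x) *\<^sub>R 0) \<le> e * \<bar>y - x\<bar>"
          using d(1) d'(1) by (intro exI[of _ "min d d'"]) auto
      qed
      from has_vector_derivative_add[OF this, of G "\<sigma> x"] show "(f has_vector_derivative \<sigma> x) (at x)"
        using elim x by simp
    qed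
  qed
qed

lemma has_density_right_cont:
  assumes d: "has_density \<sigma> f" and s: "s \<in> I"
  shows "(f \<longlongrightarrow> f s) (at_right s)"
proof -
  note \<sigma> = has_densityD[OF d]
  obtain b where b: "s < b" "b < L" using s dense by auto
  have "((\<lambda>a. LINT x:{a..b}|M. \<sigma> x) \<longlongrightarrow> (LINT x:{s<..b}|M. \<sigma> x)) (at_right s)"
    by (rule tendsto_set_lebesgue_integral_at_right) (use b in \<open>auto intro!: set_integrable_M \<sigma>\<close>)
  have "((\<lambda>a. LINT x:{a<..b}|M. \<sigma> x) \<longlongrightarrow> (LINT x:{s<..b}|M. \<sigma> x)) (at_right s)"
  proof (rule tendsto_at_right_sequentially[OF b(1)])
    fix S assume S: "\<And>n. s < S n" "\<And>n. S n < b" "decseq S" "S \<longlonglongrightarrow> s"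
    have "(\<Union>n. {S n<..b}) = {s<..b}"
    proof safe
      fix x assume x: "x \<in> {s<..b}"
      then have "\<forall>\<^sub>F n in sequentially. S n < x" using S(4) by (auto dest: order_tendstoD)
      then show "x \<in> (\<Union>n. {S n<..b})" using x by (auto simp: eventually_sequentially)
    qed (use S(1) in \<open>auto intro: less_trans\<close>)
    moreover have "(\<lambda>n. LINT x:{S n<..b}|M. \<sigma> x) \<longlonglongrightarrow> (LINT x:(\<Union>n. {S n<..b})|M. \<sigma> x)"
    proof (rule set_integral_cont_up)
      show "incseq (\<lambda>n. {S n<..b})"
        using S(3) by (auto simp: incseq_def decseq_def) (meson le_less_trans)
    qed (auto intro!: set_integrable_M \<sigma>)
    ultimately show "(\<lambda>n. LINT x:{S n<..b}|M. \<sigma> x) \<longlonglongrightarrow> (LINT x:{s<..b}|M. \<sigma> x)" by simp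
  qed
  then have "((\<lambda>a. f b - (LINT x:{a<..b}|M. \<sigma> x)) \<longlongrightarrow> f b - (LINT x:{s<..b}|M. \<sigma> x)) (at_right s)"
    by (intro tendsto_intros)
  moreover have "f b - (LINT x:{s<..b}|M. \<sigma> x) = f s"
    using \<sigma>(3)[of s b, symmetric] s b by auto
  moreover have "\<forall>\<^sub>F a in at_right s. f b - (LINT x:{a<..b}|M. \<sigma> x) = f a"
  proof -
    have "f b - (LINT x:{a<..b}|M. \<sigma> x) = f a" if "s < a" "a < b" for a
      using \<sigma>(3)[of a b, symmetric] s b that by auto
    then show ?thesis using b(1) by (auto simp: eventually_at_right)
  qed
  ultimately show ?thesis by (auto elim: Lim_transform_eventually)
qed

text \<open>The atom of \<open>\<sigma> M\<close> at \<open>s\<close> is the jump, so this algebraic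
  expression is the left limit of a function with density \<open>\<sigma>\<close>. Unlike a limit it
  is visibly measurable, since it differs from \<open>f\<close> only at the countably many atoms of
  \<open>M\<close>.\<close>

definition left_value :: "(real \<Rightarrow> 'b::euclidean_space) \<Rightarrow> (real \<Rightarrow> 'b) \<Rightarrow> real \<Rightarrow> 'b" where
  "left_value \<sigma> f s = f s - measure M {s} *\<^sub>R \<sigma> s"

lemma has_density_left_lim:
  assumes d: "has_density \<sigma> f" and s: "s \<in> I"
  shows "(f \<longlongrightarrow> left_value \<sigma> f s) (at_left s)"
proof -
  note \<sigma> = has_densityD[OF d]
  obtain b where b: "0 < b" "b < s" using s dense by auto
  have "((\<lambda>a. LINT x:{b<..a}|M. \<sigma> x) \<longlongrightarrow> (LINT x:{b<..<s}|M. \<sigma> x)) (at_left s)"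
  proof (rule tendsto_at_left_sequentially[OF b(2)])
    fix S assume S: "\<And>n. S n < s" "\<And>n. b < S n" "incseq S" "S \<longlonglongrightarrow> s"
    have "(\<Union>n. {b<..S n}) = {b<..<s}"
    proof safe
      fix x assume x: "x \<in> {b<..<s}"
      then have "\<forall>\<^sub>F n in sequentially. x < S n" using S(4) by (auto dest: order_tendstoD)
      then show "x \<in> (\<Union>n. {b<..S n})" using x by (auto simp: eventually_sequentially intro: less_imp_le)
    qed (use S(1) in \<open>auto intro: le_less_trans\<close>)
    moreover have "(\<lambda>n. LINT x:{b<..S n}|M. \<sigma> x) \<longlonglongrightarrow> (LINT x:(\<Union>n. {b<..S n})|M. \<sigma> x)"
    proof (rule set_integral_cont_up)
      show "incseq (\<lambda>n. {b<..S n})"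
        using S(3) by (auto simp: incseq_def) (meson order_trans)
    qed (auto intro!: set_integrable_M \<sigma>)
    ultimately show "(\<lambda>n. LINT x:{b<..S n}|M. \<sigma> x) \<longlonglongrightarrow> (LINT x:{b<..<s}|M. \<sigma> x)" by simp
  qed
  then have "((\<lambda>a. f b + (LINT x:{b<..a}|M. \<sigma> x)) \<longlongrightarrow> f b + (LINT x:{b<..<s}|M. \<sigma> x)) (at_left s)"
    by (intro tendsto_intros)
  moreover have "f b + (LINT x:{b<..<s}|M. \<sigma> x) = left_value \<sigma> f s"
  proof -
    have "{b<..s} = {b<..<s} \<union> {s}" using b by auto
    then have "(LINT x:{b<..s}|M. \<sigma> x) = (LINT x:{b<..<s} \<union> {s}|M. \<sigma> x)" by simp
    also have "\<dots> = (LINT x:{b<..<s}|M. \<sigma> x) + (LINT x:{s}|M. \<sigma> x)"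
      by (rule set_integral_Un) (auto intro!: set_integrable_M \<sigma>)
    also have "(LINT x:{s}|M. \<sigma> x) = measure M {s} *\<^sub>R \<sigma> s"
    proof -
      have "(LINT x:{s}|M. \<sigma> x) = (LINT x|M. indicator {s} x *\<^sub>R \<sigma> s)"
        unfolding set_lebesgue_integral_def
        by (rule Bochner_Integration.integral_cong) (auto simp: indicator_def)
      then show ?thesis by (simp add: emeasure_eq_measure)
    qed
    finally show ?thesis using \<sigma>(3)[of b s] s b by (auto simp: left_value_def algebra_simps)
  qed
  moreover have "\<forall>\<^sub>F a in at_left s. f b + (LINT x:{b<..a}|M. \<sigma> x) = f a"
  proof -
    have "f b + (LINT x:{b<..a}|M. \<sigma> x) = f a" if "b < a" "a < s" for a
      using \<sigma>(3)[of b a, symmetric] s b that by auto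
    then show ?thesis using b(2) by (auto simp: eventually_at_left)
  qed
  ultimately show ?thesis by (auto elim: Lim_transform_eventually)
qed

lemma measure_singleton_off_N: "s \<notin> N \<Longrightarrow> measure M {s} = 0"
proof -
  assume "s \<notin> N"
  then have "{s} - N = {s}" by auto
  then have "emeasure M {s} = emeasure lborel ({s} \<inter> I)" using M_off_N[of "{s}"] by simp
  also have "\<dots> \<le> emeasure lborel {s}" by (rule emeasure_mono) auto
  finally show ?thesis by (simp add: measure_def)
qed

lemma countable_atoms: "countable {s. measure M {s} \<noteq> 0}"
  by (rule countable_support)

lemma measure_outside_I: "emeasure M (- I) = 0"
  using M_off_N[of "- I"] N_subset by (simp add: Diff_triv disjoint_eq_subset_Compl Int_commute)

lemma AE_M_I: "AE x in M. x \<in> I"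
  using measure_outside_I by (intro AE_I[of _ _ "- I"]) auto

end

section \<open>Weak derivatives\<close>

lemma borel_measurable_lebesgue_on [measurable (raw)]:
  "f \<in> borel_measurable borel \<Longrightarrow> f \<in> borel_measurable (lebesgue_on S)"
  by (intro measurable_restrict_space1 measurable_completion) simp

lemma continuous_borel_measurable_lebesgue_on:
  fixes f :: "real \<Rightarrow> 'b::euclidean_space"
  shows "continuous_on UNIV f \<Longrightarrow> f \<in> borel_measurable (lebesgue_on S)"
  by (intro borel_measurable_lebesgue_on borel_measurable_continuous_onI)

lemma integrable_bounded_scaleR:
  fixes f :: "'a \<Rightarrow> 'b::{banach, second_countable_topology}" and w :: "'a \<Rightarrow> real"
  assumes "integrable M f" "w \<in> borel_measurable M" "\<And>x. x \<in> space M \<Longrightarrow> \<bar>w x\<bar> \<le> B"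
  shows "integrable M (\<lambda>x. w x *\<^sub>R f x)"
proof (rule Bochner_Integration.integrable_bound)
  show "integrable M (\<lambda>x. B * norm (f x))" using assms(1) by simp
  show "(\<lambda>x. w x *\<^sub>R f x) \<in> borel_measurable M" using assms(1,2) by measurable
  show "AE x in M. norm (w x *\<^sub>R f x) \<le> norm (B * norm (f x))"
    using assms(3) by (intro AE_I2) (auto simp: abs_mult intro!: mult_right_mono order_trans[OF _ abs_ge_self])
qed

lemma test_function_bounded:
  assumes "test_function {a<..<b} \<phi>" "a < b"
  obtains B where "\<And>x. \<bar>\<phi> x\<bar> \<le> B" "\<And>x. \<bar>deriv \<phi> x\<bar> \<le> B"
proof -
  obtain l r where lr: "l < r" "\<And>x. x \<notin> {l..r} \<Longrightarrow> \<phi> x = 0" "\<And>x. x \<notin> {l..r} \<Longrightarrow> deriv \<phi> x = 0"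
    using test_function_support[OF assms] by metis
  have "bounded (\<phi> ` {l..r})" "bounded (deriv \<phi> ` {l..r})"
    using test_functionD[OF assms(1)]
    by (auto intro!: compact_imp_bounded compact_continuous_image intro: continuous_on_subset)
  then obtain B1 B2 where "\<forall>y\<in>\<phi> ` {l..r}. norm y \<le> B1" "\<forall>y\<in>deriv \<phi> ` {l..r}. norm y \<le> B2"
    unfolding bounded_iff by blast
  then have B: "\<And>x. x \<in> {l..r} \<Longrightarrow> \<bar>\<phi> x\<bar> \<le> B1" "\<And>x. x \<in> {l..r} \<Longrightarrow> \<bar>deriv \<phi> x\<bar> \<le> B2"
    by auto
  have "0 \<le> B1" "0 \<le> B2" using B[of l] lr(1) by auto
  then have "\<bar>\<phi> x\<bar> \<le> max B1 B2 \<and> \<bar>deriv \<phi> x\<bar> \<le> max B1 B2" for x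
    using B[of x] lr(2,3)[of x] by (cases "x \<in> {l..r}") auto
  then show ?thesis using that by blast
qed

text \<open>A primitive of \<open>w\<close> is constant to the right of the support, and the zero
  mean makes that constant vanish; so the primitive that vanishes on the left has compact support as
  well.\<close>

lemma zero_mean_antiderivative:
  fixes w :: "real \<Rightarrow> real"
  assumes w: "test_function {a<..<b} w" "a < b" and zero: "integral {a..b} w = 0"
  obtains \<phi> where "test_function {a<..<b} \<phi>" "deriv \<phi> = w"
proof -
  obtain l r where lr: "a < l" "l < r" "r < b" "\<And>x. x \<notin> {l..r} \<Longrightarrow> w x = 0"
    using test_function_support[OF w] by metis
  \<comment> \<open>Starting at \<open>l - 1\<close> rather than \<open>l\<close> makes every
    \<open>x \<ge> l\<close> interior to \<open>{l - 1..x + 1}\<close>, where the integral can be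
    differentiated.\<close>
  define \<phi> where "\<phi> x = integral {l - 1..x} w" for x
  have cont: "continuous_on S w" for S
    using test_functionD(2)[OF w(1)] by (rule continuous_on_subset) simp
  then have int: "w integrable_on {x..y}" for x y by (rule integrable_continuous_real)
  have left: "\<phi> x = 0" if "x < l" for x
  proof -
    have "\<phi> x = integral {l - 1..x} (\<lambda>x. 0)" unfolding \<phi>_def
      by (rule integral_cong) (use that lr(4) in auto)
    then show ?thesis by simp
  qed
  have z: "integral {x..y} w = 0" if "x < l \<and> y < l \<or> r < x \<and> r < y \<or> y < x" for x y
  proof -
    have "integral {x..y} w = integral {x..y} (\<lambda>x. 0)"
      by (rule integral_cong) (use that lr(4) in auto)
    then show ?thesis by simp
  qed
  have split: "integral {x..z} w = integral {x..y} w + integral {y..z} w" if "x \<le> y" "y \<le> z" for x y z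
    using Henstock_Kurzweil_Integration.integral_combine[OF that int] by simp
  have right: "\<phi> x = 0" if "r < x" for x
  proof -
    obtain l' where l': "a \<le> l'" "l - 1 \<le> l'" "l' < l" using lr(1) by (intro that[of "max a (l - 1)"]) auto
    obtain r' where r': "r' \<le> b" "r' \<le> x" "r < r'" using lr(3) \<open>r < x\<close> by (intro that[of "min b x"]) auto
    have "integral {a..b} w = integral {a..l'} w + integral {l'..r'} w + integral {r'..b} w"
      using split[of a l' b] split[of l' r' b] l' r' lr(2) by auto
    moreover have "\<phi> x = integral {l - 1..l'} w + integral {l'..r'} w + integral {r'..x} w"
      unfolding \<phi>_def using split[of "l - 1" l' x] split[of l' r' x] l' r' lr(2) by auto
    ultimately show ?thesis
      using z[of a l'] z[of "l - 1" l'] z[of r' b] z[of r' x] l' r' lr \<open>r < x\<close> zero by auto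
  qed
  have D: "(\<phi> has_real_derivative w x) (at x)" for x
  proof (cases "x < l")
    case True
    have "((\<lambda>x. 0) has_real_derivative w x) (at x)" using lr(4)[of x] True by simp
    then show ?thesis
      by (rule has_field_derivative_transform_within_open[of _ _ _ "{..<l}"]) (use True left in auto)
  next
    case False
    have "(\<phi> has_vector_derivative w x) (at x within {l - 1..x + 1})"
      unfolding \<phi>_def by (rule integral_has_vector_derivative) (use cont False in auto)
    then have "(\<phi> has_vector_derivative w x) (at x)"
      by (subst (asm) at_within_interior) (use False in auto)
    then show ?thesis by (simp add: has_real_derivative_iff_has_vector_derivative)
  qed
  have "Ck (Suc k) \<phi> UNIV" for k
    unfolding Ck_Suc_real using D w(1) by (intro exI[of _ w]) (auto simp: test_function_def)
  then have "Ck k \<phi> UNIV" for k by (cases k) (auto simp del: Ck.simps intro: Ck_SucD)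
  moreover have "\<phi> x = 0" if "x \<notin> {l..r}" for x using left right that by force
  moreover have "{l..r} \<subseteq> {a<..<b}" using lr by auto
  ultimately have "test_function {a<..<b} \<phi>" unfolding test_function_def by blast
  moreover have "deriv \<phi> = w" using D by (auto simp: fun_eq_iff intro: DERIV_imp_deriv)
  ultimately show ?thesis using that by blast
qed

lemma test_function_lincomb:
  assumes "test_function I f" "test_function I g"
  shows "test_function I (\<lambda>x. f x + g x * c)"
proof -
  obtain K1 K2 where K: "compact K1" "K1 \<subseteq> I" "\<forall>x. x \<notin> K1 \<longrightarrow> f x = 0"
      "compact K2" "K2 \<subseteq> I" "\<forall>x. x \<notin> K2 \<longrightarrow> g x = 0"
    using assms unfolding test_function_def by blast
  show ?thesis unfolding test_function_def
  proof
    show "\<forall>k. Ck k (\<lambda>x. f x + g x * c) UNIV"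
      using assms by (intro allI Ck_add Ck_cmult) (auto simp: test_function_def)
    show "\<exists>K. compact K \<and> K \<subseteq> I \<and> (\<forall>x. x \<notin> K \<longrightarrow> f x + g x * c = 0)"
      using K by (intro exI[of _ "K1 \<union> K2"]) auto
  qed
qed

lemma bump_integral_pos:
  assumes "a < b" "a \<le> c" "d \<le> b" "c < d" shows "0 < integral {a..b} (bump c d n)"
proof -
  have cont: "continuous_on S (bump c d n)" for S
    using test_functionD(2)[OF test_function_bump[of c d UNIV n]] continuous_on_subset by blast
  have int: "bump c d n integrable_on {a..b}" using cont by (rule integrable_continuous_real)
  have "integral {a..b} (bump c d n) \<noteq> 0"
  proof
    assume "integral {a..b} (bump c d n) = 0"
    then have "(bump c d n has_integral 0) (cbox a b)" using int by (simp add: has_integral_integral)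
    then have "bump c d n ((c + d) / 2) = 0"
      by (rule has_integral_0_cbox_imp_0[rotated -3])
        (use assms cont bump_nonneg in auto)
    moreover have "(c + d) / 2 - c = (d - c) / 2" "d - (c + d) / 2 = (d - c) / 2" by (simp_all add: field_simps)
    moreover have "0 < real (Suc n) * ((d - c) / 2)" using \<open>c < d\<close> by simp
    ultimately show False by (simp add: bump_def flat_exp_def del: of_nat_Suc)
  qed
  moreover have "0 \<le> integral {a..b} (bump c d n)"
    by (rule integral_nonneg[OF int]) (simp add: bump_nonneg)
  ultimately show ?thesis by simp
qed

text \<open>The lemma of du Bois-Reymond. Every test function of mean zero is the derivative of a
  test function, so testing \<open>f\<close> against a function only sees the mean of that function.
  Bumps converging to indicators turn this into averages over intervals, and Lebesgue
  differentiation recovers the values of \<open>f\<close>.\<close>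

lemma zero_weak_derivative_imp_const:
  fixes f :: "real \<Rightarrow> 'b::euclidean_space"
  assumes "a < b" and f: "integrable (lebesgue_on {a<..<b}) f"
    and weak: "\<And>\<phi>. test_function {a<..<b} \<phi> \<Longrightarrow> (LINT x|lebesgue_on {a<..<b}. deriv \<phi> x *\<^sub>R f x) = 0"
  obtains K where "AE x in lebesgue_on {a<..<b}. f x = K"
proof -
  let ?\<Lambda> = "lebesgue_on {a<..<b}"
  obtain c where c: "a < c" "c < b" using dense assms(1) by blast
  obtain d where d: "c < d" "d < b" using dense c(2) by blast
  define \<psi>0 where "\<psi>0 = bump c d 0"
  have \<psi>0: "test_function {a<..<b} \<psi>0" unfolding \<psi>0_def by (rule test_function_bump) (use c d in auto)
  define c0 where "c0 = integral {a..b} \<psi>0"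
  have c0: "c0 > 0" unfolding c0_def \<psi>0_def by (rule bump_integral_pos) (use c d in auto)
  define K where "K = (1 / c0) *\<^sub>R (LINT x|?\<Lambda>. \<psi>0 x *\<^sub>R f x)"
  have int: "integrable ?\<Lambda> (\<lambda>x. \<psi> x *\<^sub>R f x)" if \<psi>: "test_function {a<..<b} \<psi>" for \<psi>
  proof -
    obtain B where "\<And>x. \<bar>\<psi> x\<bar> \<le> B" using test_function_bounded[OF \<psi> assms(1)] by metis
    then show ?thesis
      using integrable_bounded_scaleR[OF f continuous_borel_measurable_lebesgue_on[OF test_functionD(2)[OF \<psi>]]]
      by blast
  qed
  have eqK: "(LINT x|?\<Lambda>. \<psi> x *\<^sub>R f x) = integral {a..b} \<psi> *\<^sub>R K" if \<psi>: "test_function {a<..<b} \<psi>" for \<psi>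
  proof -
    have io: "\<psi> integrable_on {a..b}" "\<psi>0 integrable_on {a..b}"
      using test_functionD(2)[OF \<psi>] test_functionD(2)[OF \<psi>0]
      by (auto intro!: integrable_continuous_real intro: continuous_on_subset)
    have i0: "integrable ?\<Lambda> (\<lambda>x. m *\<^sub>R (\<psi>0 x *\<^sub>R f x))" for m
      using int[OF \<psi>0] by (intro integrable_scaleR_right)
    \<comment> \<open>This multiple of \<open>\<psi>0\<close> cancels the mean of
      \<open>\<psi>\<close>, so that the combination is the derivative of a test function.\<close>
    define m where "m = - integral {a..b} \<psi> / c0"
    have w: "test_function {a<..<b} (\<lambda>x. \<psi> x + \<psi>0 x * m)"
      by (rule test_function_lincomb[OF \<psi> \<psi>0])
    have "integral {a..b} (\<lambda>x. \<psi> x + \<psi>0 x * m) = integral {a..b} \<psi> + c0 * m"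
      unfolding c0_def using io
      by (subst Henstock_Kurzweil_Integration.integral_add) (auto intro: integrable_on_mult_left)
    also have "\<dots> = 0" using c0 by (simp add: m_def)
    finally obtain \<phi> where "test_function {a<..<b} \<phi>" "deriv \<phi> = (\<lambda>x. \<psi> x + \<psi>0 x * m)"
      using zero_mean_antiderivative[OF w assms(1)] by metis
    then have "(LINT x|?\<Lambda>. (\<psi> x + \<psi>0 x * m) *\<^sub>R f x) = 0" using weak by metis
    also have "(\<lambda>x. (\<psi> x + \<psi>0 x * m) *\<^sub>R f x) = (\<lambda>x. \<psi> x *\<^sub>R f x + m *\<^sub>R (\<psi>0 x *\<^sub>R f x))"
      by (auto simp: scaleR_add_left mult.commute)
    finally have "(LINT x|?\<Lambda>. \<psi> x *\<^sub>R f x) + m *\<^sub>R (LINT x|?\<Lambda>. \<psi>0 x *\<^sub>R f x) = 0"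
      using Bochner_Integration.integral_add[OF int[OF \<psi>] i0] by (simp del: scaleR_scaleR)
    then show ?thesis by (simp add: K_def m_def eq_neg_iff_add_eq_0[symmetric])
  qed
  have main: "integral {p..q} f = (q - p) *\<^sub>R K" if pq: "a < p" "p < q" "q < b" for p q
  proof -
    have bump: "test_function {a<..<b} (bump p q n)" for n
      by (rule test_function_bump) (use pq in auto)
    have "(\<lambda>n. LINT x|?\<Lambda>. bump p q n x *\<^sub>R f x) \<longlonglongrightarrow> (LINT x|?\<Lambda>. indicator {p<..<q} x *\<^sub>R f x)"
    proof (rule integral_dominated_convergence[where w="\<lambda>x. norm (f x)"])
      show "(\<lambda>x. indicator {p<..<q} x *\<^sub>R f x) \<in> borel_measurable ?\<Lambda>"
        by (intro borel_measurable_scaleR borel_measurable_lebesgue_on[OF borel_measurable_indicator]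
            borel_measurable_integrable[OF f]) simp
      show "AE x in ?\<Lambda>. (\<lambda>n. bump p q n x *\<^sub>R f x) \<longlonglongrightarrow> indicator {p<..<q} x *\<^sub>R f x"
        by (intro AE_I2 tendsto_intros bump_tendsto)
      show "AE x in ?\<Lambda>. norm (bump p q n x *\<^sub>R f x) \<le> norm (f x)" for n
        using bump_nonneg[of p q n] bump_le[of p q n]
        by (intro AE_I2) (auto intro!: mult_left_le_one_le intro: order_trans[OF _ indicator_le_1])
    qed (use f int[OF bump] in auto)
    moreover have "(\<lambda>n. integral {a..b} (bump p q n)) \<longlonglongrightarrow> integral {a..b} (indicator {p<..<q})"
    proof (rule dominated_convergence(2)[where h="\<lambda>_. 1"])
      show "bump p q n integrable_on {a..b}" for n
        using test_functionD(2)[OF bump[of n]]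
        by (auto intro!: integrable_continuous_real intro: continuous_on_subset)
      show "norm (bump p q n x) \<le> 1" for n x
        using bump_nonneg[of p q n x] order_trans[OF bump_le[of p q n x] indicator_le_1] by auto
    qed (auto intro: bump_tendsto)
    moreover have "integral {a..b} (indicator {p<..<q} :: real \<Rightarrow> real) = q - p"
    proof -
      have "integral {a..b} (indicator {p<..<q} :: real \<Rightarrow> real) = integral {a..b} (\<lambda>x. if x \<in> {p<..<q} then 1 else 0)"
        by (rule integral_cong) (auto simp: indicator_def)
      also have "\<dots> = integral {p<..<q} (\<lambda>x. 1 :: real)"
        by (subst integral_restrict_Int) (use pq in \<open>auto simp: Int_absorb1 Int_absorb2 subset_eq\<close>)
      also have "\<dots> = q - p" using pq by (simp flip: integral_open_interval_real)
      finally show ?thesis .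
    qed
    ultimately have "(\<lambda>n. integral {a..b} (bump p q n) *\<^sub>R K) \<longlonglongrightarrow> (LINT x|?\<Lambda>. indicator {p<..<q} x *\<^sub>R f x)"
        "(\<lambda>n. integral {a..b} (bump p q n) *\<^sub>R K) \<longlonglongrightarrow> (q - p) *\<^sub>R K"
      by (auto simp: eqK[OF bump] intro!: tendsto_intros)
    then have "(LINT x|?\<Lambda>. indicator {p<..<q} x *\<^sub>R f x) = (q - p) *\<^sub>R K" by (rule LIMSEQ_unique)
    moreover have "(LINT x|?\<Lambda>. indicator {p<..<q} x *\<^sub>R f x) = integral {p..q} f"
    proof -
      have i: "integrable ?\<Lambda> (\<lambda>x. indicator {p<..<q} x *\<^sub>R f x)"
        by (rule integrable_bounded_scaleR[OF f, of _ 1]) (auto simp: indicator_def intro!: borel_measurable_lebesgue_on)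
      have "(LINT x|?\<Lambda>. indicator {p<..<q} x *\<^sub>R f x) = integral {a<..<b} (\<lambda>x. indicator {p<..<q} x *\<^sub>R f x)"
        by (rule lebesgue_integral_eq_integral[OF i]) simp
      also have "\<dots> = integral {a<..<b} (\<lambda>x. if x \<in> {p<..<q} then f x else 0)"
        by (rule integral_cong) (auto simp: indicator_def)
      also have "\<dots> = integral {p<..<q} f"
        by (subst integral_restrict_Int) (use pq in \<open>auto simp: Int_absorb1 Int_absorb2 subset_eq\<close>)
      finally show ?thesis by (simp add: integral_open_interval_real)
    qed
    ultimately show ?thesis by simp
  qed
  define f0 where "f0 x = (if x \<in> {a<..<b} then f x else 0)" for x
  have "integrable lebesgue f0"
    using Lebesgue_Measure.integrable_restrict_UNIV[of "{a<..<b}" f] f by (simp add: f0_def[abs_def])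
  then have "f0 integrable_on cbox x y" for x y
    by (meson integrable_on_lebesgue integrable_on_subcbox subset_UNIV)
  then obtain T where T: "negligible T" "\<And>x e. \<lbrakk>x \<notin> T; 0 < e\<rbrakk> \<Longrightarrow> \<exists>d>0. \<forall>h. 0 < h \<and> h < d \<longrightarrow>
      norm (integral (cbox x (x + h *\<^sub>R One)) f0 /\<^sub>R h ^ DIM(real) - f0 x) < e"
    using integrable_ccontinuous_explicit[of f0] by blast
  have "f x = K" if x: "x \<in> {a<..<b}" "x \<notin> T" for x
  proof -
    have "norm (K - f x) < e" if "e > 0" for e
    proof -
      obtain d where d: "d > 0" "\<And>h. 0 < h \<Longrightarrow> h < d \<Longrightarrow> norm (integral {x..x + h} f0 /\<^sub>R h - f0 x) < e"
        using T(2)[OF x(2) \<open>e > 0\<close>] by auto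
      have "0 < min d (b - x)" using d x by auto
      then obtain h where h: "0 < h" "h < d" "h < b - x" using dense by (metis min_less_iff_conj)
      have "integral {x..x + h} f0 = integral {x..x + h} f"
        by (rule integral_cong) (use x h in \<open>auto simp: f0_def\<close>)
      also have "\<dots> = h *\<^sub>R K" using main[of x "x + h"] x h by auto
      finally show ?thesis using d(2)[OF h(1,2)] h x by (simp add: f0_def)
    qed
    then have "\<not> 0 < norm (K - f x)" by blast
    then show ?thesis by simp
  qed
  moreover have "AE x in lebesgue. x \<notin> T" using T(1) by (simp add: negligible_iff_null_sets AE_not_in)
  ultimately have "AE x in ?\<Lambda>. f x = K" by (subst AE_restrict_space_iff) auto
  then show ?thesis using that by blast
qed

lemma set_integral_sums:
  fixes f :: "'a \<Rightarrow> 'b::{banach, second_countable_topology}"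
  assumes f: "integrable M f" and A: "\<And>i::nat. A i \<in> sets M" "disjoint_family A"
  shows "(\<lambda>n. LINT x:A n|M. f x) sums (LINT x:(\<Union>n. A n)|M. f x)"
proof -
  have "(\<lambda>n. LINT x:(\<Union>i<n. A i)|M. f x) \<longlonglongrightarrow> (LINT x:(\<Union>n. \<Union>i<n. A i)|M. f x)"
    by (rule set_integral_cont_up)
      (use A f in \<open>auto intro!: integrable_imp_set_integrable simp: incseq_def intro: less_le_trans\<close>)
  moreover have "(\<Union>n. \<Union>i<n. A i) = (\<Union>n. A n)" by auto
  moreover have "(LINT x:(\<Union>i<n. A i)|M. f x) = (\<Sum>i<n. LINT x:A i|M. f x)" for n
    by (rule set_integral_finite_Union)
      (use A f in \<open>auto intro!: integrable_imp_set_integrable intro: disjoint_family_on_mono\<close>)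
  ultimately show ?thesis by (simp add: sums_def)
qed

section \<open>Functions of bounded variation and their densities\<close>

context bv_measure begin

text \<open>Anchoring the integral at minus infinity avoids the values of \<open>f\<close> at the
  ends of the interval, which \<open>has_density\<close> does not control, and yields bounds and
  measurability on the whole interval.\<close>

lemma has_density_cumulative:
  fixes \<sigma> :: "real \<Rightarrow> 'b::euclidean_space"
  assumes d: "has_density \<sigma> f"
  obtains K where "\<And>x. x \<in> I \<Longrightarrow> f x = K + (LINT s:{..x}|M. \<sigma> s)"
proof -
  note \<sigma> = has_densityD[OF d]
  have diff: "(LINT s:{..b}|M. \<sigma> s) = (LINT s:{..a}|M. \<sigma> s) + (LINT s:{a<..b}|M. \<sigma> s)" if "a \<le> b" for a b
  proof -
    have "(LINT s:{..a} \<union> {a<..b}|M. \<sigma> s) = (LINT s:{..a}|M. \<sigma> s) + (LINT s:{a<..b}|M. \<sigma> s)"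
      by (rule set_integral_Un) (auto intro!: set_integrable_M \<sigma>)
    moreover have "{..a} \<union> {a<..b} = {..b}" using that by auto
    ultimately show ?thesis by simp
  qed
  define x0 where "x0 = L / 2"
  have x0: "x0 \<in> I" using L_pos by (simp add: x0_def)
  have "f x = (f x0 - (LINT s:{..x0}|M. \<sigma> s)) + (LINT s:{..x}|M. \<sigma> s)" if "x \<in> I" for x
  proof (cases "x \<le> x0")
    case True
    then show ?thesis using diff[of x x0] \<sigma>(3)[of x x0] that x0 by (auto simp: algebra_simps)
  next
    case False
    then show ?thesis using diff[of x0 x] \<sigma>(3)[of x0 x] that x0 by (auto simp: algebra_simps)
  qed
  then show ?thesis using that by blast
qed

lemma cumulative_measurable:
  fixes \<sigma> :: "real \<Rightarrow> 'b::euclidean_space"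
  assumes "integrable M \<sigma>"
  shows "(\<lambda>x. LINT s:{..x}|M. \<sigma> s) \<in> borel_measurable borel"
proof -
  have [measurable]: "\<sigma> \<in> borel_measurable borel"
    using assms by (auto cong: measurable_cong_sets dest: borel_measurable_integrable)
  have "(\<lambda>(x, s). (if s \<le> x then 1 else 0) *\<^sub>R \<sigma> s) \<in> borel_measurable (borel \<Otimes>\<^sub>M borel)"
    by measurable
  then have "(\<lambda>(x, s). (if s \<le> x then 1 else 0) *\<^sub>R \<sigma> s) \<in> borel_measurable (borel \<Otimes>\<^sub>M M)"
    by (simp cong: measurable_cong_sets sets_pair_measure_cong)
  from borel_measurable_lebesgue_integral[OF this]
  have "(\<lambda>x. LINT s|M. (if s \<le> x then 1 else 0) *\<^sub>R \<sigma> s) \<in> borel_measurable borel" by simp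
  moreover have "(LINT s|M. (if s \<le> x then 1 else 0) *\<^sub>R \<sigma> s) = (LINT s:{..x}|M. \<sigma> s)" for x
    unfolding set_lebesgue_integral_def
    by (rule Bochner_Integration.integral_cong) (auto simp: indicator_def)
  ultimately show ?thesis by simp
qed

lemma has_density_integrable:
  fixes \<sigma> :: "real \<Rightarrow> 'b::euclidean_space"
  assumes d: "has_density \<sigma> f"
  shows "integrable (lebesgue_on I) f"
proof -
  note \<sigma> = has_densityD[OF d]
  obtain K where K: "\<And>x. x \<in> I \<Longrightarrow> f x = K + (LINT s:{..x}|M. \<sigma> s)"
    using has_density_cumulative[OF d] by blast
  interpret l: finite_measure "lebesgue_on I"
    by (rule finite_measureI) (use L_pos in \<open>auto simp: emeasure_restrict_space\<close>)
  have "integrable (lebesgue_on I) (\<lambda>x. K + (LINT s:{..x}|M. \<sigma> s))"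
  proof (rule l.integrable_const_bound)
    show "AE x in lebesgue_on I. norm (K + (LINT s:{..x}|M. \<sigma> s)) \<le> norm K + (LINT s|M. norm (\<sigma> s))"
    proof (rule AE_I2)
      fix x
      have "norm (LINT s:{..x}|M. \<sigma> s) \<le> (LINT s:{..x}|M. norm (\<sigma> s))"
        by (rule set_integral_norm_bound) (auto intro!: set_integrable_M \<sigma>)
      also have "\<dots> \<le> (LINT s|M. norm (\<sigma> s))"
        unfolding set_lebesgue_integral_def
        by (rule integral_mono)
          (use set_integrable_M[of "\<lambda>s. norm (\<sigma> s)" "{..x}"] \<sigma>(1) in
            \<open>auto simp: set_integrable_def mult_left_le_one_le\<close>)
      finally show "norm (K + (LINT s:{..x}|M. \<sigma> s)) \<le> norm K + (LINT s|M. norm (\<sigma> s))"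
        by (meson add_left_mono norm_triangle_ineq order_trans)
    qed
    show "(\<lambda>x. K + (LINT s:{..x}|M. \<sigma> s)) \<in> borel_measurable (lebesgue_on I)"
      by (intro borel_measurable_lebesgue_on borel_measurable_add cumulative_measurable \<sigma>) auto
  qed
  then show ?thesis by (subst Bochner_Integration.integrable_cong[OF refl]) (use K in auto)
qed

text \<open>Fubini for the kernel \<open>deriv \<phi> x\<close> restricted to
  \<open>s \<le> x\<close>: integrating over \<open>x\<close> first gives \<open>- \<phi> s\<close>
  by the fundamental theorem. The additive constant in \<open>f\<close> drops out because
  \<open>deriv \<phi>\<close> has mean zero.\<close>

lemma integration_by_parts:
  fixes \<sigma> :: "real \<Rightarrow> 'b::euclidean_space"
  assumes d: "has_density \<sigma> f" and \<phi>: "test_function I \<phi>"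
  shows "(LINT x|lebesgue_on I. deriv \<phi> x *\<^sub>R f x) = - (LINT x|M. \<phi> x *\<^sub>R \<sigma> x)"
proof -
  note \<sigma> = has_densityD[OF d]
  note [measurable] = \<sigma>(2)
  obtain K where K: "\<And>x. x \<in> I \<Longrightarrow> f x = K + (LINT s:{..x}|M. \<sigma> s)"
    using has_density_cumulative[OF d] by blast
  obtain l r where lr: "0 < l" "l < r" "r < L" "\<And>x. x \<notin> {l..r} \<Longrightarrow> \<phi> x = 0" "\<And>x. x \<notin> {l..r} \<Longrightarrow> deriv \<phi> x = 0"
    using test_function_support[OF \<phi> L_pos] by metis
  obtain B where B: "\<And>x. \<bar>\<phi> x\<bar> \<le> B" "\<And>x. \<bar>deriv \<phi> x\<bar> \<le> B"
    using test_function_bounded[OF \<phi> L_pos] by metis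
  note td = test_functionD[OF \<phi>]
  have [measurable]: "deriv \<phi> \<in> borel_measurable borel" "\<phi> \<in> borel_measurable borel"
    using td by (auto intro: borel_measurable_continuous_onI)
  have tail: "(LINT x:{s..}|lborel. deriv \<phi> x) = - \<phi> s" for s
  proof -
    define R where "R = max r s + 1"
    have "(LINT x:{s..}|lborel. deriv \<phi> x) = (LINT x|lborel. indicator {s..R} x *\<^sub>R deriv \<phi> x)"
      unfolding set_lebesgue_integral_def
    proof (rule Bochner_Integration.integral_cong[OF refl])
      fix x show "indicator {s..} x *\<^sub>R deriv \<phi> x = indicator {s..R} x *\<^sub>R deriv \<phi> x"
        using lr(5)[of x] by (cases "x \<in> {l..r}") (auto simp: indicator_def R_def)
    qed
    also have "\<dots> = \<phi> R - \<phi> s"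
    proof (rule integral_FTC_Icc)
      show "(\<phi> has_vector_derivative deriv \<phi> x) (at x within {s..R})" for x
        using has_field_derivative_at_within[OF td(1)]
        by (simp add: has_real_derivative_iff_has_vector_derivative)
      show "continuous_on {s..R} (deriv \<phi>)" using td(3) by (rule continuous_on_subset) simp
    qed (simp add: R_def)
    also have "\<phi> R = 0" by (rule lr(4)) (auto simp: R_def)
    finally show ?thesis by simp
  qed
  have \<phi>'_int: "integrable lborel (deriv \<phi>)"
  proof -
    have "integrable lborel (\<lambda>x. indicator {l..r} x *\<^sub>R deriv \<phi> x)"
      by (rule borel_integrable_compact) (use td in \<open>auto intro: continuous_on_subset\<close>)
    also have "(\<lambda>x. indicator {l..r} x *\<^sub>R deriv \<phi> x) = deriv \<phi>"
    proof
      show "indicator {l..r} x *\<^sub>R deriv \<phi> x = deriv \<phi> x" for x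
        using lr(5)[of x] by (cases "x \<in> {l..r}") auto
    qed
    finally show ?thesis .
  qed
  have mean: "(LINT x|lborel. deriv \<phi> x) = 0"
  proof -
    have "(LINT x|lborel. deriv \<phi> x) = (LINT x:{0..}|lborel. deriv \<phi> x)"
      unfolding set_lebesgue_integral_def
    proof (rule Bochner_Integration.integral_cong[OF refl])
      fix x show "deriv \<phi> x = indicator {0..} x *\<^sub>R deriv \<phi> x"
        using lr(1) lr(5)[of x] by (cases "x \<in> {l..r}") auto
    qed
    then show ?thesis using tail[of 0] lr(4)[of 0] lr(1) by simp
  qed
  define g where "g x = (LINT s:{..x}|M. \<sigma> s)" for x
  define h where "h = (\<lambda>x s. (if s \<le> x then deriv \<phi> x else 0) *\<^sub>R \<sigma> s)"
  interpret P: pair_sigma_finite lborel M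
    by (intro pair_sigma_finite.intro sigma_finite_lborel) (rule sigma_finite_measure_axioms)
  have "(\<lambda>(x, s). h x s) \<in> borel_measurable (borel \<Otimes>\<^sub>M borel)"
    unfolding h_def by measurable
  then have h_meas: "(\<lambda>(x, s). h x s) \<in> borel_measurable (lborel \<Otimes>\<^sub>M M)"
    by (simp cong: measurable_cong_sets sets_pair_measure_cong)
  have h_int: "integrable (lborel \<Otimes>\<^sub>M M) (\<lambda>(x, s). h x s)"
  proof (rule Bochner_Integration.integrable_bound[OF _ h_meas])
    show "integrable (lborel \<Otimes>\<^sub>M M) (\<lambda>(x, s). deriv \<phi> x * norm (\<sigma> s))"
    proof (rule P.Fubini_integrable)
      have "(\<lambda>(x, s). deriv \<phi> x * norm (\<sigma> s)) \<in> borel_measurable (borel \<Otimes>\<^sub>M borel)" by measurable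
      then show "(\<lambda>(x, s). deriv \<phi> x * norm (\<sigma> s)) \<in> borel_measurable (lborel \<Otimes>\<^sub>M M)"
        by (simp cong: measurable_cong_sets sets_pair_measure_cong)
    qed (use \<phi>'_int \<sigma>(1) in \<open>auto simp: abs_mult\<close>)
    show "AE x in lborel \<Otimes>\<^sub>M M. norm (case x of (x, s) \<Rightarrow> h x s) \<le> norm (case x of (x, s) \<Rightarrow> deriv \<phi> x * norm (\<sigma> s))"
      by (intro AE_I2) (auto simp: h_def abs_mult)
  qed
  have g_int: "integrable lborel (\<lambda>x. deriv \<phi> x *\<^sub>R g x)" "(LINT x|lborel. deriv \<phi> x *\<^sub>R g x) = (LINT x|lborel. LINT s|M. h x s)"
  proof -
    have *: "(LINT s|M. h x s) = deriv \<phi> x *\<^sub>R g x" for x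
    proof -
      have "(LINT s|M. h x s) = (LINT s|M. deriv \<phi> x *\<^sub>R (indicator {..x} s *\<^sub>R \<sigma> s))"
        by (rule Bochner_Integration.integral_cong) (auto simp: h_def indicator_def)
      then show ?thesis by (simp only: integral_scaleR_right g_def set_lebesgue_integral_def)
    qed
    show "integrable lborel (\<lambda>x. deriv \<phi> x *\<^sub>R g x)" using P.integrable_fst[OF h_int] by (simp add: *)
    show "(LINT x|lborel. deriv \<phi> x *\<^sub>R g x) = (LINT x|lborel. LINT s|M. h x s)" by (simp add: *)
  qed
  have "(LINT x|lborel. LINT s|M. h x s) = (LINT s|M. LINT x|lborel. h x s)"
    by (rule P.Fubini_integral[OF h_int, symmetric])
  also have "\<dots> = (LINT s|M. - (\<phi> s *\<^sub>R \<sigma> s))"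
  proof (rule Bochner_Integration.integral_cong[OF refl])
    fix s
    have "(LINT x|lborel. h x s) = (LINT x|lborel. (indicator {s..} x *\<^sub>R deriv \<phi> x) *\<^sub>R \<sigma> s)"
      by (rule Bochner_Integration.integral_cong) (auto simp: h_def indicator_def)
    also have "\<dots> = (LINT x|lborel. indicator {s..} x *\<^sub>R deriv \<phi> x) *\<^sub>R \<sigma> s"
      by (rule integral_scaleR_left) (use integrable_mult_indicator[OF _ \<phi>'_int, of "{s..}"] in simp)
    finally show "(LINT x|lborel. h x s) = - (\<phi> s *\<^sub>R \<sigma> s)"
      using tail[of s] by (simp add: set_lebesgue_integral_def)
  qed
  finally have main: "(LINT x|lborel. deriv \<phi> x *\<^sub>R g x) = - (LINT s|M. \<phi> s *\<^sub>R \<sigma> s)"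
    using g_int by simp
  have "(LINT x|lebesgue_on I. deriv \<phi> x *\<^sub>R f x) = (LINT x|lebesgue_on I. deriv \<phi> x *\<^sub>R (K + g x))"
    by (rule Bochner_Integration.integral_cong) (auto simp: K g_def)
  also have "\<dots> = (LINT x|lebesgue. indicator I x *\<^sub>R (deriv \<phi> x *\<^sub>R (K + g x)))"
    by (rule integral_restrict_space) auto
  also have "\<dots> = (LINT x|lebesgue. deriv \<phi> x *\<^sub>R K + deriv \<phi> x *\<^sub>R g x)"
  proof (rule Bochner_Integration.integral_cong[OF refl])
    fix x show "indicator I x *\<^sub>R (deriv \<phi> x *\<^sub>R (K + g x)) = deriv \<phi> x *\<^sub>R K + deriv \<phi> x *\<^sub>R g x"
      using lr(1-3) lr(5)[of x] by (cases "x \<in> {l..r}") (auto simp: scaleR_add_right)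
  qed
  also have "\<dots> = (LINT x|lborel. deriv \<phi> x *\<^sub>R K + deriv \<phi> x *\<^sub>R g x)"
    by (rule integral_completion) (use g_int(1) in auto)
  also have "\<dots> = (LINT x|lborel. deriv \<phi> x *\<^sub>R K) + (LINT x|lborel. deriv \<phi> x *\<^sub>R g x)"
    by (rule Bochner_Integration.integral_add) (use g_int(1) \<phi>'_int in auto)
  also have "(LINT x|lborel. deriv \<phi> x *\<^sub>R K) = (LINT x|lborel. deriv \<phi> x) *\<^sub>R K"
    by (rule integral_scaleR_left) (use \<phi>'_int in auto)
  finally show ?thesis using main mean by simp
qed

text \<open>Putting 0 on all other sets is what \<open>vector_measure\<close> demands; it makes
  equality of vector measures an equality of functions, as needed for the descriptions by
  \<open>THE\<close>.\<close>

definition density_measure :: "(real \<Rightarrow> 'b::euclidean_space) \<Rightarrow> real set \<Rightarrow> 'b" where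
  "density_measure \<sigma> A = (if A \<in> sets (restrict_space borel I) then LINT x:A|M. \<sigma> x else 0)"

lemma sets_restrict_I: "A \<in> sets (restrict_space borel I) \<longleftrightarrow> A \<in> sets borel \<and> A \<subseteq> I"
  by (subst sets_restrict_space_iff) auto

lemma vector_measure_density:
  fixes \<sigma> :: "real \<Rightarrow> 'b::euclidean_space"
  assumes \<sigma>: "integrable M \<sigma>"
  shows "vector_measure I (density_measure \<sigma>)"
  unfolding vector_measure_def
proof (intro conjI allI impI)
  fix A :: "nat \<Rightarrow> real set"
  assume A: "range A \<subseteq> sets (restrict_space borel I) \<and> disjoint_family A"
  then have Ai: "A i \<in> sets borel" "A i \<subseteq> I" for i using sets_restrict_I by blast+
  then have U: "(\<Union>n. A n) \<in> sets (restrict_space borel I)" unfolding sets_restrict_I by auto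
  have "(\<lambda>n. LINT x:A n|M. \<sigma> x) sums (LINT x:(\<Union>n. A n)|M. \<sigma> x)"
    by (rule set_integral_sums) (use A Ai \<sigma> in auto)
  then show "(\<lambda>n. density_measure \<sigma> (A n)) sums density_measure \<sigma> (\<Union>n. A n)"
    using U Ai by (simp add: density_measure_def sets_restrict_I)
qed (auto simp: density_measure_def)

end

lemma borel_measurable_lebesgue_on_AE:
  fixes f g :: "real \<Rightarrow> 'b::euclidean_space"
  assumes f: "f \<in> borel_measurable (lebesgue_on S)" and S: "S \<in> sets lebesgue"
    and eq: "AE x in lebesgue_on S. f x = g x"
  shows "g \<in> borel_measurable (lebesgue_on S)"
proof -
  have "(\<lambda>x. if x \<in> S then f x else 0) \<in> borel_measurable lebesgue"
    using f S by (simp add: borel_measurable_if)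
  moreover have "AE x in lebesgue. (if x \<in> S then f x else 0) = (if x \<in> S then g x else 0)"
    using eq S by (subst (asm) AE_restrict_space_iff) auto
  ultimately have "(\<lambda>x. if x \<in> S then g x else 0) \<in> borel_measurable lebesgue"
    by (rule borel_measurable_AE)
  then show ?thesis using S by (simp add: borel_measurable_if)
qed

text \<open>The integral against a vector measure must not depend on the measure and density chosen
  to represent it. Two representations agree on sets, and monotone approximation extends the
  agreement to bounded scalar integrands.\<close>

lemma has_vm_integral_unique:
  fixes \<sigma> \<sigma>' :: "'a \<Rightarrow> 'b::euclidean_space"
  assumes sets: "sets m' = sets m"
    and \<sigma>: "integrable m \<sigma>" "integrable m' \<sigma>'"
    and eq: "\<And>A. A \<in> sets m \<Longrightarrow> (LINT x:A|m. \<sigma> x) = (LINT x:A|m'. \<sigma>' x)"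
    and \<phi>: "\<phi> \<in> borel_measurable m" "\<And>x. \<bar>\<phi> x\<bar> \<le> B"
  shows "(LINT x|m. \<phi> x *\<^sub>R \<sigma> x) = (LINT x|m'. \<phi> x *\<^sub>R \<sigma>' x)"
proof -
  have meas: "u \<in> borel_measurable m' \<longleftrightarrow> u \<in> borel_measurable m" for u :: "'a \<Rightarrow> real"
    by (simp cong: measurable_cong_sets add: sets)
  have sp: "space m' = space m" using sets by (rule sets_eq_imp_space_eq)
  have int: "integrable m (\<lambda>x. u x *\<^sub>R \<sigma> x)" "integrable m' (\<lambda>x. u x *\<^sub>R \<sigma>' x)"
    if "u \<in> borel_measurable m" "\<And>x. x \<in> space m \<Longrightarrow> \<bar>u x\<bar> \<le> C" for u C
    using integrable_bounded_scaleR[OF \<sigma>(1), of u C] integrable_bounded_scaleR[OF \<sigma>(2), of u C] that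
    by (auto simp: meas sp)
  \<comment> \<open>Boundedness is part of the induction claim because the summands and approximants
    are known to be integrable against the densities only if they inherit it.\<close>
  have nonneg: "(\<exists>C. \<forall>x\<in>space m. u x \<le> C) \<longrightarrow> (LINT x|m. u x *\<^sub>R \<sigma> x) = (LINT x|m'. u x *\<^sub>R \<sigma>' x)"
    if "u \<in> borel_measurable m" "\<And>x. 0 \<le> u x" for u :: "'a \<Rightarrow> real"
    using that
  proof (induction rule: borel_measurable_induct_real)
    case (set A)
    then show ?case using eq[OF set] by (simp add: set_lebesgue_integral_def)
  next
    case (mult u c)
    show ?case
    \<comment> \<open>For \<open>c = 0\<close> a bound on \<open>c * u\<close> does not bound
      \<open>u\<close>, but both sides vanish.\<close>
    proof (cases "c = 0")
      case False
      have "(\<exists>C. \<forall>x\<in>space m. c * u x \<le> C) \<Longrightarrow> \<exists>C. \<forall>x\<in>space m. u x \<le> C"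
        using False mult.hyps(1) by (metis less_eq_real_def mult.commute pos_le_divide_eq)
      then show ?thesis using mult.IH by (simp flip: scaleR_scaleR)
    qed simp
  next
    case (add u v)
    show ?case
    proof
      assume "\<exists>C. \<forall>x\<in>space m. v x + u x \<le> C"
      then obtain C where C: "\<And>x. x \<in> space m \<Longrightarrow> v x + u x \<le> C" by blast
      have b: "\<bar>u x\<bar> \<le> C" "\<bar>v x\<bar> \<le> C" if "x \<in> space m" for x using C[OF that] add.hyps(2,4)[of x] by auto
      then have "\<exists>C. \<forall>x\<in>space m. u x \<le> C" "\<exists>C. \<forall>x\<in>space m. v x \<le> C" by (meson abs_le_D1)+
      then show "(LINT x|m. (v x + u x) *\<^sub>R \<sigma> x) = (LINT x|m'. (v x + u x) *\<^sub>R \<sigma>' x)"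
        using add.IH int[OF add.hyps(1) b(1)] int[OF add.hyps(3) b(2)] by (simp add: scaleR_add_left)
    qed
  next
    case (seq U)
    show ?case
    proof
      assume "\<exists>C. \<forall>x\<in>space m. u x \<le> C"
      then obtain C where C: "\<And>x. x \<in> space m \<Longrightarrow> u x \<le> C" by blast
      have U_le: "U i x \<le> C" if "x \<in> space m" for i x
        using seq.hyps(3) order_trans[OF incseq_le[OF _ seq.hyps(4)[OF that]] C[OF that]]
        by (auto simp: incseq_def le_fun_def)
      have U_abs: "\<bar>U i x\<bar> \<le> C" if "x \<in> space m" for i x using U_le[OF that] seq.hyps(2) by simp
      have u_meas: "u \<in> borel_measurable m" using that(1) by simp
      have lim: "(\<lambda>i. LINT x|n. U i x *\<^sub>R \<tau> x) \<longlonglongrightarrow> (LINT x|n. u x *\<^sub>R \<tau> x)"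
        if n: "sets n = sets m" and \<tau>: "integrable n \<tau>" for n and \<tau> :: "'a \<Rightarrow> 'b"
      proof (rule integral_dominated_convergence[where w="\<lambda>x. C * norm (\<tau> x)"])
        have sp': "space n = space m" using n by (rule sets_eq_imp_space_eq)
        have [measurable]: "U i \<in> borel_measurable n" "u \<in> borel_measurable n" for i
          using seq.hyps(1) u_meas n by (simp_all cong: measurable_cong_sets)
        have [measurable]: "\<tau> \<in> borel_measurable n" using \<tau> by simp
        show "(\<lambda>x. u x *\<^sub>R \<tau> x) \<in> borel_measurable n" "\<And>i. (\<lambda>x. U i x *\<^sub>R \<tau> x) \<in> borel_measurable n"
          by measurable
        show "integrable n (\<lambda>x. C * norm (\<tau> x))" using \<tau> by simp
        show "AE x in n. (\<lambda>i. U i x *\<^sub>R \<tau> x) \<longlonglongrightarrow> u x *\<^sub>R \<tau> x"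
          using seq.hyps(4) by (auto intro!: AE_I2 tendsto_intros simp: sp')
        show "AE x in n. norm (U i x *\<^sub>R \<tau> x) \<le> C * norm (\<tau> x)" for i
          using U_abs by (auto intro!: AE_I2 mult_right_mono simp: sp')
      qed
      have "(LINT x|m. U i x *\<^sub>R \<sigma> x) = (LINT x|m'. U i x *\<^sub>R \<sigma>' x)" for i
        using seq.IH U_le by blast
      then show "(LINT x|m. u x *\<^sub>R \<sigma> x) = (LINT x|m'. u x *\<^sub>R \<sigma>' x)"
        using LIMSEQ_unique lim[OF refl \<sigma>(1)] lim[OF sets \<sigma>(2)] by simp
    qed
  qed
  have [measurable]: "\<phi> \<in> borel_measurable m" by fact
  have b: "\<bar>max 0 (\<phi> x)\<bar> \<le> B" "\<bar>max 0 (- \<phi> x)\<bar> \<le> B" for x using \<phi>(2)[of x] by auto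
  then have "\<exists>C. \<forall>x\<in>space m. max 0 (\<phi> x) \<le> C" "\<exists>C. \<forall>x\<in>space m. max 0 (- \<phi> x) \<le> C"
    by (meson abs_le_D1)+
  then have "(LINT x|m. max 0 (\<phi> x) *\<^sub>R \<sigma> x) = (LINT x|m'. max 0 (\<phi> x) *\<^sub>R \<sigma>' x)"
      "(LINT x|m. max 0 (- \<phi> x) *\<^sub>R \<sigma> x) = (LINT x|m'. max 0 (- \<phi> x) *\<^sub>R \<sigma>' x)"
    using nonneg by auto
  moreover have "\<phi> x *\<^sub>R v = max 0 (\<phi> x) *\<^sub>R v - max 0 (- \<phi> x) *\<^sub>R v" for x and v :: 'b
    by (auto simp: max_def)
  moreover have "integrable m (\<lambda>x. max 0 (\<phi> x) *\<^sub>R \<sigma> x)" "integrable m' (\<lambda>x. max 0 (\<phi> x) *\<^sub>R \<sigma>' x)"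
      "integrable m (\<lambda>x. max 0 (- \<phi> x) *\<^sub>R \<sigma> x)" "integrable m' (\<lambda>x. max 0 (- \<phi> x) *\<^sub>R \<sigma>' x)"
    using b by (auto intro!: int[where C=B])
  ultimately show ?thesis by simp
qed

lemma vector_measure_empty: "vector_measure I \<mu> \<Longrightarrow> \<mu> {} = 0"
proof -
  assume "vector_measure I \<mu>"
  moreover have "range (\<lambda>_::nat. {}) \<subseteq> sets (restrict_space borel I)" "disjoint_family (\<lambda>_::nat. {})"
    by (auto simp: disjoint_family_on_def)
  ultimately have "(\<lambda>n::nat. \<mu> {}) sums \<mu> (\<Union>n::nat. {})" unfolding vector_measure_def by blast
  then show ?thesis by (auto simp: sums_iff summable_const_iff)
qed

lemma vector_measure_Un:
  assumes \<mu>: "vector_measure I \<mu>"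
    and A: "A \<in> sets (restrict_space borel I)" "B \<in> sets (restrict_space borel I)" "A \<inter> B = {}"
  shows "\<mu> (A \<union> B) = \<mu> A + \<mu> B"
proof -
  define C where "C n = (if n = 0 then A else if n = 1 then B else {})" for n :: nat
  have "range C \<subseteq> sets (restrict_space borel I)" "disjoint_family C"
    using A by (auto simp: C_def disjoint_family_on_def)
  then have "(\<lambda>n. \<mu> (C n)) sums \<mu> (\<Union>n. C n)" using \<mu> unfolding vector_measure_def by blast
  moreover have "(\<Union>n. C n) = A \<union> B" by (auto simp: C_def split: if_splits)
  moreover have "(\<lambda>n. \<mu> (C n)) sums (\<Sum>n\<in>{0, 1}. \<mu> (C n))"
    by (rule sums_finite) (auto simp: C_def vector_measure_empty[OF \<mu>])
  ultimately show ?thesis by (auto simp: C_def dest: sums_unique2)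
qed

lemma decseq_Ioc_partition:
  fixes a :: "nat \<Rightarrow> real"
  assumes "decseq a" "a \<longlonglongrightarrow> l" "\<And>n. l < a n"
  shows "disjoint_family (\<lambda>n. {a (Suc n)<..a n})" "(\<Union>n. {a (Suc n)<..a n}) = {l<..a 0}"
proof -
  have "{a (Suc m)<..a m} \<inter> {a (Suc n)<..a n} = {}" if "m < n" for m n
    using decseqD[OF assms(1), of "Suc m" n] that by auto
  then show "disjoint_family (\<lambda>n. {a (Suc n)<..a n})"
    unfolding disjoint_family_on_def by (metis Int_commute linorder_neqE_nat)
  have "x \<in> (\<Union>n. {a (Suc n)<..a n})" if x: "l < x" "x \<le> a 0" for x
  proof -
    have "\<exists>n. a n < x" using order_tendstoD(2)[OF assms(2) x(1)] by (auto simp: eventually_sequentially)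
    then have n: "a (LEAST n. a n < x) < x" by (rule LeastI_ex)
    then obtain k where k: "(LEAST n. a n < x) = Suc k" using x(2) by (metis leD not0_implies_Suc)
    then have "\<not> a k < x" using not_less_Least[of k "\<lambda>n. a n < x"] by auto
    then show ?thesis using n k by (auto intro!: exI[of _ k])
  qed
  then show "(\<Union>n. {a (Suc n)<..a n}) = {l<..a 0}"
    using assms(3) decseqD[OF assms(1), of 0] by (fastforce intro: order_trans less_trans)
qed

lemma incseq_Ioc_partition:
  fixes a :: "nat \<Rightarrow> real"
  assumes "incseq a" "a \<longlonglongrightarrow> l" "\<And>n. a n < l"
  shows "disjoint_family (\<lambda>n. {a n<..a (Suc n)})" "(\<Union>n. {a n<..a (Suc n)}) = {a 0<..<l}"
proof -
  have "{a m<..a (Suc m)} \<inter> {a n<..a (Suc n)} = {}" if "m < n" for m n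
    using incseqD[OF assms(1), of "Suc m" n] that by auto
  then show "disjoint_family (\<lambda>n. {a n<..a (Suc n)})"
    unfolding disjoint_family_on_def by (metis Int_commute linorder_neqE_nat)
  have "x \<in> (\<Union>n. {a n<..a (Suc n)})" if x: "a 0 < x" "x < l" for x
  proof -
    have "\<exists>n. x \<le> a n"
      using order_tendstoD(1)[OF assms(2) x(2)] by (auto simp: eventually_sequentially intro: less_imp_le)
    then have n: "x \<le> a (LEAST n. x \<le> a n)" by (rule LeastI_ex)
    then obtain k where k: "(LEAST n. x \<le> a n) = Suc k" using x(1) by (metis leD not0_implies_Suc)
    then have "\<not> x \<le> a k" using not_less_Least[of k "\<lambda>n. x \<le> a n"] by auto
    then show ?thesis using n k by (auto intro!: exI[of _ k])
  qed
  then show "(\<Union>n. {a n<..a (Suc n)}) = {a 0<..<l}"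
    using assms(3) incseqD[OF assms(1), of 0] by (fastforce intro: le_less_trans)
qed

text \<open>The hypothesis only concerns half-open intervals with both ends inside the open
  interval. Countable additivity extends the agreement to \<open>{0<..b}\<close> and to the whole
  interval, which covers the traces of all closed rays; these are stable under intersection and
  generate the Borel sets.\<close>

lemma vector_measure_eqI:
  fixes L :: real
  assumes \<mu>: "vector_measure {0<..<L} \<mu>" and \<nu>: "vector_measure {0<..<L} \<nu>" and "0 < L"
    and eq: "\<And>a b. 0 < a \<Longrightarrow> a \<le> b \<Longrightarrow> b < L \<Longrightarrow> \<mu> {a<..b} = \<nu> {a<..b}"
  shows "\<mu> = \<nu>"
proof
  let ?I = "{0<..<L}"
  have r: "A \<in> sets (restrict_space borel ?I) \<longleftrightarrow> A \<in> sets borel \<and> A \<subseteq> ?I" for A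
    by (subst sets_restrict_space_iff) auto
  have U: "\<mu> (\<Union>n. A n) = \<nu> (\<Union>n. A n)"
    if "\<And>n. A n \<in> sets borel" "\<And>n. A n \<subseteq> ?I" "disjoint_family A" "\<And>n. \<mu> (A n) = \<nu> (A n)" for A :: "nat \<Rightarrow> real set"
  proof -
    have "range A \<subseteq> sets (restrict_space borel ?I)" using that r by auto
    then have "(\<lambda>n. \<mu> (A n)) sums \<mu> (\<Union>n. A n)" "(\<lambda>n. \<nu> (A n)) sums \<nu> (\<Union>n. A n)"
      using \<mu> \<nu> that(3) unfolding vector_measure_def by blast+
    then show ?thesis using that(4) sums_unique2 by simp
  qed
  have lim: "(\<lambda>n. d / real (Suc n)) \<longlonglongrightarrow> 0" for d
    using tendsto_mult[OF tendsto_const LIMSEQ_inverse_real_of_nat, of d] by (simp add: divide_inverse)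
  have mono: "d / real (Suc n) \<le> d / real (Suc m)" if "m \<le> n" "0 < d" for m n d
    using that by (intro divide_left_mono) auto
  have left: "\<mu> {0<..b} = \<nu> {0<..b}" if b: "0 < b" "b < L" for b
  proof -
    define a where "a n = b / real (Suc n)" for n
    have a: "decseq a" "a \<longlonglongrightarrow> 0" "\<And>n. 0 < a n"
      using lim mono b by (auto simp: a_def[abs_def] decseq_def simp del: of_nat_Suc)
    have ab: "a n < L" "a (Suc n) \<le> a n" for n
      using decseqD[OF a(1), of 0 n] decseqD[OF a(1), of n "Suc n"] b by (auto simp: a_def)
    have "\<mu> (\<Union>n. {a (Suc n)<..a n}) = \<nu> (\<Union>n. {a (Suc n)<..a n})"
      using a ab less_trans[OF a(3)] le_less_trans[OF _ ab(1)] eq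
      by (intro U decseq_Ioc_partition[OF a]) auto
    then show ?thesis using decseq_Ioc_partition[OF a] by (simp add: a_def)
  qed
  have right: "\<mu> {L/2<..<L} = \<nu> {L/2<..<L}"
  proof -
    define a where "a n = L - (L / 2) / real (Suc n)" for n
    have a: "incseq a" "a \<longlonglongrightarrow> L" "\<And>n. a n < L"
      using tendsto_diff[OF tendsto_const lim, of L "L/2"] mono[of _ _ "L/2"] \<open>0 < L\<close>
      by (auto simp: a_def[abs_def] incseq_def simp del: of_nat_Suc)
    have "0 < a 0" using \<open>0 < L\<close> by (simp add: a_def)
    then have ab: "0 < a n" "a n \<le> a (Suc n)" for n
      using incseqD[OF a(1), of 0 n] incseqD[OF a(1), of n "Suc n"] by auto
    have "\<mu> (\<Union>n. {a n<..a (Suc n)}) = \<nu> (\<Union>n. {a n<..a (Suc n)})"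
      using a ab less_trans[OF ab(1)] le_less_trans[OF _ a(3)] eq
      by (intro U incseq_Ioc_partition[OF a]) auto
    then show ?thesis using incseq_Ioc_partition[OF a] by (simp add: a_def)
  qed
  have I: "\<mu> {0<..<L} = \<nu> {0<..<L}"
  proof -
    have sp: "{0<..<L} = {0<..L/2} \<union> {L/2<..<L}" using \<open>0 < L\<close> by auto
    have "{0<..L/2} \<in> sets (restrict_space borel ?I)" "{L/2<..<L} \<in> sets (restrict_space borel ?I)"
        "{0<..L/2} \<inter> {L/2<..<L} = {}"
      using \<open>0 < L\<close> unfolding r by auto
    from vector_measure_Un[OF \<mu> this] vector_measure_Un[OF \<nu> this] show ?thesis
      using left[of "L/2"] right \<open>0 < L\<close> by (simp flip: sp)
  qed
  have main: "\<mu> (A \<inter> ?I) = \<nu> (A \<inter> ?I)" if "A \<in> sets borel" for A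
  proof -
    have "Int_stable (range (atMost :: real \<Rightarrow> real set))" by (auto simp: Int_stable_def)
    moreover have "range atMost \<subseteq> Pow (UNIV :: real set)" by simp
    moreover have "A \<in> sigma_sets UNIV (range atMost)"
      using that by (simp add: borel_eq_atMost)
    ultimately show ?thesis
    proof (induction rule: sigma_sets_induct_disjoint)
      case (basic A)
      then obtain b where A: "A = {..b}" by auto
      show ?case
      proof (cases "b \<le> 0 \<or> L \<le> b")
        case True
        then have "A \<inter> ?I = {} \<or> A \<inter> ?I = ?I" using A by auto
        then show ?thesis using I vector_measure_empty[OF \<mu>] vector_measure_empty[OF \<nu>] by auto
      next
        case False
        then have "A \<inter> ?I = {0<..b}" using A by auto
        then show ?thesis using left[of b] False by simp
      qed
    next
      case empty
      then show ?case using vector_measure_empty[OF \<mu>] vector_measure_empty[OF \<nu>] by simp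
    next
      case (compl A)
      then have A: "A \<in> sets borel" by (simp add: borel_eq_atMost)
      have "?I = (A \<inter> ?I) \<union> ((UNIV - A) \<inter> ?I)" by auto
      then show ?case
        using vector_measure_Un[OF \<mu>, of "A \<inter> ?I" "(UNIV - A) \<inter> ?I"]
          vector_measure_Un[OF \<nu>, of "A \<inter> ?I" "(UNIV - A) \<inter> ?I"] I compl(2) A by (auto simp: r)
    next
      case (union A)
      have "\<mu> (\<Union>n. A n \<inter> ?I) = \<nu> (\<Union>n. A n \<inter> ?I)"
      proof (rule U)
        show "A n \<inter> ?I \<in> sets borel" for n
        proof -
          have "A n \<in> sets borel" using union(2) by (auto simp: borel_eq_atMost)
          then show ?thesis by simp
        qed
        show "disjoint_family (\<lambda>n. A n \<inter> ?I)" using union(1) by (auto simp: disjoint_family_on_def)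
      qed (use union(3) in auto)
      then show ?case by simp
    qed
  qed
  show "\<mu> A = \<nu> A" for A
  proof (cases "A \<in> sets (restrict_space borel ?I)")
    case True
    then show ?thesis using main[of A] by (simp add: r Int_absorb2)
  next
    case False
    then show ?thesis using \<mu> \<nu> by (simp add: vector_measure_def)
  qed
qed

context bv_measure begin

lemma is_distr_deriv_density:
  fixes \<sigma> :: "real \<Rightarrow> 'b::euclidean_space"
  assumes d: "has_density \<sigma> f" and eq: "AE x in lebesgue_on I. g x = f x"
  shows "is_distr_deriv I g (density_measure \<sigma>)" "integrable (lebesgue_on I) g"
proof -
  note \<sigma> = has_densityD[OF d]
  note f = has_density_integrable[OF d]
  have g: "g \<in> borel_measurable (lebesgue_on I)"
    by (rule borel_measurable_lebesgue_on_AE[OF borel_measurable_integrable[OF f]]) (use eq in auto)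
  show "integrable (lebesgue_on I) g"
    using integrable_cong_AE[OF g borel_measurable_integrable[OF f] eq] f by simp
  show "is_distr_deriv I g (density_measure \<sigma>)"
    unfolding is_distr_deriv_def
  proof (intro conjI allI impI vector_measure_density \<sigma>)
    fix \<phi> assume \<phi>: "test_function I \<phi>"
    have m: "deriv \<phi> \<in> borel_measurable (lebesgue_on I)"
      by (rule continuous_borel_measurable_lebesgue_on[OF test_functionD(3)[OF \<phi>]])
    have "(LINT x|lebesgue_on I. deriv \<phi> x *\<^sub>R g x) = (LINT x|lebesgue_on I. deriv \<phi> x *\<^sub>R f x)"
      by (rule integral_cong_AE)
        (use eq in \<open>auto intro!: borel_measurable_scaleR m g borel_measurable_integrable[OF f]\<close>)
    then have y: "- (LINT x|lebesgue_on I. deriv \<phi> x *\<^sub>R g x) = (LINT x|M. \<phi> x *\<^sub>R \<sigma> x)"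
      using integration_by_parts[OF d \<phi>] by simp
    have \<phi>m: "\<phi> \<in> borel_measurable borel"
      using test_functionD(2)[OF \<phi>] by (rule borel_measurable_continuous_onI)
    obtain B where B: "\<And>x. \<bar>\<phi> x\<bar> \<le> B" using test_function_bounded[OF \<phi> L_pos] by metis
    have int: "integrable M (\<lambda>x. \<phi> x *\<^sub>R \<sigma> x)"
      by (rule integrable_bounded_scaleR[OF \<sigma>(1)]) (use \<phi>m B in auto)
    obtain l r where lr: "0 < l" "r < L" "\<And>x. x \<notin> {l..r} \<Longrightarrow> \<phi> x = 0"
      using test_function_support[OF \<phi> L_pos] by metis
    have \<phi>I: "indicator I x *\<^sub>R \<phi> x *\<^sub>R \<sigma> x = \<phi> x *\<^sub>R \<sigma> x" for x
      using lr(1,2) lr(3)[of x] by (cases "x \<in> {l..r}") auto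
    show "has_vm_integral I (density_measure \<sigma>) \<phi> (- (LINT x|lebesgue_on I. deriv \<phi> x *\<^sub>R g x))"
      unfolding has_vm_integral_def y
    \<comment> \<open>A representing measure has to live on the Borel sets of the interval, whereas
      \<open>M\<close> is a measure on the line.\<close>
    proof (intro exI[of _ "restrict_space M I"] exI[of _ \<sigma>] conjI ballI)
      show "finite_measure (restrict_space M I)" by (rule finite_measure_restrict_space) (auto intro: finite_measure_axioms)
      show "sets (restrict_space M I) = sets (restrict_space borel I)" by (rule sets_restrict_space_cong) simp
      show "integrable (restrict_space M I) \<sigma>"
        by (subst integrable_restrict_space) (use \<sigma>(1) in \<open>auto intro!: integrable_mult_indicator\<close>)
      show "integrable (restrict_space M I) (\<lambda>x. \<phi> x *\<^sub>R \<sigma> x)"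
        by (subst integrable_restrict_space) (use int in \<open>auto simp: \<phi>I simp del: scaleR_scaleR\<close>)
      show "(LINT x|M. \<phi> x *\<^sub>R \<sigma> x) = (LINT x|restrict_space M I. \<phi> x *\<^sub>R \<sigma> x)"
        by (subst integral_restrict_space) (auto simp: \<phi>I simp del: scaleR_scaleR)
      fix A assume "A \<in> sets (restrict_space M I)"
      then have A: "A \<in> sets borel" "A \<subseteq> I" "A \<in> sets (restrict_space borel I)"
        by (auto simp: sets_restrict_space)
      show "density_measure \<sigma> A = (LINT x:A|restrict_space M I. \<sigma> x)"
        using A unfolding density_measure_def set_lebesgue_integral_def
        by (subst integral_restrict_space)
          (auto intro!: Bochner_Integration.integral_cong simp: indicator_def)
    qed
  qed
qed

end

section \<open>Every BV function has a density\<close>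

lemma measure_sum_exists:
  fixes A B :: "'a measure"
  assumes "sets B = sets A"
  obtains C where "sets C = sets A" "\<And>X. X \<in> sets A \<Longrightarrow> emeasure C X = emeasure A X + emeasure B X"
proof
  define C where "C = measure_of (space A) (sets A) (\<lambda>X. emeasure A X + emeasure B X)"
  show C: "sets C = sets A" by (simp add: C_def)
  fix X assume X: "X \<in> sets A"
  show "emeasure C X = emeasure A X + emeasure B X"
  proof (rule emeasure_measure_of[OF C_def])
    show "positive (sets C) (\<lambda>X. emeasure A X + emeasure B X)" by (simp add: positive_def)
    show "countably_additive (sets C) (\<lambda>X. emeasure A X + emeasure B X)"
      unfolding countably_additive_def C
    proof (intro allI impI)
      fix Y :: "nat \<Rightarrow> 'a set" assume Y: "range Y \<subseteq> sets A" "disjoint_family Y"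
      have "(\<Sum>i. emeasure A (Y i)) = emeasure A (\<Union>i. Y i)" "(\<Sum>i. emeasure B (Y i)) = emeasure B (\<Union>i. Y i)"
        using Y assms by (auto intro!: suminf_emeasure)
      then show "(\<Sum>i. emeasure A (Y i) + emeasure B (Y i)) = emeasure A (\<Union>i. Y i) + emeasure B (\<Union>i. Y i)"
        by (simp add: suminf_add[symmetric])
    qed
  qed (use X C sets.space_closed in auto)
qed

text \<open>With \<open>\<nu>\<close> the sum of \<open>M0\<close> and Lebesgue measure on the interval, \<open>N\<close> is where the density of
  Lebesgue measure with respect to \<open>\<nu>\<close> vanishes.\<close>

lemma bv_measure_dominating:
  fixes M0 :: "real measure"
  assumes "0 < L" "finite_measure M0" and s0: "sets M0 = sets borel" and out: "emeasure M0 (- {0<..<L}) = 0"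
  obtains M N k where "bv_measure M L N" "k \<in> borel_measurable borel" "\<And>x. 0 \<le> k x"
    "M0 = density M (\<lambda>x. ennreal (k x))"
proof -
  let ?I = "{0<..<L}"
  interpret m0: finite_measure M0 by fact
  define \<Lambda> where "\<Lambda> = density lborel (indicator ?I :: real \<Rightarrow> ennreal)"
  have \<Lambda>s [simp]: "sets \<Lambda> = sets borel" by (simp add: \<Lambda>_def)
  have \<Lambda>: "emeasure \<Lambda> A = emeasure lborel (A \<inter> ?I)" if "A \<in> sets borel" for A
    unfolding \<Lambda>_def using that by (subst emeasure_density) (auto simp: indicator_inter_arith[symmetric] Int_commute)
  obtain \<nu> where \<nu>s: "sets \<nu> = sets \<Lambda>" and \<nu>: "\<And>X. X \<in> sets \<Lambda> \<Longrightarrow> emeasure \<nu> X = emeasure \<Lambda> X + emeasure M0 X"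
    using measure_sum_exists[of M0 \<Lambda>] s0 by auto
  have \<nu>b [simp, measurable_cong]: "sets \<nu> = sets borel" using \<nu>s by simp
  have sp [simp]: "space \<nu> = UNIV" "space M0 = UNIV" using sets_eq_imp_space_eq[OF \<nu>b] sets_eq_imp_space_eq[OF s0] by auto
  have \<Lambda>fin: "emeasure \<Lambda> UNIV < \<infinity>" using \<Lambda>[of UNIV] \<open>0 < L\<close> by simp
  interpret \<nu>: finite_measure \<nu>
  proof (rule finite_measureI)
    show "emeasure \<nu> (space \<nu>) \<noteq> \<infinity>"
      using \<nu>[of UNIV] \<Lambda>fin m0.emeasure_finite[of UNIV] by (simp add: less_top)
  qed
  have ac\<Lambda>: "absolutely_continuous \<nu> \<Lambda>"
    unfolding absolutely_continuous_def using \<nu> by (auto simp: null_sets_def)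
  then obtain h where h': "h \<in> borel_measurable \<nu>" and h\<Lambda>: "density \<nu> h = \<Lambda>"
    using \<nu>.Radon_Nikodym[OF ac\<Lambda>] \<nu>s by auto
  have h [measurable]: "h \<in> borel_measurable borel"
    using h' by (simp cong: measurable_cong_sets)
  have emh: "emeasure \<Lambda> A = (\<integral>\<^sup>+x\<in>A. h x \<partial>\<nu>)" if "A \<in> sets borel" for A
    unfolding h\<Lambda>[symmetric] using that by (subst emeasure_density) auto
  define N where "N = {x \<in> ?I. h x = 0}"
  have N [measurable]: "N \<in> sets borel" unfolding N_def by measurable
  have "emeasure \<Lambda> N = (\<integral>\<^sup>+x. 0 \<partial>\<nu>)"
    unfolding emh[OF N] by (rule nn_integral_cong) (auto simp: N_def indicator_def)
  moreover have "N \<inter> ?I = N" by (auto simp: N_def)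
  ultimately have N0: "emeasure lborel N = 0" using \<Lambda>[OF N] by simp
  \<comment> \<open>With the weight \<open>h\<close> alone \<open>M\<close> would just be Lebesgue
    measure on the interval and would lose the singular part of \<open>M0\<close>; the weight 1 on
    \<open>N\<close> restores it there.\<close>
  define w where "w x = (if x \<in> N then 1 else h x)" for x
  have w [measurable]: "w \<in> borel_measurable borel" unfolding w_def[abs_def] by measurable
  define M where "M = density \<nu> w"
  have Ms [simp, measurable_cong]: "sets M = sets borel" by (simp add: M_def)
  have emM: "emeasure M A = (\<integral>\<^sup>+x\<in>A. w x \<partial>\<nu>)" if "A \<in> sets borel" for A
    unfolding M_def using that by (subst emeasure_density) auto
  have off: "emeasure M (A - N) = emeasure lborel (A \<inter> ?I)" if A: "A \<in> sets borel" for A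
  proof -
    have "emeasure M (A - N) = (\<integral>\<^sup>+x\<in>A - N. h x \<partial>\<nu>)"
      by (subst emM) (use A in \<open>auto intro!: nn_integral_cong simp: w_def indicator_def\<close>)
    also have "\<dots> = emeasure \<Lambda> (A - N)" by (rule emh[symmetric]) (use A in auto)
    also have "\<dots> = emeasure lborel ((A \<inter> ?I) - N)" by (subst \<Lambda>) (use A in \<open>auto intro!: arg_cong[where f="emeasure lborel"]\<close>)
    also have "\<dots> = emeasure lborel (A \<inter> ?I)"
      by (rule emeasure_Diff_null_set) (use N0 A in \<open>auto simp: null_sets_def\<close>)
    finally show ?thesis .
  qed
  have "finite_measure M"
  proof (rule finite_measureI)
    have "emeasure M UNIV \<le> (\<integral>\<^sup>+x. 1 + h x \<partial>\<nu>)"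
      by (subst emM) (auto intro!: nn_integral_mono simp: w_def)
    also have "\<dots> = emeasure \<nu> UNIV + emeasure \<Lambda> UNIV"
      using emh[of UNIV] by (subst nn_integral_add) auto
    also have "\<dots> < \<infinity>" using \<Lambda>fin by (simp add: less_top[symmetric])
    finally show "emeasure M (space M) \<noteq> \<infinity>" using sets_eq_imp_space_eq[OF Ms] by simp
  qed
  then have M: "bv_measure M L N"
    by (intro bv_measure.intro bv_measure_axioms.intro)
      (use \<open>0 < L\<close> N0 off in \<open>auto simp: null_sets_def N_def\<close>)
  interpret M: bv_measure M L N by fact
  have "absolutely_continuous M M0"
    unfolding absolutely_continuous_def
  proof
    fix A assume "A \<in> null_sets M"
    then have A: "A \<in> sets borel" "emeasure M A = 0" by auto
    have "AE x in \<nu>. w x * indicator A x = 0"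
      using A emM[OF A(1)] by (subst nn_integral_0_iff_AE[symmetric]) auto
    then have "AE x in \<nu>. \<not> (x \<in> A \<and> w x \<noteq> 0)" by eventually_elim (auto simp: indicator_def)
    then have "emeasure \<nu> {x. x \<in> A \<and> w x \<noteq> 0} = 0" by (subst (asm) AE_iff_measurable[OF _ refl]) (use A in auto)
    then have "emeasure M0 {x. x \<in> A \<and> w x \<noteq> 0} = 0" using \<nu>[of "{x. x \<in> A \<and> w x \<noteq> 0}"] A by simp
    \<comment> \<open>Where \<open>w\<close> vanishes, \<open>x\<close> lies outside the interval:
      inside it, \<open>h x = 0\<close> puts \<open>x\<close> into \<open>N\<close>, where
      \<open>w\<close> is 1.\<close>
    moreover have "A \<subseteq> {x. x \<in> A \<and> w x \<noteq> 0} \<union> (- ?I)" by (auto simp: w_def N_def)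
    then have "emeasure M0 A \<le> emeasure M0 {x. x \<in> A \<and> w x \<noteq> 0} + emeasure M0 (- ?I)"
      by (intro order_trans[OF emeasure_mono emeasure_subadditive]) (use A s0 in auto)
    ultimately have "emeasure M0 A = 0" using out by simp
    then show "A \<in> null_sets M0" using A s0 by auto
  qed
  then obtain k where k': "k \<in> borel_measurable M" and kM: "density M k = M0"
    using M.Radon_Nikodym[of M0] s0 by auto
  have k [measurable]: "k \<in> borel_measurable borel"
    using k' by (simp cong: measurable_cong_sets)
  have "(\<integral>\<^sup>+x. k x \<partial>M) = emeasure M0 UNIV"
    unfolding kM[symmetric] by (subst emeasure_density) auto
  then have "AE x in M. k x \<noteq> \<infinity>" using m0.emeasure_finite[of UNIV] by (intro nn_integral_PInf_AE) auto
  then have "AE x in M. k x = ennreal (enn2real (k x))" by eventually_elim (auto simp: less_top)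
  then have "density M k = density M (\<lambda>x. ennreal (enn2real (k x)))" by (intro density_cong) auto
  then show ?thesis using kM M by (intro that[of M N "\<lambda>x. enn2real (k x)"]) auto
qed

text \<open>The representation hidden in \<open>has_vm_integral\<close> is moved to the line and
  expressed through a dominating \<open>M\<close>. The cumulative integral of the resulting density
  has the same distributional derivative as \<open>f\<close>, so the two differ by a constant
  a.e.\<close>

lemma is_distr_deriv_imp_density:
  fixes f :: "real \<Rightarrow> 'b::euclidean_space"
  assumes "0 < L" and f: "integrable (lebesgue_on {0<..<L}) f" and \<mu>: "is_distr_deriv {0<..<L} f \<mu>"
  obtains M N \<sigma> f0 where "bv_measure M L N" "bv_measure.has_density M L \<sigma> f0"
    "AE x in lebesgue_on {0<..<L}. f x = f0 x" "\<mu> = bv_measure.density_measure M L \<sigma>"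
proof -
  let ?I = "{0<..<L}"
  have vm: "vector_measure ?I \<mu>" using \<mu> by (simp add: is_distr_deriv_def)
  \<comment> \<open>The zero test function serves only to extract some measure and density
    representing \<open>\<mu>\<close>.\<close>
  have "test_function ?I (\<lambda>x. 0)"
    using test_function_lincomb[OF test_function_bump[of 0 "-1" ?I 0] test_function_bump[of 0 "-1" ?I 0], of "-1"]
    by simp
  then have "has_vm_integral ?I \<mu> (\<lambda>x. 0) (- (LINT x|lebesgue_on ?I. deriv (\<lambda>x. 0) x *\<^sub>R f x))"
    using \<mu> unfolding is_distr_deriv_def by blast
  then obtain m \<sigma>0 where m: "finite_measure m" and ms: "sets m = sets (restrict_space borel ?I)"
      and \<sigma>0: "integrable m \<sigma>0" and \<mu>m: "\<And>A. A \<in> sets m \<Longrightarrow> \<mu> A = (LINT x:A|m. \<sigma>0 x)"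
    unfolding has_vm_integral_def by blast
  interpret m: finite_measure m by fact
  have spm: "space m = ?I" using sets_eq_imp_space_eq[OF ms] by (simp add: space_restrict_space)
  have id [measurable]: "(\<lambda>x. x) \<in> measurable m borel"
    using measurable_ident_sets[OF refl, of "restrict_space borel ?I"] ms
    by (auto simp: measurable_def sets_restrict_space spm)
  define M0 where "M0 = distr m borel (\<lambda>x. x)"
  define \<sigma>1 where "\<sigma>1 x = indicator ?I x *\<^sub>R \<sigma>0 x" for x
  have \<sigma>1 [measurable]: "\<sigma>1 \<in> borel_measurable borel"
  proof -
    have "\<sigma>0 \<in> borel_measurable (restrict_space borel ?I)"
      using borel_measurable_integrable[OF \<sigma>0] ms by (simp cong: measurable_cong_sets)
    then show ?thesis unfolding \<sigma>1_def[abs_def] by (subst (asm) borel_measurable_restrict_space_iff) auto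
  qed
  have M0: "finite_measure M0" unfolding M0_def by (rule m.finite_measure_distr) measurable
  have M0s: "sets M0 = sets borel" by (simp add: M0_def)
  have "emeasure M0 (- ?I) = 0" unfolding M0_def by (subst emeasure_distr) (auto simp: spm)
  from bv_measure_dominating[OF \<open>0 < L\<close> M0 M0s this] obtain M N k where M: "bv_measure M L N"
      and k [measurable]: "k \<in> borel_measurable borel" and k0: "\<And>x. 0 \<le> k x" and M0k: "M0 = density M (\<lambda>x. ennreal (k x))"
    by metis
  interpret M: bv_measure M L N by fact
  define \<sigma> where "\<sigma> x = k x *\<^sub>R \<sigma>1 x" for x
  have [measurable]: "\<sigma> \<in> borel_measurable borel" unfolding \<sigma>_def[abs_def] by measurable
  have "integrable M0 \<sigma>1"
    unfolding M0_def
  proof (subst integrable_distr_eq)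
    have "integrable m \<sigma>1 \<longleftrightarrow> integrable m \<sigma>0"
      by (rule Bochner_Integration.integrable_cong) (auto simp: \<sigma>1_def spm)
    then show "integrable m \<sigma>1" using \<sigma>0 by simp
  qed auto
  moreover have [measurable]: "\<sigma>1 \<in> borel_measurable M" "k \<in> borel_measurable M"
    using \<sigma>1 k by (simp_all cong: measurable_cong_sets)
  ultimately have \<sigma>int: "integrable M \<sigma>"
    unfolding M0k \<sigma>_def[abs_def] by (subst (asm) integrable_density) (use k0 in auto)
  have \<mu>M: "\<mu> A = (LINT x:A|M. \<sigma> x)" if A: "A \<in> sets borel" "A \<subseteq> ?I" for A
  proof -
    have "A \<in> sets m" using A unfolding ms by (subst sets_restrict_space_iff) auto
    then have "\<mu> A = (LINT x|m. indicator A x *\<^sub>R \<sigma>0 x)" using \<mu>m by (simp add: set_lebesgue_integral_def)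
    also have "\<dots> = (LINT x|m. indicator A x *\<^sub>R \<sigma>1 x)"
      by (rule Bochner_Integration.integral_cong) (auto simp: \<sigma>1_def spm)
    also have "\<dots> = (LINT x|M0. indicator A x *\<^sub>R \<sigma>1 x)"
      unfolding M0_def by (subst integral_distr) (use A in auto)
    also have "\<dots> = (LINT x|M. k x *\<^sub>R (indicator A x *\<^sub>R \<sigma>1 x))"
      unfolding M0k
      by (rule integral_density) (use A k0 in \<open>auto intro!: borel_measurable_scaleR borel_measurable_indicator\<close>)
    also have "\<dots> = (LINT x:A|M. \<sigma> x)"
      unfolding set_lebesgue_integral_def by (rule Bochner_Integration.integral_cong) (auto simp: \<sigma>_def)
    finally show ?thesis .
  qed
  have \<mu>eq: "\<mu> = M.density_measure \<sigma>"
  proof (rule vector_measure_eqI[OF vm M.vector_measure_density[OF \<sigma>int] \<open>0 < L\<close>])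
    fix a b :: real assume "0 < a" "a \<le> b" "b < L"
    then have "{a<..b} \<in> sets borel" "{a<..b} \<subseteq> ?I" by auto
    then show "\<mu> {a<..b} = M.density_measure \<sigma> {a<..b}"
      using \<mu>M by (simp add: M.density_measure_def M.sets_restrict_I)
  qed
  define f0 where "f0 x = (LINT s:{..x}|M. \<sigma> s)" for x
  have f0: "f0 b - f0 a = (LINT s:{a<..b}|M. \<sigma> s)" if "a \<le> b" for a b
  proof -
    have "(LINT s:{..a} \<union> {a<..b}|M. \<sigma> s) = f0 a + (LINT s:{a<..b}|M. \<sigma> s)"
      unfolding f0_def by (rule set_integral_Un) (auto intro!: M.set_integrable_M \<sigma>int)
    moreover have "{..a} \<union> {a<..b} = {..b}" using that by auto
    ultimately show ?thesis by (simp add: f0_def)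
  qed
  have d0: "M.has_density \<sigma> f0" using f0 \<sigma>int by (simp add: M.has_density_def)
  note f0int = M.has_density_integrable[OF d0]
  have "(LINT x|lebesgue_on ?I. deriv \<phi> x *\<^sub>R (f x - f0 x)) = 0" if \<phi>: "test_function ?I \<phi>" for \<phi>
  proof -
    obtain B where B: "\<And>x. \<bar>\<phi> x\<bar> \<le> B" "\<And>x. \<bar>deriv \<phi> x\<bar> \<le> B" using test_function_bounded[OF \<phi> \<open>0 < L\<close>] by metis
    have [measurable]: "\<phi> \<in> borel_measurable borel"
      using test_functionD(2)[OF \<phi>] by (rule borel_measurable_continuous_onI)
    \<comment> \<open>The representations obtained here may vary with \<open>\<phi>\<close> and with
      the function tested, hence the appeal to \<open>has_vm_integral_unique\<close>.\<close>
    obtain m' \<sigma>' where m': "finite_measure m'" and m's: "sets m' = sets (restrict_space borel ?I)"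
      and \<sigma>': "integrable m' \<sigma>'" and \<mu>m': "\<And>A. A \<in> sets m' \<Longrightarrow> \<mu> A = (LINT x:A|m'. \<sigma>' x)"
      and y: "- (LINT x|lebesgue_on ?I. deriv \<phi> x *\<^sub>R f x) = (LINT x|m'. \<phi> x *\<^sub>R \<sigma>' x)"
      using \<mu> \<phi> unfolding is_distr_deriv_def has_vm_integral_def by blast
    obtain m'' \<sigma>'' where m'': "finite_measure m''" and m''s: "sets m'' = sets (restrict_space borel ?I)"
      and \<sigma>'': "integrable m'' \<sigma>''" and \<mu>m'': "\<And>A. A \<in> sets m'' \<Longrightarrow> \<mu> A = (LINT x:A|m''. \<sigma>'' x)"
      and y'': "- (LINT x|lebesgue_on ?I. deriv \<phi> x *\<^sub>R f0 x) = (LINT x|m''. \<phi> x *\<^sub>R \<sigma>'' x)"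
      using M.is_distr_deriv_density(1)[OF d0, of f0] \<phi> unfolding \<mu>eq[symmetric] is_distr_deriv_def has_vm_integral_def
      by auto
    have "\<phi> \<in> borel_measurable m'" using m's by (simp cong: measurable_cong_sets add: measurable_restrict_space1)
    then have "(LINT x|m'. \<phi> x *\<^sub>R \<sigma>' x) = (LINT x|m''. \<phi> x *\<^sub>R \<sigma>'' x)"
      by (intro has_vm_integral_unique[OF _ \<sigma>' \<sigma>'' _ _ B(1)]) (use m's m''s \<mu>m' \<mu>m'' in auto)
    then have "(LINT x|lebesgue_on ?I. deriv \<phi> x *\<^sub>R f x) = (LINT x|lebesgue_on ?I. deriv \<phi> x *\<^sub>R f0 x)"
      using y y'' by (metis neg_equal_iff_equal)
    moreover have m: "deriv \<phi> \<in> borel_measurable (lebesgue_on ?I)"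
      by (rule continuous_borel_measurable_lebesgue_on[OF test_functionD(3)[OF \<phi>]])
    have "integrable (lebesgue_on ?I) (\<lambda>x. deriv \<phi> x *\<^sub>R f x)" "integrable (lebesgue_on ?I) (\<lambda>x. deriv \<phi> x *\<^sub>R f0 x)"
      using integrable_bounded_scaleR[OF f m] integrable_bounded_scaleR[OF f0int m] B(2) by blast+
    ultimately show ?thesis by (simp add: scaleR_diff_right)
  qed
  then obtain K where K: "AE x in lebesgue_on ?I. f x - f0 x = K"
    using zero_weak_derivative_imp_const[OF \<open>0 < L\<close>, of "\<lambda>x. f x - f0 x"] f f0int by auto
  have "M.has_density \<sigma> (\<lambda>x. K + f0 x)" using f0 \<sigma>int by (simp add: M.has_density_def)
  moreover have "AE x in lebesgue_on ?I. f x = K + f0 x" using K by eventually_elim (auto simp: algebra_simps)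
  ultimately show ?thesis using that[OF M _ _ \<mu>eq] by blast
qed

lemma AE_lebesgue_on_Ioo_frequently:
  fixes L :: real
  assumes "AE x in lebesgue_on {0<..<L}. P x" "0 \<le> a" "a < b" "b \<le> L"
  obtains x where "a < x" "x < b" "P x"
proof (rule ccontr)
  assume "\<not> thesis"
  then have n: "\<And>x. a < x \<Longrightarrow> x < b \<Longrightarrow> \<not> P x" using that by blast
  have "AE x in lebesgue. x \<in> {0<..<L} \<longrightarrow> P x" using assms(1) by (subst (asm) AE_restrict_space_iff) auto
  then have "AE x in lebesgue. x \<notin> {a<..<b}" by eventually_elim (use n assms in auto)
  then have "AE x in lborel. x \<notin> {a<..<b}" by (simp add: AE_completion_iff)
  then have "emeasure lborel {a<..<b} = 0"
    using AE_iff_measurable[of "{a<..<b}" lborel "\<lambda>x. x \<notin> {a<..<b}"] by (simp add: set_eq_iff)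
  then show False using assms by simp
qed

text \<open>An a.e. identity holds at points arbitrarily close to the right of \<open>s\<close>,
  which forces the two limits together. This is how a.e. identities become pointwise identities of
  right-continuous representatives.\<close>

lemma right_cont_AE_eq:
  fixes f g :: "real \<Rightarrow> 'b::metric_space"
  assumes "AE x in lebesgue_on {0<..<L}. f x = g x" and s: "s \<in> {0<..<L}"
    and "(f \<longlongrightarrow> l) (at_right s)" "(g \<longlongrightarrow> l') (at_right s)"
  shows "l = l'"
proof (rule ccontr)
  assume "l \<noteq> l'"
  define e where "e = dist l l' / 2"
  have e: "e > 0" using \<open>l \<noteq> l'\<close> by (simp add: e_def)
  have "\<forall>\<^sub>F x in at_right s. dist (f x) l < e \<and> dist (g x) l' < e"
    using tendstoD[OF assms(3) e] tendstoD[OF assms(4) e] by (rule eventually_conj)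
  then obtain b where b: "s < b" "\<And>x. s < x \<Longrightarrow> x < b \<Longrightarrow> dist (f x) l < e \<and> dist (g x) l' < e"
    by (auto simp: eventually_at_right_field)
  have "s < min b L" using b(1) s by auto
  then obtain x where x: "s < x" "x < min b L" "f x = g x"
    using AE_lebesgue_on_Ioo_frequently[OF assms(1), of s "min b L"] s by auto
  have "dist l l' \<le> dist (f x) l + dist (f x) l'" by (rule dist_triangle3)
  then show False using b(2)[of x] x by (simp add: e_def)
qed

text \<open>The two derivatives come with dominating measures that need not agree. The comparison
  goes through the right-continuous representatives, which coincide on the interval and whose
  increments are the values of the measures on half-open intervals.\<close>

lemma is_distr_deriv_unique:
  fixes f :: "real \<Rightarrow> 'b::euclidean_space"
  assumes "0 < L" and f: "integrable (lebesgue_on {0<..<L}) f"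
    and \<mu>: "is_distr_deriv {0<..<L} f \<mu>" and \<mu>': "is_distr_deriv {0<..<L} f \<mu>'"
  shows "\<mu> = \<mu>'"
proof -
  let ?I = "{0<..<L}"
  obtain M N \<sigma> f0 where 1: "bv_measure M L N" "bv_measure.has_density M L \<sigma> f0"
    "AE x in lebesgue_on ?I. f x = f0 x" "\<mu> = bv_measure.density_measure M L \<sigma>"
    by (rule is_distr_deriv_imp_density[OF \<open>0 < L\<close> f \<mu>])
  obtain M' N' \<sigma>' f0' where 2: "bv_measure M' L N'" "bv_measure.has_density M' L \<sigma>' f0'"
    "AE x in lebesgue_on ?I. f x = f0' x" "\<mu>' = bv_measure.density_measure M' L \<sigma>'"
    by (rule is_distr_deriv_imp_density[OF \<open>0 < L\<close> f \<mu>'])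
  interpret M: bv_measure M L N by fact
  interpret M': bv_measure M' L N' by fact
  have ae: "AE x in lebesgue_on ?I. f0 x = f0' x" using 1(3) 2(3) by eventually_elim simp
  have eq: "f0 s = f0' s" if "s \<in> ?I" for s
    by (rule right_cont_AE_eq[OF ae that M.has_density_right_cont[OF 1(2) that] M'.has_density_right_cont[OF 2(2) that]])
  show ?thesis
  proof (rule vector_measure_eqI[OF _ _ \<open>0 < L\<close>])
    show "vector_measure ?I \<mu>" "vector_measure ?I \<mu>'" using \<mu> \<mu>' by (auto simp: is_distr_deriv_def)
    fix a b :: real assume ab: "0 < a" "a \<le> b" "b < L"
    then have "{a<..b} \<in> sets borel" "{a<..b} \<subseteq> ?I" by auto
    then show "\<mu> {a<..b} = \<mu>' {a<..b}"
      unfolding 1(4) 2(4) M.density_measure_def M'.density_measure_def M.sets_restrict_I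
      using M.has_densityD(3)[OF 1(2) ab] M'.has_densityD(3)[OF 2(2) ab] eq[of a] eq[of b] ab by simp
  qed
qed

section \<open>Absolutely continuous and singular parts through densities\<close>

context bv_measure begin

lemma distr_deriv_density:
  fixes \<sigma> :: "real \<Rightarrow> 'b::euclidean_space"
  assumes d: "has_density \<sigma> f" and eq: "AE x in lebesgue_on I. g x = f x"
  shows "distr_deriv I g = density_measure \<sigma>"
  unfolding distr_deriv_def
  using is_distr_deriv_density[OF d eq] is_distr_deriv_unique[OF L_pos]
  by (intro the_equality) blast+

lemma density_measure_Int:
  fixes \<sigma> :: "real \<Rightarrow> 'b::euclidean_space"
  assumes "B \<in> sets borel"
  shows "density_measure (\<lambda>x. indicator B x *\<^sub>R \<sigma> x) A
    = (if A \<in> sets (restrict_space borel I) then LINT x:A \<inter> B|M. \<sigma> x else 0)"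
  unfolding density_measure_def set_lebesgue_integral_def
  by (auto intro!: Bochner_Integration.integral_cong simp: indicator_def)

text \<open>Off \<open>N\<close> the measure \<open>M\<close> is Lebesgue measure, so cutting the
  density off on \<open>N\<close> leaves an absolutely continuous part, and the rest is carried by
  the null set \<open>N\<close>. For uniqueness, a set is cut along the union of the two null sets:
  both candidates vanish on it, and outside it both equal the whole derivative.\<close>

lemma D_ac_density:
  fixes \<sigma> :: "real \<Rightarrow> 'b::euclidean_space"
  assumes d: "has_density \<sigma> f" and eq: "AE x in lebesgue_on I. g x = f x"
  shows "D_ac I g = density_measure (\<lambda>x. indicator (- N) x *\<^sub>R \<sigma> x)"
  unfolding D_ac_def
proof (rule the_equality)
  note \<sigma> = has_densityD[OF d]
  let ?\<nu> = "density_measure (\<lambda>x. indicator (- N) x *\<^sub>R \<sigma> x)"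
  have int: "integrable M (\<lambda>x. indicator (- N) x *\<^sub>R \<sigma> x)" by (rule integrable_mult_indicator) (use \<sigma>(1) in auto)
  have vm: "vector_measure I ?\<nu>" by (rule vector_measure_density[OF int])
  have ac: "vm_abs_cont ?\<nu>"
    unfolding vm_abs_cont_def
  proof
    fix A :: "real set" assume A: "A \<in> null_sets lborel"
    then have "A \<in> sets borel" by auto
    have "(LINT x:A - N|M. \<sigma> x) = (LINT x:A \<inter> I|lborel. \<sigma> x)"
      by (rule integral_off_N[OF \<sigma>(1) \<open>A \<in> sets borel\<close>])
    also have "\<dots> = 0"
      unfolding set_lebesgue_integral_def
      by (rule integral_eq_zero_AE) (use AE_not_in[OF A] in \<open>auto elim!: eventually_mono\<close>)
    finally show "?\<nu> A = 0" by (simp add: density_measure_Int Diff_eq)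
  qed
  have diff: "distr_deriv I g A - ?\<nu> A = (if A \<in> sets (restrict_space borel I) then LINT x:A \<inter> N|M. \<sigma> x else 0)" for A
  proof (cases "A \<in> sets (restrict_space borel I)")
    case True
    then have A: "A \<in> sets borel" "A \<inter> I = A" using sets_restrict_I by auto
    show ?thesis using True integral_split_N[OF \<sigma>(1) A(1)] integral_off_N[OF \<sigma>(1) A(1)]
      by (simp add: distr_deriv_density[OF d eq] density_measure_Int density_measure_def[of \<sigma>] Diff_eq)
  qed (simp add: distr_deriv_density[OF d eq] density_measure_def)
  have sing: "vm_singular I (\<lambda>A. distr_deriv I g A - ?\<nu> A)"
    unfolding vm_singular_def diff
  proof (intro bexI[of _ N] ballI N_null)
    fix A assume A: "A \<in> sets (restrict_space borel I)"
    then have "A \<inter> N \<in> sets (restrict_space borel I)" using sets_restrict_I by auto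
    then show "(if A \<in> sets (restrict_space borel I) then LINT x:A \<inter> N|M. \<sigma> x else 0)
      = (if A \<inter> N \<in> sets (restrict_space borel I) then LINT x:A \<inter> N \<inter> N|M. \<sigma> x else 0)" using A by (simp add: Int_assoc)
  qed
  show "vector_measure I ?\<nu> \<and> vm_abs_cont ?\<nu> \<and> vm_singular I (\<lambda>A. distr_deriv I g A - ?\<nu> A)"
    using vm ac sing by blast
  fix \<nu>' assume *: "vector_measure I \<nu>' \<and> vm_abs_cont \<nu>' \<and> vm_singular I (\<lambda>A. distr_deriv I g A - \<nu>' A)"
  then obtain N' where N': "N' \<in> null_sets lborel"
      "\<And>A. A \<in> sets (restrict_space borel I) \<Longrightarrow> distr_deriv I g A - \<nu>' A = distr_deriv I g (A \<inter> N') - \<nu>' (A \<inter> N')"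
    unfolding vm_singular_def by blast
  have e': "\<nu>' {} = 0" using * vector_measure_empty by blast
  have e: "distr_deriv I g {} = 0" unfolding distr_deriv_density[OF d eq] by (rule vector_measure_empty[OF vector_measure_density[OF \<sigma>(1)]])
  show "\<nu>' = ?\<nu>"
  proof
    fix A show "\<nu>' A = ?\<nu> A"
    proof (cases "A \<in> sets (restrict_space borel I)")
      case False
      then show ?thesis using * vm by (simp add: vector_measure_def)
    next
      case True
      then have A: "A \<in> sets borel" "A \<subseteq> I" using sets_restrict_I by auto
      let ?B = "A \<inter> (N \<union> N')" and ?C = "A - (N \<union> N')"
      have NN: "N \<union> N' \<in> null_sets lborel" using N_null N'(1) by (rule null_sets.Un)
      have B: "?B \<in> sets (restrict_space borel I)" "?C \<in> sets (restrict_space borel I)"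
        unfolding sets_restrict_I using A NN by auto
      have "?B \<in> null_sets lborel" using NN A by (intro null_set_Int1) auto
      then have z: "\<nu>' ?B = 0" "?\<nu> ?B = 0" using * ac by (auto simp: vm_abs_cont_def)
      have "?C \<inter> N' = {}" by auto
      then have "\<nu>' ?C = distr_deriv I g ?C" using N'(2)[OF B(2)] e e' by simp
      moreover have "?C \<inter> N = {}" by auto
      then have "?\<nu> ?C = distr_deriv I g ?C"
        using diff[of ?C] by (simp add: set_lebesgue_integral_def split: if_split_asm)
      moreover have "A = ?B \<union> ?C" "?B \<inter> ?C = {}" by auto
      ultimately show ?thesis
        using vector_measure_Un[OF _ B] * vm z by (metis (no_types, lifting))
    qed
  qed
qed

lemma D_sing_density:
  fixes \<sigma> :: "real \<Rightarrow> 'b::euclidean_space"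
  assumes d: "has_density \<sigma> f" and eq: "AE x in lebesgue_on I. g x = f x"
    and A: "A \<in> sets borel" "A \<subseteq> I"
  shows "D_sing I g A = (LINT x:A \<inter> N|M. \<sigma> x)"
proof -
  have "A \<in> sets (restrict_space borel I)" "A \<inter> I = A" using A sets_restrict_I by auto
  then show ?thesis
    using integral_split_N[OF has_densityD(1)[OF d] A(1)] integral_off_N[OF has_densityD(1)[OF d] A(1)]
    by (simp add: D_sing_def D_ac_density[OF d eq] distr_deriv_density[OF d eq] density_measure_Int
        density_measure_def[of \<sigma>] Diff_eq)
qed

end

text \<open>Links the unordered sum over the jump set with integration over counting measure, the
  form in which a countable set decomposes into its atoms.\<close>

lemma infsum_ennreal_eq_nn_integral:
  fixes f :: "'a \<Rightarrow> ennreal"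
  assumes "countable A"
  shows "(\<Sum>\<^sub>\<infinity>x\<in>A. f x) = (\<integral>\<^sup>+x. f x \<partial>count_space A)"
proof -
  have sup: "(\<Sum>\<^sub>\<infinity>x\<in>A. f x) = (SUP F\<in>{F. finite F \<and> F \<subseteq> A}. sum f F)"
    by (rule nonneg_infsum_complete) simp
  show ?thesis
  proof (rule antisym)
    show "(\<Sum>\<^sub>\<infinity>x\<in>A. f x) \<le> (\<integral>\<^sup>+x. f x \<partial>count_space A)"
      unfolding sup
    proof (rule SUP_least)
      fix F assume "F \<in> {F. finite F \<and> F \<subseteq> A}"
      then have F: "finite F" "F \<subseteq> A" by auto
      have "sum f F = (\<integral>\<^sup>+x. f x \<partial>count_space F)" using F(1) by (simp add: nn_integral_count_space_finite)
      also have "\<dots> = (\<integral>\<^sup>+x. f x * indicator F x \<partial>count_space A)"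
        using nn_integral_restrict_space[of F "count_space A" f] F(2)
        by (simp add: restrict_count_space Int_absorb1 Int_absorb2)
      also have "\<dots> \<le> (\<integral>\<^sup>+x. f x \<partial>count_space A)"
        by (rule nn_integral_mono) (auto simp: indicator_def)
      finally show "sum f F \<le> (\<integral>\<^sup>+x. f x \<partial>count_space A)" .
    qed
    show "(\<integral>\<^sup>+x. f x \<partial>count_space A) \<le> (\<Sum>\<^sub>\<infinity>x\<in>A. f x)"
    proof (cases "finite A")
      case True
      then show ?thesis by (simp add: nn_integral_count_space_finite)
    next
      case False
      have bij: "bij_betw (from_nat_into A) UNIV A" using assms False by (rule bij_betw_from_nat_into)
      have "(\<integral>\<^sup>+x. f x \<partial>count_space A) = (\<Sum>n. f (from_nat_into A n))"
        using nn_integral_bij_count_space[OF bij, of f] by (simp add: nn_integral_count_space_nat)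
      also have "\<dots> \<le> (\<Sum>\<^sub>\<infinity>x\<in>A. f x)"
        unfolding suminf_eq_SUP
      proof (rule SUP_least)
        fix n
        have inj: "inj_on (from_nat_into A) {..<n}" using bij by (auto simp: bij_betw_def intro: inj_on_subset)
        have "(\<Sum>i<n. f (from_nat_into A i)) = sum f (from_nat_into A ` {..<n})"
          by (simp add: sum.reindex[OF inj])
        also have "\<dots> \<le> (\<Sum>\<^sub>\<infinity>x\<in>A. f x)"
          unfolding sup by (rule SUP_upper) (use bij in \<open>auto simp: bij_betw_def\<close>)
        finally show "(\<Sum>i<n. f (from_nat_into A i)) \<le> (\<Sum>\<^sub>\<infinity>x\<in>A. f x)" .
      qed
      finally show ?thesis .
    qed
  qed
qed

section \<open>Essential one-sided limits\<close>

lemma AE_lebesgue_Ioo_ex: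
  fixes a b :: real
  assumes "AE x in lebesgue. P x" "a < b"
  obtains x where "a < x" "x < b" "P x"
proof (rule ccontr)
  assume "\<not> thesis"
  then have n: "\<And>x. a < x \<Longrightarrow> x < b \<Longrightarrow> \<not> P x" using that by blast
  have "AE x in lebesgue. x \<notin> {a<..<b}" using assms(1) by eventually_elim (use n in auto)
  then have "AE x in lborel. x \<notin> {a<..<b}" by (simp add: AE_completion_iff)
  then have "emeasure lborel {a<..<b} = 0"
    using AE_iff_measurable[of "{a<..<b}" lborel "\<lambda>x. x \<notin> {a<..<b}"] by (simp add: set_eq_iff)
  then show False using assms by simp
qed

lemma ess_right_lim_unique:
  assumes "ess_right_lim f s l" "ess_right_lim f s l'" shows "l = l'"
proof (rule ccontr)
  assume "l \<noteq> l'"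
  then have e: "dist l l' / 2 > 0" by simp
  obtain d1 where d1: "d1 > 0" "AE r in lebesgue. s < r \<and> r < s + d1 \<longrightarrow> dist (f r) l < dist l l' / 2"
    using assms(1) e unfolding ess_right_lim_def by blast
  obtain d2 where d2: "d2 > 0" "AE r in lebesgue. s < r \<and> r < s + d2 \<longrightarrow> dist (f r) l' < dist l l' / 2"
    using assms(2) e unfolding ess_right_lim_def by blast
  have "AE r in lebesgue. (s < r \<and> r < s + d1 \<longrightarrow> dist (f r) l < dist l l' / 2) \<and>
     (s < r \<and> r < s + d2 \<longrightarrow> dist (f r) l' < dist l l' / 2)"
    using d1(2) d2(2) by eventually_elim auto
  moreover have "s < s + min d1 d2" using d1 d2 by auto
  ultimately obtain r where "s < r" "r < s + min d1 d2" "dist (f r) l < dist l l' / 2" "dist (f r) l' < dist l l' / 2"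
    by (rule AE_lebesgue_Ioo_ex) auto
  then show False using dist_triangle3[of l l' "f r"] by simp
qed

lemma ess_left_lim_unique:
  assumes "ess_left_lim f s l" "ess_left_lim f s l'" shows "l = l'"
proof (rule ccontr)
  assume "l \<noteq> l'"
  then have e: "dist l l' / 2 > 0" by simp
  obtain d1 where d1: "d1 > 0" "AE r in lebesgue. s - d1 < r \<and> r < s \<longrightarrow> dist (f r) l < dist l l' / 2"
    using assms(1) e unfolding ess_left_lim_def by blast
  obtain d2 where d2: "d2 > 0" "AE r in lebesgue. s - d2 < r \<and> r < s \<longrightarrow> dist (f r) l' < dist l l' / 2"
    using assms(2) e unfolding ess_left_lim_def by blast
  have "AE r in lebesgue. (s - d1 < r \<and> r < s \<longrightarrow> dist (f r) l < dist l l' / 2) \<and>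
     (s - d2 < r \<and> r < s \<longrightarrow> dist (f r) l' < dist l l' / 2)"
    using d1(2) d2(2) by eventually_elim auto
  moreover have "s - min d1 d2 < s" using d1 d2 by auto
  ultimately obtain r where "s - min d1 d2 < r" "r < s" "dist (f r) l < dist l l' / 2" "dist (f r) l' < dist l l' / 2"
    by (rule AE_lebesgue_Ioo_ex) auto
  then show False using dist_triangle3[of l l' "f r"] by simp
qed

lemma ess_right_limI:
  assumes eq: "AE x in lebesgue_on {0<..<L}. g x = f x" and s: "s \<in> {0<..<L}" and lim: "(f \<longlongrightarrow> l) (at_right s)"
  shows "ess_right_lim g s l"
  unfolding ess_right_lim_def
proof (intro allI impI)
  fix e :: real assume "0 < e"
  then obtain b where b: "s < b" "\<And>x. s < x \<Longrightarrow> x < b \<Longrightarrow> dist (f x) l < e"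
    using tendstoD[OF lim] by (auto simp: eventually_at_right_field)
  have "AE x in lebesgue. x \<in> {0<..<L} \<longrightarrow> g x = f x" using eq by (subst (asm) AE_restrict_space_iff) auto
  then have "AE r in lebesgue. s < r \<and> r < s + (min b L - s) \<longrightarrow> dist (g r) l < e"
    by eventually_elim (use b s in auto)
  moreover have "0 < min b L - s" using b s by auto
  ultimately show "\<exists>\<delta>>0. AE r in lebesgue. s < r \<and> r < s + \<delta> \<longrightarrow> dist (g r) l < e" by blast
qed

lemma ess_left_limI:
  assumes eq: "AE x in lebesgue_on {0<..<L}. g x = f x" and s: "s \<in> {0<..<L}" and lim: "(f \<longlongrightarrow> l) (at_left s)"
  shows "ess_left_lim g s l"
  unfolding ess_left_lim_def
proof (intro allI impI)
  fix e :: real assume "0 < e"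
  then obtain b where b: "b < s" "\<And>x. b < x \<Longrightarrow> x < s \<Longrightarrow> dist (f x) l < e"
    using tendstoD[OF lim] by (auto simp: eventually_at_left_field)
  have "AE x in lebesgue. x \<in> {0<..<L} \<longrightarrow> g x = f x" using eq by (subst (asm) AE_restrict_space_iff) auto
  then have "AE r in lebesgue. s - (s - max b 0) < r \<and> r < s \<longrightarrow> dist (g r) l < e"
    by eventually_elim (use b s in auto)
  moreover have "0 < s - max b 0" using b s by auto
  ultimately show "\<exists>\<delta>>0. AE r in lebesgue. s - \<delta> < r \<and> r < s \<longrightarrow> dist (g r) l < e" by blast
qed

lemma rlim_eq: "ess_right_lim f s l \<Longrightarrow> rlim f s = l"
  unfolding rlim_def using ess_right_lim_unique by (intro the_equality) blast+

lemma llim_eq: "ess_left_lim f s l \<Longrightarrow> llim f s = l"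
  unfolding llim_def using ess_left_lim_unique by (intro the_equality) blast+

section \<open>Jump set and total variation of a function with density\<close>

context bv_measure begin

lemma
  fixes \<sigma> :: "real \<Rightarrow> 'b::euclidean_space"
  assumes d: "has_density \<sigma> f" and eq: "AE x in lebesgue_on I. g x = f x" and s: "s \<in> I"
  shows rlim_density: "rlim g s = f s" and llim_density: "llim g s = left_value \<sigma> f s"
    and jump_set_density: "s \<in> jump_set I g \<longleftrightarrow> left_value \<sigma> f s \<noteq> f s"
proof -
  have r: "ess_right_lim g s (f s)" by (rule ess_right_limI[OF eq s has_density_right_cont[OF d s]])
  have l: "ess_left_lim g s (left_value \<sigma> f s)" by (rule ess_left_limI[OF eq s has_density_left_lim[OF d s]])
  show "rlim g s = f s" "llim g s = left_value \<sigma> f s" using r l by (auto intro: rlim_eq llim_eq)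
  show "s \<in> jump_set I g \<longleftrightarrow> left_value \<sigma> f s \<noteq> f s"
    using r l s unfolding jump_set_def by (auto dest: ess_right_lim_unique ess_left_lim_unique)
qed

text \<open>A jump requires an atom of \<open>M\<close>. There are no atoms off \<open>N\<close>,
  where \<open>M\<close> is Lebesgue measure, and a finite measure has at most countably
  many.\<close>

lemma jump_set_subset_atoms:
  fixes \<sigma> :: "real \<Rightarrow> 'b::euclidean_space"
  assumes d: "has_density \<sigma> f" and eq: "AE x in lebesgue_on I. g x = f x"
  shows "jump_set I g \<subseteq> N" "countable (jump_set I g)"
proof -
  have *: "measure M {s} \<noteq> 0" if "s \<in> jump_set I g" for s
  proof
    assume 0: "measure M {s} = 0"
    have "s \<in> I" using that by (simp add: jump_set_def)
    then show False using jump_set_density[OF d eq, of s] that 0 by (simp add: left_value_def)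
  qed
  show "jump_set I g \<subseteq> N" using * measure_singleton_off_N by blast
  show "countable (jump_set I g)" by (rule countable_subset[OF _ countable_atoms]) (use * in blast)
qed

text \<open>The lower bound needs a partition on which \<open>\<tau>\<close> is nearly constant, so
  that little cancels in the integrals: the cells are the sets where \<open>\<tau>\<close> is within
  \<open>e\<close> of the n-th point of a countable dense set, made disjoint.\<close>

lemma total_variation_density:
  fixes \<tau> :: "real \<Rightarrow> 'b::euclidean_space"
  assumes int: "integrable M \<tau>"
    and \<nu>: "\<And>A. A \<in> sets borel \<Longrightarrow> A \<subseteq> I \<Longrightarrow> \<nu> A = (LINT x:A|M. \<tau> x)"
  shows "total_variation \<nu> I = (\<integral>\<^sup>+x. norm (\<tau> x) \<partial>M)"
proof -
  have [measurable]: "\<tau> \<in> borel_measurable borel"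
    using int by (auto cong: measurable_cong_sets dest: borel_measurable_integrable)
  define \<kappa> where "\<kappa> = density M (\<lambda>x. ennreal (norm (\<tau> x)))"
  have s\<kappa> [simp]: "sets \<kappa> = sets borel" by (simp add: \<kappa>_def)
  have \<kappa>: "emeasure \<kappa> A = (\<integral>\<^sup>+x\<in>A. norm (\<tau> x) \<partial>M)" if "A \<in> sets borel" for A
    unfolding \<kappa>_def using that by (subst emeasure_density) auto
  have \<kappa>I: "emeasure \<kappa> I = (\<integral>\<^sup>+x. norm (\<tau> x) \<partial>M)"
  proof -
    have "AE x in M. ennreal (norm (\<tau> x)) * indicator I x = ennreal (norm (\<tau> x))"
      using AE_M_I by eventually_elim (auto simp: indicator_def)
    then show ?thesis by (subst \<kappa>) (auto intro!: nn_integral_cong_AE)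
  qed
  have I_int: "set_integrable M A \<tau>" if "A \<in> sets borel" for A using int that by (rule set_integrable_M)
  have bound: "ennreal (norm (\<nu> A)) \<le> emeasure \<kappa> A" if A: "A \<in> sets borel" "A \<subseteq> I" for A
  proof -
    have "ennreal (norm (\<nu> A)) \<le> (\<integral>\<^sup>+x. norm (indicator A x *\<^sub>R \<tau> x) \<partial>M)"
      unfolding \<nu>[OF A] set_lebesgue_integral_def
      by (rule integral_norm_bound_ennreal) (use I_int[OF A(1)] in \<open>simp add: set_integrable_def\<close>)
    also have "\<dots> = emeasure \<kappa> A" unfolding \<kappa>[OF A(1)]
      by (rule nn_integral_cong) (auto simp: indicator_def)
    finally show ?thesis .
  qed
  show ?thesis
  proof (rule antisym)
    show "total_variation \<nu> I \<le> (\<integral>\<^sup>+x. norm (\<tau> x) \<partial>M)"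
      unfolding total_variation_def
    proof (rule SUP_least)
      fix A :: "nat \<Rightarrow> real set"
      assume A: "A \<in> {A. range A \<subseteq> sets borel \<and> disjoint_family A \<and> (\<Union>n. A n) = I}"
      then have "A n \<in> sets borel" "A n \<subseteq> I" for n by auto
      then have "(\<Sum>n. ennreal (norm (\<nu> (A n)))) \<le> (\<Sum>n. emeasure \<kappa> (A n))"
        by (intro suminf_le bound) auto
      also have "\<dots> = emeasure \<kappa> I" using A by (subst suminf_emeasure) auto
      finally show "(\<Sum>n. ennreal (norm (\<nu> (A n)))) \<le> (\<integral>\<^sup>+x. norm (\<tau> x) \<partial>M)" using \<kappa>I by simp
    qed
    obtain D :: "'b set" where D: "countable D" "\<And>Y. open Y \<Longrightarrow> Y \<noteq> {} \<Longrightarrow> \<exists>d\<in>D. d \<in> Y"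
      using countable_dense_setE by blast
    have "D \<noteq> {}" using D(2)[of UNIV] by auto
    define d where "d = from_nat_into D"
    have "(\<integral>\<^sup>+x. norm (\<tau> x) \<partial>M) \<le> total_variation \<nu> I + ennreal (2 * e * measure M I)" if e: "e > 0" for e
    proof -
      define C where "C n = {x \<in> I. dist (d n) (\<tau> x) < e}" for n
      have C: "C n \<in> sets borel" for n unfolding C_def by measurable
      have CI: "(\<Union>n. C n) = I"
      proof -
        have "\<exists>n. dist (d n) (\<tau> x) < e" for x
        proof -
          obtain y where "y \<in> D" "y \<in> ball (\<tau> x) e" using D(2)[of "ball (\<tau> x) e"] e by auto
          then show ?thesis using from_nat_into_surj[OF D(1), of y] by (auto simp: d_def dist_commute)
        qed
        then show ?thesis by (auto simp: C_def)
      qed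
      define A where "A = disjointed C"
      have A: "A n \<in> sets borel" "A n \<subseteq> C n" "disjoint_family A" "(\<Union>n. A n) = I" for n
        using C CI sets.range_disjointed_sets'[of C borel] disjointed_subset[of C n] disjoint_family_disjointed[of C] UN_disjointed_eq[of C]
        by (auto simp: A_def)
      have AI: "A n \<subseteq> I" for n using A(4) by auto
      \<comment> \<open>One \<open>e\<close> is lost in replacing \<open>norm (\<tau> x)\<close> by
        \<open>norm (d n)\<close>, a second one in replacing the integral of \<open>d n\<close> by
        that of \<open>\<tau>\<close>.\<close>
      have main: "emeasure \<kappa> (A n) \<le> ennreal (norm (\<nu> (A n))) + ennreal (2 * e) * emeasure M (A n)" for n
      proof -
        note iA = I_int[OF A(1)[of n]]
        have cst: "set_integrable M (A n) (\<lambda>x. c)" for c :: 'b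
          by (rule set_integrable_M) (use A in auto)
        have cstr: "set_integrable M (A n) (\<lambda>x. c)" for c :: real
          by (rule set_integrable_M) (use A in auto)
        have near: "norm (\<tau> x - d n) \<le> e" if "x \<in> A n" for x
          using A(2)[of n] that by (auto simp: C_def dist_norm norm_minus_commute less_imp_le)
        have "(LINT x:A n|M. norm (\<tau> x)) \<le> (LINT x:A n|M. norm (d n) + e)"
        proof (rule set_integral_mono)
          show "norm (\<tau> x) \<le> norm (d n) + e" if "x \<in> A n" for x
            using near[OF that] norm_triangle_sub[of "\<tau> x" "d n"] by simp
        qed (use iA cstr in \<open>auto intro: set_integrable_norm\<close>)
        also have "\<dots> = (norm (d n) + e) * measure M (A n)"
          by (simp add: set_lebesgue_integral_def mult.commute emeasure_eq_measure)
        finally have 1: "(LINT x:A n|M. norm (\<tau> x)) \<le> (norm (d n) + e) * measure M (A n)" .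
        have "(LINT x:A n|M. d n) = measure M (A n) *\<^sub>R d n"
          using A(1)[of n] by (simp add: set_lebesgue_integral_def emeasure_eq_measure)
        then have "norm (d n) * measure M (A n) = norm (LINT x:A n|M. d n)" by (simp add: mult.commute)
        also have "(LINT x:A n|M. d n) = (LINT x:A n|M. \<tau> x) - (LINT x:A n|M. \<tau> x - d n)"
          using iA cst[of "d n"] by simp
        also have "norm \<dots> \<le> norm (\<nu> (A n)) + norm (LINT x:A n|M. \<tau> x - d n)"
          using \<nu>[OF A(1) AI] by (simp add: norm_triangle_ineq4)
        also have "norm (LINT x:A n|M. \<tau> x - d n) \<le> (LINT x:A n|M. norm (\<tau> x - d n))"
          by (rule set_integral_norm_bound) (use iA cst[of "d n"] in auto)
        also have "\<dots> \<le> (LINT x:A n|M. e)"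
          by (rule set_integral_mono) (use iA cst[of "d n"] cstr[of e] near in \<open>auto intro!: set_integrable_norm\<close>)
        also have "\<dots> = e * measure M (A n)"
          by (simp add: set_lebesgue_integral_def mult.commute emeasure_eq_measure)
        finally have 2: "(LINT x:A n|M. norm (\<tau> x)) \<le> norm (\<nu> (A n)) + 2 * e * measure M (A n)"
          using 1 by (simp add: algebra_simps)
        have "emeasure \<kappa> (A n) = (\<integral>\<^sup>+x. ennreal (indicator (A n) x *\<^sub>R norm (\<tau> x)) \<partial>M)"
          unfolding \<kappa>[OF A(1)] by (rule nn_integral_cong) (auto simp: indicator_def)
        also have "\<dots> = ennreal (LINT x:A n|M. norm (\<tau> x))"
          unfolding set_lebesgue_integral_def
          by (rule nn_integral_eq_integral) (use set_integrable_norm[OF iA] in \<open>auto simp: set_integrable_def\<close>)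
        also have "\<dots> \<le> ennreal (norm (\<nu> (A n)) + 2 * e * measure M (A n))" using 2 by (rule ennreal_leI)
        also have "\<dots> = ennreal (norm (\<nu> (A n))) + ennreal (2 * e * measure M (A n))"
          using e by (intro ennreal_plus) auto
        also have "ennreal (2 * e * measure M (A n)) = ennreal (2 * e) * emeasure M (A n)"
          unfolding emeasure_eq_measure by (rule ennreal_mult) (use e in auto)
        finally show ?thesis .
      qed
      have "(\<integral>\<^sup>+x. norm (\<tau> x) \<partial>M) = (\<Sum>n. emeasure \<kappa> (A n))"
        using A \<kappa>I by (subst suminf_emeasure) auto
      also have "\<dots> \<le> (\<Sum>n. ennreal (norm (\<nu> (A n))) + ennreal (2 * e) * emeasure M (A n))"
        by (intro suminf_le main) auto
      also have "\<dots> = (\<Sum>n. ennreal (norm (\<nu> (A n)))) + ennreal (2 * e) * (\<Sum>n. emeasure M (A n))"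
        by (simp add: suminf_add[symmetric] ennreal_suminf_cmult)
      also have "(\<Sum>n. emeasure M (A n)) = emeasure M I" using A by (subst suminf_emeasure) auto
      also have "ennreal (2 * e) * emeasure M I = ennreal (2 * e * measure M I)"
        unfolding emeasure_eq_measure by (rule ennreal_mult[symmetric]) (use e in auto)
      finally have "(\<integral>\<^sup>+x. norm (\<tau> x) \<partial>M) \<le> (\<Sum>n. ennreal (norm (\<nu> (A n)))) + ennreal (2 * e * measure M I)" .
      moreover have "(\<Sum>n. ennreal (norm (\<nu> (A n)))) \<le> total_variation \<nu> I"
        unfolding total_variation_def by (rule SUP_upper) (use A in auto)
      ultimately show ?thesis by (meson add_right_mono order_trans)
    qed
    note eps = this
    show "(\<integral>\<^sup>+x. norm (\<tau> x) \<partial>M) \<le> total_variation \<nu> I"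
    proof (rule ennreal_le_epsilon)
      fix e :: real assume e: "0 < e"
      define e' where "e' = e / (2 * (measure M I + 1))"
      have p: "0 < measure M I + 1" by (simp add: add_nonneg_pos)
      have "0 < e'" using e p by (simp add: e'_def)
      have "2 * e' * measure M I \<le> e"
        using e p by (simp add: e'_def field_simps)
      then show "(\<integral>\<^sup>+x. norm (\<tau> x) \<partial>M) \<le> total_variation \<nu> I + ennreal e"
        using eps[OF \<open>0 < e'\<close>] by (meson add_left_mono ennreal_leI order_trans)
    qed
  qed
qed

end

section \<open>Product and chain rules\<close>

lemma divided_difference_bound:
  fixes h h' :: "real \<Rightarrow> real"
  assumes "\<And>x. (h has_real_derivative h' x) (at x)"
  obtains \<xi> where "min x y \<le> \<xi>" "\<xi> \<le> max x y" "(if x = y then h' x else (h y - h x) / (y - x)) = h' \<xi>"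
proof (cases "x = y")
  case False
  then consider "x < y" | "y < x" by linarith
  then show ?thesis
  proof cases
    case 1
    then obtain z where "x < z" "z < y" "h y - h x = (y - x) * h' z" using MVT2[of x y h h'] assms by blast
    then show ?thesis using 1 by (intro that[of z]) (auto simp: field_simps)
  next
    case 2
    then obtain z where "y < z" "z < x" "h x - h y = (x - y) * h' z" using MVT2[of y x h h'] assms by blast
    then show ?thesis using 2 by (intro that[of z]) (auto simp: field_simps)
  qed
qed (use that[of x] in auto)

text \<open>Near the diagonal the divided difference is a value of \<open>h'\<close> at an
  intermediate point. In the chain rule the arguments are the values of \<open>f\<close> at the ends
  of a shrinking interval, and their limits coincide exactly where \<open>f\<close> does not
  jump.\<close>

lemma divided_difference_tendsto:
  fixes h h' :: "real \<Rightarrow> real"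
  assumes D: "\<And>x. (h has_real_derivative h' x) (at x)" and cont: "continuous_on UNIV h'"
    and x: "x \<longlonglongrightarrow> a" and y: "y \<longlonglongrightarrow> b"
  shows "(\<lambda>n. if x n = y n then h' (x n) else (h (y n) - h (x n)) / (y n - x n))
    \<longlonglongrightarrow> (if a = b then h' a else (h b - h a) / (b - a))"
proof (cases "a = b")
  case True
  have "\<exists>\<xi>. min (x n) (y n) \<le> \<xi> \<and> \<xi> \<le> max (x n) (y n) \<and>
      (if x n = y n then h' (x n) else (h (y n) - h (x n)) / (y n - x n)) = h' \<xi>" for n
    using divided_difference_bound[of h h' "x n" "y n"] D by metis
  then obtain \<xi> where \<xi>: "\<And>n. min (x n) (y n) \<le> \<xi> n" "\<And>n. \<xi> n \<le> max (x n) (y n)"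
      "\<And>n. (if x n = y n then h' (x n) else (h (y n) - h (x n)) / (y n - x n)) = h' (\<xi> n)"
    by metis
  have "(\<lambda>n. min (x n) (y n)) \<longlonglongrightarrow> min a b" "(\<lambda>n. max (x n) (y n)) \<longlonglongrightarrow> max a b"
    using x y by (auto intro: tendsto_min tendsto_max)
  then have "\<xi> \<longlonglongrightarrow> a"
    using True \<xi>(1,2) by (intro tendsto_sandwich[of "\<lambda>n. min (x n) (y n)" \<xi> _ "\<lambda>n. max (x n) (y n)"]) auto
  moreover have "isCont h' a" using cont by (simp add: continuous_on_eq_continuous_at)
  ultimately have "(\<lambda>n. h' (\<xi> n)) \<longlonglongrightarrow> h' a" by (rule isCont_tendsto_compose[rotated])
  then show ?thesis using True \<xi>(3) by simp
next
  case False
  have "isCont h z" for z using D by (rule DERIV_isCont)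
  then have "(\<lambda>n. (h (y n) - h (x n)) / (y n - x n)) \<longlonglongrightarrow> (h b - h a) / (b - a)"
    using False x y by (intro tendsto_intros isCont_tendsto_compose[of _ h]) auto
  moreover have "(\<lambda>n. x n - y n) \<longlonglongrightarrow> a - b" using x y by (intro tendsto_intros)
  then have "\<forall>\<^sub>F n in sequentially. x n - y n \<noteq> 0" by (rule tendsto_imp_eventually_ne) (use False in simp)
  then have "\<forall>\<^sub>F n in sequentially. (h (y n) - h (x n)) / (y n - x n)
      = (if x n = y n then h' (x n) else (h (y n) - h (x n)) / (y n - x n))" by eventually_elim simp
  ultimately have "(\<lambda>n. if x n = y n then h' (x n) else (h (y n) - h (x n)) / (y n - x n))
      \<longlonglongrightarrow> (h b - h a) / (b - a)" by (rule Lim_transform_eventually)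
  then show ?thesis using False by simp
qed

context bv_measure begin

text \<open>Riemann sums over finer and finer partitions converge by dominated convergence; a partition
  interval \<open>(x, y]\<close> containing \<open>s\<close> shrinks to \<open>s\<close> with \<open>x < s\<close>, hence the left limits below.\<close>

lemma has_density_refine:
  fixes F :: "real \<Rightarrow> 'c::euclidean_space"
  assumes F: "\<And>x y. 0 < x \<Longrightarrow> x \<le> y \<Longrightarrow> y < L \<Longrightarrow> F y - F x = (LINT s:{x<..y}|M. R x y s)"
    and R: "\<And>x y. x \<in> I \<Longrightarrow> y \<in> I \<Longrightarrow> integrable M (R x y)"
    and w: "integrable M w" "\<And>x y s. x \<in> I \<Longrightarrow> y \<in> I \<Longrightarrow> norm (R x y s) \<le> w s"
    and \<rho>: "\<rho> \<in> borel_measurable borel"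
    and lim: "\<And>s x y. s \<in> I \<Longrightarrow> x \<longlonglongrightarrow> s \<Longrightarrow> y \<longlonglongrightarrow> s \<Longrightarrow> (\<And>n. x n < s) \<Longrightarrow> (\<And>n. s \<le> y n) \<Longrightarrow>
      (\<And>n. x n \<in> I) \<Longrightarrow> (\<And>n. y n \<in> I) \<Longrightarrow> (\<lambda>n. R (x n) (y n) s) \<longlonglongrightarrow> \<rho> s"
  shows "has_density \<rho> F"
proof -
  have bound: "norm (\<rho> s) \<le> w s" if "s \<in> I" for s
  proof -
    \<comment> \<open>Any admissible approximation gives the bound: the left points are
      \<open>s - d n\<close>, kept positive by the factor \<open>s / 2\<close>, and the right point
      is always \<open>s\<close> itself.\<close>
    define d where "d n = s / 2 * inverse (real (Suc n))" for n
    have "d \<longlonglongrightarrow> s / 2 * 0"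
      unfolding d_def[abs_def] by (intro tendsto_mult tendsto_const LIMSEQ_inverse_real_of_nat)
    then have d0: "d \<longlonglongrightarrow> 0" by simp
    have d: "0 < d n" "d n < s" for n
    proof -
      have "inverse (real (Suc n)) \<le> 1" by (simp add: field_simps)
      then have "s / 2 * inverse (real (Suc n)) \<le> s / 2 * 1" using that by (intro mult_left_mono) auto
      then show "0 < d n" "d n < s" using that by (auto simp: d_def)
    qed
    define x where "x n = s - d n" for n
    have "x \<longlonglongrightarrow> s - 0" unfolding x_def[abs_def] by (intro tendsto_diff tendsto_const d0)
    moreover have x: "x n < s" "0 < x n" for n using d[of n] by (auto simp: x_def)
    ultimately have "(\<lambda>n. R (x n) s s) \<longlonglongrightarrow> \<rho> s" using that x less_trans[OF x(1)] by (intro lim) auto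
    moreover have "norm (R (x n) s s) \<le> w s" for n using x[of n] that by (intro w) auto
    ultimately show ?thesis by (intro tendsto_le[OF _ tendsto_const tendsto_norm]) auto
  qed
  have \<rho>int: "integrable M \<rho>"
  proof (rule Bochner_Integration.integrable_bound[OF w(1)])
    show "\<rho> \<in> borel_measurable M" using \<rho> by (simp cong: measurable_cong_sets)
    show "AE s in M. norm (\<rho> s) \<le> norm (w s)"
      using AE_M_I by eventually_elim (use bound in \<open>force\<close>)
  qed
  have "F b - F a = (LINT s:{a<..b}|M. \<rho> s)" if ab: "0 < a" "a \<le> b" "b < L" for a b
  proof (cases "a = b")
    case False
    then have "a < b" using ab by simp
    define p where "p m i = a + (b - a) * real i / real (Suc m)" for m i :: nat
    have p0: "p m 0 = a" and pm: "p m (Suc m) = b" for m by (auto simp: p_def simp del: of_nat_Suc)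
    have p_mono: "p m i \<le> p m j" if "i \<le> j" for m i j
      using that \<open>a < b\<close> unfolding p_def by (intro add_left_mono divide_right_mono mult_left_mono) auto
    have p_in: "a \<le> p m i" "p m i \<le> b" if "i \<le> Suc m" for m i
      using p_mono[of 0 i m] p_mono[of i "Suc m" m] that p0[of m] pm[of m] by auto
    have p_I: "p m i \<in> I" if "i \<le> Suc m" for m i using p_in[OF that] ab by auto
    have p_step: "p m (Suc i) - p m i = (b - a) / real (Suc m)" for m i
    proof -
      have "p m (Suc i) - p m i = ((b - a) * (real i + 1) - (b - a) * real i) / real (Suc m)"
        by (simp add: p_def diff_divide_distrib)
      also have "(b - a) * (real i + 1) - (b - a) * real i = b - a" by (simp add: algebra_simps)
      finally show ?thesis .
    qed
    define g where "g m s = (\<Sum>i<Suc m. indicator {p m i<..p m (Suc i)} s *\<^sub>R R (p m i) (p m (Suc i)) s)" for m s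
    have gF: "F b - F a = (LINT s|M. g m s)" for m
    proof -
      have "F b - F a = (\<Sum>i<Suc m. F (p m (Suc i)) - F (p m i))"
        using sum_lessThan_telescope[of "\<lambda>i. F (p m i)" "Suc m"] p0[of m] pm[of m] by simp
      also have "\<dots> = (\<Sum>i<Suc m. LINT s:{p m i<..p m (Suc i)}|M. R (p m i) (p m (Suc i)) s)"
        by (rule sum.cong[OF refl], rule F) (use p_I p_mono in \<open>auto simp: less_Suc_eq_le\<close>)
      also have "\<dots> = (LINT s|M. g m s)"
        unfolding g_def set_lebesgue_integral_def
        by (rule Bochner_Integration.integral_sum[symmetric])
          (auto intro!: integrable_mult_indicator R p_I)
      finally show ?thesis .
    qed
    have ex: "\<exists>x y. x < s \<and> s \<le> y \<and> y - x = (b - a) / real (Suc m) \<and> x \<in> I \<and> y \<in> I \<and> g m s = R x y s"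
      if s: "s \<in> {a<..b}" for m s
    proof -
      \<comment> \<open>The first partition point that is not left of \<open>s\<close>; as the
        intervals are open on the left and closed on the right, exactly the interval ending there
        contains \<open>s\<close>.\<close>
      define k where "k = (LEAST k. s \<le> p m k)"
      have k: "s \<le> p m k" unfolding k_def by (rule LeastI[of _ "Suc m"]) (use s pm in auto)
      have k_le: "k \<le> Suc m" unfolding k_def by (rule Least_le) (use s pm in auto)
      have "k \<noteq> 0" using k s p0[of m] by (metis greaterThanAtMost_iff leD)
      then obtain i where i: "k = Suc i" by (cases k) auto
      have less: "p m i < s" using not_less_Least[of i "\<lambda>k. s \<le> p m k"] i unfolding k_def by auto
      have "i < Suc m" using i k_le by simp
      have "indicator {p m j<..p m (Suc j)} s *\<^sub>R R (p m j) (p m (Suc j)) s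
          = (if j = i then R (p m i) (p m (Suc i)) s else 0)" for j
      proof -
        consider "j = i" | "j < i" | "i < j" by linarith
        then show ?thesis
        proof cases
          case 1 then show ?thesis using k less i by auto
        next
          case 2 then show ?thesis using p_mono[of "Suc j" i m] less by auto
        next
          case 3 then show ?thesis using p_mono[of "Suc i" j m] k i by auto
        qed
      qed
      then have "g m s = R (p m i) (p m (Suc i)) s"
        using \<open>i < Suc m\<close> by (simp add: g_def del: sum.lessThan_Suc)
      then show ?thesis
        using less k i p_step[of m i] p_I[of i m] p_I[of "Suc i" m] \<open>i < Suc m\<close>
        by (intro exI[of _ "p m i"] exI[of _ "p m (Suc i)"]) auto
    qed
    have g0: "g m s = 0" if "s \<notin> {a<..b}" for m s
    proof -
      have "s \<notin> {p m i<..p m (Suc i)}" if "i < Suc m" for i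
        using p_in[of i m] p_in[of "Suc i" m] that \<open>s \<notin> {a<..b}\<close> by auto
      then show ?thesis unfolding g_def by (intro sum.neutral) auto
    qed
    have glim: "(\<lambda>m. g m s) \<longlonglongrightarrow> indicator {a<..b} s *\<^sub>R \<rho> s" for s
    proof (cases "s \<in> {a<..b}")
      case True
      obtain x y where xy: "\<And>m. x m < s" "\<And>m. s \<le> y m" "\<And>m. y m - x m = (b - a) / real (Suc m)"
          "\<And>m. x m \<in> I" "\<And>m. y m \<in> I" "\<And>m. g m s = R (x m) (y m) s"
        using ex[OF True] by metis
      have z: "(\<lambda>m. (b - a) / real (Suc m)) \<longlonglongrightarrow> 0"
        using tendsto_mult[OF tendsto_const LIMSEQ_inverse_real_of_nat, of "b - a"] by (simp add: divide_inverse)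
      have "x \<longlonglongrightarrow> s - 0"
      proof (rule tendsto_sandwich[OF _ _ tendsto_diff[OF tendsto_const z] tendsto_diff[OF tendsto_const tendsto_const]])
        show "\<forall>\<^sub>F n in sequentially. s - (b - a) / real (Suc n) \<le> x n"
          using xy(2,3) by (intro always_eventually allI) (smt (verit))
        show "\<forall>\<^sub>F n in sequentially. x n \<le> s - 0"
          using xy(1) by (intro always_eventually allI) (simp add: less_imp_le)
      qed
      moreover have "y \<longlonglongrightarrow> s + 0"
      proof (rule tendsto_sandwich[OF _ _ tendsto_add[OF tendsto_const tendsto_const] tendsto_add[OF tendsto_const z]])
        show "\<forall>\<^sub>F n in sequentially. y n \<le> s + (b - a) / real (Suc n)"
          using xy(1,3) by (intro always_eventually allI) (smt (verit))
        show "\<forall>\<^sub>F n in sequentially. s + 0 \<le> y n" using xy(2) by auto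
      qed
      moreover have "s \<in> I" using True ab by auto
      ultimately show ?thesis using lim[of s x y] xy True by simp
    next
      case False then show ?thesis using g0 by simp
    qed
    have gw: "norm (g m s) \<le> norm (w s)" for m s
    proof (cases "s \<in> {a<..b}")
      case True
      then show ?thesis using ex[OF True, of m] w(2) by (metis abs_ge_self order_trans real_norm_def)
    qed (simp add: g0)
    have "(\<lambda>m. LINT s|M. g m s) \<longlonglongrightarrow> (LINT s|M. indicator {a<..b} s *\<^sub>R \<rho> s)"
    proof (rule integral_dominated_convergence[where w="\<lambda>s. norm (w s)"])
      show "(\<lambda>s. indicator {a<..b} s *\<^sub>R \<rho> s) \<in> borel_measurable M"
        using \<rho> by (simp cong: measurable_cong_sets)
      show "g m \<in> borel_measurable M" for m
        unfolding g_def
        by (intro borel_measurable_sum borel_measurable_scaleR borel_measurable_indicator borel_measurable_integrable R p_I)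
          auto
    qed (use w glim gw in auto)
    then have "(\<lambda>m. F b - F a) \<longlonglongrightarrow> (LINT s:{a<..b}|M. \<rho> s)"
      unfolding gF[symmetric] set_lebesgue_integral_def by simp
    then show ?thesis by (simp add: LIMSEQ_const_iff)
  qed (simp add: set_lebesgue_integral_def)
  then show ?thesis using \<rho>int by (simp add: has_density_def)
qed

lemma has_density_bounded:
  assumes d: "has_density \<sigma> f"
  obtains B where "\<And>s. s \<in> I \<Longrightarrow> norm (f s) \<le> B"
proof -
  note \<sigma> = has_densityD[OF d]
  obtain K where K: "\<And>x. x \<in> I \<Longrightarrow> f x = K + (LINT s:{..x}|M. \<sigma> s)"
    using has_density_cumulative[OF d] by blast
  have "norm (f x) \<le> norm K + (LINT s|M. norm (\<sigma> s))" if "x \<in> I" for x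
  proof -
    have "norm (LINT s:{..x}|M. \<sigma> s) \<le> (LINT s:{..x}|M. norm (\<sigma> s))"
      by (rule set_integral_norm_bound) (auto intro!: set_integrable_M \<sigma>)
    also have "\<dots> \<le> (LINT s|M. norm (\<sigma> s))"
      unfolding set_lebesgue_integral_def
      by (rule integral_mono)
        (use set_integrable_M[of "\<lambda>s. norm (\<sigma> s)" "{..x}"] \<sigma>(1) in
          \<open>auto simp: set_integrable_def mult_left_le_one_le\<close>)
    finally show ?thesis using K[OF that] by (metis add_left_mono norm_triangle_ineq order_trans)
  qed
  then show ?thesis using that by blast
qed

lemma has_density_seq_right:
  assumes d: "has_density \<sigma> f" and s: "s \<in> I" and y: "y \<longlonglongrightarrow> s" "\<And>n. s \<le> y n"
  shows "(\<lambda>n. f (y n)) \<longlonglongrightarrow> f s"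
proof -
  have "continuous (at s within {s<..}) f"
    using has_density_right_cont[OF d s] by (simp add: continuous_within)
  then have "continuous (at s within {s..}) f"
    by (simp add: continuous_within at_within_Ici_at_right)
  then show ?thesis using y by (auto simp: continuous_within_sequentially o_def)
qed

lemma has_density_seq_left:
  assumes d: "has_density \<sigma> f" and s: "s \<in> I" and x: "x \<longlonglongrightarrow> s" "\<And>n. x n < s"
  shows "(\<lambda>n. f (x n)) \<longlonglongrightarrow> left_value \<sigma> f s"
proof -
  have "filterlim x (at_left s) sequentially"
    unfolding filterlim_at using x by (auto simp: less_imp_neq intro!: always_eventually)
  then show ?thesis using has_density_left_lim[OF d s] filterlim_compose by blast
qed

lemma left_value_measurable [measurable]:
  fixes \<sigma> f :: "real \<Rightarrow> 'b::euclidean_space"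
  assumes [measurable]: "\<sigma> \<in> borel_measurable borel" "f \<in> borel_measurable borel"
  shows "left_value \<sigma> f \<in> borel_measurable borel"
proof (rule measurable_discrete_difference[where X="{s. measure M {s} \<noteq> 0}"])
  show "f \<in> borel_measurable borel" by fact
  show "countable {s. measure M {s} \<noteq> 0}" by (rule countable_atoms)
qed (auto simp: left_value_def)

text \<open>The increment over a partition interval splits into the increment of \<open>f\<close>
  paired with \<open>g\<close> at the right end and \<open>f\<close> at the left end paired with the
  increment of \<open>g\<close>. In the limit this leaves \<open>g s\<close> in one term and the
  left limit of \<open>f\<close> in the other, which accounts correctly for simultaneous
  jumps.\<close>

lemma has_density_product:
  fixes f :: "real \<Rightarrow> 'b::euclidean_space" and g :: "real \<Rightarrow> 'c::euclidean_space"
    and P :: "'b \<Rightarrow> 'c \<Rightarrow> 'd::euclidean_space"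
  assumes P: "bounded_bilinear P"
    and f: "has_density \<sigma>f f" and g: "has_density \<sigma>g g"
    and [measurable]: "f \<in> borel_measurable borel" "g \<in> borel_measurable borel"
  shows "has_density (\<lambda>s. P (\<sigma>f s) (g s) + P (left_value \<sigma>f f s) (\<sigma>g s)) (\<lambda>s. P (f s) (g s))"
proof -
  interpret P: bounded_bilinear P by fact
  note [measurable] = has_densityD(2)[OF f] has_densityD(2)[OF g]
  note int = has_densityD(1)[OF f] has_densityD(1)[OF g]
  obtain K where K: "\<And>a b. norm (P a b) \<le> norm a * norm b * K" "0 \<le> K" using P.nonneg_bounded by blast
  obtain B1 where B1: "\<And>s. s \<in> I \<Longrightarrow> norm (f s) \<le> B1" using has_density_bounded[OF f] by blast
  obtain B2 where B2: "\<And>s. s \<in> I \<Longrightarrow> norm (g s) \<le> B2" using has_density_bounded[OF g] by blast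
  have Pm: "(\<lambda>x. P (u x) (v x)) \<in> borel_measurable borel"
    if "u \<in> borel_measurable borel" "v \<in> borel_measurable borel" for u v
    using that by (rule borel_measurable_continuous_Pair)
      (intro P.continuous_on continuous_intros)
  have int1: "integrable M (\<lambda>s. P (\<sigma>f s) c)" for c
    by (rule integrable_bounded_linear[OF P.bounded_linear_left int(1)])
  have int2: "integrable M (\<lambda>s. P c (\<sigma>g s))" for c
    by (rule integrable_bounded_linear[OF P.bounded_linear_right int(2)])
  show ?thesis
  proof (rule has_density_refine[where R="\<lambda>x y s. P (\<sigma>f s) (g y) + P (f x) (\<sigma>g s)"
        and w="\<lambda>s. (norm (\<sigma>f s) * B2 + B1 * norm (\<sigma>g s)) * K"])
    fix x y :: real assume xy: "0 < x" "x \<le> y" "y < L"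
    have "P (f y) (g y) - P (f x) (g x) = P (f y - f x) (g y) + P (f x) (g y - g x)"
      by (simp add: P.diff_left P.diff_right)
    also have "P (f y - f x) (g y) = (LINT s:{x<..y}|M. P (\<sigma>f s) (g y))"
      unfolding has_densityD(3)[OF f xy] set_lebesgue_integral_def
      by (subst integral_bounded_linear[OF P.bounded_linear_left, symmetric])
        (use int(1) in \<open>auto intro!: integrable_mult_indicator simp: P.scaleR_left\<close>)
    also have "P (f x) (g y - g x) = (LINT s:{x<..y}|M. P (f x) (\<sigma>g s))"
      unfolding has_densityD(3)[OF g xy] set_lebesgue_integral_def
      by (subst integral_bounded_linear[OF P.bounded_linear_right, symmetric])
        (use int(2) in \<open>auto intro!: integrable_mult_indicator simp: P.scaleR_right\<close>)
    also have "(LINT s:{x<..y}|M. P (\<sigma>f s) (g y)) + (LINT s:{x<..y}|M. P (f x) (\<sigma>g s))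
      = (LINT s:{x<..y}|M. P (\<sigma>f s) (g y) + P (f x) (\<sigma>g s))"
      by (rule set_integral_add(2)[symmetric]) (auto intro!: set_integrable_M int1 int2)
    finally show "P (f y) (g y) - P (f x) (g x) = (LINT s:{x<..y}|M. P (\<sigma>f s) (g y) + P (f x) (\<sigma>g s))" .
  next
    show "integrable M (\<lambda>s. (norm (\<sigma>f s) * B2 + B1 * norm (\<sigma>g s)) * K)" using int by auto
    fix x y s assume "x \<in> I" "y \<in> I"
    show "integrable M (\<lambda>s. P (\<sigma>f s) (g y) + P (f x) (\<sigma>g s))" using int1 int2 by auto
    have "norm (P (\<sigma>f s) (g y) + P (f x) (\<sigma>g s)) \<le> norm (\<sigma>f s) * norm (g y) * K + norm (f x) * norm (\<sigma>g s) * K"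
      by (rule norm_triangle_mono[OF K(1) K(1)])
    also have "\<dots> \<le> norm (\<sigma>f s) * B2 * K + B1 * norm (\<sigma>g s) * K"
      using B1[OF \<open>x \<in> I\<close>] B2[OF \<open>y \<in> I\<close>] K(2) by (intro add_mono mult_right_mono mult_left_mono) auto
    finally show "norm (P (\<sigma>f s) (g y) + P (f x) (\<sigma>g s)) \<le> (norm (\<sigma>f s) * B2 + B1 * norm (\<sigma>g s)) * K"
      by (simp add: algebra_simps)
  next
    show "(\<lambda>s. P (\<sigma>f s) (g s) + P (left_value \<sigma>f f s) (\<sigma>g s)) \<in> borel_measurable borel"
      by (intro borel_measurable_add Pm) measurable
    fix s x y assume "s \<in> I" "x \<longlonglongrightarrow> s" "y \<longlonglongrightarrow> s" "\<And>n. x n < s" "\<And>n. s \<le> y n"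
    then show "(\<lambda>n. P (\<sigma>f s) (g (y n)) + P (f (x n)) (\<sigma>g s)) \<longlonglongrightarrow> P (\<sigma>f s) (g s) + P (left_value \<sigma>f f s) (\<sigma>g s)"
      using has_density_seq_right[OF g] has_density_seq_left[OF f]
      by (intro tendsto_intros P.tendsto) auto
  qed
qed

text \<open>The increment of \<open>h\<close> along \<open>f\<close> is a divided difference times
  the increment of \<open>f\<close>. As the interval shrinks, the nodes become the left limit of
  \<open>f\<close> and \<open>f s\<close>, so the factor is \<open>h'\<close> at continuity points
  and a difference quotient at jumps.\<close>

lemma has_density_chain:
  fixes f :: "real \<Rightarrow> real"
  assumes f: "has_density \<sigma> f" and [measurable]: "f \<in> borel_measurable borel"
    and D: "\<And>x. (h has_real_derivative h' x) (at x)" and cont: "continuous_on UNIV h'" and B: "\<And>x. \<bar>h' x\<bar> \<le> B"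
  shows "has_density (\<lambda>s. (if left_value \<sigma> f s = f s then h' (f s)
      else (h (f s) - h (left_value \<sigma> f s)) / (f s - left_value \<sigma> f s)) * \<sigma> s) (\<lambda>s. h (f s))"
proof -
  note [measurable] = has_densityD(2)[OF f]
  define H where "H x y = (if x = y then h' x else (h y - h x) / (y - x))" for x y
  have H: "\<bar>H x y\<bar> \<le> B" for x y
    using divided_difference_bound[of h h' x y, OF D] B unfolding H_def by metis
  have [measurable]: "h' \<in> borel_measurable borel" using cont by (rule borel_measurable_continuous_onI)
  have [measurable]: "h \<in> borel_measurable borel"
    by (intro borel_measurable_continuous_onI continuous_at_imp_continuous_on) (use D in \<open>auto intro: DERIV_isCont\<close>)
  have "has_density (\<lambda>s. H (left_value \<sigma> f s) (f s) * \<sigma> s) (\<lambda>s. h (f s))"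
  proof (rule has_density_refine[where R="\<lambda>x y s. H (f x) (f y) * \<sigma> s" and w="\<lambda>s. B * norm (\<sigma> s)"])
    fix x y :: real assume xy: "0 < x" "x \<le> y" "y < L"
    have "h (f y) - h (f x) = H (f x) (f y) * (f y - f x)" by (simp add: H_def)
    then show "h (f y) - h (f x) = (LINT s:{x<..y}|M. H (f x) (f y) * \<sigma> s)"
      unfolding has_densityD(3)[OF f xy] by simp
  next
    show "integrable M (\<lambda>s. B * norm (\<sigma> s))" using has_densityD(1)[OF f] by auto
    fix x y s assume "x \<in> I" "y \<in> I"
    show "integrable M (\<lambda>s. H (f x) (f y) * \<sigma> s)" using has_densityD(1)[OF f] by auto
    show "norm (H (f x) (f y) * \<sigma> s) \<le> B * norm (\<sigma> s)" using H by (auto simp: abs_mult intro: mult_right_mono)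
  next
    show "(\<lambda>s. H (left_value \<sigma> f s) (f s) * \<sigma> s) \<in> borel_measurable borel"
      unfolding H_def by measurable
    fix s x y assume *: "s \<in> I" "x \<longlonglongrightarrow> s" "y \<longlonglongrightarrow> s" "\<And>n. x n < s" "\<And>n. s \<le> y n"
    have "(\<lambda>n. H (f (x n)) (f (y n))) \<longlonglongrightarrow> H (left_value \<sigma> f s) (f s)"
      unfolding H_def
      by (rule divided_difference_tendsto[OF D cont has_density_seq_left[OF f] has_density_seq_right[OF f]])
        (use * in auto)
    then show "(\<lambda>n. H (f (x n)) (f (y n)) * \<sigma> s) \<longlonglongrightarrow> H (left_value \<sigma> f s) (f s) * \<sigma> s"
      by (intro tendsto_intros)
  qed
  moreover have "H (left_value \<sigma> f s) (f s) = (if left_value \<sigma> f s = f s then h' (f s)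
      else (h (f s) - h (left_value \<sigma> f s)) / (f s - left_value \<sigma> f s))" for s by (auto simp: H_def)
  ultimately show ?thesis by simp
qed

end

section \<open>Absolute continuity from dominated increments\<close>

lemma finite_absolutely_continuous_density:
  fixes \<mu> :: "real measure"
  assumes "finite_measure \<mu>" and s: "sets \<mu> = sets borel" and ac: "absolutely_continuous lborel \<mu>"
  obtains k where "integrable lborel k" "\<And>x. 0 \<le> k x" "\<And>A. A \<in> sets borel \<Longrightarrow> measure \<mu> A = (LINT x:A|lborel. k x)"
proof -
  interpret \<mu>: finite_measure \<mu> by fact
  obtain h where h': "h \<in> borel_measurable lborel" and h: "density lborel h = \<mu>"
    using sigma_finite_measure.Radon_Nikodym[OF sigma_finite_lborel ac] s by auto
  have hm [measurable]: "h \<in> borel_measurable borel" using h' by simp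
  define k where "k x = enn2real (h x)" for x
  have [measurable]: "k \<in> borel_measurable borel" unfolding k_def by measurable
  have "(\<integral>\<^sup>+x. h x \<partial>lborel) = emeasure \<mu> UNIV"
    unfolding h[symmetric] by (subst emeasure_density) auto
  then have fin: "(\<integral>\<^sup>+x. h x \<partial>lborel) \<noteq> \<infinity>" by simp
  then have "AE x in lborel. h x \<noteq> \<infinity>" by (intro nn_integral_PInf_AE) auto
  then have hk: "AE x in lborel. h x = ennreal (k x)" by eventually_elim (auto simp: less_top k_def)
  have k0: "0 \<le> k x" for x by (simp add: k_def)
  have "(\<integral>\<^sup>+x. ennreal (k x) \<partial>lborel) = (\<integral>\<^sup>+x. h x \<partial>lborel)"
    by (rule nn_integral_cong_AE) (use hk in \<open>auto elim: eventually_mono\<close>)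
  then have int: "integrable lborel k"
    using fin k0 by (intro integrableI_nonneg) (auto simp: less_top)
  have "measure \<mu> A = (LINT x:A|lborel. k x)" if A: "A \<in> sets borel" for A
  proof -
    have "emeasure \<mu> A = (\<integral>\<^sup>+x. ennreal (indicator A x *\<^sub>R k x) \<partial>lborel)"
      unfolding h[symmetric]
      by (subst emeasure_density) (use A hk in \<open>auto intro!: nn_integral_cong_AE elim!: eventually_mono simp: indicator_def\<close>)
    also have "\<dots> = ennreal (LINT x:A|lborel. k x)"
      unfolding set_lebesgue_integral_def
      by (rule nn_integral_eq_integral) (use A k0 integrable_mult_indicator[OF _ int, of A] in auto)
    finally show ?thesis using k0 by (simp add: measure_def set_lebesgue_integral_def Bochner_Integration.integral_nonneg)
  qed
  then show ?thesis using that int k0 by blast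
qed

text \<open>With \<open>W\<close> a primitive of \<open>w\<close>, both \<open>W + f\<close> and
  \<open>W - f\<close> are nondecreasing and right-continuous. Their Stieltjes measures add up to
  twice the measure with density \<open>w\<close>, so both have Lebesgue densities, and half the
  difference of these is the density of \<open>f\<close>.\<close>

lemma dominated_increments_real:
  fixes f :: "real \<Rightarrow> real"
  assumes w: "integrable lborel w" "\<And>x. 0 \<le> w x"
    and f: "\<And>x y. x \<le> y \<Longrightarrow> \<bar>f y - f x\<bar> \<le> (LINT s:{x<..y}|lborel. w s)"
  obtains g where "integrable lborel g" "\<And>x y. x \<le> y \<Longrightarrow> f y - f x = (LINT s:{x<..y}|lborel. g s)"
proof -
  note [measurable] = borel_measurable_integrable[OF w(1), simplified]
  define \<kappa> where "\<kappa> = density lborel (\<lambda>x. ennreal (w x))"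
  have s\<kappa> [simp]: "sets \<kappa> = sets borel" by (simp add: \<kappa>_def)
  have em\<kappa>: "emeasure \<kappa> A = ennreal (LINT x:A|lborel. w x)" if A: "A \<in> sets borel" for A
  proof -
    have "emeasure \<kappa> A = (\<integral>\<^sup>+x. ennreal (indicator A x *\<^sub>R w x) \<partial>lborel)"
      unfolding \<kappa>_def using A by (subst emeasure_density) (auto intro!: nn_integral_cong simp: indicator_def)
    also have "\<dots> = ennreal (LINT x:A|lborel. w x)"
      unfolding set_lebesgue_integral_def
      by (rule nn_integral_eq_integral) (use A w integrable_mult_indicator[OF _ w(1), of A] in auto)
    finally show ?thesis .
  qed
  have sp\<kappa>: "space \<kappa> = UNIV" by (simp add: \<kappa>_def)
  interpret \<kappa>: finite_measure \<kappa>
    by (rule finite_measureI) (simp add: sp\<kappa> em\<kappa>)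
  define W where "W x = measure \<kappa> {..x}" for x
  have Wd: "W y - W x = (LINT s:{x<..y}|lborel. w s)" if "x \<le> y" for x y
  proof -
    have "measure \<kappa> ({..x} \<union> {x<..y}) = W x + measure \<kappa> {x<..y}"
      unfolding W_def by (rule \<kappa>.finite_measure_Union) auto
    moreover have "{..x} \<union> {x<..y} = {..y}" using that by auto
    moreover have "0 \<le> (LINT s:{x<..y}|lborel. w s)"
      using w(2) by (simp add: set_lebesgue_integral_def Bochner_Integration.integral_nonneg)
    ultimately show ?thesis using em\<kappa>[of "{x<..y}"] by (simp add: W_def measure_def)
  qed
  have Wcont: "(W \<longlongrightarrow> W x) (at_right x)" for x
  proof (rule tendsto_at_right_sequentially[of x "x + 1"])
    fix S assume S: "\<And>n. x < S n" "decseq S" "S \<longlonglongrightarrow> x"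
    have "(\<Inter>n. {..S n}) = {..x}"
    proof safe
      fix z assume z: "z \<in> (\<Inter>n. {..S n})"
      then have "z \<le> S n" for n by auto
      then show "z \<le> x" using S(3) by (intro LIMSEQ_le_const) auto
    qed (use S(1) in \<open>auto intro: order_trans less_imp_le\<close>)
    moreover have "(\<lambda>n. measure \<kappa> {..S n}) \<longlonglongrightarrow> measure \<kappa> (\<Inter>n. {..S n})"
      by (rule \<kappa>.finite_Lim_measure_decseq) (use S(2) in \<open>auto simp: decseq_def\<close>)
    ultimately show "(\<lambda>n. W (S n)) \<longlonglongrightarrow> W x" by (simp add: W_def)
  qed simp
  have fcont: "(f \<longlongrightarrow> f x) (at_right x)" for x
  proof -
    have "((\<lambda>y. W y - W x) \<longlongrightarrow> 0) (at_right x)" using Wcont[of x] by (simp add: LIM_zero)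
    moreover have "\<forall>\<^sub>F y in at_right x. norm (f y - f x) \<le> W y - W x"
      using f[of x] Wd[of x] by (auto simp: eventually_at_filter less_imp_le)
    ultimately have "((\<lambda>y. f y - f x) \<longlongrightarrow> 0) (at_right x)" by (rule Lim_null_comparison[rotated])
    then show ?thesis by (rule LIM_zero_cancel)
  qed
  define \<mu>1 where "\<mu>1 = interval_measure (\<lambda>x. W x + f x)"
  define \<mu>2 where "\<mu>2 = interval_measure (\<lambda>x. W x - f x)"
  have \<mu>1: "emeasure \<mu>1 {x<..y} = ennreal ((W y + f y) - (W x + f x))" if "x \<le> y" for x y
    unfolding \<mu>1_def
  proof (rule emeasure_interval_measure_Ioc[OF that])
    show "W a + f a \<le> W b + f b" if "a \<le> b" for a b using f[OF that] Wd[OF that] by auto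
    show "continuous (at_right a) (\<lambda>x. W x + f x)" for a
      using Wcont fcont by (auto simp: continuous_within intro!: tendsto_intros)
  qed
  have \<mu>2: "emeasure \<mu>2 {x<..y} = ennreal ((W y - f y) - (W x - f x))" if "x \<le> y" for x y
    unfolding \<mu>2_def
  proof (rule emeasure_interval_measure_Ioc[OF that])
    show "W a - f a \<le> W b - f b" if "a \<le> b" for a b using f[OF that] Wd[OF that] by auto
    show "continuous (at_right a) (\<lambda>x. W x - f x)" for a
      using Wcont fcont by (auto simp: continuous_within intro!: tendsto_intros)
  qed
  obtain C where C: "sets C = sets \<mu>1" "\<And>X. X \<in> sets \<mu>1 \<Longrightarrow> emeasure C X = emeasure \<mu>1 X + emeasure \<mu>2 X"
    using measure_sum_exists[of \<mu>2 \<mu>1] by (auto simp: \<mu>1_def \<mu>2_def)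
  have s1 [simp]: "sets \<mu>1 = sets borel" "sets \<mu>2 = sets borel" by (auto simp: \<mu>1_def \<mu>2_def)
  obtain C' where C': "sets C' = sets \<kappa>" "\<And>X. X \<in> sets \<kappa> \<Longrightarrow> emeasure C' X = emeasure \<kappa> X + emeasure \<kappa> X"
    using measure_sum_exists[of \<kappa> \<kappa>] by auto
  \<comment> \<open>It suffices to compare on half-open intervals, where the contributions of
    \<open>f\<close> to the two Stieltjes measures cancel.\<close>
  have "C = C'"
  proof (rule measure_eqI_generator_eq[where E="range (\<lambda>(a, b). {a<..b})" and \<Omega>=UNIV and A="\<lambda>n. {- real n<..real n}"])
    show "Int_stable (range (\<lambda>(a, b). {a<..b::real}))"
    proof (rule Int_stableI)
      fix A B :: "real set" assume "A \<in> range (\<lambda>(a, b). {a<..b})" "B \<in> range (\<lambda>(a, b). {a<..b})"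
      then obtain a b c d where "A = {a<..b}" "B = {c<..d}" by auto
      then have "A \<inter> B = {max a c<..min b d}" by auto
      then show "A \<inter> B \<in> range (\<lambda>(a, b). {a<..b})" by auto
    qed
    show "sets C = sigma_sets UNIV (range (\<lambda>(a, b). {a<..b}))" "sets C' = sigma_sets UNIV (range (\<lambda>(a, b). {a<..b}))"
      using C(1) C'(1) by (simp_all add: borel_sigma_sets_Ioc)
    show "(\<Union>i::nat. {- real i<..real i}) = UNIV"
    proof (intro set_eqI iffI UNIV_I)
      fix x :: real
      obtain n :: nat where "\<bar>x\<bar> < real n" using reals_Archimedean2 by blast
      then show "x \<in> (\<Union>i::nat. {- real i<..real i})" by (intro UN_I[of n]) auto
    qed
    show "emeasure C {- real i<..real i} \<noteq> \<infinity>" for i :: nat using C(2) \<mu>1 \<mu>2 by simp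
    fix X assume "X \<in> range (\<lambda>(a, b). {a<..b::real})"
    then obtain a b where X: "X = {a<..b}" by auto
    show "emeasure C X = emeasure C' X"
    proof (cases "a \<le> b")
      case True
      have "emeasure C X = ennreal ((W b + f b) - (W a + f a)) + ennreal ((W b - f b) - (W a - f a))"
        using X C(2) \<mu>1[OF True] \<mu>2[OF True] by simp
      also have "\<dots> = ennreal ((W b - W a) + (W b - W a))"
        using f[OF True] Wd[OF True] by (subst ennreal_plus[symmetric]) (auto simp: algebra_simps)
      also have "\<dots> = ennreal (W b - W a) + ennreal (W b - W a)"
        using f[OF True] Wd[OF True] by (intro ennreal_plus) auto
      also have "\<dots> = emeasure C' X" using X C'(2) em\<kappa>[of "{a<..b}"] Wd[OF True] by simp
      finally show ?thesis .
    next
      case False then show ?thesis using X by simp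
    qed
  qed auto
  then have sum: "emeasure \<mu>1 X + emeasure \<mu>2 X = emeasure \<kappa> X + emeasure \<kappa> X" if "X \<in> sets borel" for X
    using C(2)[of X] C'(2)[of X] that by simp
  have *: "finite_measure \<mu>" "absolutely_continuous lborel \<mu>"
    if s: "sets \<mu> = sets borel" and le: "\<And>X. X \<in> sets borel \<Longrightarrow> emeasure \<mu> X \<le> emeasure \<kappa> X + emeasure \<kappa> X" for \<mu>
  proof -
    show "finite_measure \<mu>"
    proof (rule finite_measureI)
      have "emeasure \<mu> UNIV \<le> emeasure \<kappa> UNIV + emeasure \<kappa> UNIV" by (rule le) simp
      also have "\<dots> < \<infinity>" by (simp add: less_top[symmetric])
      finally show "emeasure \<mu> (space \<mu>) \<noteq> \<infinity>" using sets_eq_imp_space_eq[OF s] by simp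
    qed
    show "absolutely_continuous lborel \<mu>"
      unfolding absolutely_continuous_def
    proof
      fix A :: "real set" assume A: "A \<in> null_sets lborel"
      then have "A \<in> null_sets \<kappa>"
        unfolding \<kappa>_def by (subst null_sets_density_iff) (use AE_not_in[OF A] in \<open>auto elim!: eventually_mono\<close>)
      then have "emeasure \<kappa> A = 0" by (rule null_setsD1)
      moreover have "A \<in> sets borel" using A by (simp add: null_sets_def)
      ultimately show "A \<in> null_sets \<mu>" using le[of A] s by (simp add: null_sets_def)
    qed
  qed
  have 1: "finite_measure \<mu>1" "absolutely_continuous lborel \<mu>1" "finite_measure \<mu>2" "absolutely_continuous lborel \<mu>2"
    by (rule *; simp add: sum[symmetric])+
  obtain k1 where k1: "integrable lborel k1" "\<And>A. A \<in> sets borel \<Longrightarrow> measure \<mu>1 A = (LINT x:A|lborel. k1 x)"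
    by (rule finite_absolutely_continuous_density[OF 1(1) s1(1) 1(2)]) blast
  obtain k2 where k2: "integrable lborel k2" "\<And>A. A \<in> sets borel \<Longrightarrow> measure \<mu>2 A = (LINT x:A|lborel. k2 x)"
    by (rule finite_absolutely_continuous_density[OF 1(3) s1(2) 1(4)]) blast
  show ?thesis
  proof (rule that[of "\<lambda>x. (k1 x - k2 x) / 2"])
    show "integrable lborel (\<lambda>x. (k1 x - k2 x) / 2)" using k1(1) k2(1) by auto
    fix x y :: real assume xy: "x \<le> y"
    have "measure \<mu>1 {x<..y} = (W y + f y) - (W x + f x)" "measure \<mu>2 {x<..y} = (W y - f y) - (W x - f x)"
      using \<mu>1[OF xy] \<mu>2[OF xy] f[OF xy] Wd[OF xy] by (auto simp: measure_def)
    then have "f y - f x = ((LINT s:{x<..y}|lborel. k1 s) - (LINT s:{x<..y}|lborel. k2 s)) / 2"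
      by (simp flip: k1(2) k2(2))
    also have "(LINT s:{x<..y}|lborel. k1 s) - (LINT s:{x<..y}|lborel. k2 s) = (LINT s:{x<..y}|lborel. k1 s - k2 s)"
      by (rule set_integral_diff(2)[symmetric]) (use k1 k2 in \<open>auto intro!: integrable_imp_set_integrable\<close>)
    finally show "f y - f x = (LINT s:{x<..y}|lborel. (k1 s - k2 s) / 2)" by simp
  qed
qed

lemma dominated_increments:
  fixes f :: "real \<Rightarrow> 'b::euclidean_space"
  assumes w: "integrable lborel w" "\<And>x. 0 \<le> w x" and "0 \<le> L"
    and f: "\<And>x y. 0 \<le> x \<Longrightarrow> x \<le> y \<Longrightarrow> y \<le> L \<Longrightarrow> norm (f y - f x) \<le> (LINT s:{x<..y}|lborel. w s)"
  obtains g where "integrable lborel g"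
    "\<And>x y. 0 \<le> x \<Longrightarrow> x \<le> y \<Longrightarrow> y \<le> L \<Longrightarrow> f y - f x = (LINT s:{x<..y}|lborel. g s)"
proof -
  \<comment> \<open>Clamping to \<open>{0..L}\<close> extends \<open>f\<close> by constants, which
    keeps the increments dominated on the whole line.\<close>
  define cl where "cl x = max 0 (min L x)" for x :: real
  have cl: "0 \<le> cl x" "cl x \<le> L" "x \<le> y \<Longrightarrow> cl x \<le> cl y" for x y using \<open>0 \<le> L\<close> by (auto simp: cl_def)
  have comp: "\<exists>g. integrable lborel g \<and> (\<forall>x y. x \<le> y \<longrightarrow> f (cl y) \<bullet> i - f (cl x) \<bullet> i = (LINT s:{x<..y}|lborel. g s))"
    if i: "i \<in> Basis" for i
  proof -
    have "\<bar>f (cl y) \<bullet> i - f (cl x) \<bullet> i\<bar> \<le> (LINT s:{x<..y}|lborel. w s)" if "x \<le> y" for x y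
    proof -
      have "\<bar>f (cl y) \<bullet> i - f (cl x) \<bullet> i\<bar> \<le> norm (f (cl y) - f (cl x))"
        using Basis_le_norm[OF i, of "f (cl y) - f (cl x)"] by (simp add: inner_diff_left)
      also have "\<dots> \<le> (LINT s:{cl x<..cl y}|lborel. w s)" by (rule f) (use cl that in auto)
      also have "\<dots> \<le> (LINT s:{x<..y}|lborel. w s)"
        unfolding set_lebesgue_integral_def
      proof (rule integral_mono)
        show "indicator {cl x<..cl y} s *\<^sub>R w s \<le> indicator {x<..y} s *\<^sub>R w s" for s
          using w(2)[of s] by (auto simp: indicator_def cl_def)
      qed (use integrable_mult_indicator[OF _ w(1)] in auto)
      finally show ?thesis .
    qed
    from dominated_increments_real[OF w this] show ?thesis by metis
  qed
  then obtain G where G: "\<And>i. i \<in> Basis \<Longrightarrow> integrable lborel (G i)"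
      "\<And>i x y. i \<in> Basis \<Longrightarrow> x \<le> y \<Longrightarrow> f (cl y) \<bullet> i - f (cl x) \<bullet> i = (LINT s:{x<..y}|lborel. G i s)"
    by metis
  define g where "g s = (\<Sum>i\<in>Basis. G i s *\<^sub>R i)" for s
  have gint: "integrable lborel g" unfolding g_def using G(1) by auto
  show ?thesis
  proof (rule that[OF gint])
    fix x y assume xy: "0 \<le> x" "x \<le> y" "y \<le> L"
    then have c: "cl x = x" "cl y = y" by (auto simp: cl_def)
    show "f y - f x = (LINT s:{x<..y}|lborel. g s)"
    proof (rule euclidean_eqI)
      fix i :: 'b assume i: "i \<in> Basis"
      have "(LINT s:{x<..y}|lborel. g s) \<bullet> i = (LINT s:{x<..y}|lborel. g s \<bullet> i)"
        unfolding set_lebesgue_integral_def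
        by (subst integral_inner_left[symmetric]) (auto intro!: integrable_mult_indicator gint)
      also have "(\<lambda>s. g s \<bullet> i) = G i"
        using i by (auto simp: g_def inner_sum_left inner_Basis if_distrib cong: if_cong)
      finally show "(f y - f x) \<bullet> i = (LINT s:{x<..y}|lborel. g s) \<bullet> i"
        using G(2)[OF i xy(2)] c by (simp add: inner_diff_left)
    qed
  qed
qed

section \<open>Length of curves\<close>

lemma curve_length_le:
  assumes "\<And>n s. (\<And>i. i < n \<Longrightarrow> s i \<le> s (Suc i)) \<Longrightarrow> (\<And>i. i \<le> n \<Longrightarrow> s i \<in> {a..b}) \<Longrightarrow>
    (\<Sum>i<n. ennreal (dist (g (s i)) (g (s (Suc i))))) \<le> C"
  shows "curve_length a b g \<le> C"
  unfolding curve_length_def by (rule SUP_least) (auto simp del: sum_ennreal intro!: assms)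

lemma curve_length_ge:
  assumes "\<And>i. i < n \<Longrightarrow> s i \<le> s (Suc i)" "\<And>i. i \<le> n \<Longrightarrow> s i \<in> {a..b}"
  shows "(\<Sum>i<n. ennreal (dist (g (s i)) (g (s (Suc i))))) \<le> curve_length a b g"
  unfolding curve_length_def by (rule SUP_upper2[of "(n, s)"]) (use assms in auto)

lemma dist_le_curve_length:
  "a \<le> x \<Longrightarrow> x \<le> y \<Longrightarrow> y \<le> b \<Longrightarrow> ennreal (dist (g x) (g y)) \<le> curve_length a b g"
  using curve_length_ge[of 1 "\<lambda>i. if i = 0 then x else y" a b g] by auto

text \<open>A partition of the first part is prolonged by the two points \<open>s\<close> and
  \<open>r\<close>. This fragment of superadditivity suffices to make an arc length parametrization
  1-Lipschitz.\<close>

lemma curve_length_append: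
  assumes "a \<le> s" "s \<le> r"
  shows "curve_length a s g + ennreal (dist (g s) (g r)) \<le> curve_length a r g"
proof -
  have "curve_length a s g + ennreal (dist (g s) (g r)) =
     (SUP (n, t) \<in> {(n::nat, t::nat \<Rightarrow> real). (\<forall>i<n. t i \<le> t (Suc i)) \<and> t ` {..n} \<subseteq> {a..s}}.
        (\<Sum>i<n. ennreal (dist (g (t i)) (g (t (Suc i))))) + ennreal (dist (g s) (g r)))"
    unfolding curve_length_def split_def
    by (rule ennreal_SUP_add_left[symmetric]) (use assms in \<open>auto intro!: exI[of _ "\<lambda>_. a"]\<close>)
  also have "\<dots> \<le> curve_length a r g"
  proof (rule SUP_least, clarify)
    fix n :: nat and t :: "nat \<Rightarrow> real" assume t: "\<forall>i<n. t i \<le> t (Suc i)" "t ` {..n} \<subseteq> {a..s}"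
    define t' where "t' i = (if i \<le> n then t i else if i = Suc n then s else r)" for i
    have tn: "a \<le> t i" "t i \<le> s" if "i \<le> n" for i using t(2) that by auto
    have "(\<Sum>i<n. ennreal (dist (g (t i)) (g (t (Suc i))))) + ennreal (dist (g s) (g r))
       \<le> (\<Sum>i<n. ennreal (dist (g (t' i)) (g (t' (Suc i))))) + ennreal (dist (g (t' n)) (g (t' (Suc n))))
          + ennreal (dist (g (t' (Suc n))) (g (t' (Suc (Suc n)))))"
      by (intro add_mono order_trans[OF _ add_increasing2]) (auto simp: t'_def intro!: sum_mono)
    also have "\<dots> = (\<Sum>i<Suc (Suc n). ennreal (dist (g (t' i)) (g (t' (Suc i)))))" by simp
    also have "\<dots> \<le> curve_length a r g"
      by (rule curve_length_ge) (use t(1) tn assms in \<open>auto simp: t'_def less_Suc_eq intro: order_trans\<close>)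
    finally show "(\<Sum>i<n. ennreal (dist (g (t i)) (g (t (Suc i))))) + ennreal (dist (g s) (g r)) \<le> curve_length a r g" .
  qed
  finally show ?thesis .
qed

lemma arc_length_curve_lipschitz:
  assumes c: "arc_length_curve F c L" and "0 \<le> s" "s \<le> r" "r \<le> L"
  shows "dist (F (c s)) (F (c r)) \<le> r - s"
proof -
  have "curve_length 0 s (F \<circ> c) = ennreal s" "curve_length 0 r (F \<circ> c) = ennreal r"
    using assms by (auto simp: arc_length_curve_def)
  then have "ennreal s + ennreal (dist (F (c s)) (F (c r))) \<le> ennreal r"
    using curve_length_append[of 0 s r "F \<circ> c"] assms by simp
  then have "ennreal (s + dist (F (c s)) (F (c r))) \<le> ennreal r"
    using assms by (subst ennreal_plus) auto
  then show ?thesis using assms by (subst (asm) ennreal_le_iff) auto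
qed

lemma has_vector_derivative_norm_le:
  assumes "(f has_vector_derivative d) (at x)" "open S" "x \<in> S"
    and "\<And>y. y \<in> S \<Longrightarrow> norm (f y - f x) \<le> K * \<bar>y - x\<bar>"
  shows "norm d \<le> K"
proof (rule field_le_epsilon)
  fix e :: real assume "0 < e"
  then obtain r where r: "r > 0" "\<And>y. \<bar>y - x\<bar> < r \<Longrightarrow> norm (f y - f x - (y - x) *\<^sub>R d) \<le> e * \<bar>y - x\<bar>"
    using assms(1) unfolding has_vector_derivative_def has_derivative_within_alt by (auto simp: real_norm_def)
  obtain r' where r': "r' > 0" "\<And>y. \<bar>y - x\<bar> < r' \<Longrightarrow> y \<in> S"
    using assms(2,3) by (metis dist_real_def open_dist)
  define h where "h = min r r' / 2"
  have h: "0 < h" "h < r" "h < r'" using r r' by (auto simp: h_def)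
  have "h * norm d \<le> norm (f (x + h) - f x - h *\<^sub>R d) + norm (f (x + h) - f x)"
    using norm_triangle_ineq4[of "f (x + h) - f x" "f (x + h) - f x - h *\<^sub>R d"] h(1) by simp
  also have "\<dots> \<le> e * h + K * h"
    using r(2)[of "x + h"] assms(4)[OF r'(2)[of "x + h"]] h by (intro add_mono) auto
  finally have "h * norm d \<le> h * (K + e)" by (simp add: algebra_simps)
  then show "norm d \<le> K + e" using h(1) by simp
qed

lemma set_integral_Ioc_diff:
  fixes f :: "real \<Rightarrow> 'b::euclidean_space"
  assumes "integrable lborel f" "a \<le> x" "x \<le> y"
  shows "(LINT s:{a<..y}|lborel. f s) = (LINT s:{a<..x}|lborel. f s) + (LINT s:{x<..y}|lborel. f s)"
proof -
  have "(LINT s:{a<..x} \<union> {x<..y}|lborel. f s) = (LINT s:{a<..x}|lborel. f s) + (LINT s:{x<..y}|lborel. f s)"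
    by (rule set_integral_Un) (auto intro!: integrable_imp_set_integrable assms)
  moreover have "{a<..x} \<union> {x<..y} = {a<..y}" using assms by auto
  ultimately show ?thesis by simp
qed

text \<open>The speed is at most one and its integral is at least the length \<open>L\<close>, so it is one a.e.\<close>

lemma arc_length_curve_unit_speed:
  fixes F :: "'m::topological_space \<Rightarrow> real^'n"
  assumes c: "arc_length_curve F c L"
  shows "AE s in lborel. s \<in> {0<..<L} \<longrightarrow>
    (F \<circ> c has_vector_derivative tantrix F c s) (at s) \<and> norm (tantrix F c s) = 1"
proof -
  have L: "0 < L" using c by (simp add: arc_length_curve_def)
  define w :: "real \<Rightarrow> real" where "w s = indicator {0<..L} s" for s
  have w: "integrable lborel w" "\<And>s. 0 \<le> w s"
    using L by (auto simp: w_def[abs_def] integrable_indicator_iff)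
  have "norm ((F \<circ> c) y - (F \<circ> c) x) \<le> (LINT s:{x<..y}|lborel. w s)" if "0 \<le> x" "x \<le> y" "y \<le> L" for x y
  proof -
    have "{x<..y} \<inter> {0<..L} = {x<..y}" using that by auto
    then have "(LINT s:{x<..y}|lborel. w s) = y - x"
      using that by (simp add: set_lebesgue_integral_def w_def indicator_inter_arith[symmetric])
    then show ?thesis using arc_length_curve_lipschitz[OF c that] by (simp add: dist_norm norm_minus_commute)
  qed
  from dominated_increments[OF w less_imp_le[OF L] this] obtain g where g: "integrable lborel g"
    "\<And>x y. 0 \<le> x \<Longrightarrow> x \<le> y \<Longrightarrow> y \<le> L \<Longrightarrow> (F \<circ> c) y - (F \<circ> c) x = (LINT s:{x<..y}|lborel. g s)"
    by metis
  have D: "AE s in lborel. s \<in> {0<..<L} \<longrightarrow> (F \<circ> c has_vector_derivative g s) (at s)"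
    by (rule AE_has_vector_derivative_lborel[OF g(1)]) (use g(2) in auto)
  then have g1: "AE s in lborel. s \<in> {0<..<L} \<longrightarrow> norm (g s) \<le> 1"
  proof eventually_elim
    case (elim s)
    show ?case
    proof
      assume s: "s \<in> {0<..<L}"
      show "norm (g s) \<le> 1"
      proof (rule has_vector_derivative_norm_le[OF elim[rule_format, OF s] _ s])
        fix y assume "y \<in> {0<..<L}"
        then show "norm ((F \<circ> c) y - (F \<circ> c) s) \<le> 1 * \<bar>y - s\<bar>"
          using arc_length_curve_lipschitz[OF c, of s y] arc_length_curve_lipschitz[OF c, of y s] s
          by (cases "s \<le> y") (auto simp: dist_norm norm_minus_commute)
      qed simp
    qed
  qed
  note gn = integrable_norm[OF g(1)]
  have "curve_length 0 L (F \<circ> c) \<le> ennreal (LINT s:{0<..L}|lborel. norm (g s))"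
  proof (rule curve_length_le)
    fix n and p :: "nat \<Rightarrow> real" assume p: "\<And>i. i < n \<Longrightarrow> p i \<le> p (Suc i)" "\<And>i. i \<le> n \<Longrightarrow> p i \<in> {0..L}"
    define G where "G x = (LINT s:{0<..x}|lborel. norm (g s))" for x
    have G: "G y - G x = (LINT s:{x<..y}|lborel. norm (g s))" if "0 \<le> x" "x \<le> y" for x y
      using set_integral_Ioc_diff[OF gn that] by (simp add: G_def)
    have G0: "0 \<le> (LINT s:{x<..y}|lborel. norm (g s))" for x y
      by (simp add: set_lebesgue_integral_def Bochner_Integration.integral_nonneg)
    have "(\<Sum>i<n. dist ((F \<circ> c) (p i)) ((F \<circ> c) (p (Suc i)))) \<le> (\<Sum>i<n. G (p (Suc i)) - G (p i))"
    proof (rule sum_mono)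
      fix i assume "i \<in> {..<n}"
      then have i: "0 \<le> p i" "p i \<le> p (Suc i)" "p (Suc i) \<le> L" using p(1)[of i] p(2)[of i] p(2)[of "Suc i"] by auto
      have "dist ((F \<circ> c) (p i)) ((F \<circ> c) (p (Suc i))) = norm (LINT s:{p i<..p (Suc i)}|lborel. g s)"
        using g(2)[OF i] by (simp add: dist_commute[of "F (c (p i))"]) (simp add: dist_norm)
      also have "\<dots> \<le> (LINT s:{p i<..p (Suc i)}|lborel. norm (g s))"
        by (rule set_integral_norm_bound) (auto intro!: integrable_imp_set_integrable g)
      also have "\<dots> = G (p (Suc i)) - G (p i)" using G[OF i(1,2)] by simp
      finally show "dist ((F \<circ> c) (p i)) ((F \<circ> c) (p (Suc i))) \<le> G (p (Suc i)) - G (p i)" .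
    qed
    also have "\<dots> = G (p n) - G (p 0)" by (rule sum_lessThan_telescope)
    also have "\<dots> \<le> G L"
      using G[of "p n" L] p(2)[of n] G0[of "p n" L] G0[of 0 "p 0"] unfolding G_def by auto
    finally have "(\<Sum>i<n. dist ((F \<circ> c) (p i)) ((F \<circ> c) (p (Suc i)))) \<le> G L" .
    then show "(\<Sum>i<n. ennreal (dist ((F \<circ> c) (p i)) ((F \<circ> c) (p (Suc i))))) \<le> ennreal (LINT s:{0<..L}|lborel. norm (g s))"
      by (simp add: G_def ennreal_leI)
  qed
  moreover have "curve_length 0 L (F \<circ> c) = ennreal L" using c L by (simp add: arc_length_curve_def)
  moreover have "0 \<le> (LINT s:{0<..L}|lborel. norm (g s))"
    by (simp add: set_lebesgue_integral_def Bochner_Integration.integral_nonneg)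
  ultimately have "L \<le> (LINT s:{0<..L}|lborel. norm (g s))" by (simp add: ennreal_le_iff)
  also have "\<dots> = (LINT s|lborel. indicator {0<..<L} s *\<^sub>R norm (g s))"
    unfolding set_lebesgue_integral_def
    by (rule integral_cong_AE) (use AE_lborel_singleton[of L] borel_measurable_integrable[OF g(1)] in
      \<open>auto elim!: eventually_mono simp: indicator_def\<close>)
  finally have le: "L \<le> (LINT s|lborel. indicator {0<..<L} s *\<^sub>R norm (g s))" .
  define d where "d s = indicator {0<..<L} s *\<^sub>R (1 - norm (g s))" for s
  have dint: "integrable lborel d"
  proof -
    have "integrable lborel (\<lambda>s. indicator {0<..<L} s - indicator {0<..<L} s *\<^sub>R norm (g s))"
      using integrable_mult_indicator[OF _ gn, of "{0<..<L}"] L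
      by (intro Bochner_Integration.integrable_diff) (auto simp: integrable_indicator_iff)
    then show ?thesis by (simp add: d_def[abs_def] algebra_simps)
  qed
  have "(LINT s|lborel. d s) = (LINT s|lborel. indicator {0<..<L} s - indicator {0<..<L} s *\<^sub>R norm (g s))"
    by (rule Bochner_Integration.integral_cong) (auto simp: d_def algebra_simps)
  also have "\<dots> = L - (LINT s|lborel. indicator {0<..<L} s *\<^sub>R norm (g s))"
    using integrable_mult_indicator[OF _ gn, of "{0<..<L}"] L
    by (subst Bochner_Integration.integral_diff) (auto simp: integrable_indicator_iff)
  finally have "(LINT s|lborel. d s) \<le> 0" using le by simp
  moreover have d0: "AE s in lborel. 0 \<le> d s" using g1 by eventually_elim (auto simp: d_def indicator_def)
  ultimately have "(LINT s|lborel. d s) = 0" using integral_nonneg_AE[OF d0] by simp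
  then have "AE s in lborel. d s = 0" using integral_nonneg_eq_0_iff_AE[OF dint d0] by simp
  with D show ?thesis
  proof eventually_elim
    case (elim s)
    then show ?case
      by (auto simp: tantrix_def d_def indicator_def vector_derivative_at)
  qed
qed

lemma curve_length_lipschitz_le:
  assumes lip: "\<And>x y. a \<le> x \<Longrightarrow> x \<le> y \<Longrightarrow> y \<le> b \<Longrightarrow> dist (g x) (g y) \<le> K * (y - x)" and "a \<le> b" "0 \<le> K"
  shows "curve_length a b g \<le> ennreal (K * (b - a))"
proof (rule curve_length_le)
  fix n and s :: "nat \<Rightarrow> real" assume s: "\<And>i. i < n \<Longrightarrow> s i \<le> s (Suc i)" "\<And>i. i \<le> n \<Longrightarrow> s i \<in> {a..b}"
  have "(\<Sum>i<n. dist (g (s i)) (g (s (Suc i)))) \<le> (\<Sum>i<n. K * s (Suc i) - K * s i)"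
  proof (rule sum_mono)
    fix i assume "i \<in> {..<n}"
    then show "dist (g (s i)) (g (s (Suc i))) \<le> K * s (Suc i) - K * s i"
      using lip[of "s i" "s (Suc i)"] s(1)[of i] s(2)[of i] s(2)[of "Suc i"] by (simp add: right_diff_distrib)
  qed
  also have "\<dots> = K * s n - K * s 0" by (rule sum_lessThan_telescope)
  also have "\<dots> = K * (s n - s 0)" by (simp add: right_diff_distrib)
  also have "\<dots> \<le> K * (b - a)"
    using s(2)[of n] s(2)[of 0] \<open>0 \<le> K\<close> by (intro mult_left_mono) auto
  finally show "(\<Sum>i<n. ennreal (dist (g (s i)) (g (s (Suc i))))) \<le> ennreal (K * (b - a))"
    by (simp add: ennreal_leI)
qed

section \<open>Angles, chords and distance on the sphere\<close>

lemma arccos_triangle: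
  fixes x y z :: "'a::euclidean_space"
  assumes u: "norm x = 1" "norm y = 1" "norm z = 1"
  shows "arccos (x \<bullet> z) \<le> arccos (x \<bullet> y) + arccos (y \<bullet> z)"
proof -
  have b: "-1 \<le> p \<bullet> q \<and> p \<bullet> q \<le> 1" if "norm p = 1" "norm q = 1" for p q :: 'a
    using Cauchy_Schwarz_ineq2[of p q] that by auto
  define \<alpha> where "\<alpha> = arccos (x \<bullet> y)"
  define \<beta> where "\<beta> = arccos (y \<bullet> z)"
  have \<alpha>: "0 \<le> \<alpha>" "\<alpha> \<le> pi" "cos \<alpha> = x \<bullet> y" using b[OF u(1,2)] by (auto simp: \<alpha>_def arccos_lbound arccos_ubound cos_arccos)
  have \<beta>: "0 \<le> \<beta>" "\<beta> \<le> pi" "cos \<beta> = y \<bullet> z" using b[OF u(2,3)] by (auto simp: \<beta>_def arccos_lbound arccos_ubound cos_arccos)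
  show ?thesis
  proof (cases "\<alpha> + \<beta> \<le> pi")
    case True
    have s: "norm (p - (p \<bullet> y) *\<^sub>R y) = sin t" if "norm p = 1" "p \<bullet> y = cos t" "0 \<le> t" "t \<le> pi" for p t
    proof -
      have "(norm (p - (p \<bullet> y) *\<^sub>R y))\<^sup>2 = 1 - (p \<bullet> y)\<^sup>2"
        unfolding power2_norm_eq_inner using that(1) u(2) by (simp add: inner_diff norm_eq_1 inner_commute power2_eq_square)
      also have "\<dots> = (sin t)\<^sup>2" using that(2) by (simp add: sin_squared_eq)
      finally show ?thesis using sin_ge_zero[OF that(3,4)] by (simp add: power2_eq_iff_nonneg)
    qed
    \<comment> \<open>The parts of \<open>x\<close> and \<open>z\<close> orthogonal to
      \<open>y\<close> have norms sin \<alpha> and sin \<beta>. Cauchy-Schwarz for them and the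
      addition theorem bound \<open>x \<bullet> z\<close> from below by cos (\<alpha> +
      \<beta>).\<close>
    let ?p = "x - (x \<bullet> y) *\<^sub>R y" and ?q = "z - (z \<bullet> y) *\<^sub>R y"
    have "x \<bullet> z = (x \<bullet> y) * (y \<bullet> z) + ?p \<bullet> ?q"
      using u(2) by (simp add: inner_diff inner_commute norm_eq_1)
    moreover have "\<bar>?p \<bullet> ?q\<bar> \<le> norm ?p * norm ?q" by (rule Cauchy_Schwarz_ineq2)
    moreover have "norm ?p = sin \<alpha>" using s[of x \<alpha>] u \<alpha> by simp
    moreover have "norm ?q = sin \<beta>" using s[of z \<beta>] u \<beta> by (simp add: inner_commute)
    ultimately have "cos (\<alpha> + \<beta>) \<le> x \<bullet> z" using \<alpha>(3) \<beta>(3) by (simp add: cos_add)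
    then have "arccos (x \<bullet> z) \<le> arccos (cos (\<alpha> + \<beta>))"
      using b[OF u(1,3)] by (intro arccos_le_arccos) auto
    also have "\<dots> = \<alpha> + \<beta>" using True \<alpha> \<beta> by (intro arccos_cos) auto
    finally show ?thesis by (simp add: \<alpha>_def \<beta>_def)
  next
    case False
    have "arccos (x \<bullet> z) \<le> pi" using b[OF u(1,3)] by (auto intro: arccos_ubound)
    then show ?thesis using False by (simp add: \<alpha>_def \<beta>_def)
  qed
qed

lemma arccos_inner_self: "norm x = 1 \<Longrightarrow> arccos (x \<bullet> x) = 0"
  by (simp add: norm_eq_1)

lemma dist_eq_sin_half_arccos:
  fixes x y :: "'a::euclidean_space"
  assumes u: "norm x = 1" "norm y = 1"
  shows "dist x y = 2 * sin (arccos (x \<bullet> y) / 2)"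
proof -
  define \<alpha> where "\<alpha> = arccos (x \<bullet> y)"
  have "-1 \<le> x \<bullet> y \<and> x \<bullet> y \<le> 1" using Cauchy_Schwarz_ineq2[of x y] u by auto
  then have \<alpha>: "0 \<le> \<alpha>" "\<alpha> \<le> pi" "cos \<alpha> = x \<bullet> y" by (auto simp: \<alpha>_def arccos_lbound arccos_ubound cos_arccos)
  have "(dist x y)\<^sup>2 = 2 - 2 * (x \<bullet> y)"
    using u by (simp add: dist_norm power2_norm_eq_inner inner_diff norm_eq_1 inner_commute)
  also have "\<dots> = 2 - 2 * cos (2 * (\<alpha> / 2))" using \<alpha>(3) by simp
  also have "\<dots> = (2 * sin (\<alpha> / 2))\<^sup>2" by (subst cos_double_sin) (simp add: power_mult_distrib)
  finally show ?thesis using \<alpha> sin_ge_zero[of "\<alpha> / 2"] unfolding \<alpha>_def[symmetric]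
    by (intro power2_eq_imp_eq[of _ "2 * sin (\<alpha> / 2)"]) auto
qed

text \<open>For small angles the chord is almost the angle, since sin u / u tends to 1. Uniform
  continuity makes all consecutive angles of a fine partition small, the triangle inequality for
  angles adds them up, and finally \<open>e\<close> tends to 0.\<close>

lemma arccos_le_curve_length:
  fixes \<gamma> :: "real \<Rightarrow> 'a::euclidean_space"
  assumes cont: "continuous_on {0..1} \<gamma>" and sph: "\<gamma> ` {0..1} \<subseteq> sphere 0 1"
  shows "ennreal (arccos (\<gamma> 0 \<bullet> \<gamma> 1)) \<le> curve_length 0 1 \<gamma>"
proof (cases "curve_length 0 1 \<gamma> = \<infinity>")
  case False
  then obtain \<Lambda> where \<Lambda>: "0 \<le> \<Lambda>" "curve_length 0 1 \<gamma> = ennreal \<Lambda>"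
    by (cases "curve_length 0 1 \<gamma>") auto
  have n1: "norm (\<gamma> s) = 1" if "s \<in> {0..1}" for s
    using sph that by (auto simp: image_subset_iff)
  define ang where "ang s t = arccos (\<gamma> s \<bullet> \<gamma> t)" for s t
  have bd: "-1 \<le> \<gamma> s \<bullet> \<gamma> t \<and> \<gamma> s \<bullet> \<gamma> t \<le> 1" if "s \<in> {0..1}" "t \<in> {0..1}" for s t
    using Cauchy_Schwarz_ineq2[of "\<gamma> s" "\<gamma> t"] n1 that by auto
  have main: "(1 - e) * ang 0 1 \<le> \<Lambda>" if e: "0 < e" "e < 1" for e
  proof -
    have "(sin has_real_derivative 1) (at 0)" using DERIV_sin[of 0] by simp
    then have "((\<lambda>u::real. sin u / u) \<longlongrightarrow> 1) (at 0)" by (simp add: has_field_derivative_iff)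
    then have "\<forall>\<^sub>F u in at 0. sin u / u > 1 - e" by (rule order_tendstoD) (use e in simp)
    then obtain \<eta> where \<eta>: "\<eta> > 0" "\<And>u::real. u \<noteq> 0 \<Longrightarrow> \<bar>u\<bar> < \<eta> \<Longrightarrow> sin u / u > 1 - e"
      by (auto simp: eventually_at dist_real_def)
    have "continuous_on ({0..1} \<times> {0..1}) (\<lambda>(s, t). ang s t)"
      unfolding ang_def split_def
      by (intro continuous_on_arccos continuous_intros continuous_on_compose2[OF cont]) (use bd in auto)
    then have "uniformly_continuous_on ({0..1} \<times> {0..1}) (\<lambda>(s, t). ang s t)"
      by (intro compact_uniformly_continuous compact_Times) auto
    then obtain \<delta> where \<delta>: "\<delta> > 0" "\<And>p q. p \<in> {0..1} \<times> {0..1} \<Longrightarrow> q \<in> {0..1} \<times> {0..1} \<Longrightarrow> dist q p < \<delta> \<Longrightarrow>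
        dist (case q of (s, t) \<Rightarrow> ang s t) (case p of (s, t) \<Rightarrow> ang s t) < 2 * \<eta>"
      unfolding uniformly_continuous_on_def using \<eta>(1) by (metis mult_pos_pos zero_less_numeral)
    have near: "\<bar>ang s t\<bar> < 2 * \<eta>" if "s \<in> {0..1}" "t \<in> {0..1}" "\<bar>t - s\<bar> < \<delta>" for s t
    proof -
      have "dist (s, t) (s, s) < \<delta>" using that by (simp add: dist_Pair_Pair dist_real_def)
      then have "dist (ang s t) (ang s s) < 2 * \<eta>" using \<delta>(2)[of "(s, s)" "(s, t)"] that by auto
      then show ?thesis using n1[OF that(1)] by (simp add: dist_real_def ang_def arccos_inner_self)
    qed
    obtain m where m: "inverse (real (Suc m)) < \<delta>" using reals_Archimedean[OF \<delta>(1)] by blast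
    define p where "p i = real i / real (Suc m)" for i
    have p: "p i \<in> {0..1}" if "i \<le> Suc m" for i using that by (auto simp: p_def field_simps)
    have ps: "p (Suc i) - p i = inverse (real (Suc m))" for i
      by (simp add: p_def divide_inverse left_diff_distrib[symmetric] del: of_nat_Suc)
    have chord: "(1 - e) * ang (p i) (p (Suc i)) \<le> dist (\<gamma> (p i)) (\<gamma> (p (Suc i)))" if i: "i < Suc m" for i
    proof -
      have pi: "p i \<in> {0..1}" "p (Suc i) \<in> {0..1}" using p[of i] p[of "Suc i"] i by auto
      let ?a = "ang (p i) (p (Suc i))"
      have a0: "0 \<le> ?a" using bd[OF pi] by (auto simp: ang_def arccos_lbound)
      have "\<bar>?a\<bar> < 2 * \<eta>" by (rule near[OF pi]) (use ps[of i] m in simp)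
      then have "(1 - e) * (?a / 2) \<le> sin (?a / 2)"
        using \<eta>(2)[of "?a / 2"] a0 by (cases "?a = 0") (auto simp: field_simps)
      then show ?thesis using dist_eq_sin_half_arccos[OF n1[OF pi(1)] n1[OF pi(2)]] by (simp add: ang_def)
    qed
    have tri: "ang (p 0) (p k) \<le> (\<Sum>i<k. ang (p i) (p (Suc i)))" if "k \<le> Suc m" for k
      using that
    proof (induction k)
      case 0 then show ?case using n1[OF p[of 0]] by (simp add: ang_def arccos_inner_self)
    next
      case (Suc k)
      have "ang (p 0) (p (Suc k)) \<le> ang (p 0) (p k) + ang (p k) (p (Suc k))"
        unfolding ang_def by (rule arccos_triangle) (use Suc.prems in \<open>auto intro!: n1 p\<close>)
      then show ?case using Suc by simp
    qed
    have "(1 - e) * ang (p 0) (p (Suc m)) \<le> (1 - e) * (\<Sum>i<Suc m. ang (p i) (p (Suc i)))"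
      using tri[of "Suc m"] e by (intro mult_left_mono) auto
    also have "\<dots> \<le> (\<Sum>i<Suc m. dist (\<gamma> (p i)) (\<gamma> (p (Suc i))))"
      unfolding sum_distrib_left by (rule sum_mono) (use chord in auto)
    finally have "ennreal ((1 - e) * ang (p 0) (p (Suc m))) \<le> ennreal (\<Sum>i<Suc m. dist (\<gamma> (p i)) (\<gamma> (p (Suc i))))"
      by (rule ennreal_leI)
    also have "\<dots> = (\<Sum>i<Suc m. ennreal (dist (\<gamma> (p i)) (\<gamma> (p (Suc i)))))" by (rule sum_ennreal[symmetric]) simp
    also have "\<dots> \<le> ennreal \<Lambda>"
      unfolding \<Lambda>(2)[symmetric]
    proof (rule curve_length_ge)
      show "p i \<le> p (Suc i)" for i using ps[of i] by (smt (verit) inverse_nonnegative_iff_nonnegative of_nat_0_le_iff)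
      show "p i \<in> {0..1}" if "i \<le> Suc m" for i by (rule p[OF that])
    qed
    finally show ?thesis using \<Lambda>(1) by (simp add: ennreal_le_iff p_def)
  qed
  have "ang 0 1 \<le> \<Lambda>"
  proof (rule tendsto_upperbound)
    show "((\<lambda>e. (1 - e) * ang 0 1) \<longlongrightarrow> ang 0 1) (at_right 0)"
      by (auto intro!: tendsto_eq_intros)
    show "\<forall>\<^sub>F e in at_right 0. (1 - e) * ang 0 1 \<le> \<Lambda>"
      unfolding eventually_at_right_field by (intro exI[of _ 1]) (use main in auto)
  qed simp
  then show ?thesis unfolding \<Lambda>(2) ang_def by (rule ennreal_leI)
qed simp

text \<open>The arc of the great circle is a competitor of length at most
  \<open>\<bar>b - a\<bar>\<close>. No curve is shorter than the angle between the end points, and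
  this angle is \<open>arccos (cos \<bar>b - a\<bar>)\<close>, which returns
  \<open>\<bar>b - a\<bar>\<close> only up to \<pi>.\<close>

lemma sphere_dist_circle:
  fixes x y :: "real^'n"
  assumes xy: "norm x = 1" "norm y = 1" "x \<bullet> y = 0" and ab: "\<bar>b - a\<bar> \<le> pi"
  shows "sphere_dist (cos a *\<^sub>R x + sin a *\<^sub>R y) (cos b *\<^sub>R x + sin b *\<^sub>R y) = ennreal \<bar>b - a\<bar>"
proof -
  define P where "P s = cos s *\<^sub>R x + sin s *\<^sub>R y" for s
  have inn: "P s \<bullet> P t = cos (t - s)" for s t
    using xy by (simp add: P_def inner_add norm_eq_1 inner_commute cos_diff algebra_simps)
  have n1: "norm (P s) = 1" for s using inn[of s s] by (simp add: norm_eq_1)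
  have dist: "dist (P s) (P t) \<le> \<bar>t - s\<bar>" for s t
  proof (rule power2_le_imp_le)
    have "(dist (P s) (P t))\<^sup>2 = 2 - 2 * cos (t - s)"
      using inn[of s s] inn[of t t] inn[of s t]
      by (simp add: dist_norm power2_norm_eq_inner inner_diff inner_commute)
    also have "\<dots> = (2 * sin ((t - s) / 2))\<^sup>2"
    proof -
      have "2 * ((t - s) / 2) = t - s" by simp
      then show ?thesis using cos_double_sin[of "(t - s) / 2"] by (simp only:) (simp add: power_mult_distrib)
    qed
    also have "\<dots> \<le> \<bar>t - s\<bar>\<^sup>2"
      using abs_sin_x_le_abs_x[of "(t - s) / 2"] by (intro iffD1[OF abs_le_square_iff]) (simp add: abs_mult)
    finally show "(dist (P s) (P t))\<^sup>2 \<le> \<bar>t - s\<bar>\<^sup>2" .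
  qed simp
  show ?thesis unfolding P_def[symmetric]
  proof (rule antisym)
    define \<gamma> where "\<gamma> s = P (a + s * (b - a))" for s
    have "sphere_dist (P a) (P b) \<le> curve_length 0 1 \<gamma>"
      unfolding sphere_dist_def
    proof (rule INF_lower, safe)
      show "continuous_on {0..1} \<gamma>" unfolding \<gamma>_def P_def by (intro continuous_intros)
    qed (auto simp: \<gamma>_def n1)
    also have "\<dots> \<le> ennreal (\<bar>b - a\<bar> * (1 - 0))"
    proof (rule curve_length_lipschitz_le)
      fix s t :: real assume "0 \<le> s" "s \<le> t" "t \<le> 1"
      have "dist (\<gamma> s) (\<gamma> t) \<le> \<bar>(a + t * (b - a)) - (a + s * (b - a))\<bar>" unfolding \<gamma>_def by (rule dist)
      also have "\<dots> = \<bar>(t - s) * (b - a)\<bar>" by (simp add: algebra_simps)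
      also have "\<dots> = \<bar>b - a\<bar> * (t - s)" using \<open>s \<le> t\<close> by (simp add: abs_mult)
      finally show "dist (\<gamma> s) (\<gamma> t) \<le> \<bar>b - a\<bar> * (t - s)" .
    qed auto
    finally show "sphere_dist (P a) (P b) \<le> ennreal \<bar>b - a\<bar>" by simp
    show "ennreal \<bar>b - a\<bar> \<le> sphere_dist (P a) (P b)"
      unfolding sphere_dist_def
    proof (rule INF_greatest, clarify)
      fix \<gamma> :: "real \<Rightarrow> real^'n"
      assume \<gamma>: "continuous_on {0..1} \<gamma>" "\<gamma> ` {0..1} \<subseteq> sphere 0 1" "\<gamma> 0 = P a" "\<gamma> 1 = P b"
      have "arccos (\<gamma> 0 \<bullet> \<gamma> 1) = arccos (cos \<bar>b - a\<bar>)" unfolding \<gamma>(3,4) inn by simp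
      also have "\<dots> = \<bar>b - a\<bar>" by (rule arccos_cos) (use ab in auto)
      finally show "ennreal \<bar>b - a\<bar> \<le> curve_length 0 1 \<gamma>" using arccos_le_curve_length[OF \<gamma>(1,2)] by simp
    qed
  qed
qed

section \<open>Charts\<close>

lemma Ck_Suc_imp_has_derivative:
  assumes "Ck (Suc k) f S" "x \<in> S"
  shows "(f has_derivative frechet_derivative f (at x)) (at x)"
  using assms by (simp add: frechet_derivative_works)

lemma Ck_imp_continuous_on:
  assumes "Ck k f S" shows "continuous_on S f"
  using assms by (cases k) (auto intro!: continuous_at_imp_continuous_on differentiable_imp_continuous_within)

lemma linear_norm_le_sum_Basis:
  fixes A :: "'a::euclidean_space \<Rightarrow> 'b::real_normed_vector"
  assumes "bounded_linear A" and "\<And>i. i \<in> Basis \<Longrightarrow> norm (A i) \<le> e"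
  shows "norm (A v) \<le> real DIM('a) * e * norm v"
proof -
  interpret bounded_linear A by fact
  have "A v = (\<Sum>i\<in>Basis. (v \<bullet> i) *\<^sub>R A i)"
    by (subst euclidean_representation[symmetric, of v]) (simp only: sum scaleR)
  also have "norm \<dots> \<le> (\<Sum>i\<in>(Basis :: 'a set). norm v * e)"
    by (rule sum_norm_le) (use assms(2) in \<open>auto intro!: mult_mono Basis_le_norm\<close>)
  finally show ?thesis by (simp add: mult_ac)
qed

lemma Ck_Suc_lipschitz_on_cball:
  fixes f :: "'a::euclidean_space \<Rightarrow> 'b::real_normed_vector"
  assumes f: "Ck (Suc k) f S" and S: "cball x0 \<rho> \<subseteq> S"
  obtains K where "0 \<le> K" "\<And>x y. x \<in> cball x0 \<rho> \<Longrightarrow> y \<in> cball x0 \<rho> \<Longrightarrow> norm (f x - f y) \<le> K * norm (x - y)"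
proof -
  let ?d = "\<lambda>x. frechet_derivative f (at x)"
  have D: "(f has_derivative ?d x) (at x)" if "x \<in> S" for x
    using f that by (auto simp: frechet_derivative_works)
  have cont: "continuous_on S (\<lambda>x. ?d x v)" for v
    using f Ck_imp_continuous_on[of k "\<lambda>x. ?d x v" S] by auto
  have "\<exists>e. \<forall>x\<in>cball x0 \<rho>. norm (?d x i) \<le> e" for i
  proof -
    have "compact ((\<lambda>x. ?d x i) ` cball x0 \<rho>)"
      using cont S by (intro compact_continuous_image continuous_on_subset[OF cont]) auto
    then show ?thesis using compact_imp_bounded by (force simp: bounded_iff)
  qed
  then obtain e where e: "\<And>i x. x \<in> cball x0 \<rho> \<Longrightarrow> norm (?d x i) \<le> e i" by metis
  define E where "E = (\<Sum>i\<in>Basis. \<bar>e i\<bar>)"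
  have "norm (?d x i) \<le> E" if "x \<in> cball x0 \<rho>" "i \<in> Basis" for x i
  proof -
    have "norm (?d x i) \<le> \<bar>e i\<bar>" using e[OF that(1), of i] by simp
    also have "\<dots> \<le> E" unfolding E_def by (rule member_le_sum) (use that in auto)
    finally show ?thesis .
  qed
  then have on: "onorm (?d x) \<le> real DIM('a) * E" if "x \<in> cball x0 \<rho>" for x
  proof (intro onorm_bound linear_norm_le_sum_Basis)
    show "bounded_linear (?d x)" using that S by (intro has_derivative_bounded_linear[OF D]) auto
  qed (use that in \<open>auto intro!: sum_nonneg simp: E_def\<close>)
  have "norm (f x - f y) \<le> real DIM('a) * E * norm (x - y)"
    if "x \<in> cball x0 \<rho>" "y \<in> cball x0 \<rho>" for x y
  proof (rule differentiable_bound[OF convex_cball _ on that])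
    fix z assume "z \<in> cball x0 \<rho>"
    then have "z \<in> S" using S by blast
    then show "(f has_derivative ?d z) (at z within cball x0 \<rho>)" by (rule has_derivative_at_withinI[OF D])
  qed
  moreover have "0 \<le> real DIM('a) * E" by (simp add: E_def sum_nonneg)
  ultimately show ?thesis using that by blast
qed

text \<open>Near \<open>x0\<close> the derivative of \<open>G\<close> differs from the one at
  \<open>x0\<close> by at most half of the lower bound \<open>B\<close> of the latter, so
  subtracting the linear part leaves a remainder with Lipschitz constant
  \<open>B / 2\<close>.\<close>

lemma immersion_locally_bilipschitz:
  fixes G :: "'a::euclidean_space \<Rightarrow> 'b::euclidean_space"
  assumes G: "Ck 3 G D" and "open D" "x0 \<in> D" and inj: "inj (frechet_derivative G (at x0))"
  obtains \<rho> k where "0 < \<rho>" "0 < k" "cball x0 \<rho> \<subseteq> D"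
    "\<And>x y. x \<in> cball x0 \<rho> \<Longrightarrow> y \<in> cball x0 \<rho> \<Longrightarrow> k * norm (x - y) \<le> norm (G x - G y)"
proof -
  let ?d = "\<lambda>x. frechet_derivative G (at x)"
  have G3: "Ck (Suc (Suc (Suc 0))) G D" using G by (simp only: numeral_3_eq_3)
  have D: "(G has_derivative ?d x) (at x)" if "x \<in> D" for x
    using Ck_Suc_imp_has_derivative[OF G3 that] .
  have lin: "bounded_linear (?d x)" if "x \<in> D" for x using D[OF that] by (rule has_derivative_bounded_linear)
  have cont: "continuous_on D (\<lambda>x. ?d x v)" for v
    using G3 Ck_imp_continuous_on[of "Suc (Suc 0)" "\<lambda>x. ?d x v" D] by simp
  obtain B where B: "B > 0" "\<And>v. B * norm v \<le> norm (?d x0 v)"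
    using linear_inj_bounded_below_pos[OF bounded_linear.linear[OF lin[OF \<open>x0 \<in> D\<close>]] inj] by blast
  \<comment> \<open>The operator norm is at most the dimension times the largest norm on a basis
    vector, so this tolerance on basis vectors gives \<open>B / 2\<close>.\<close>
  define e where "e = B / (2 * real DIM('a))"
  have e: "e > 0" using B(1) by (simp add: e_def)
  have "\<forall>\<^sub>F x in at x0. \<forall>i\<in>Basis. norm (?d x i - ?d x0 i) < e"
  proof (intro eventually_ball_finite ballI finite_Basis)
    fix i :: 'a
    have "isCont (\<lambda>x. ?d x i) x0" using cont \<open>open D\<close> \<open>x0 \<in> D\<close> by (simp add: continuous_on_eq_continuous_at)
    then have "((\<lambda>x. ?d x i) \<longlongrightarrow> ?d x0 i) (at x0)" by (simp add: isCont_def)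
    from tendstoD[OF this e] show "\<forall>\<^sub>F x in at x0. norm (?d x i - ?d x0 i) < e" by (simp add: dist_norm)
  qed
  then obtain r where r: "r > 0" "\<And>x i. x \<noteq> x0 \<Longrightarrow> dist x x0 < r \<Longrightarrow> i \<in> Basis \<Longrightarrow> norm (?d x i - ?d x0 i) < e"
    unfolding eventually_at by auto
  obtain r' where r': "r' > 0" "cball x0 r' \<subseteq> D" using \<open>open D\<close> \<open>x0 \<in> D\<close> open_contains_cball by blast
  define \<rho> where "\<rho> = min (r / 2) r'"
  have \<rho>: "\<rho> > 0" "cball x0 \<rho> \<subseteq> D" using r r' by (auto simp: \<rho>_def)
  have on: "onorm (\<lambda>v. ?d x v - ?d x0 v) \<le> B / 2" if x: "x \<in> cball x0 \<rho>" for x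
  proof (rule onorm_bound)
    fix v
    have "norm (?d x i - ?d x0 i) \<le> e" if "i \<in> Basis" for i
    proof (cases "x = x0")
      case False
      have "dist x x0 < r" using x r(1) by (auto simp: \<rho>_def dist_commute)
      then show ?thesis using r(2)[OF False _ that] by simp
    qed (use e in simp)
    moreover have "bounded_linear (\<lambda>v. ?d x v - ?d x0 v)"
      using lin \<rho> x \<open>x0 \<in> D\<close> by (intro bounded_linear_sub) auto
    ultimately have "norm (?d x v - ?d x0 v) \<le> real DIM('a) * e * norm v" by (rule linear_norm_le_sum_Basis[rotated])
    then show "norm (?d x v - ?d x0 v) \<le> B / 2 * norm v" by (simp add: e_def)
  qed (use B in simp)
  have "B / 2 * norm (x - y) \<le> norm (G x - G y)" if xy: "x \<in> cball x0 \<rho>" "y \<in> cball x0 \<rho>" for x y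
  proof -
    have "norm ((G x - ?d x0 x) - (G y - ?d x0 y)) \<le> B / 2 * norm (x - y)"
    proof (rule differentiable_bound[OF convex_cball _ on xy])
      fix z assume "z \<in> cball x0 \<rho>"
      then have "z \<in> D" using \<rho> by auto
      have "((\<lambda>x. ?d x0 x) has_derivative ?d x0) (at z)"
        using bounded_linear_imp_has_derivative[OF lin[OF \<open>x0 \<in> D\<close>]] .
      then show "((\<lambda>x. G x - ?d x0 x) has_derivative (\<lambda>v. ?d z v - ?d x0 v)) (at z within cball x0 \<rho>)"
        using has_derivative_diff[OF D[OF \<open>z \<in> D\<close>]] has_derivative_at_withinI by blast
    qed
    moreover have "?d x0 x - ?d x0 y = ?d x0 (x - y)"
      using bounded_linear.linear[OF lin[OF \<open>x0 \<in> D\<close>]] by (simp add: linear_diff)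
    then have "?d x0 (x - y) = (G x - G y) - ((G x - ?d x0 x) - (G y - ?d x0 y))" by (simp add: algebra_simps)
    then have "norm (?d x0 (x - y)) \<le> norm (G x - G y) + norm ((G x - ?d x0 x) - (G y - ?d x0 y))"
      by (metis norm_triangle_ineq4)
    ultimately show ?thesis using B(2)[of "x - y"] by simp
  qed
  then show ?thesis using \<rho> B(1) by (intro that[of \<rho> "B / 2"]) auto
qed

lemma chart_at:
  assumes "closed_immersed_surface \<A> F"
  obtains D \<phi> \<psi> x0 where "(D, \<phi>) \<in> \<A>" "open D" "homeomorphism D (\<phi> ` D) \<phi> \<psi>" "open (\<phi> ` D)" "x0 \<in> D" "\<phi> x0 = p"
    "Ck 3 (F \<circ> \<phi>) D" "\<And>x. x \<in> D \<Longrightarrow> inj (frechet_derivative (F \<circ> \<phi>) (at x))"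
proof -
  have A: "C3_atlas \<A>" and F: "\<And>D \<phi>. (D, \<phi>) \<in> \<A> \<Longrightarrow> Ck 3 (F \<circ> \<phi>) D \<and> (\<forall>x\<in>D. inj (frechet_derivative (F \<circ> \<phi>) (at x)))"
    using assms by (auto simp: closed_immersed_surface_def)
  have "p \<in> (\<Union>(D, \<phi>)\<in>\<A>. \<phi> ` D)" using A by (auto simp: C3_atlas_def)
  then obtain D \<phi> x0 where D: "(D, \<phi>) \<in> \<A>" "x0 \<in> D" "\<phi> x0 = p" by auto
  moreover have "open D" "open (\<phi> ` D)" "\<exists>\<psi>. homeomorphism D (\<phi> ` D) \<phi> \<psi>"
    using A D(1) unfolding C3_atlas_def by blast+
  ultimately show ?thesis using F[OF D(1)] that by blast
qed

text \<open>A connected set whose image under the immersion stays close to \<open>F p\<close> cannot leave a chart ball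
  around \<open>p\<close>, since it would have to cross the bounding sphere.\<close>

lemma connected_in_chart_ball:
  fixes F :: "'m::t2_space \<Rightarrow> 'b::real_normed_vector" and \<phi> :: "'a::euclidean_space \<Rightarrow> 'm"
  assumes hom: "homeomorphism D (\<phi> ` D) \<phi> \<psi>" and D: "open D" "open (\<phi> ` D)" "cball x0 \<rho> \<subseteq> D" "0 < \<rho>"
    and low: "\<And>x. x \<in> cball x0 \<rho> \<Longrightarrow> k * norm (x - x0) \<le> norm (F (\<phi> x) - F (\<phi> x0))"
    and K: "connected K" "\<phi> x0 \<in> K" "F ` K \<subseteq> ball (F (\<phi> x0)) (k * \<rho>)"
  shows "K \<subseteq> \<phi> ` ball x0 \<rho>"
proof -
  have "openin (top_of_set (\<phi> ` D)) (\<phi> ` ball x0 \<rho>)"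
  proof (rule homeomorphism_imp_open_map[OF hom])
    show "openin (top_of_set D) (ball x0 \<rho>)" using D ball_subset_cball[of x0 \<rho>] by (auto simp: openin_open_eq)
  qed
  then have op: "open (\<phi> ` ball x0 \<rho>)" using D(2) by (simp add: openin_open_eq)
  have "compact (\<phi> ` cball x0 \<rho>)"
    using homeomorphism_cont1[OF hom] D(3) by (intro compact_continuous_image) (auto intro: continuous_on_subset)
  then have cl: "open (- \<phi> ` cball x0 \<rho>)" by (simp add: compact_imp_closed open_Compl)
  have sph: "q \<notin> \<phi> ` sphere x0 \<rho>" if "q \<in> K" for q
  proof
    assume "q \<in> \<phi> ` sphere x0 \<rho>"
    then obtain y where y: "q = \<phi> y" "dist x0 y = \<rho>" by auto
    then have "k * \<rho> \<le> norm (F q - F (\<phi> x0))" using low[of y] by (auto simp: dist_norm norm_minus_commute)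
    then show False using K(3) that by (auto simp: dist_norm norm_minus_commute)
  qed
  have "cball x0 \<rho> = ball x0 \<rho> \<union> sphere x0 \<rho>" by auto
  then have "K \<subseteq> \<phi> ` ball x0 \<rho> \<union> - \<phi> ` cball x0 \<rho>" using sph by auto
  moreover have "\<phi> ` ball x0 \<rho> \<inter> - \<phi> ` cball x0 \<rho> \<inter> K = {}" using ball_subset_cball[of x0 \<rho>] by auto
  ultimately have "\<phi> ` ball x0 \<rho> \<inter> K = {} \<or> - \<phi> ` cball x0 \<rho> \<inter> K = {}"
    using K(1) op cl by (auto simp: connected_def)
  moreover have "\<phi> x0 \<in> \<phi> ` ball x0 \<rho> \<inter> K" using K(2) D(4) by auto
  ultimately show ?thesis using \<open>K \<subseteq> _ \<union> _\<close> by blast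
qed

text \<open>Continuity of \<open>c\<close> in the surface keeps it in the chart ball for nearby
  parameters, and the lower bilipschitz bound of the immersion turns the Lipschitz bound on the
  image curve into one for the coordinates.\<close>

lemma curve_in_chart:
  fixes F :: "'m::t2_space \<Rightarrow> real^'n" and c :: "real \<Rightarrow> 'm"
  assumes S: "closed_immersed_surface \<A> F" and c: "continuous_on {0..L} c" and s0: "s0 \<in> {0..L}"
    and lip: "\<And>s r. s \<in> {0..L} \<Longrightarrow> r \<in> {0..L} \<Longrightarrow> norm (F (c s) - F (c r)) \<le> \<bar>s - r\<bar>"
  obtains D \<phi> x \<rho> k \<delta> where "(D, \<phi>) \<in> \<A>" "open D" "Ck 3 (F \<circ> \<phi>) D"
    "\<And>y. y \<in> D \<Longrightarrow> inj (frechet_derivative (F \<circ> \<phi>) (at y))"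
    "0 < \<rho>" "0 < k" "0 < \<delta>" "cball (x s0) \<rho> \<subseteq> D"
    "\<And>s. s \<in> {0..L} \<Longrightarrow> \<bar>s - s0\<bar> < \<delta> \<Longrightarrow> x s \<in> cball (x s0) \<rho> \<and> \<phi> (x s) = c s"
    "\<And>s r. s \<in> {0..L} \<Longrightarrow> \<bar>s - s0\<bar> < \<delta> \<Longrightarrow> r \<in> {0..L} \<Longrightarrow> \<bar>r - s0\<bar> < \<delta> \<Longrightarrow> norm (x s - x r) \<le> k * \<bar>s - r\<bar>"
proof -
  obtain D \<phi> \<psi> x0 where ch: "(D, \<phi>) \<in> \<A>" "open D" "homeomorphism D (\<phi> ` D) \<phi> \<psi>" "open (\<phi> ` D)" "x0 \<in> D" "\<phi> x0 = c s0"
    "Ck 3 (F \<circ> \<phi>) D" "\<And>x. x \<in> D \<Longrightarrow> inj (frechet_derivative (F \<circ> \<phi>) (at x))"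
    using chart_at[OF S, of "c s0"] by metis
  obtain \<rho> k where \<rho>: "0 < \<rho>" "0 < k" "cball x0 \<rho> \<subseteq> D"
    "\<And>x y. x \<in> cball x0 \<rho> \<Longrightarrow> y \<in> cball x0 \<rho> \<Longrightarrow> k * norm (x - y) \<le> norm ((F \<circ> \<phi>) x - (F \<circ> \<phi>) y)"
    using immersion_locally_bilipschitz[OF ch(7,2,5) ch(8)[OF ch(5)]] by metis
  define x where "x s = \<psi> (c s)" for s
  have x0: "x s0 = x0" using homeomorphism_apply1[OF ch(3,5)] ch(6) by (simp add: x_def)
  have op: "open (\<phi> ` ball x0 \<rho>)"
  proof -
    have "openin (top_of_set (\<phi> ` D)) (\<phi> ` ball x0 \<rho>)"
      by (rule homeomorphism_imp_open_map[OF ch(3)]) (use \<rho>(3) ball_subset_cball[of x0 \<rho>] ch(2) in \<open>auto simp: openin_open_eq\<close>)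
    then show ?thesis using ch(4) by (simp add: openin_open_eq)
  qed
  have "c s0 \<in> \<phi> ` ball x0 \<rho>" using ch(6) \<rho>(1) by (metis centre_in_ball imageI)
  then have "\<forall>\<^sub>F s in at s0 within {0..L}. c s \<in> \<phi> ` ball x0 \<rho>"
    using c s0 op by (intro topological_tendstoD[of c "c s0"]) (simp_all add: continuous_on_def)
  then obtain \<delta> where \<delta>: "\<delta> > 0" "\<And>s. s \<in> {0..L} \<Longrightarrow> s \<noteq> s0 \<Longrightarrow> dist s s0 < \<delta> \<Longrightarrow> c s \<in> \<phi> ` ball x0 \<rho>"
    unfolding eventually_at by blast
  have in_ball: "x s \<in> cball x0 \<rho> \<and> \<phi> (x s) = c s" if "s \<in> {0..L}" "\<bar>s - s0\<bar> < \<delta>" for s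
  proof -
    have "c s \<in> \<phi> ` ball x0 \<rho>" using \<delta>(2)[OF that(1)] \<open>c s0 \<in> _\<close> that(2) by (cases "s = s0") (auto simp: dist_real_def)
    then obtain y where y: "y \<in> ball x0 \<rho>" "c s = \<phi> y" by auto
    moreover have "y \<in> D" using y(1) \<rho>(3) by auto
    ultimately show ?thesis using homeomorphism_apply1[OF ch(3) \<open>y \<in> D\<close>] by (auto simp: x_def)
  qed
  have "norm (x s - x r) \<le> (1 / k) * \<bar>s - r\<bar>"
    if "s \<in> {0..L}" "\<bar>s - s0\<bar> < \<delta>" "r \<in> {0..L}" "\<bar>r - s0\<bar> < \<delta>" for s r
  proof -
    have "k * norm (x s - x r) \<le> norm (F (c s) - F (c r))"
      using \<rho>(4)[of "x s" "x r"] in_ball[OF that(1,2)] in_ball[OF that(3,4)] by simp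
    also have "\<dots> \<le> \<bar>s - r\<bar>" using lip that by simp
    finally show ?thesis using \<rho>(2) by (simp add: field_simps)
  qed
  then show ?thesis
    using ch \<rho> \<delta>(1) in_ball x0 by (intro that[of D \<phi> \<rho> "1 / k" \<delta> x]) auto
qed

section \<open>The angle function\<close>

context bv_measure begin

lemma has_density_cong:
  assumes "has_density \<sigma> f" "\<And>x. x \<in> I \<Longrightarrow> f x = g x"
  shows "has_density \<sigma> g"
  using assms by (auto simp: has_density_def)

text \<open>The product and chain rules ask for Borel functions on the whole line; the values
  outside the interval are free and can be set to 0.\<close>

lemma has_density_restrict:
  fixes \<sigma> :: "real \<Rightarrow> 'b::euclidean_space"
  assumes d: "has_density \<sigma> f"
  shows "has_density \<sigma> (\<lambda>x. if x \<in> I then f x else 0)"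
    "(\<lambda>x. if x \<in> I then f x else 0) \<in> borel_measurable borel"
proof -
  show "has_density \<sigma> (\<lambda>x. if x \<in> I then f x else 0)" by (rule has_density_cong[OF d]) simp
  obtain K where K: "\<And>x. x \<in> I \<Longrightarrow> f x = K + (LINT s:{..x}|M. \<sigma> s)"
    using has_density_cumulative[OF d] by blast
  have [measurable]: "(\<lambda>x. LINT s:{..x}|M. \<sigma> s) \<in> borel_measurable borel"
    by (rule cumulative_measurable[OF has_densityD(1)[OF d]])
  have "(\<lambda>x. if x \<in> I then f x else 0) = (\<lambda>x. if x \<in> I then K + (LINT s:{..x}|M. \<sigma> s) else 0)"
    using K by auto
  also have "\<dots> \<in> borel_measurable borel" by measurable
  finally show "(\<lambda>x. if x \<in> I then f x else 0) \<in> borel_measurable borel" .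
qed

lemma has_density_add:
  assumes "has_density \<sigma> f" "has_density \<tau> g"
  shows "has_density (\<lambda>s. \<sigma> s + \<tau> s) (\<lambda>s. f s + g s)"
  unfolding has_density_def
proof (intro conjI allI impI)
  show "integrable M (\<lambda>s. \<sigma> s + \<tau> s)" using assms[THEN has_densityD(1)] by auto
  fix a b assume ab: "0 < a" "a \<le> b" "b < L"
  have "f b + g b - (f a + g a) = (f b - f a) + (g b - g a)" by simp
  then show "f b + g b - (f a + g a) = (LINT s:{a<..b}|M. \<sigma> s + \<tau> s)"
    unfolding has_densityD(3)[OF assms(1) ab] has_densityD(3)[OF assms(2) ab]
    using assms[THEN has_densityD(1)]
    by (subst set_integral_add(2)) (auto intro!: set_integrable_M)
qed

text \<open>Off \<open>N\<close> the measure \<open>M\<close> is Lebesgue measure, so an absolutely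
  continuous function has a density that vanishes on \<open>N\<close>. It will therefore contribute
  nothing to Cantor and jump parts.\<close>

lemma has_density_lborel:
  fixes g :: "real \<Rightarrow> 'b::euclidean_space"
  assumes g: "integrable lborel g"
    and f: "\<And>x y. 0 < x \<Longrightarrow> x \<le> y \<Longrightarrow> y < L \<Longrightarrow> f y - f x = (LINT s:{x<..y}|lborel. g s)"
  shows "has_density (\<lambda>s. indicator (- N) s *\<^sub>R g s) f"
  unfolding has_density_def
proof (intro conjI allI impI)
  have [measurable]: "g \<in> borel_measurable borel" using borel_measurable_integrable[OF g] by simp
  have "integrable (density lborel (\<lambda>x. ennreal (indicator I x))) g"
    by (subst integrable_density) (use integrable_mult_indicator[OF _ g, of I] in auto)
  then have int: "integrable M (\<lambda>s. indicator (- N) s *\<^sub>R g s)"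
    unfolding density_M_eq_real[symmetric] by (subst (asm) integrable_density) auto
  then show "integrable M (\<lambda>s. indicator (- N) s *\<^sub>R g s)" .
  fix a b :: real assume ab: "0 < a" "a \<le> b" "b < L"
  have "(LINT s:{a<..b}|M. indicator (- N) s *\<^sub>R g s) = (LINT s:{a<..b} - N|M. indicator (- N) s *\<^sub>R g s)"
    unfolding set_lebesgue_integral_def
    by (rule Bochner_Integration.integral_cong) (auto simp: indicator_def)
  also have "\<dots> = (LINT s:{a<..b} \<inter> I|lborel. indicator (- N) s *\<^sub>R g s)"
    by (rule integral_off_N[OF int]) simp
  also have "\<dots> = (LINT s:{a<..b}|lborel. g s)"
  proof -
    have "{a<..b} \<inter> I = {a<..b}" using ab by auto
    moreover have "(LINT s:{a<..b}|lborel. indicator (- N) s *\<^sub>R g s) = (LINT s:{a<..b}|lborel. g s)"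
      unfolding set_lebesgue_integral_def
      by (rule integral_cong_AE) (use AE_not_in[OF N_null] in \<open>auto elim!: eventually_mono simp: indicator_def\<close>)
    ultimately show ?thesis by simp
  qed
  finally show "f b - f a = (LINT s:{a<..b}|M. indicator (- N) s *\<^sub>R g s)" using f[OF ab] by simp
qed

lemma nn_integral_off_N:
  assumes [measurable]: "h \<in> borel_measurable borel"
  shows "(\<integral>\<^sup>+x. h x * indicator (- N) x \<partial>M) = (\<integral>\<^sup>+x. h x * indicator I x \<partial>lborel)"
proof -
  have "(\<integral>\<^sup>+x. h x * indicator (- N) x \<partial>M) = (\<integral>\<^sup>+x. h x \<partial>density M (indicator (- N)))"
    by (subst nn_integral_density) (auto simp: mult.commute)
  also have "\<dots> = (\<integral>\<^sup>+x. h x * indicator I x \<partial>lborel)"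
    unfolding density_M_eq by (subst nn_integral_density) (auto simp: mult.commute)
  finally show ?thesis .
qed

text \<open>The three parts of the derivative are \<open>\<sigma> M\<close> restricted to the
  complement of \<open>N\<close>, to \<open>N\<close> without the jump set, and to the jump set. The
  last set is countable, and the atom of \<open>\<sigma> M\<close> at \<open>s\<close> is the jump
  of \<open>f\<close>.\<close>

lemma
  fixes \<sigma> :: "real \<Rightarrow> 'b::euclidean_space"
  assumes d: "has_density \<sigma> f" and eq: "AE x in lebesgue_on I. g x = f x"
  shows total_variation_D_ac: "total_variation (D_ac I g) I = (\<integral>\<^sup>+x. ennreal (norm (\<sigma> x)) * indicator I x \<partial>lborel)"
    and total_variation_D_cantor: "total_variation (D_cantor I g) I
      = (\<integral>\<^sup>+x. ennreal (norm (\<sigma> x)) * indicator (N - jump_set I g) x \<partial>M)"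
    and total_variation_D_jump: "total_variation (D_jump I g) I
      = (\<Sum>\<^sub>\<infinity>s\<in>jump_set I g. ennreal (norm (f s - left_value \<sigma> f s)))"
proof -
  note \<sigma> = has_densityD[OF d]
  note [measurable] = \<sigma>(2)
  let ?J = "jump_set I g"
  note J = jump_set_subset_atoms[OF d eq]
  have Jb [measurable]: "?J \<in> sets borel" using J(2) by (rule sets.countable[rotated]) auto
  have ind: "integrable M (\<lambda>x. indicator B x *\<^sub>R \<sigma> x)" if "B \<in> sets borel" for B
    by (rule integrable_mult_indicator) (use \<sigma>(1) that in auto)
  have nrm: "ennreal (norm (indicator B x *\<^sub>R \<sigma> x)) = ennreal (norm (\<sigma> x)) * indicator B x" for B x
    by (simp add: indicator_def)
  have "total_variation (D_ac I g) I = (\<integral>\<^sup>+x. norm (indicator (- N) x *\<^sub>R \<sigma> x) \<partial>M)"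
    unfolding D_ac_density[OF d eq]
    by (rule total_variation_density[OF ind]) (auto simp: density_measure_def sets_restrict_I)
  then show "total_variation (D_ac I g) I = (\<integral>\<^sup>+x. ennreal (norm (\<sigma> x)) * indicator I x \<partial>lborel)"
    unfolding nrm by (subst (asm) nn_integral_off_N) auto
  have set: "(LINT x:A|M. indicator B x *\<^sub>R \<sigma> x) = (LINT x:A \<inter> B|M. \<sigma> x)" for A B
    unfolding set_lebesgue_integral_def
    by (rule Bochner_Integration.integral_cong) (auto simp: indicator_def)
  have "total_variation (D_cantor I g) I = (\<integral>\<^sup>+x. norm (indicator (N - ?J) x *\<^sub>R \<sigma> x) \<partial>M)"
  proof (rule total_variation_density[OF ind])
    fix A assume A: "A \<in> sets borel" "A \<subseteq> I"
    have "(A - ?J) \<inter> N = A \<inter> (N - ?J)" by auto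
    then show "D_cantor I g A = (LINT x:A|M. indicator (N - ?J) x *\<^sub>R \<sigma> x)"
      unfolding D_cantor_def set using A by (subst D_sing_density[OF d eq]) auto
  qed auto
  then show "total_variation (D_cantor I g) I = (\<integral>\<^sup>+x. ennreal (norm (\<sigma> x)) * indicator (N - ?J) x \<partial>M)"
    unfolding nrm .
  have "total_variation (D_jump I g) I = (\<integral>\<^sup>+x. norm (indicator ?J x *\<^sub>R \<sigma> x) \<partial>M)"
  proof (rule total_variation_density[OF ind])
    fix A assume A: "A \<in> sets borel" "A \<subseteq> I"
    have "(A \<inter> ?J) \<inter> N = A \<inter> ?J" using J(1) by auto
    then show "D_jump I g A = (LINT x:A|M. indicator ?J x *\<^sub>R \<sigma> x)"
      unfolding D_jump_def set using A by (subst D_sing_density[OF d eq]) auto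
  qed auto
  also have "\<dots> = emeasure (density M (\<lambda>x. ennreal (norm (\<sigma> x)))) ?J"
    unfolding nrm by (subst emeasure_density) auto
  also have "\<dots> = (\<integral>\<^sup>+s. emeasure (density M (\<lambda>x. ennreal (norm (\<sigma> x)))) {s} \<partial>count_space ?J)"
    by (rule emeasure_countable_singleton) (use J in auto)
  also have "\<dots> = (\<integral>\<^sup>+s. ennreal (norm (f s - left_value \<sigma> f s)) \<partial>count_space ?J)"
  proof (rule nn_integral_cong)
    fix s
    have "emeasure (density M (\<lambda>x. ennreal (norm (\<sigma> x)))) {s} = (\<integral>\<^sup>+x. ennreal (norm (\<sigma> s)) * indicator {s} x \<partial>M)"
      by (subst emeasure_density) (auto intro!: nn_integral_cong simp: indicator_def)
    also have "\<dots> = ennreal (norm (\<sigma> s)) * ennreal (measure M {s})"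
      by (subst nn_integral_cmult_indicator) (auto simp: emeasure_eq_measure)
    also have "\<dots> = ennreal (norm (f s - left_value \<sigma> f s))"
      by (subst ennreal_mult[symmetric]) (auto simp: left_value_def mult.commute)
    finally show "emeasure (density M (\<lambda>x. ennreal (norm (\<sigma> x)))) {s} = ennreal (norm (f s - left_value \<sigma> f s))" .
  qed
  also have "\<dots> = (\<Sum>\<^sub>\<infinity>s\<in>?J. ennreal (norm (f s - left_value \<sigma> f s)))"
    by (rule infsum_ennreal_eq_nn_integral[symmetric, OF J(2)])
  finally show "total_variation (D_jump I g) I = (\<Sum>\<^sub>\<infinity>s\<in>?J. ennreal (norm (f s - left_value \<sigma> f s)))" .
qed

text \<open>At a jump the chain rule density is a difference quotient, so the left limit of \<open>h \<circ> f\<close> is the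
  image of the left limit.\<close>

lemma left_value_chain:
  fixes f :: "real \<Rightarrow> real"
  shows "left_value (\<lambda>s. (if left_value \<sigma> f s = f s then h' (f s)
      else (h (f s) - h (left_value \<sigma> f s)) / (f s - left_value \<sigma> f s)) * \<sigma> s) (\<lambda>s. h (f s)) s
    = h (left_value \<sigma> f s)"
proof (cases "left_value \<sigma> f s = f s")
  case True
  then have "measure M {s} * \<sigma> s = 0" by (simp add: left_value_def)
  then show ?thesis using True by (auto simp: left_value_def)
next
  case False
  have "measure M {s} * \<sigma> s = f s - left_value \<sigma> f s" by (simp add: left_value_def)
  then have "measure M {s} * ((h (f s) - h (left_value \<sigma> f s)) / (f s - left_value \<sigma> f s) * \<sigma> s)
      = (h (f s) - h (left_value \<sigma> f s)) / (f s - left_value \<sigma> f s) * (f s - left_value \<sigma> f s)"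
    by (metis mult.left_commute)
  also have "\<dots> = h (f s) - h (left_value \<sigma> f s)" using False by simp
  finally show ?thesis using False by (simp add: left_value_def[of _ "\<lambda>s. h (f s)"])
qed

end

text \<open>Geometry enters only through the orthonormal frame \<open>X\<close>, \<open>Y\<close>
  and the normality of its derivatives. The frame has no density on \<open>N\<close>, so there
  \<open>Dt\<close> comes from the change of angle alone; off \<open>N\<close> the frame does
  contribute, but only in directions that the scalar product with \<open>u\<close> ignores.\<close>

lemma bv_angle_identities:
  fixes X Y gX gY t u :: "real \<Rightarrow> real^'n" and \<Theta> :: "real \<Rightarrow> real"
  assumes L: "0 < L" and \<Theta>: "BV {0<..<L} \<Theta>"
    and opt: "\<And>s. s \<in> jump_set {0<..<L} \<Theta> \<Longrightarrow> \<bar>rlim \<Theta> s - llim \<Theta> s\<bar> \<le> pi"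
    and X: "integrable lborel gX" "\<And>x y. 0 < x \<Longrightarrow> x \<le> y \<Longrightarrow> y < L \<Longrightarrow> X y - X x = (LINT s:{x<..y}|lborel. gX s)"
    and Y: "integrable lborel gY" "\<And>x y. 0 < x \<Longrightarrow> x \<le> y \<Longrightarrow> y < L \<Longrightarrow> Y y - Y x = (LINT s:{x<..y}|lborel. gY s)"
    and on: "\<And>s. s \<in> {0<..<L} \<Longrightarrow> norm (X s) = 1 \<and> norm (Y s) = 1 \<and> X s \<bullet> Y s = 0"
    and normal: "AE s in lborel. s \<in> {0<..<L} \<longrightarrow> gX s \<bullet> X s = 0 \<and> gX s \<bullet> Y s = 0 \<and> gY s \<bullet> X s = 0 \<and> gY s \<bullet> Y s = 0"
    and t: "AE s in lebesgue_on {0<..<L}. t s = cos (\<Theta> s) *\<^sub>R X s + sin (\<Theta> s) *\<^sub>R Y s"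
    and u: "AE s in lebesgue_on {0<..<L}. u s = cos (\<Theta> s) *\<^sub>R Y s - sin (\<Theta> s) *\<^sub>R X s"
  shows "total_variation (D_ac {0<..<L} \<Theta>) {0<..<L}
      = (\<integral>\<^sup>+ s. ennreal \<bar>ae_deriv t s \<bullet> u s\<bar> \<partial>lebesgue_on {0<..<L})" (is ?ac)
    and "total_variation (D_cantor {0<..<L} \<Theta>) {0<..<L} = total_variation (D_cantor {0<..<L} t) {0<..<L}" (is ?cantor)
    and "total_variation (D_jump {0<..<L} \<Theta>) {0<..<L}
      = (\<Sum>\<^sub>\<infinity>s\<in>jump_set {0<..<L} t. sphere_dist (rlim t s) (llim t s))" (is ?jump)
proof -
  obtain \<mu> where \<mu>: "integrable (lebesgue_on {0<..<L}) \<Theta>" "is_distr_deriv {0<..<L} \<Theta> \<mu>"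
    using \<Theta> by (auto simp: BV_def)
  obtain M N \<sigma> f0 where M: "bv_measure M L N" and d0: "bv_measure.has_density M L \<sigma> f0"
      and ae0: "AE x in lebesgue_on {0<..<L}. \<Theta> x = f0 x"
    by (rule is_distr_deriv_imp_density[OF L \<mu>])
  interpret bv_measure M L N by fact
  define f where "f x = (if x \<in> I then f0 x else 0)" for x
  have f: "has_density \<sigma> f" and f_meas [measurable]: "f \<in> borel_measurable borel"
    using has_density_restrict[OF d0] by (simp_all add: f_def[abs_def])
  have \<Theta>f: "AE x in lebesgue_on I. \<Theta> x = f x"
    using ae0 AE_space[of "lebesgue_on I"] by eventually_elim (auto simp: f_def)
  note [measurable] = has_densityD(2)[OF f]
  define X' where "X' x = (if x \<in> I then X x else 0)" for x
  define Y' where "Y' x = (if x \<in> I then Y x else 0)" for x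
  define hX where "hX s = indicator (- N) s *\<^sub>R gX s" for s
  define hY where "hY s = indicator (- N) s *\<^sub>R gY s" for s
  have X': "has_density hX X'" "X' \<in> borel_measurable borel"
    using has_density_restrict[OF has_density_lborel[OF X]] by (simp_all add: X'_def[abs_def] hX_def[abs_def])
  have Y': "has_density hY Y'" "Y' \<in> borel_measurable borel"
    using has_density_restrict[OF has_density_lborel[OF Y]] by (simp_all add: Y'_def[abs_def] hY_def[abs_def])
  define lv where "lv = left_value \<sigma> f"
  define \<sigma>c where "\<sigma>c s = (if left_value \<sigma> f s = f s then - sin (f s)
      else (cos (f s) - cos (left_value \<sigma> f s)) / (f s - left_value \<sigma> f s)) * \<sigma> s" for s
  define \<sigma>s where "\<sigma>s s = (if left_value \<sigma> f s = f s then cos (f s)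
      else (sin (f s) - sin (left_value \<sigma> f s)) / (f s - left_value \<sigma> f s)) * \<sigma> s" for s
  have c: "has_density \<sigma>c (\<lambda>s. cos (f s))"
    unfolding \<sigma>c_def[abs_def]
    by (rule has_density_chain[OF f f_meas, of cos "\<lambda>x. - sin x" 1])
      (auto intro!: derivative_eq_intros continuous_intros)
  have s: "has_density \<sigma>s (\<lambda>s. sin (f s))"
    unfolding \<sigma>s_def[abs_def]
    by (rule has_density_chain[OF f f_meas, of sin cos 1])
      (auto intro!: derivative_eq_intros continuous_intros)
  have lvc: "left_value \<sigma>c (\<lambda>s. cos (f s)) s = cos (lv s)" for s
    unfolding \<sigma>c_def[abs_def] lv_def by (rule left_value_chain)
  have lvs: "left_value \<sigma>s (\<lambda>s. sin (f s)) s = sin (lv s)" for s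
    unfolding \<sigma>s_def[abs_def] lv_def by (rule left_value_chain)
  define t0 where "t0 s = cos (f s) *\<^sub>R X' s + sin (f s) *\<^sub>R Y' s" for s
  \<comment> \<open>In the product rule the trigonometric factor comes first, so it is its left
    limit that multiplies the density of the frame.\<close>
  define \<tau> where "\<tau> s = (\<sigma>c s *\<^sub>R X' s + cos (lv s) *\<^sub>R hX s) + (\<sigma>s s *\<^sub>R Y' s + sin (lv s) *\<^sub>R hY s)" for s
  have t0: "has_density \<tau> t0"
    unfolding \<tau>_def t0_def lvc[symmetric] lvs[symmetric]
    by (intro has_density_add has_density_product[OF bounded_bilinear_scaleR] c s X' Y')
      (auto intro!: borel_measurable_continuous_onI[THEN measurable_compose[OF f_meas]] continuous_intros)
  have tt0: "AE x in lebesgue_on I. t x = t0 x"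
    using t \<Theta>f AE_space[of "lebesgue_on I"] by eventually_elim (auto simp: t0_def X'_def Y'_def)
  have on': "norm (X' s) = 1" "norm (Y' s) = 1" "X' s \<bullet> Y' s = 0" if "s \<in> I" for s
    using on[OF that] that by (auto simp: X'_def Y'_def)
  have inN: "\<tau> s = \<sigma>c s *\<^sub>R X' s + \<sigma>s s *\<^sub>R Y' s" if "s \<in> N" for s
    using that by (simp add: \<tau>_def hX_def hY_def)
  have lvt: "left_value \<tau> t0 s = cos (lv s) *\<^sub>R X' s + sin (lv s) *\<^sub>R Y' s" for s
  proof (cases "s \<in> N")
    case True
    have "left_value \<tau> t0 s = left_value \<sigma>c (\<lambda>s. cos (f s)) s *\<^sub>R X' s + left_value \<sigma>s (\<lambda>s. sin (f s)) s *\<^sub>R Y' s"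
      using inN[OF True] by (simp add: left_value_def t0_def algebra_simps)
    then show ?thesis using lvc lvs by simp
  next
    case False
    then have "measure M {s} = 0" by (rule measure_singleton_off_N)
    then show ?thesis by (simp add: left_value_def lv_def t0_def)
  qed
  have bound: "\<bar>f s - lv s\<bar> \<le> pi" if "s \<in> I" for s
  proof (cases "s \<in> jump_set I \<Theta>")
    case True
    then show ?thesis using opt[OF True] rlim_density[OF f \<Theta>f that] llim_density[OF f \<Theta>f that] by (simp add: lv_def)
  next
    case False
    then show ?thesis using jump_set_density[OF f \<Theta>f that] pi_ge_zero by (simp add: lv_def)
  qed
  have inner: "t0 s \<bullet> left_value \<tau> t0 s = cos (f s - lv s)" if "s \<in> I" for s
    using on'[OF that] by (simp add: lvt t0_def inner_add norm_eq_1 inner_commute cos_diff)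
  \<comment> \<open>If \<open>t\<close> does not jump at \<open>s\<close>, the cosine of the jump of
    the angle is 1; the bound \<pi> then leaves only the jump 0 and no other multiple of
    2\<pi>.\<close>
  have J_eq: "jump_set I t = jump_set I \<Theta>"
  proof -
    have "s \<in> jump_set I t \<longleftrightarrow> s \<in> jump_set I \<Theta>" if sI: "s \<in> I" for s
    proof -
      have "left_value \<tau> t0 s = t0 s \<longleftrightarrow> lv s = f s"
      proof
        assume eq: "left_value \<tau> t0 s = t0 s"
        have "t0 s \<bullet> t0 s = 1"
          using on'[OF sI] by (simp add: t0_def inner_add norm_eq_1 inner_commute flip: power2_eq_square)
        then have "cos \<bar>f s - lv s\<bar> = cos 0" using inner[OF sI] eq by simp
        then have "\<bar>f s - lv s\<bar> = 0" by (rule cos_inj_pi[rotated 4]) (use bound[OF sI] in auto)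
        then show "lv s = f s" by simp
      next
        assume "lv s = f s"
        then show "left_value \<tau> t0 s = t0 s" by (simp add: lvt t0_def)
      qed
      then show ?thesis
        using jump_set_density[OF t0 tt0 sI] jump_set_density[OF f \<Theta>f sI] by (simp add: lv_def)
    qed
    moreover have "jump_set I t \<subseteq> I" "jump_set I \<Theta> \<subseteq> I" by (auto simp: jump_set_def)
    ultimately show ?thesis by blast
  qed
  have smooth: "\<sigma>c s = - sin (f s) * \<sigma> s" "\<sigma>s s = cos (f s) * \<sigma> s" if "lv s = f s" for s
    using that by (simp_all add: \<sigma>c_def \<sigma>s_def lv_def)
  have "norm (\<tau> s) = \<bar>\<sigma> s\<bar>" if sN: "s \<in> N" "s \<notin> jump_set I \<Theta>" for s
  proof -
    have sI: "s \<in> I" using N_subset sN by auto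
    then have "lv s = f s" using jump_set_density[OF f \<Theta>f sI] sN by (simp add: lv_def)
    then have "\<tau> s = \<sigma> s *\<^sub>R (cos (f s) *\<^sub>R Y' s - sin (f s) *\<^sub>R X' s)"
      using inN[OF sN(1)] smooth[of s] by (simp add: algebra_simps)
    moreover have "norm (cos (f s) *\<^sub>R Y' s - sin (f s) *\<^sub>R X' s) = 1"
      using on'[OF sI] by (simp add: norm_eq_1 inner_diff inner_commute flip: power2_eq_square)
    ultimately show ?thesis by simp
  qed
  then show ?cantor
    unfolding total_variation_D_cantor[OF f \<Theta>f] total_variation_D_cantor[OF t0 tt0] J_eq
    by (intro nn_integral_cong) (auto simp: indicator_def)
  have "sphere_dist (rlim t s) (llim t s) = ennreal (norm (f s - left_value \<sigma> f s))"
    if sJ: "s \<in> jump_set I t" for s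
  proof -
    have sI: "s \<in> I" using sJ by (simp add: jump_set_def)
    show ?thesis
      unfolding rlim_density[OF t0 tt0 sI] llim_density[OF t0 tt0 sI] lvt
      using sphere_dist_circle[OF on'[OF sI], of "lv s" "f s"] bound[OF sI]
      by (simp add: t0_def lv_def abs_minus_commute)
  qed
  then show ?jump
    unfolding total_variation_D_jump[OF f \<Theta>f] J_eq[symmetric] by (intro infsum_cong) simp
  have "AE x in lborel. x \<in> I \<longrightarrow> \<bar>ae_deriv t x \<bullet> u x\<bar> = \<bar>\<sigma> x\<bar>"
  proof -
    have "AE x in lebesgue. x \<in> I \<longrightarrow> u x = cos (f x) *\<^sub>R Y x - sin (f x) *\<^sub>R X x"
      using u \<Theta>f by (subst (asm) (1 2) AE_restrict_space_iff) auto
    then have "AE x in lborel. x \<in> I \<longrightarrow> u x = cos (f x) *\<^sub>R Y x - sin (f x) *\<^sub>R X x"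
      by (simp add: AE_completion_iff)
    moreover have "AE x in lborel. x \<notin> N" using N_null by (rule AE_not_in)
    moreover note has_density_vector_derivative[OF t0] normal
    ultimately show ?thesis
    proof eventually_elim
      case (elim x)
      show ?case
      proof
        assume x: "x \<in> I"
        \<comment> \<open>\<open>ae_deriv\<close> differentiates the right-continuous
          representative, which on the interval is \<open>t0\<close>.\<close>
        have "(rlim t has_vector_derivative \<tau> x) (at x)"
          by (rule has_vector_derivative_transform_within_open[of t0 _ _ I])
            (use elim x rlim_density[OF t0 tt0] in auto)
        then have "ae_deriv t x = \<tau> x" by (simp add: ae_deriv_def vector_derivative_at)
        moreover have "lv x = f x" using measure_singleton_off_N[OF elim(2)] by (simp add: lv_def left_value_def)
        then have "\<tau> x = \<sigma> x *\<^sub>R (cos (f x) *\<^sub>R Y x - sin (f x) *\<^sub>R X x) + cos (f x) *\<^sub>R gX x + sin (f x) *\<^sub>R gY x"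
          using x elim(2) smooth[of x] by (simp add: \<tau>_def hX_def hY_def X'_def Y'_def algebra_simps)
        moreover have "u x = cos (f x) *\<^sub>R Y x - sin (f x) *\<^sub>R X x" using elim x by simp
        moreover have "u x \<bullet> u x = 1" if "u x = cos (f x) *\<^sub>R Y x - sin (f x) *\<^sub>R X x"
          unfolding that using on[OF x] by (simp add: norm_eq_1 inner_diff inner_commute flip: power2_eq_square)
        ultimately have "ae_deriv t x \<bullet> u x = \<sigma> x * 1 + cos (f x) * (gX x \<bullet> u x) + sin (f x) * (gY x \<bullet> u x)"
          by (simp add: inner_add_left)
        moreover have "gX x \<bullet> u x = 0" "gY x \<bullet> u x = 0"
          using elim x by (simp_all add: inner_diff_right)
        ultimately show "\<bar>ae_deriv t x \<bullet> u x\<bar> = \<bar>\<sigma> x\<bar>" by simp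
      qed
    qed
  qed
  then have ae: "AE x in lebesgue_on I. \<bar>ae_deriv t x \<bullet> u x\<bar> = \<bar>\<sigma> x\<bar>"
    by (subst AE_restrict_space_iff) (auto intro: AE_completion)
  have "(\<integral>\<^sup>+ s. ennreal \<bar>ae_deriv t s \<bullet> u s\<bar> \<partial>lebesgue_on I) = (\<integral>\<^sup>+ s. ennreal \<bar>\<sigma> s\<bar> \<partial>lebesgue_on I)"
    by (rule nn_integral_cong_AE) (use ae in \<open>auto elim: eventually_mono\<close>)
  also have "\<dots> = (\<integral>\<^sup>+ s. ennreal \<bar>\<sigma> s\<bar> * indicator I s \<partial>lebesgue)"
    by (rule nn_integral_restrict_space) auto
  also have "\<dots> = (\<integral>\<^sup>+ s. ennreal \<bar>\<sigma> s\<bar> * indicator I s \<partial>lborel)"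
    by (rule nn_integral_completion)
  finally show ?ac unfolding total_variation_D_ac[OF f \<Theta>f] by simp
qed

section \<open>Tangent planes along the curve\<close>

lemma range_subset_tangent_plane:
  "(D, \<phi>) \<in> \<A> \<Longrightarrow> x \<in> D \<Longrightarrow> \<phi> x = p \<Longrightarrow> frechet_derivative (F \<circ> \<phi>) (at x) v \<in> tangent_plane \<A> F p"
  unfolding tangent_plane_def by blast

text \<open>The coordinates of the curve are Lipschitz but may fail to be differentiable at
  \<open>s\<close>, so the chain rule is not at hand. Instead, the derivative of the immersion has
  no component along \<open>w\<close>; hence the \<open>w\<close>-component of the curve is of
  smaller order than the coordinate increment, which is at most \<open>k\<close> times the parameter
  increment.\<close>

lemma velocity_orthogonal_normal:
  fixes F :: "'m::t2_space \<Rightarrow> real^'n" and c :: "real \<Rightarrow> 'm"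
  assumes S: "closed_immersed_surface \<A> F" and c: "continuous_on {0..L} c"
    and lip: "\<And>s r. s \<in> {0..L} \<Longrightarrow> r \<in> {0..L} \<Longrightarrow> norm (F (c s) - F (c r)) \<le> \<bar>s - r\<bar>"
    and s: "s \<in> {0<..<L}" and t: "(F \<circ> c has_vector_derivative t) (at s)"
    and w: "\<And>z. z \<in> tangent_plane \<A> F (c s) \<Longrightarrow> w \<bullet> z = 0"
  shows "w \<bullet> t = 0"
proof -
  have s0: "s \<in> {0..L}" using s by auto
  from curve_in_chart[OF S c s0 lip] obtain D \<phi> x \<rho> k \<delta> where ch: "(D, \<phi>) \<in> \<A>" "open D" "Ck 3 (F \<circ> \<phi>) D"
    and p: "0 < \<rho>" "0 < k" "0 < \<delta>" "cball (x s) \<rho> \<subseteq> D"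
    and x: "\<And>r. r \<in> {0..L} \<Longrightarrow> \<bar>r - s\<bar> < \<delta> \<Longrightarrow> x r \<in> cball (x s) \<rho> \<and> \<phi> (x r) = c r"
    and xl: "\<And>q r. q \<in> {0..L} \<Longrightarrow> \<bar>q - s\<bar> < \<delta> \<Longrightarrow> r \<in> {0..L} \<Longrightarrow> \<bar>r - s\<bar> < \<delta> \<Longrightarrow> norm (x q - x r) \<le> k * \<bar>q - r\<bar>"
    by metis
  let ?A = "frechet_derivative (F \<circ> \<phi>) (at (x s))"
  have xs: "x s \<in> D" "\<phi> (x s) = c s" using x[OF s0] p by auto
  have A: "(F \<circ> \<phi> has_derivative ?A) (at (x s))"
    using Ck_Suc_imp_has_derivative[of 2 "F \<circ> \<phi>" D "x s"] ch(3) xs by (simp add: numeral_3_eq_3 numeral_2_eq_2)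
  have wA: "w \<bullet> ?A v = 0" for v by (rule w) (rule range_subset_tangent_plane[where F=F, OF ch(1) xs])
  have "((\<lambda>r. w \<bullet> (F \<circ> c) r) has_vector_derivative 0) (at s)"
  proof (rule has_vector_derivative_epsI)
    fix e :: real assume "0 < e"
    \<comment> \<open>Cauchy-Schwarz costs a factor \<open>norm w\<close> and the coordinates a
      factor \<open>k\<close>; adding 1 keeps the denominator positive for
      \<open>w = 0\<close>.\<close>
    define e' where "e' = e / (norm w * k + 1)"
    have nk: "0 < norm w * k + 1" using p(2) by (simp add: add_nonneg_pos)
    have e': "e' > 0" using \<open>0 < e\<close> nk by (simp add: e'_def)
    obtain d where d: "d > 0" "\<And>y. norm (y - x s) < d \<Longrightarrow>
        norm ((F \<circ> \<phi>) y - (F \<circ> \<phi>) (x s) - ?A (y - x s)) \<le> e' * norm (y - x s)"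
      using A e' unfolding has_derivative_within_alt by auto
    obtain r0 where r0: "r0 > 0" "\<And>y. \<bar>y - s\<bar> < r0 \<Longrightarrow> y \<in> {0<..<L}"
      using s by (metis dist_real_def open_dist open_greaterThanLessThan)
    have "norm (w \<bullet> (F \<circ> c) y - w \<bullet> (F \<circ> c) s - (y - s) *\<^sub>R 0) \<le> e * \<bar>y - s\<bar>"
      if y: "\<bar>y - s\<bar> < min r0 (min \<delta> (d / k))" for y
    proof -
      have yI: "y \<in> {0..L}" "\<bar>y - s\<bar> < \<delta>" using r0(2)[of y] y by auto
      have xy: "norm (x y - x s) \<le> k * \<bar>y - s\<bar>" using xl[OF yI s0] p(3) by simp
      also have "k * \<bar>y - s\<bar> < k * (d / k)" using y p(2) by (intro mult_strict_left_mono) auto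
      finally have "norm (x y - x s) < d" using p(2) by simp
      from d(2)[OF this] have *: "norm (F (c y) - F (c s) - ?A (x y - x s)) \<le> e' * norm (x y - x s)"
        using x[OF yI] xs by simp
      have "w \<bullet> F (c y) - w \<bullet> F (c s) = w \<bullet> (F (c y) - F (c s) - ?A (x y - x s))"
        using wA[of "x y - x s"] by (simp add: inner_diff_right)
      then have "\<bar>w \<bullet> F (c y) - w \<bullet> F (c s)\<bar> \<le> norm w * (e' * norm (x y - x s))"
        using Cauchy_Schwarz_ineq2[of w "F (c y) - F (c s) - ?A (x y - x s)"] mult_left_mono[OF *, of "norm w"] by simp
      also have "\<dots> \<le> norm w * (e' * (k * \<bar>y - s\<bar>))"
        using xy e' by (intro mult_left_mono) auto
      also have "\<dots> = e' * (norm w * k) * \<bar>y - s\<bar>" by simp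
      also have "e' * (norm w * k) \<le> e" using nk \<open>0 < e\<close> by (simp add: e'_def field_simps)
      finally show ?thesis by (simp add: mult_right_mono)
    qed
    then show "\<exists>d>0. \<forall>y. \<bar>y - s\<bar> < d \<longrightarrow> norm (w \<bullet> (F \<circ> c) y - w \<bullet> (F \<circ> c) s - (y - s) *\<^sub>R 0) \<le> e * \<bar>y - s\<bar>"
      using r0(1) p(2,3) d(1) by (intro exI[of _ "min r0 (min \<delta> (d / k))"]) auto
  qed
  moreover have "((\<lambda>r. w \<bullet> (F \<circ> c) r) has_vector_derivative w \<bullet> t) (at s)"
    using bounded_linear.has_vector_derivative[OF bounded_linear_inner_right t] .
  ultimately show ?thesis by (rule vector_derivative_unique_at[symmetric])
qed

section \<open>The quarter turn along the curve is Lipschitz\<close>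

lemma bilinear_difference_bound:
  fixes P :: "'a::real_normed_vector \<Rightarrow> 'b::real_normed_vector \<Rightarrow> 'c::real_normed_vector"
  assumes "bounded_bilinear P" and P: "\<And>a b. norm (P a b) \<le> norm a * norm b"
    and "norm (a - a') \<le> K * d" "norm (b - b') \<le> K' * d" "norm b \<le> B" "norm a' \<le> A"
  shows "norm (P a b - P a' b') \<le> (K * B + A * K') * d"
proof -
  interpret bounded_bilinear P by fact
  have "P a b - P a' b' = P (a - a') b + P a' (b - b')" by (simp add: diff_left diff_right)
  also have "norm \<dots> \<le> norm (a - a') * norm b + norm a' * norm (b - b')"
    by (rule norm_triangle_mono) (rule P)+
  also have "\<dots> \<le> (K * d) * B + A * (K' * d)"
    using assms(3-6) order_trans[OF norm_ge_zero assms(3)] order_trans[OF norm_ge_zero assms(6)]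
    by (intro add_mono mult_mono) auto
  finally show ?thesis by (simp add: algebra_simps)
qed

text \<open>Rotation by \<open>\<pi>/2\<close> in the plane oriented by the orthonormal frame \<open>(a, b)\<close>, composed with the
  projection onto that plane.\<close>

definition quarter_turn :: "'a::real_inner \<Rightarrow> 'a \<Rightarrow> 'a \<Rightarrow> 'a" where
  "quarter_turn a b v = (v \<bullet> a) *\<^sub>R b - (v \<bullet> b) *\<^sub>R a"

lemma quarter_turn_diff: "quarter_turn a b (v - w) = quarter_turn a b v - quarter_turn a b w"
  by (simp add: quarter_turn_def inner_diff_left algebra_simps)

lemma norm_quarter_turn_le:
  assumes "norm a \<le> C" "norm b \<le> C" shows "norm (quarter_turn a b v) \<le> 2 * C\<^sup>2 * norm v"
proof -
  have C: "0 \<le> C" using assms(1) norm_ge_zero order_trans by blast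
  have 1: "norm ((v \<bullet> x) *\<^sub>R y) \<le> C\<^sup>2 * norm v" if "norm x \<le> C" "norm y \<le> C" for x y :: 'a
  proof -
    have "norm ((v \<bullet> x) *\<^sub>R y) \<le> (norm v * norm x) * norm y"
      using Cauchy_Schwarz_ineq2[of v x] by (simp add: mult_right_mono)
    also have "\<dots> \<le> (norm v * C) * C" using that C by (intro mult_mono mult_left_mono) auto
    finally show ?thesis by (simp add: power2_eq_square mult_ac)
  qed
  show ?thesis unfolding quarter_turn_def
    using norm_triangle_ineq4[of "(v \<bullet> a) *\<^sub>R b" "(v \<bullet> b) *\<^sub>R a"] 1[OF assms] 1[OF assms(2,1)] by simp
qed

lemma span_orthonormal_expand:
  fixes a b v :: "'a::real_inner"
  assumes "norm a = 1" "norm b = 1" "a \<bullet> b = 0" "v \<in> span {a, b}"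
  shows "v = (v \<bullet> a) *\<^sub>R a + (v \<bullet> b) *\<^sub>R b"
proof -
  obtain k l where v: "v = k *\<^sub>R a + l *\<^sub>R b"
    using assms(4) by (auto simp: span_insert span_singleton algebra_simps diff_eq_eq)
  have "v \<bullet> a = k" "v \<bullet> b = l"
    using assms(1-3) by (simp_all add: v inner_add norm_eq_1 inner_commute)
  then show ?thesis using v by simp
qed

text \<open>A (non-orthonormal) basis \<open>(p, q)\<close> of the plane spanned by \<open>(a, b)\<close>; \<open>quarter_turn\<close> scales with
  the determinant of the change of basis, whose square is the Gram determinant of \<open>(p, q)\<close>.\<close>

lemma quarter_turn_change_basis:
  fixes a b p q v :: "'a::real_inner"
  assumes ab: "norm a = 1" "norm b = 1" "a \<bullet> b = 0" and pq: "p \<in> span {a, b}" "q \<in> span {a, b}"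
  defines "d \<equiv> (p \<bullet> a) * (q \<bullet> b) - (p \<bullet> b) * (q \<bullet> a)"
  shows "quarter_turn p q v = d *\<^sub>R quarter_turn a b v"
    and "d\<^sup>2 = (p \<bullet> p) * (q \<bullet> q) - (p \<bullet> q)\<^sup>2"
proof -
  define p1 where "p1 = p \<bullet> a" define p2 where "p2 = p \<bullet> b"
  define q1 where "q1 = q \<bullet> a" define q2 where "q2 = q \<bullet> b"
  have p: "p = p1 *\<^sub>R a + p2 *\<^sub>R b" and q: "q = q1 *\<^sub>R a + q2 *\<^sub>R b"
    using span_orthonormal_expand[OF ab] pq by (simp_all add: p1_def p2_def q1_def q2_def)
  have d: "d = p1 * q2 - p2 * q1" by (simp add: d_def p1_def p2_def q1_def q2_def)
  show "quarter_turn p q v = d *\<^sub>R quarter_turn a b v"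
    unfolding quarter_turn_def d by (subst (1 2) p, subst (1 2) q) (simp add: inner_add_right algebra_simps)
  have "p \<bullet> p = p1\<^sup>2 + p2\<^sup>2" "q \<bullet> q = q1\<^sup>2 + q2\<^sup>2" "p \<bullet> q = p1 * q1 + p2 * q2"
    using ab by (simp_all add: p q inner_add norm_eq_1 inner_commute power2_eq_square algebra_simps)
  then show "d\<^sup>2 = (p \<bullet> p) * (q \<bullet> q) - (p \<bullet> q)\<^sup>2"
    unfolding d by (simp add: power2_eq_square algebra_simps)
qed

text \<open>The coordinate basis \<open>p\<close>, \<open>q\<close> is Lipschitz along the curve,
  but its orientation relative to the frame is hidden in the determinant \<open>d\<close>. As the
  frame is merely continuous, \<open>d\<close> is first known to be continuous and nonzero, hence of
  constant sign near \<open>s0\<close>. Its square is a Gram determinant, which is Lipschitz, and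
  factoring the difference of squares makes \<open>d\<close> Lipschitz too. Dividing the turn in the
  coordinate basis by \<open>d\<close> gives the claim.\<close>

lemma quarter_turn_locally_lipschitz:
  fixes F :: "'m::t2_space \<Rightarrow> real^'n" and c :: "real \<Rightarrow> 'm"
  assumes S: "closed_immersed_surface \<A> F" and c: "continuous_on {0..L} c"
    and lip: "\<And>s r. s \<in> {0..L} \<Longrightarrow> r \<in> {0..L} \<Longrightarrow> norm (F (c s) - F (c r)) \<le> \<bar>s - r\<bar>"
    and e: "orienting_frame \<A> F c L e1 e2" and s0: "s0 \<in> {0..L}"
  shows "\<exists>\<delta> K. 0 < \<delta> \<and> 0 \<le> K \<and> (\<forall>s\<in>{0..L}. \<forall>r\<in>{0..L}. \<bar>s - s0\<bar> < \<delta> \<longrightarrow> \<bar>r - s0\<bar> < \<delta> \<longrightarrow>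
    (\<forall>v. norm (quarter_turn (e1 s) (e2 s) v - quarter_turn (e1 r) (e2 r) v) \<le> K * \<bar>s - r\<bar> * norm v))"
proof -
  from curve_in_chart[OF S c s0 lip] obtain D \<phi> x \<rho> k \<delta> where ch: "(D, \<phi>) \<in> \<A>" "open D" "Ck 3 (F \<circ> \<phi>) D"
      "\<And>y. y \<in> D \<Longrightarrow> inj (frechet_derivative (F \<circ> \<phi>) (at y))"
    and pos: "0 < \<rho>" "0 < k" "0 < \<delta>" "cball (x s0) \<rho> \<subseteq> D"
    and x: "\<And>r. r \<in> {0..L} \<Longrightarrow> \<bar>r - s0\<bar> < \<delta> \<Longrightarrow> x r \<in> cball (x s0) \<rho> \<and> \<phi> (x r) = c r"
    and xl: "\<And>q r. q \<in> {0..L} \<Longrightarrow> \<bar>q - s0\<bar> < \<delta> \<Longrightarrow> r \<in> {0..L} \<Longrightarrow> \<bar>r - s0\<bar> < \<delta> \<Longrightarrow> norm (x q - x r) \<le> k * \<bar>q - r\<bar>"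
    by metis
  let ?A = "\<lambda>y. frechet_derivative (F \<circ> \<phi>) (at y)"
  let ?S = "{s \<in> {0..L}. \<bar>s - s0\<bar> < \<delta>}"
  have G3: "Ck (Suc (Suc (Suc 0))) (F \<circ> \<phi>) D" using ch(3) by (simp only: numeral_3_eq_3)
  define b1 b2 where "b1 = (axis 1 1 :: real^2)" and "b2 = (axis 2 1 :: real^2)"
  define p where "p s = ?A (x s) b1" for s
  define q where "q s = ?A (x s) b2" for s
  have xD: "x s \<in> D" "\<phi> (x s) = c s" if "s \<in> ?S" for s using x[of s] that pos(4) by auto
  have lipA: "\<exists>K\<ge>0. \<forall>s\<in>?S. \<forall>r\<in>?S. norm (?A (x s) b - ?A (x r) b) \<le> K * \<bar>s - r\<bar>" for b
  proof -
    have "Ck (Suc (Suc 0)) (\<lambda>y. ?A y b) D" using G3 by simp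
    then obtain K where K: "0 \<le> K" "\<And>y z. y \<in> cball (x s0) \<rho> \<Longrightarrow> z \<in> cball (x s0) \<rho> \<Longrightarrow> norm (?A y b - ?A z b) \<le> K * norm (y - z)"
      using Ck_Suc_lipschitz_on_cball[of "Suc 0" "\<lambda>y. ?A y b" D "x s0" \<rho>] pos(4) by blast
    have "norm (?A (x s) b - ?A (x r) b) \<le> (K * k) * \<bar>s - r\<bar>" if "s \<in> ?S" "r \<in> ?S" for s r
    proof -
      have "norm (?A (x s) b - ?A (x r) b) \<le> K * norm (x s - x r)" using K(2) x[of s] x[of r] that by auto
      also have "\<dots> \<le> K * (k * \<bar>s - r\<bar>)" using xl[of s r] that K(1) by (intro mult_left_mono) auto
      finally show ?thesis by simp
    qed
    then show ?thesis using K(1) pos(2) by (intro exI[of _ "K * k"]) auto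
  qed
  obtain Kp where Kp: "0 \<le> Kp" "\<And>s r. s \<in> ?S \<Longrightarrow> r \<in> ?S \<Longrightarrow> norm (p s - p r) \<le> Kp * \<bar>s - r\<bar>"
    using lipA[of b1] unfolding p_def by blast
  obtain Kq where Kq: "0 \<le> Kq" "\<And>s r. s \<in> ?S \<Longrightarrow> r \<in> ?S \<Longrightarrow> norm (q s - q r) \<le> Kq * \<bar>s - r\<bar>"
    using lipA[of b2] unfolding q_def by blast
  have s0S: "s0 \<in> ?S" using s0 pos(3) by simp
  \<comment> \<open>One constant for four purposes: a bound and a Lipschitz constant for both
    \<open>p\<close> and \<open>q\<close>.\<close>
  define C where "C = Kp + Kq + (norm (p s0) + Kp * \<delta>) + (norm (q s0) + Kq * \<delta>)"
  have nn: "0 \<le> Kp * \<delta>" "0 \<le> Kq * \<delta>" using Kp(1) Kq(1) pos(3) by auto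
  have C0: "0 \<le> C" using Kp(1) Kq(1) nn by (simp add: C_def)
  have Cp: "norm (p s) \<le> C" "norm (q s) \<le> C" if "s \<in> ?S" for s
  proof -
    have "norm (p s) \<le> norm (p s0) + norm (p s - p s0)" using norm_triangle_sub[of "p s" "p s0"] by simp
    also have "norm (p s - p s0) \<le> Kp * \<delta>"
      using Kp(2)[OF that s0S] mult_left_mono[of "\<bar>s - s0\<bar>" \<delta> Kp] Kp(1) that by auto
    finally show "norm (p s) \<le> C" using Kp(1) Kq(1) nn by (simp add: C_def add_increasing2 add_increasing)
    have "norm (q s) \<le> norm (q s0) + norm (q s - q s0)" using norm_triangle_sub[of "q s" "q s0"] by simp
    also have "norm (q s - q s0) \<le> Kq * \<delta>"
      using Kq(2)[OF that s0S] mult_left_mono[of "\<bar>s - s0\<bar>" \<delta> Kq] Kq(1) that by auto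
    finally show "norm (q s) \<le> C" using Kp(1) Kq(1) nn by (simp add: C_def add_increasing2 add_increasing)
  qed
  have Cl: "norm (p s - p r) \<le> C * \<bar>s - r\<bar>" "norm (q s - q r) \<le> C * \<bar>s - r\<bar>" if "s \<in> ?S" "r \<in> ?S" for s r
  proof -
    have "Kp \<le> C" "Kq \<le> C" using Kp(1) Kq(1) nn norm_ge_zero[of "p s0"] norm_ge_zero[of "q s0"] unfolding C_def by linarith+
    then show "norm (p s - p r) \<le> C * \<bar>s - r\<bar>" "norm (q s - q r) \<le> C * \<bar>s - r\<bar>"
      using order_trans[OF Kp(2)[OF that] mult_right_mono] order_trans[OF Kq(2)[OF that] mult_right_mono] by auto
  qed
  have fr: "norm (e1 s) = 1" "norm (e2 s) = 1" "e1 s \<bullet> e2 s = 0" "span {e1 s, e2 s} = tangent_plane \<A> F (c s)" if "s \<in> {0..L}" for s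
    using e that unfolding orienting_frame_def by auto
  have sp: "?A (x s) v \<in> span {e1 s, e2 s}" if "s \<in> ?S" for s v
    using range_subset_tangent_plane[OF ch(1) xD[OF that], of F v] fr(4)[of s] that by simp
  define d where "d s = (p s \<bullet> e1 s) * (q s \<bullet> e2 s) - (p s \<bullet> e2 s) * (q s \<bullet> e1 s)" for s
  have J: "quarter_turn (p s) (q s) v = d s *\<^sub>R quarter_turn (e1 s) (e2 s) v"
      "(d s)\<^sup>2 = (p s \<bullet> p s) * (q s \<bullet> q s) - (p s \<bullet> q s)\<^sup>2" if "s \<in> ?S" for s v
    using quarter_turn_change_basis[OF fr(1,2,3)[of s], of "p s" "q s"] sp[OF that] that by (auto simp: d_def p_def q_def)
  have lin: "linear (?A (x s))" if "s \<in> ?S" for s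
    using Ck_Suc_imp_has_derivative[OF G3 xD(1)[OF that]] has_derivative_linear by blast
  have "d s0 \<noteq> 0"
  proof
    assume d0: "d s0 = 0"
    have z: "\<alpha> = 0 \<and> \<beta> = 0" if "\<alpha> *\<^sub>R p s0 + \<beta> *\<^sub>R q s0 = 0" for \<alpha> \<beta>
    proof -
      have "?A (x s0) (\<alpha> *\<^sub>R b1 + \<beta> *\<^sub>R b2) = ?A (x s0) 0"
        using that lin[OF s0S] by (simp add: p_def q_def linear_add linear_scale linear_0)
      then have *: "\<alpha> *\<^sub>R b1 + \<beta> *\<^sub>R b2 = 0" using ch(4)[OF xD(1)[OF s0S]] by (simp add: inj_eq)
      have "(\<alpha> *\<^sub>R b1 + \<beta> *\<^sub>R b2) $ 1 = \<alpha>" "(\<alpha> *\<^sub>R b1 + \<beta> *\<^sub>R b2) $ 2 = \<beta>" by (simp_all add: b1_def b2_def axis_def)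
      then show ?thesis using * by (metis zero_index)
    qed
    have ex: "v = (v \<bullet> e1 s0) *\<^sub>R e1 s0 + (v \<bullet> e2 s0) *\<^sub>R e2 s0" if "v \<in> span {e1 s0, e2 s0}" for v
      by (rule span_orthonormal_expand[OF fr(1,2,3) that]) (use s0 in auto)
    have pq: "p s0 \<in> span {e1 s0, e2 s0}" "q s0 \<in> span {e1 s0, e2 s0}" using sp[OF s0S] by (auto simp: p_def q_def)
    have lc: "\<alpha> *\<^sub>R p s0 + \<beta> *\<^sub>R q s0 = 0"
      if "\<alpha> * (p s0 \<bullet> e1 s0) + \<beta> * (q s0 \<bullet> e1 s0) = 0" "\<alpha> * (p s0 \<bullet> e2 s0) + \<beta> * (q s0 \<bullet> e2 s0) = 0" for \<alpha> \<beta>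
      using that ex[of "\<alpha> *\<^sub>R p s0 + \<beta> *\<^sub>R q s0"] pq by (simp add: span_add span_scale inner_add_left)
    \<comment> \<open>With a vanishing determinant these coefficient pairs give vanishing
      combinations of \<open>p s0\<close> and \<open>q s0\<close>, so injectivity of the derivative
      makes all four coordinates 0. Then the coefficients 1 and 0 also give 0, against
      injectivity.\<close>
    have "q s0 \<bullet> e2 s0 = 0 \<and> - (p s0 \<bullet> e2 s0) = 0"
      by (rule z, rule lc) (use d0 in \<open>simp_all add: d_def mult_ac\<close>)
    moreover have "q s0 \<bullet> e1 s0 = 0 \<and> - (p s0 \<bullet> e1 s0) = 0"
      by (rule z, rule lc) (use d0 in \<open>simp_all add: d_def mult_ac\<close>)
    ultimately have "(1::real) = 0 \<and> (0::real) = 0" by (intro z lc) simp_all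
    then show False by simp
  qed
  \<comment> \<open>With half of the modulus at \<open>s0\<close> as tolerance, nearby determinants
    have the same sign and modulus at least \<open>m\<close>, and the sum of two of them has modulus
    at least \<open>2 * m\<close>.\<close>
  define m where "m = \<bar>d s0\<bar> / 2"
  have m: "m > 0" using \<open>d s0 \<noteq> 0\<close> by (simp add: m_def)
  have cS: "continuous_on ?S p" "continuous_on ?S q"
  proof -
    have "C-lipschitz_on ?S p" "C-lipschitz_on ?S q"
      using Cl C0 by (auto intro!: lipschitz_onI simp: dist_norm)
    then show "continuous_on ?S p" "continuous_on ?S q" by (auto intro: lipschitz_on_continuous_on)
  qed
  have "continuous_on ?S e1" "continuous_on ?S e2"
    using e by (auto simp: orienting_frame_def intro: continuous_on_subset)
  then have "continuous_on ?S d" unfolding d_def by (intro continuous_intros cS)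
  from continuous_on_iff[THEN iffD1, OF this, rule_format, OF s0S m]
  obtain \<delta>' where "\<delta>' > 0 \<and> (\<forall>s\<in>?S. dist s s0 < \<delta>' \<longrightarrow> dist (d s) (d s0) < m)" ..
  then have \<delta>': "\<delta>' > 0" "\<And>s. s \<in> ?S \<Longrightarrow> dist s s0 < \<delta>' \<Longrightarrow> dist (d s) (d s0) < m" by blast+
  define \<eta> where "\<eta> = min \<delta> \<delta>'"
  \<comment> \<open>The Lipschitz constant \<open>4 * C\<^sup>2\<close> of the turn in the
    coordinate basis, plus that of \<open>d\<close> times the norm bound 2 of the turn in the frame,
    divided by the lower bound \<open>m\<close> of the determinant.\<close>
  define K where "K = (4 * C\<^sup>2 + (8 * C^4 / (2 * m)) * 2) / m"
  have "norm (quarter_turn (e1 s) (e2 s) v - quarter_turn (e1 r) (e2 r) v) \<le> K * \<bar>s - r\<bar> * norm v"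
    if s: "s \<in> {0..L}" "\<bar>s - s0\<bar> < \<eta>" and r: "r \<in> {0..L}" "\<bar>r - s0\<bar> < \<eta>" for s r v
  proof -
    have S: "s \<in> ?S" "r \<in> ?S" using s r by (auto simp: \<eta>_def)
    have ds: "\<bar>d s - d s0\<bar> < m" "\<bar>d r - d s0\<bar> < m"
      using \<delta>'(2)[OF S(1)] \<delta>'(2)[OF S(2)] s r by (auto simp: \<eta>_def dist_real_def)
    have dm: "m \<le> \<bar>d s\<bar>" "2 * m \<le> \<bar>d s + d r\<bar>" using ds m_def by linarith+
    let ?h = "\<bar>s - r\<bar>"
    have inn: "\<bar>f s \<bullet> g s - f r \<bullet> g r\<bar> \<le> (2 * C\<^sup>2) * ?h" "\<bar>f s \<bullet> g s\<bar> \<le> C\<^sup>2" "\<bar>f r \<bullet> g r\<bar> \<le> C\<^sup>2"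
      if "f \<in> {p, q}" "g \<in> {p, q}" for f g
    proof -
      have b: "norm (f s - f r) \<le> C * ?h" "norm (g s - g r) \<le> C * ?h" "norm (f s) \<le> C" "norm (g s) \<le> C"
          "norm (f r) \<le> C" "norm (g r) \<le> C"
        using that Cl[OF S] Cp[OF S(1)] Cp[OF S(2)] by auto
      have "norm (f s \<bullet> g s - f r \<bullet> g r) \<le> (C * C + C * C) * ?h"
        by (rule bilinear_difference_bound[OF bounded_bilinear_inner _ b(1,2,4,5)]) (simp add: Cauchy_Schwarz_ineq2)
      then show "\<bar>f s \<bullet> g s - f r \<bullet> g r\<bar> \<le> (2 * C\<^sup>2) * ?h" by (simp add: power2_eq_square)
      have cc: "norm (f t) * norm (g t) \<le> C * C" if "norm (f t) \<le> C" "norm (g t) \<le> C" for t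
        using that C0 by (intro mult_mono) auto
      show "\<bar>f s \<bullet> g s\<bar> \<le> C\<^sup>2" "\<bar>f r \<bullet> g r\<bar> \<le> C\<^sup>2"
        using order_trans[OF Cauchy_Schwarz_ineq2 cc] b by (simp_all add: power2_eq_square)
    qed
    have pr: "\<bar>a * b - a' * b'\<bar> \<le> (4 * C^4) * ?h"
      if "\<bar>a - a'\<bar> \<le> (2 * C\<^sup>2) * ?h" "\<bar>b - b'\<bar> \<le> (2 * C\<^sup>2) * ?h" "\<bar>b\<bar> \<le> C\<^sup>2" "\<bar>a'\<bar> \<le> C\<^sup>2" for a b a' b'
    proof -
      have "norm (a * b - a' * b') \<le> ((2 * C\<^sup>2) * C\<^sup>2 + C\<^sup>2 * (2 * C\<^sup>2)) * ?h"
        by (rule bilinear_difference_bound[OF bounded_bilinear_mult]) (use that in \<open>auto simp: abs_mult\<close>)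
      then show ?thesis by (simp add: power2_eq_square power4_eq_xxxx mult_ac)
    qed
    have "\<bar>(d s)\<^sup>2 - (d r)\<^sup>2\<bar> \<le> \<bar>(p s \<bullet> p s) * (q s \<bullet> q s) - (p r \<bullet> p r) * (q r \<bullet> q r)\<bar>
        + \<bar>(p s \<bullet> q s) * (p s \<bullet> q s) - (p r \<bullet> q r) * (p r \<bullet> q r)\<bar>"
    proof -
      have "(d s)\<^sup>2 - (d r)\<^sup>2 = ((p s \<bullet> p s) * (q s \<bullet> q s) - (p r \<bullet> p r) * (q r \<bullet> q r))
          - ((p s \<bullet> q s) * (p s \<bullet> q s) - (p r \<bullet> q r) * (p r \<bullet> q r))"
        unfolding J(2)[OF S(1)] J(2)[OF S(2)] by (simp add: power2_eq_square)
      then show ?thesis by (metis abs_triangle_ineq4)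
    qed
    also have "\<dots> \<le> 4 * C^4 * ?h + 4 * C^4 * ?h"
      by (intro add_mono pr inn) auto
    finally have "\<bar>(d s)\<^sup>2 - (d r)\<^sup>2\<bar> \<le> 8 * C^4 * ?h" by (simp add: mult_ac)
    moreover have "(d s)\<^sup>2 - (d r)\<^sup>2 = (d s + d r) * (d s - d r)" by (simp add: power2_eq_square algebra_simps)
    ultimately have "\<bar>d s + d r\<bar> * \<bar>d s - d r\<bar> \<le> 8 * C^4 * ?h" by (simp add: abs_mult)
    moreover have "2 * m * \<bar>d s - d r\<bar> \<le> \<bar>d s + d r\<bar> * \<bar>d s - d r\<bar>" using dm by (intro mult_right_mono) auto
    ultimately have dd: "\<bar>d s - d r\<bar> \<le> 8 * C^4 / (2 * m) * ?h" using m by (simp add: field_simps)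
    let ?Js = "quarter_turn (e1 s) (e2 s) v" and ?Jr = "quarter_turn (e1 r) (e2 r) v"
    have Jr: "norm ?Jr \<le> 2 * norm v" using norm_quarter_turn_le[of "e1 r" 1 "e2 r" v] fr[of r] r by simp
    have B: "norm (quarter_turn (p s) (q s) v - quarter_turn (p r) (q r) v) \<le> 4 * C\<^sup>2 * ?h * norm v"
    proof -
      have "quarter_turn (p s) (q s) v - quarter_turn (p r) (q r) v
          = ((v \<bullet> p s) *\<^sub>R q s - (v \<bullet> p r) *\<^sub>R q r) - ((v \<bullet> q s) *\<^sub>R p s - (v \<bullet> q r) *\<^sub>R p r)"
        by (simp add: quarter_turn_def algebra_simps)
      moreover have t: "norm ((v \<bullet> f s) *\<^sub>R g s - (v \<bullet> f r) *\<^sub>R g r) \<le> ((norm v * C) * C + (norm v * C) * C) * ?h"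
        if "f \<in> {p, q}" "g \<in> {p, q}" for f g
      proof (rule bilinear_difference_bound[OF bounded_bilinear_scaleR])
        have "\<bar>v \<bullet> f s - v \<bullet> f r\<bar> \<le> norm v * norm (f s - f r)"
          using Cauchy_Schwarz_ineq2[of v "f s - f r"] by (simp add: inner_diff_right)
        also have "\<dots> \<le> norm v * (C * ?h)" using that Cl[OF S] by (intro mult_left_mono) auto
        finally show "norm (v \<bullet> f s - v \<bullet> f r) \<le> norm v * C * ?h" by simp
        show "norm (v \<bullet> f r) \<le> norm v * C"
          using order_trans[OF Cauchy_Schwarz_ineq2[of v "f r"] mult_left_mono[of "norm (f r)" C "norm v"]] that Cp[OF S(2)] by auto
      qed (use that Cl[OF S] Cp[OF S(1)] in auto)
      have "norm (((v \<bullet> p s) *\<^sub>R q s - (v \<bullet> p r) *\<^sub>R q r) - ((v \<bullet> q s) *\<^sub>R p s - (v \<bullet> q r) *\<^sub>R p r))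
          \<le> ((norm v * C) * C + (norm v * C) * C) * ?h + ((norm v * C) * C + (norm v * C) * C) * ?h"
        by (rule order_trans[OF norm_triangle_ineq4 add_mono]) (rule t; simp)+
      ultimately have "norm (quarter_turn (p s) (q s) v - quarter_turn (p r) (q r) v)
          \<le> ((norm v * C) * C + (norm v * C) * C) * ?h + ((norm v * C) * C + (norm v * C) * C) * ?h" by simp
      then show ?thesis by (simp add: power2_eq_square algebra_simps)
    qed
    have deq: "d s *\<^sub>R (?Js - ?Jr) = (quarter_turn (p s) (q s) v - quarter_turn (p r) (q r) v) - (d s - d r) *\<^sub>R ?Jr"
      unfolding J(1)[OF S(1)] J(1)[OF S(2)] by (simp add: algebra_simps)
    have "\<bar>d s\<bar> * norm (?Js - ?Jr) \<le> 4 * C\<^sup>2 * ?h * norm v + \<bar>d s - d r\<bar> * norm ?Jr"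
    proof -
      have "\<bar>d s\<bar> * norm (?Js - ?Jr) = norm (d s *\<^sub>R (?Js - ?Jr))" by simp
      also have "\<dots> \<le> norm (quarter_turn (p s) (q s) v - quarter_turn (p r) (q r) v) + norm ((d s - d r) *\<^sub>R ?Jr)"
        unfolding deq by (rule norm_triangle_ineq4)
      finally show ?thesis using B by simp
    qed
    also have "\<dots> \<le> 4 * C\<^sup>2 * ?h * norm v + (8 * C^4 / (2 * m) * ?h) * (2 * norm v)"
      using dd Jr by (intro add_mono mult_mono order_refl) auto
    also have "\<dots> = m * (K * ?h * norm v)" using m by (simp add: K_def field_simps)
    finally have "\<bar>d s\<bar> * norm (?Js - ?Jr) \<le> m * (K * ?h * norm v)" .
    moreover have "m * norm (?Js - ?Jr) \<le> \<bar>d s\<bar> * norm (?Js - ?Jr)" using dm by (intro mult_right_mono) auto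
    ultimately have "m * norm (?Js - ?Jr) \<le> m * (K * ?h * norm v)" by linarith
    then show ?thesis using m by simp
  qed
  moreover have "0 < \<eta>" using pos(3) \<delta>'(1) by (simp add: \<eta>_def)
  moreover have "0 \<le> K" using m C0 by (simp add: K_def)
  ultimately show ?thesis by blast
qed

text \<open>A Lebesgue number \<open>lb\<close> of a finite subcover separates two cases: nearby
  parameters share a neighbourhood with a local constant, while distant ones only need the bound 2
  on the norm of the turn, which produces the constant \<open>4 / lb\<close>.\<close>

lemma quarter_turn_lipschitz:
  fixes F :: "'m::t2_space \<Rightarrow> real^'n" and c :: "real \<Rightarrow> 'm"
  assumes S: "closed_immersed_surface \<A> F" and c: "continuous_on {0..L} c"
    and lip: "\<And>s r. s \<in> {0..L} \<Longrightarrow> r \<in> {0..L} \<Longrightarrow> norm (F (c s) - F (c r)) \<le> \<bar>s - r\<bar>"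
    and e: "orienting_frame \<A> F c L e1 e2"
  obtains K where "0 \<le> K" "\<And>s r v. s \<in> {0..L} \<Longrightarrow> r \<in> {0..L} \<Longrightarrow>
    norm (quarter_turn (e1 s) (e2 s) v - quarter_turn (e1 r) (e2 r) v) \<le> K * \<bar>s - r\<bar> * norm v"
proof -
  let ?J = "\<lambda>s. quarter_turn (e1 s) (e2 s)"
  obtain \<delta> \<kappa> where loc: "\<And>s0. s0 \<in> {0..L} \<Longrightarrow> 0 < \<delta> s0 \<and> 0 \<le> \<kappa> s0 \<and> (\<forall>s\<in>{0..L}. \<forall>r\<in>{0..L}. \<bar>s - s0\<bar> < \<delta> s0 \<longrightarrow> \<bar>r - s0\<bar> < \<delta> s0 \<longrightarrow>
    (\<forall>v. norm (?J s v - ?J r v) \<le> \<kappa> s0 * \<bar>s - r\<bar> * norm v))"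
    using quarter_turn_locally_lipschitz[OF S c lip e] by metis
  have \<delta>: "0 < \<delta> s" "0 \<le> \<kappa> s" if "s \<in> {0..L}" for s using loc[OF that] by blast+
  have cov: "{0..L} \<subseteq> (\<Union>s\<in>{0..L}. ball s (\<delta> s / 2))"
  proof
    fix s assume "s \<in> {0..L}"
    moreover from this have "s \<in> ball s (\<delta> s / 2)" using \<delta>(1)[of s] by simp
    ultimately show "s \<in> (\<Union>s\<in>{0..L}. ball s (\<delta> s / 2))" by blast
  qed
  obtain T where T: "T \<subseteq> {0..L}" "finite T" "{0..L} \<subseteq> (\<Union>s\<in>T. ball s (\<delta> s / 2))"
    by (rule compactE_image[OF compact_Icc _ cov]) auto
  define lb where "lb = Min (insert 1 ((\<lambda>s. \<delta> s / 2) ` T))"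
  have lb: "lb > 0" unfolding lb_def using T(1,2) \<delta>(1) by (subst Min_gr_iff) auto
  have lb2: "lb \<le> \<delta> s / 2" if "s \<in> T" for s
    unfolding lb_def using T(2) that by (intro Min_le) auto
  define K where "K = Max (insert (4 / lb) (\<kappa> ` T))"
  have K: "4 / lb \<le> K" "\<And>s. s \<in> T \<Longrightarrow> \<kappa> s \<le> K" using T(2) by (auto simp: K_def)
  have K0: "0 \<le> K" using K(1) lb by (meson divide_nonneg_pos order_trans zero_le_numeral)
  have "norm (?J s v - ?J r v) \<le> K * \<bar>s - r\<bar> * norm v" if s: "s \<in> {0..L}" and r: "r \<in> {0..L}" for s r v
  proof (cases "\<bar>s - r\<bar> < lb")
    case True
    obtain s0 where s0: "s0 \<in> T" "dist s0 s < \<delta> s0 / 2" using subsetD[OF T(3) s] by auto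
    have "\<bar>s - s0\<bar> < \<delta> s0" "\<bar>r - s0\<bar> < \<delta> s0" using True s0(2) lb2[OF s0(1)] unfolding dist_real_def by linarith+
    moreover have "s0 \<in> {0..L}" using s0(1) T(1) by blast
    ultimately have "norm (?J s v - ?J r v) \<le> \<kappa> s0 * \<bar>s - r\<bar> * norm v" using loc[of s0] s r by blast
    also have "\<dots> \<le> K * \<bar>s - r\<bar> * norm v" using K(2)[OF s0(1)] by (intro mult_right_mono) auto
    finally show ?thesis .
  next
    case False
    have n: "norm (?J t v) \<le> 2 * norm v" if "t \<in> {0..L}" for t
      using norm_quarter_turn_le[of "e1 t" 1 "e2 t" v] e that by (auto simp: orienting_frame_def)
    have "norm (?J s v - ?J r v) \<le> 4 * norm v" using norm_triangle_ineq4[of "?J s v" "?J r v"] n[OF s] n[OF r] by simp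
    also have "4 \<le> K * \<bar>s - r\<bar>"
    proof -
      have "4 = (4 / lb) * lb" using lb by simp
      also have "\<dots> \<le> K * \<bar>s - r\<bar>" using False K(1) K0 lb by (intro mult_mono) auto
      finally show ?thesis .
    qed
    finally show ?thesis by (simp add: mult_right_mono)
  qed
  then show ?thesis using that K0 by blast
qed

section \<open>Inscribed polygonals\<close>

lemma dist_le_geodesic_dist:
  fixes F :: "'m::topological_space \<Rightarrow> real^'n"
  shows "ennreal (dist (F p) (F q)) \<le> geodesic_dist F p q"
  unfolding geodesic_dist_def
proof (rule INF_greatest, clarify)
  fix \<gamma> :: "real \<Rightarrow> 'm" show "ennreal (dist (F (\<gamma> 0)) (F (\<gamma> 1))) \<le> curve_length 0 1 (F \<circ> \<gamma>)"
    using dist_le_curve_length[of 0 0 1 1 "F \<circ> \<gamma>"] by simp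
qed

lemma dist_le_modulus:
  assumes "i < n" "x \<in> {t i..t (Suc i)}" "y \<in> {t i..t (Suc i)}"
  shows "ennreal (dist (F (c x)) (F (c y))) \<le> modulus F c n t"
proof -
  have "ennreal (dist (F (c x)) (F (c y))) \<le> geodesic_dist F (c x) (c y)" by (rule dist_le_geodesic_dist)
  also have "\<dots> \<le> geodesic_diameter F (c ` {t i..t (Suc i)})"
    unfolding geodesic_diameter_def by (rule SUP_upper2[of "(c x, c y)"]) (use assms in auto)
  also have "\<dots> \<le> modulus F c n t"
    unfolding modulus_def by (rule Max_ge) (use assms in auto)
  finally show ?thesis .
qed

lemma arc_length_curve_not_constant:
  fixes F :: "'m::topological_space \<Rightarrow> real^'n"
  assumes c: "arc_length_curve F c L" and ab: "0 \<le> a" "a < b" "b \<le> L"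
  shows "\<exists>x\<in>{a..b}. F (c x) \<noteq> F (c a)"
proof (rule ccontr)
  assume "\<not> (\<exists>x\<in>{a..b}. F (c x) \<noteq> F (c a))"
  then have const: "F (c x) = F (c a)" if "x \<in> {a..b}" for x using that by blast
  have "AE s in lebesgue. s \<in> {0<..<L} \<longrightarrow> (F \<circ> c has_vector_derivative tantrix F c s) (at s) \<and> norm (tantrix F c s) = 1"
    using arc_length_curve_unit_speed[OF c] by (rule AE_completion)
  then obtain s where s: "a < s" "s < b"
    "s \<in> {0<..<L} \<longrightarrow> (F \<circ> c has_vector_derivative tantrix F c s) (at s) \<and> norm (tantrix F c s) = 1"
    using AE_lebesgue_Ioo_ex[OF _ ab(2)] by blast
  then have t: "(F \<circ> c has_vector_derivative tantrix F c s) (at s)" "norm (tantrix F c s) = 1" using ab by auto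
  have "((\<lambda>_. F (c a)) has_vector_derivative 0) (at s)" by simp
  then have "(F \<circ> c has_vector_derivative 0) (at s)"
  proof (rule has_vector_derivative_transform_within_open)
    show "F (c a) = (F \<circ> c) y" if "y \<in> {a<..<b}" for y using const[of y] that by simp
  qed (use s in auto)
  then show False using vector_derivative_unique_at[OF t(1)] t(2) by fastforce
qed

text \<open>Small modulus forces a fine mesh, because \<open>F \<circ> c\<close> is constant on no interval of a fixed grid.\<close>

lemma mesh_le_of_modulus:
  fixes F :: "'m::topological_space \<Rightarrow> real^'n"
  assumes c: "arc_length_curve F c L" and \<delta>: "0 < \<delta>"
  obtains \<epsilon> where "0 < \<epsilon>" "\<And>n t i. modulus F c n t < ennreal \<epsilon> \<Longrightarrow> i < n \<Longrightarrow> 0 \<le> t i \<Longrightarrow> t (Suc i) \<le> L \<Longrightarrow> t (Suc i) - t i \<le> \<delta>"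
proof -
  have L: "0 < L" using c by (simp add: arc_length_curve_def)
  obtain m :: nat where m: "2 * L / \<delta> < real m" using reals_Archimedean2 by blast
  have "0 < 2 * L / \<delta>" using L \<delta> by simp
  then have m0: "0 < real m" using m by linarith
  \<comment> \<open>The width is below half of \<open>\<delta>\<close>, so an interval of parameters
    longer than \<open>\<delta>\<close> contains a whole grid cell, and on each cell the image curve
    moves by at least \<open>\<epsilon>\<close>.\<close>
  define h where "h = L / real m"
  have h: "0 < h" "2 * h < \<delta>" "real m * h = L" using L m m0 \<delta> by (auto simp: h_def field_simps)
  have ex: "\<exists>x\<in>{real j * h..real (Suc j) * h}. F (c x) \<noteq> F (c (real j * h))" if "j < m" for j
  proof (rule arc_length_curve_not_constant[OF c])
    have "real (Suc j) * h \<le> real m * h" using that h(1) by (intro mult_right_mono) auto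
    then show "real (Suc j) * h \<le> L" using h(3) by simp
  qed (use h(1) in auto)
  then obtain x where x: "\<And>j. j < m \<Longrightarrow> x j \<in> {real j * h..real (Suc j) * h} \<and> F (c (x j)) \<noteq> F (c (real j * h))"
    by metis
  define \<epsilon> where "\<epsilon> = Min ((\<lambda>j. dist (F (c (x j))) (F (c (real j * h)))) ` {..<m})"
  have ne: "{..<m} \<noteq> {}" using m0 by auto
  have \<epsilon>: "0 < \<epsilon>" unfolding \<epsilon>_def using ne x by (subst Min_gr_iff) auto
  have \<epsilon>j: "\<epsilon> \<le> dist (F (c (x j))) (F (c (real j * h)))" if "j < m" for j
    unfolding \<epsilon>_def using that by (intro Min_le) auto
  have "t (Suc i) - t i \<le> \<delta>" if mod: "modulus F c n t < ennreal \<epsilon>" "i < n" "0 \<le> t i" "t (Suc i) \<le> L" for n t i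
  proof (rule ccontr)
    assume "\<not> t (Suc i) - t i \<le> \<delta>"
    then have big: "t i + 2 * h < t (Suc i)" using h(2) by simp
    define j where "j = nat \<lceil>t i / h\<rceil>"
    have "0 \<le> t i / h" using that(3) h(1) by simp
    then have j: "t i / h \<le> real j" "real j < t i / h + 1" by (auto simp: j_def) linarith+
    have "t i = (t i / h) * h" using h(1) by simp
    also have "\<dots> \<le> real j * h" using j(1) h(1) by (intro mult_right_mono) auto
    finally have j1: "t i \<le> real j * h" .
    have "real j * h < (t i / h + 1) * h" using j(2) h(1) by (intro mult_strict_right_mono) auto
    also have "\<dots> = t i + h" using h(1) by (simp add: field_simps)
    finally have j2: "real (Suc j) * h < t (Suc i)" using big by (simp add: algebra_simps)
    then have "real (Suc j) * h < real m * h" using that(4) h(3) by simp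
    then have "j < m" using h(1) by simp
    have "ennreal (dist (F (c (x j))) (F (c (real j * h)))) \<le> modulus F c n t"
      by (rule dist_le_modulus[OF mod(2)]) (use x[OF \<open>j < m\<close>] j1 j2 h(1) in \<open>auto simp: algebra_simps\<close>)
    then have "ennreal (dist (F (c (x j))) (F (c (real j * h)))) < ennreal \<epsilon>" using mod(1) by (rule le_less_trans)
    then have "dist (F (c (x j))) (F (c (real j * h))) < \<epsilon>" by (simp add: ennreal_less_iff)
    then show False using \<epsilon>j[OF \<open>j < m\<close>] by simp
  qed
  then show ?thesis using that \<epsilon> by blast
qed

lemma incseq_upto:
  fixes t :: "nat \<Rightarrow> real"
  assumes "\<And>i. i < n \<Longrightarrow> t i \<le> t (Suc i)" "i \<le> j" "j \<le> n" shows "t i \<le> t j"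
  using assms(2,3)
proof (induction j rule: dec_induct)
  case (step k) then show ?case using assms(1)[of k] by simp
qed simp

lemma partition_find:
  fixes t :: "nat \<Rightarrow> real"
  assumes "t 0 \<le> s" "s \<le> t n" "0 < n"
  obtains i where "i < n" "t i \<le> s" "s \<le> t (Suc i)"
proof -
  define k where "k = (LEAST k. s \<le> t (Suc k))"
  have ex: "s \<le> t (Suc (n - 1))" using assms by simp
  have k: "s \<le> t (Suc k)" unfolding k_def by (rule LeastI[of "\<lambda>k. s \<le> t (Suc k)", OF ex])
  have kn: "k \<le> n - 1" unfolding k_def by (rule Least_le) (rule ex)
  have "t k \<le> s"
  proof (cases k)
    case (Suc j)
    then have "\<not> s \<le> t (Suc j)" using not_less_Least[of j "\<lambda>k. s \<le> t (Suc k)"] by (simp add: k_def)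
    then show ?thesis using Suc by simp
  qed (use assms in simp)
  then show ?thesis using k kn assms(3) that[of k] by auto
qed

text \<open>Length is a supremum of chord sums, so some partition \<open>\<sigma>\<close> is within
  \<open>\<eta> / 2\<close> of it. Each of its points is followed within \<open>\<delta>\<close> by
  a point of the fine partition \<open>t\<close>; passing to these costs at most
  \<open>2 * \<delta>\<close> per chord, and the triangle inequality then compares with all chords
  of \<open>t\<close>.\<close>

lemma chord_sum_ge:
  fixes F :: "'m::topological_space \<Rightarrow> real^'n"
  assumes c: "arc_length_curve F c L" and \<eta>: "0 < \<eta>"
  obtains \<delta> where "0 < \<delta>" "\<And>n t. 0 < n \<Longrightarrow> t 0 = 0 \<Longrightarrow> t n = L \<Longrightarrow> (\<And>i. i < n \<Longrightarrow> t i < t (Suc i)) \<Longrightarrow>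
    (\<And>i. i < n \<Longrightarrow> t (Suc i) - t i \<le> \<delta>) \<Longrightarrow> L - \<eta> \<le> (\<Sum>i<n. dist (F (c (t i))) (F (c (t (Suc i)))))"
proof -
  have L: "0 < L" "curve_length 0 L (F \<circ> c) = ennreal L" using c by (simp_all add: arc_length_curve_def)
  have "\<exists>m \<sigma>. (\<forall>i<m. \<sigma> i \<le> \<sigma> (Suc i)) \<and> \<sigma> ` {..m} \<subseteq> {0..L} \<and> L - \<eta> / 2 \<le> (\<Sum>i<m. dist (F (c (\<sigma> i))) (F (c (\<sigma> (Suc i)))))"
  proof (cases "L \<le> \<eta> / 2")
    case True
    then show ?thesis using L by (intro exI[of _ 0] exI[of _ "\<lambda>_. 0"]) auto
  next
    case False
    have "ennreal (L - \<eta> / 2) < curve_length 0 L (F \<circ> c)"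
      unfolding L(2) using \<eta> L(1) False by (intro ennreal_lessI) auto
    then obtain m \<sigma> where \<sigma>: "\<forall>i<m. \<sigma> i \<le> \<sigma> (Suc i)" "\<sigma> ` {..m} \<subseteq> {0..L}"
        "ennreal (L - \<eta> / 2) < (\<Sum>i<m. ennreal (dist ((F \<circ> c) (\<sigma> i)) ((F \<circ> c) (\<sigma> (Suc i)))))"
      unfolding curve_length_def less_SUP_iff by auto
    then have "ennreal (L - \<eta> / 2) < ennreal (\<Sum>i<m. dist (F (c (\<sigma> i))) (F (c (\<sigma> (Suc i)))))" by simp
    then have "L - \<eta> / 2 \<le> (\<Sum>i<m. dist (F (c (\<sigma> i))) (F (c (\<sigma> (Suc i)))))"
      using False by (subst (asm) ennreal_less_iff) auto
    then show ?thesis using \<sigma>(1,2) by blast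
  qed
  then obtain m \<sigma> where \<sigma>': "\<forall>i<m. \<sigma> i \<le> \<sigma> (Suc i)" "\<sigma> ` {..m} \<subseteq> {0..L}"
     "L - \<eta> / 2 \<le> (\<Sum>i<m. dist (F (c (\<sigma> i))) (F (c (\<sigma> (Suc i)))))" by blast
  have \<sigma>: "\<sigma> i \<le> \<sigma> (Suc i)" if "i < m" for i using \<sigma>'(1) that by blast
  have \<sigma>I: "\<sigma> i \<in> {0..L}" if "i \<le> m" for i using \<sigma>'(2) that by blast
  \<comment> \<open>Chosen so that the loss of \<open>2 * \<delta>\<close> on each of the
    \<open>m\<close> chords totals at most \<open>\<eta> / 2\<close>.\<close>
  define \<delta> where "\<delta> = \<eta> / (4 * real (Suc m))"
  have \<delta>: "0 < \<delta>" "2 * real m * \<delta> \<le> \<eta> / 2" using \<eta> by (auto simp: \<delta>_def field_simps)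
  have "L - \<eta> \<le> (\<Sum>i<n. dist (F (c (t i))) (F (c (t (Suc i)))))"
    if t: "0 < n" "t 0 = 0" "t n = L" "\<And>i. i < n \<Longrightarrow> t i < t (Suc i)" "\<And>i. i < n \<Longrightarrow> t (Suc i) - t i \<le> \<delta>" for n t
  proof -
    have mono: "t i \<le> t j" if "i \<le> j" "j \<le> n" for i j using incseq_upto[of n t] t(4) that less_imp_le by blast
    have tI: "0 \<le> t i" "t i \<le> L" if "i \<le> n" for i using mono[of 0 i] mono[of i n] t that by auto
    define ix where "ix s = (LEAST k. s \<le> t k)" for s
    have ix: "s \<le> t (ix s)" "ix s \<le> n" "t (ix s) - s \<le> \<delta>" if "s \<in> {0..L}" for s
    proof -
      have ex: "s \<le> t n" using that t by auto
      show 1: "s \<le> t (ix s)" unfolding ix_def by (rule LeastI[of "\<lambda>k. s \<le> t k", OF ex])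
      show 2: "ix s \<le> n" unfolding ix_def by (rule Least_le) (rule ex)
      show "t (ix s) - s \<le> \<delta>"
      proof (cases "ix s")
        case 0 then show ?thesis using t(2) that \<delta>(1) by auto
      next
        case (Suc j)
        then have "\<not> s \<le> t j" using not_less_Least[of j "\<lambda>k. s \<le> t k"] by (simp add: ix_def)
        then show ?thesis using t(5)[of j] Suc 2 by simp
      qed
    qed
    have ix_mono: "ix s \<le> ix r" if "s \<le> r" "r \<in> {0..L}" for s r
      unfolding ix_def[of s] by (rule Least_le) (use ix(1)[OF that(2)] that(1) in auto)
    define G where "G k = (\<Sum>i<k. dist (F (c (t i))) (F (c (t (Suc i)))))" for k
    have Gd: "dist (F (c (t i))) (F (c (t j))) \<le> G j - G i" if "i \<le> j" for i j
      using that
    proof (induction j rule: dec_induct)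
      case (step k)
      have "dist (F (c (t i))) (F (c (t (Suc k)))) \<le> dist (F (c (t i))) (F (c (t k))) + dist (F (c (t k))) (F (c (t (Suc k))))"
        by (rule dist_triangle)
      then show ?case using step by (simp add: G_def)
    qed simp
    have Gm: "G i \<le> G j" if "i \<le> j" for i j using order_trans[OF zero_le_dist Gd[OF that]] by simp
    have "dist (F (c (\<sigma> j))) (F (c (\<sigma> (Suc j)))) \<le> (G (ix (\<sigma> (Suc j))) - G (ix (\<sigma> j))) + 2 * \<delta>" if j: "j < m" for j
    proof -
      have s: "\<sigma> j \<in> {0..L}" "\<sigma> (Suc j) \<in> {0..L}" "\<sigma> j \<le> \<sigma> (Suc j)" using \<sigma>[OF j] \<sigma>I[of j] \<sigma>I[of "Suc j"] j by auto
      have near: "dist (F (c s)) (F (c (t (ix s)))) \<le> \<delta>" if "s \<in> {0..L}" for s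
      proof -
        have "dist (F (c s)) (F (c (t (ix s)))) \<le> t (ix s) - s"
          using arc_length_curve_lipschitz[OF c, of s "t (ix s)"] ix[OF that] tI(2)[OF ix(2)[OF that]] that by auto
        then show ?thesis using ix(3)[OF that] by simp
      qed
      have "dist (F (c (\<sigma> j))) (F (c (\<sigma> (Suc j)))) \<le> dist (F (c (\<sigma> j))) (F (c (t (ix (\<sigma> j)))))
          + dist (F (c (t (ix (\<sigma> j))))) (F (c (t (ix (\<sigma> (Suc j)))))) + dist (F (c (t (ix (\<sigma> (Suc j)))))) (F (c (\<sigma> (Suc j))))"
        by (meson add_right_mono dist_triangle order_trans)
      then show ?thesis using near[OF s(1)] near[OF s(2)] Gd[OF ix_mono[OF s(3,2)]] by (simp add: dist_commute)
    qed
    then have "(\<Sum>j<m. dist (F (c (\<sigma> j))) (F (c (\<sigma> (Suc j))))) \<le> (\<Sum>j<m. (G (ix (\<sigma> (Suc j))) - G (ix (\<sigma> j))) + 2 * \<delta>)"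
      by (intro sum_mono) auto
    also have "\<dots> = (G (ix (\<sigma> m)) - G (ix (\<sigma> 0))) + 2 * real m * \<delta>"
      using sum_lessThan_telescope[of "\<lambda>j. G (ix (\<sigma> j))" m] by (simp add: sum.distrib)
    also have "\<dots> \<le> G n + \<eta> / 2"
      using Gm[OF ix(2)[OF \<sigma>I[of m]]] Gm[of 0 "ix (\<sigma> 0)"] \<delta>(2) by (simp add: G_def)
    finally show ?thesis using \<sigma>'(3) by (simp add: G_def)
  qed
  then show ?thesis using that \<delta>(1) by blast
qed

text \<open>Length is a supremum of chord sums, so a bound from below has to go through chords: on a
  fine grid the velocity is almost constant by uniform continuity, hence each chord is almost
  \<open>v\<close> times its parameter length.\<close>

lemma constant_speed_length_ge:
  fixes g :: "real \<Rightarrow> 'b::euclidean_space"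
  assumes ab: "a < b" and g: "\<And>s. s \<in> {a..b} \<Longrightarrow> (g has_vector_derivative d s) (at s within {a..b})"
    and cont: "continuous_on {a..b} d" and v: "\<And>s. s \<in> {a..b} \<Longrightarrow> norm (d s) = v"
  shows "ennreal (v * (b - a)) \<le> curve_length a b g"
proof (cases "curve_length a b g = \<infinity>")
  case False
  then obtain \<Lambda> where \<Lambda>: "0 \<le> \<Lambda>" "curve_length a b g = ennreal \<Lambda>" by (cases "curve_length a b g") auto
  have "v * (b - a) \<le> \<Lambda> + e" if e: "e > 0" for e
  proof -
    define e' where "e' = e / (b - a)"
    have e': "e' > 0" using e ab by (simp add: e'_def)
    have "uniformly_continuous_on {a..b} d" using cont by (rule compact_uniformly_continuous) simp
    then obtain \<delta> where \<delta>: "\<delta> > 0" "\<And>s r. s \<in> {a..b} \<Longrightarrow> r \<in> {a..b} \<Longrightarrow> dist r s < \<delta> \<Longrightarrow> dist (d r) (d s) < e'"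
      unfolding uniformly_continuous_on_def using e' by blast
    obtain m :: nat where m: "(b - a) / \<delta> < real m" using reals_Archimedean2 by blast
    have "0 < (b - a) / \<delta>" using ab \<delta> by simp
    then have m0: "0 < real m" using m by linarith
    define h where "h = (b - a) / real m"
    have h: "0 < h" "h < \<delta>" "real m * h = b - a" using ab m m0 \<delta> by (auto simp: h_def field_simps)
    define p where "p i = a + real i * h" for i
    have p: "p i \<in> {a..b}" if "i \<le> m" for i
    proof -
      have "real i * h \<le> real m * h" using that h(1) by (intro mult_right_mono) auto
      then show ?thesis using h by (simp add: p_def)
    qed
    have ps: "p (Suc i) = p i + h" for i by (simp add: p_def algebra_simps)
    have chord: "(v - e') * h \<le> dist (g (p i)) (g (p (Suc i)))" if i: "i < m" for i
    proof -
      have pi: "p i \<in> {a..b}" "p (Suc i) \<in> {a..b}" using p[of i] p[of "Suc i"] i by auto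
      have sub: "{p i..p (Suc i)} \<subseteq> {a..b}" using pi by auto
      have "norm ((g (p (Suc i)) - p (Suc i) *\<^sub>R d (p i)) - (g (p i) - p i *\<^sub>R d (p i))) \<le> e' * norm (p (Suc i) - p i)"
      proof (rule differentiable_bound[where S="{p i..p (Suc i)}" and f'="\<lambda>x h. h *\<^sub>R (d x - d (p i))"])
        fix x assume x: "x \<in> {p i..p (Suc i)}"
        then have xab: "x \<in> {a..b}" using sub by blast
        have "((\<lambda>x. g x - x *\<^sub>R d (p i)) has_vector_derivative (d x - d (p i))) (at x within {a..b})"
          by (auto intro!: derivative_eq_intros g[OF xab])
        then have "((\<lambda>x. g x - x *\<^sub>R d (p i)) has_vector_derivative (d x - d (p i))) (at x within {p i..p (Suc i)})"
          using sub by (rule has_vector_derivative_within_subset)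
        then show "((\<lambda>x. g x - x *\<^sub>R d (p i)) has_derivative (\<lambda>h. h *\<^sub>R (d x - d (p i)))) (at x within {p i..p (Suc i)})"
          by (simp add: has_vector_derivative_def)
        have "dist x (p i) < \<delta>" using x ps h by (auto simp: dist_real_def)
        then have "norm (d x - d (p i)) < e'" using \<delta>(2)[OF pi(1) xab] by (simp add: dist_norm)
        then show "onorm (\<lambda>h. h *\<^sub>R (d x - d (p i))) \<le> e'"
          by (intro onorm_bound) (use e' in \<open>auto simp: mult.commute[of "\<bar>_\<bar>"] intro!: mult_right_mono\<close>)
      qed (use ps h in auto)
      then have "norm ((g (p (Suc i)) - g (p i)) - h *\<^sub>R d (p i)) \<le> e' * h"
        using h(1) by (simp add: ps algebra_simps)
      moreover have "norm (h *\<^sub>R d (p i)) = v * h" using v[OF pi(1)] h(1) by simp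
      ultimately have "v * h - e' * h \<le> norm (g (p (Suc i)) - g (p i))"
        using norm_triangle_ineq2[of "h *\<^sub>R d (p i)" "h *\<^sub>R d (p i) - (g (p (Suc i)) - g (p i))"]
        by (simp add: norm_minus_commute)
      then show ?thesis by (simp add: dist_norm norm_minus_commute left_diff_distrib)
    qed
    have "(v - e') * (b - a) = (\<Sum>i<m. (v - e') * h)" using h(3) by (simp add: mult.left_commute)
    also have "\<dots> \<le> (\<Sum>i<m. dist (g (p i)) (g (p (Suc i))))" by (rule sum_mono) (use chord in auto)
    finally have le: "(v - e') * (b - a) \<le> (\<Sum>i<m. dist (g (p i)) (g (p (Suc i))))" .
    have "ennreal (\<Sum>i<m. dist (g (p i)) (g (p (Suc i)))) = (\<Sum>i<m. ennreal (dist (g (p i)) (g (p (Suc i)))))"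
      by (rule sum_ennreal[symmetric]) simp
    also have "\<dots> \<le> ennreal \<Lambda>"
      unfolding \<Lambda>(2)[symmetric] by (rule curve_length_ge) (use ps p h(1) in auto)
    finally have "(\<Sum>i<m. dist (g (p i)) (g (p (Suc i)))) \<le> \<Lambda>" using \<Lambda>(1) by (simp add: ennreal_le_iff)
    then have "(v - e') * (b - a) \<le> \<Lambda>" using le by simp
    moreover have "e' * (b - a) = e" using ab by (simp add: e'_def)
    ultimately show ?thesis by (simp add: left_diff_distrib)
  qed
  then have "v * (b - a) \<le> \<Lambda>" by (rule field_le_epsilon)
  then show ?thesis unfolding \<Lambda>(2) by (rule ennreal_leI)
qed simp

lemma geodesic_dist_le_arc:
  fixes F :: "'m::topological_space \<Rightarrow> real^'n"
  assumes c: "arc_length_curve F c L" and ab: "0 \<le> a" "a \<le> b" "b \<le> L"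
  shows "geodesic_dist F (c a) (c b) \<le> ennreal (b - a)"
proof -
  define \<gamma> where "\<gamma> s = c (a + s * (b - a))" for s
  have r: "0 \<le> a + s * (b - a) \<and> a + s * (b - a) \<le> L" if "0 \<le> s" "s \<le> 1" for s
    using that ab mult_left_le_one_le[of "b - a" s] by auto
  have "continuous_on {0..1} \<gamma>"
    unfolding \<gamma>_def
    by (rule continuous_on_compose2[of "{0..L}" c]) (use c r in \<open>auto simp: arc_length_curve_def intro!: continuous_intros\<close>)
  then have "geodesic_dist F (c a) (c b) \<le> curve_length 0 1 (F \<circ> \<gamma>)"
    unfolding geodesic_dist_def by (intro INF_lower) (auto simp: \<gamma>_def)
  also have "\<dots> \<le> ennreal ((b - a) * (1 - 0))"
  proof (rule curve_length_lipschitz_le)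
    fix x y :: real assume xy: "0 \<le> x" "x \<le> y" "y \<le> 1"
    have "x * (b - a) \<le> y * (b - a)" using xy ab by (intro mult_right_mono) auto
    then show "dist ((F \<circ> \<gamma>) x) ((F \<circ> \<gamma>) y) \<le> (b - a) * (y - x)"
      using arc_length_curve_lipschitz[OF c, of "a + x * (b - a)" "a + y * (b - a)"] r[of x] r[of y] xy
      by (simp add: \<gamma>_def algebra_simps)
  qed (use ab in auto)
  finally show ?thesis by simp
qed

text \<open>Comparing speeds and lengths piece by piece shows that vertices are attained at almost the same
  parameters on the polygonal and on the curve.\<close>

lemma inscribed_polygonal_close:
  fixes F :: "'m::t2_space \<Rightarrow> real^'n" and \<A> :: "'m atlas"
  assumes c: "arc_length_curve F c L"
    and ins: "inscribed \<A> F c 0 L n t \<tau> P" and ends: "t 0 = 0" "t n = L" "\<tau> 0 = 0" "\<tau> n = L"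
    and cv: "const_velocity F n \<tau> P"
    and mesh: "\<And>i. i < n \<Longrightarrow> t (Suc i) - t i \<le> \<delta>"
    and chord: "L - \<eta> \<le> (\<Sum>i<n. dist (F (c (t i))) (F (c (t (Suc i)))))" and \<eta>: "\<eta> \<le> L / 2"
    and s: "s \<in> {0..L}"
  shows "\<exists>K. connected K \<and> c s \<in> K \<and> P s \<in> K \<and> F ` K \<subseteq> cball (F (c s)) (4 * \<delta> + \<eta>)"
proof -
  have L: "0 < L" and cc: "continuous_on {0..L} c" using c by (simp_all add: arc_length_curve_def)
  have n: "0 < n" and ga: "\<And>i. i < n \<Longrightarrow> geodesic_arc \<A> F P (\<tau> i) (\<tau> (Suc i))"
    and tm: "\<And>i. i < n \<Longrightarrow> t i < t (Suc i)" and Pv: "\<And>i. i \<le> n \<Longrightarrow> P (\<tau> i) = c (t i)"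
    and mini: "\<And>i. i < n \<Longrightarrow> minimizing F P (\<tau> i) (\<tau> (Suc i))"
    using ins by (auto simp: inscribed_def polygonal_def)
  obtain v where v: "\<And>i s. i < n \<Longrightarrow> s \<in> {\<tau> i..\<tau> (Suc i)} \<Longrightarrow>
      norm (vector_derivative (F \<circ> P) (at s within {\<tau> i..\<tau> (Suc i)})) = v"
    using cv unfolding const_velocity_def by blast
  have \<tau>m: "\<tau> i < \<tau> (Suc i)" if "i < n" for i using ga[OF that] by (simp add: geodesic_arc_def)
  have tI: "0 \<le> t i" "t i \<le> L" if "i \<le> n" for i
    using incseq_upto[of n t 0 i] incseq_upto[of n t i n] tm ends that less_imp_le by auto
  have piece: "v * (\<tau> (Suc i) - \<tau> i) \<le> t (Suc i) - t i"
    "\<And>x y. x \<in> {\<tau> i..\<tau> (Suc i)} \<Longrightarrow> y \<in> {\<tau> i..\<tau> (Suc i)} \<Longrightarrow> dist (F (P x)) (F (P y)) \<le> v * \<bar>x - y\<bar>"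
    "continuous_on {\<tau> i..\<tau> (Suc i)} P" if i: "i < n" for i
  proof -
    let ?T = "{\<tau> i..\<tau> (Suc i)}"
    obtain d w where dw: "\<And>s. s \<in> ?T \<Longrightarrow> (F \<circ> P has_vector_derivative d s) (at s within ?T)"
        "\<And>s. s \<in> ?T \<Longrightarrow> (d has_vector_derivative w s) (at s within ?T)"
      using ga[OF i] unfolding geodesic_arc_def by blast
    show "continuous_on ?T P" using ga[OF i] by (simp add: geodesic_arc_def)
    have dv: "norm (d s) = v" if "s \<in> ?T" for s
      using v[OF i that] vector_derivative_within_cbox[of "\<tau> i" "\<tau> (Suc i)" s "F \<circ> P" "d s"] dw(1)[OF that] \<tau>m[OF i] that
      by simp
    have "continuous_on ?T d"
      unfolding continuous_on_eq_continuous_within using has_vector_derivative_continuous[OF dw(2)] by blast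
    then have "ennreal (v * (\<tau> (Suc i) - \<tau> i)) \<le> curve_length (\<tau> i) (\<tau> (Suc i)) (F \<circ> P)"
      by (intro constant_speed_length_ge[OF \<tau>m[OF i] dw(1) _ dv])
    also have "\<dots> = geodesic_dist F (c (t i)) (c (t (Suc i)))"
      using mini[OF i] Pv[of i] Pv[of "Suc i"] i by (simp add: minimizing_def)
    also have "\<dots> \<le> ennreal (t (Suc i) - t i)"
      by (rule geodesic_dist_le_arc[OF c]) (use tI[of i] tI[of "Suc i"] tm[OF i] i in auto)
    finally show "v * (\<tau> (Suc i) - \<tau> i) \<le> t (Suc i) - t i" using tm[OF i] by (simp add: ennreal_le_iff)
    fix x y assume xy: "x \<in> ?T" "y \<in> ?T"
    have "norm ((F \<circ> P) x - (F \<circ> P) y) \<le> v * norm (x - y)"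
    proof (rule differentiable_bound[where S="?T" and f'="\<lambda>x h. h *\<^sub>R d x"])
      fix z assume z: "z \<in> ?T"
      show "(F \<circ> P has_derivative (\<lambda>h. h *\<^sub>R d z)) (at z within ?T)" using dw(1)[OF z] by (simp add: has_vector_derivative_def)
      show "onorm (\<lambda>h. h *\<^sub>R d z) \<le> v"
        by (rule onorm_bound) (use dv[OF z] norm_ge_zero[of "d z"] in auto)
    qed (use xy in auto)
    then show "dist (F (P x)) (F (P y)) \<le> v * \<bar>x - y\<bar>" by (simp add: dist_norm)
  qed
  have part: "v * (\<tau> j - \<tau> i) \<le> t j - t i" if "i \<le> j" "j \<le> n" for i j
    using that
  proof (induction j rule: dec_induct)
    case (step k)
    then show ?case using piece(1)[of k] by (simp add: algebra_simps)
  qed simp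
  have "L - \<eta> \<le> (\<Sum>i<n. v * \<tau> (Suc i) - v * \<tau> i)"
  proof (rule order_trans[OF chord sum_mono])
    fix i assume "i \<in> {..<n}"
    then have i: "i < n" by simp
    show "dist (F (c (t i))) (F (c (t (Suc i)))) \<le> v * \<tau> (Suc i) - v * \<tau> i"
      using piece(2)[OF i, of "\<tau> i" "\<tau> (Suc i)"] \<tau>m[OF i] Pv[of i] Pv[of "Suc i"] i by (simp add: algebra_simps)
  qed
  also have "\<dots> = v * L" using sum_lessThan_telescope[of "\<lambda>i. v * \<tau> i" n] ends by simp
  finally have vL: "L - \<eta> \<le> v * L" .
  have "v * L \<le> L" using part[of 0 n] ends by simp
  then have v1: "v \<le> 1" using L by simp
  \<comment> \<open>The bound \<open>\<eta> \<le> L / 2\<close> keeps the speed at least 1/2, so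
    that short arcs of the polygonal also have short parameter intervals.\<close>
  have "L * (1/2) \<le> L * v" using vL \<eta> by (simp add: mult.commute)
  then have v2: "1/2 \<le> v" using L by (simp only: mult_le_cancel_left_pos)
  obtain i where i: "i < n" "\<tau> i \<le> s" "s \<le> \<tau> (Suc i)"
    using partition_find[of \<tau> s n] ends s n by auto
  have \<tau>0: "0 \<le> \<tau> i" "\<tau> i \<le> L" using incseq_upto[of n \<tau> 0 i] incseq_upto[of n \<tau> i n] \<tau>m ends i less_imp_le by auto
  \<comment> \<open>The polygonal is no longer than the curve, both before and after the vertex;
    since \<open>(1 - v) * L \<le> \<eta>\<close>, this traps \<open>t i\<close> within
    \<open>\<eta>\<close> of \<open>\<tau> i\<close>.\<close>
  have "v * \<tau> i \<le> t i" "v * (L - \<tau> i) \<le> L - t i" using part[of 0 i] part[of i n] i ends by auto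
  moreover have "(1 - v) * \<tau> i \<le> (1 - v) * L" using v1 \<tau>0 by (intro mult_left_mono) auto
  ultimately have "t i \<le> \<tau> i + \<eta>" "\<tau> i - \<eta> \<le> t i"
    using vL mult_right_mono[OF v1, of "\<tau> i"] \<tau>0 by (auto simp: algebra_simps)
  moreover have len: "\<tau> (Suc i) - \<tau> i \<le> 2 * \<delta>"
  proof -
    have "(1/2) * (\<tau> (Suc i) - \<tau> i) \<le> v * (\<tau> (Suc i) - \<tau> i)" using v2 \<tau>m[OF i(1)] by (intro mult_right_mono) auto
    then show ?thesis using piece(1)[OF i(1)] mesh[OF i(1)] by simp
  qed
  ultimately have ts: "\<bar>t i - s\<bar> \<le> 2 * \<delta> + \<eta>" using i by auto
  have tiI: "t i \<in> {0..L}" using tI[of i] i by auto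
  \<comment> \<open>An arc of the polygonal and an arc of the curve, joined at the common vertex
    \<open>P (\<tau> i) = c (t i)\<close>; they connect \<open>P s\<close> to \<open>c s\<close>
    inside the surface without large excursions.\<close>
  define K where "K = P ` {\<tau> i..s} \<union> c ` {min (t i) s..max (t i) s}"
  have "connected (P ` {\<tau> i..s})"
    using piece(3)[OF i(1)] i by (intro connected_continuous_image) (auto intro: continuous_on_subset)
  moreover have "connected (c ` {min (t i) s..max (t i) s})"
  proof (rule connected_continuous_image)
    have "{min (t i) s..max (t i) s} \<subseteq> {0..L}" using tiI s by auto
    then show "continuous_on {min (t i) s..max (t i) s} c" by (rule continuous_on_subset[OF cc])
  qed simp
  moreover have "P (\<tau> i) \<in> P ` {\<tau> i..s}" using i by (intro imageI) auto
  moreover have "P (\<tau> i) \<in> c ` {min (t i) s..max (t i) s}"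
    using i Pv[of i] by (auto intro!: imageI)
  ultimately have "connected K" unfolding K_def by (intro connected_Un) auto
  moreover have "c s \<in> K" "P s \<in> K" using i by (auto simp: K_def)
  moreover have "F ` K \<subseteq> cball (F (c s)) (4 * \<delta> + \<eta>)"
  proof -
    have \<delta>0: "0 \<le> \<delta>" using len \<tau>m[OF i(1)] by simp
    have near: "dist (F (c r)) (F (c s)) \<le> \<bar>r - s\<bar>" if "r \<in> {0..L}" for r
      using arc_length_curve_lipschitz[OF c, of r s] arc_length_curve_lipschitz[OF c, of s r] that s
      by (cases "r \<le> s") (auto simp: dist_commute)
    have "dist (F (P x)) (F (c s)) \<le> 4 * \<delta> + \<eta>" if x: "x \<in> {\<tau> i..s}" for x
    proof -
      have "dist (F (P x)) (F (P (\<tau> i))) \<le> v * \<bar>x - \<tau> i\<bar>" by (rule piece(2)[OF i(1)]) (use x i in auto)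
      also have "\<dots> \<le> 1 * (2 * \<delta>)" using v1 v2 x i len by (intro mult_mono) auto
      finally have "dist (F (P x)) (F (c (t i))) \<le> 2 * \<delta>" using Pv[of i] i by simp
      moreover have "dist (F (c (t i))) (F (c s)) \<le> 2 * \<delta> + \<eta>" using near[OF tiI] ts by simp
      ultimately show ?thesis using dist_triangle[of "F (P x)" "F (c s)" "F (c (t i))"] by simp
    qed
    moreover have "dist (F (c r)) (F (c s)) \<le> 4 * \<delta> + \<eta>" if r: "r \<in> {min (t i) s..max (t i) s}" for r
    proof -
      have "r \<in> {0..L}" "\<bar>r - s\<bar> \<le> \<bar>t i - s\<bar>" using r tiI s by auto
      then show ?thesis using near[of r] ts \<delta>0 by simp
    qed
    ultimately show ?thesis unfolding K_def by (auto simp: dist_commute)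
  qed
  ultimately show ?thesis by blast
qed

section \<open>Absolutely continuous representatives of Sobolev functions\<close>

lemma borel_version:
  fixes g :: "real \<Rightarrow> 'b::euclidean_space"
  assumes g: "integrable (lebesgue_on S) g" and S: "S \<in> sets lebesgue"
  obtains g0 where "integrable lborel g0" "AE x in lebesgue_on S. g x = g0 x"
proof -
  define h where "h x = (if x \<in> S then g x else 0)" for x
  have h: "integrable lebesgue h"
    using Lebesgue_Measure.integrable_restrict_UNIV[OF S, of g] g by (simp add: h_def[abs_def])
  have "\<exists>k\<in>borel_measurable lborel. AE x in lborel. h x \<bullet> i = k x" for i
    by (rule completion_ex_borel_measurable_real)
      (use borel_measurable_integrable[OF h] in \<open>auto intro: borel_measurable_inner\<close>)
  then obtain k where k: "\<And>i. k i \<in> borel_measurable lborel" "\<And>i. AE x in lborel. h x \<bullet> i = k i x" by metis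
  define g0 where "g0 x = (\<Sum>i\<in>Basis. k i x *\<^sub>R i)" for x
  have g0m: "g0 \<in> borel_measurable lborel" unfolding g0_def using k(1) by measurable
  have "AE x in lborel. \<forall>i\<in>Basis. h x \<bullet> i = k i x" using k(2) by (intro AE_finite_allI) auto
  then have eq: "AE x in lborel. h x = g0 x"
  proof eventually_elim
    case (elim x)
    then show ?case unfolding g0_def by (subst euclidean_representation[symmetric, of "h x"]) (auto intro!: sum.cong)
  qed
  then have eql: "AE x in lebesgue. h x = g0 x" by (rule AE_completion)
  have "integrable lebesgue g0"
    using integrable_cong_AE[OF _ _ eql] h g0m by (auto simp: measurable_completion)
  then have "integrable lborel g0" using g0m by (simp add: integrable_completion)
  moreover have "AE x in lebesgue_on S. g x = g0 x"
    using eql S by (subst AE_restrict_space_iff) (auto simp: h_def elim!: eventually_mono split: if_splits)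
  ultimately show ?thesis using that by blast
qed

text \<open>With \<open>N\<close> empty the calculus of densities specializes to absolutely
  continuous functions on the interval, so that its results apply to weak derivatives.\<close>

lemma bv_measure_lborel:
  assumes "0 < L"
  shows "bv_measure (density lborel (indicator {0<..<L})) L {}"
proof (intro bv_measure.intro bv_measure_axioms.intro finite_measureI)
  show "emeasure (density lborel (indicator {0<..<L})) (space (density lborel (indicator {0<..<L}))) \<noteq> \<infinity>"
    using assms by (subst emeasure_density) auto
  fix A :: "real set" assume "A \<in> sets borel"
  then show "emeasure (density lborel (indicator {0<..<L})) (A - {}) = emeasure lborel (A \<inter> {0<..<L})"
    by (subst emeasure_density) (auto simp: indicator_inter_arith[symmetric] Int_commute)
qed (use assms in auto)

text \<open>Integration by parts gives the indefinite integral of a Borel version of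
  \<open>g\<close> the same weak derivative as \<open>f\<close>; the lemma of du Bois-Reymond leaves
  a constant, which is absorbed into \<open>f0\<close>.\<close>

lemma weak_deriv_representative:
  fixes f g :: "real \<Rightarrow> 'b::euclidean_space"
  assumes L: "0 < L" and w: "weak_deriv {0<..<L} f g"
  obtains f0 g0 where "integrable lborel g0" "AE x in lebesgue_on {0<..<L}. g x = g0 x"
    "\<And>x y. x \<le> y \<Longrightarrow> f0 y - f0 x = (LINT s:{x<..y}|lborel. g0 s)"
    "AE x in lebesgue_on {0<..<L}. f x = f0 x"
proof -
  let ?\<Lambda> = "lebesgue_on {0<..<L}"
  have f: "integrable ?\<Lambda> f" and g: "integrable ?\<Lambda> g"
    and fg: "\<And>\<phi>. test_function {0<..<L} \<phi> \<Longrightarrow> (LINT x|?\<Lambda>. deriv \<phi> x *\<^sub>R f x) = - (LINT x|?\<Lambda>. \<phi> x *\<^sub>R g x)"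
    using w by (auto simp: weak_deriv_def)
  obtain g0 where g0: "integrable lborel g0" "AE x in ?\<Lambda>. g x = g0 x" by (rule borel_version[OF g]) auto
  interpret bv_measure "density lborel (indicator {0<..<L})" L "{}" by (rule bv_measure_lborel[OF L])
  let ?M = "density lborel (indicator {0<..<L} :: real \<Rightarrow> ennreal)"
  define f0 where "f0 x = (LINT s:{..x}|lborel. g0 s)" for x
  have f0: "f0 y - f0 x = (LINT s:{x<..y}|lborel. g0 s)" if "x \<le> y" for x y
  proof -
    have "(LINT s:{..x} \<union> {x<..y}|lborel. g0 s) = f0 x + (LINT s:{x<..y}|lborel. g0 s)"
      unfolding f0_def by (rule set_integral_Un) (auto intro!: integrable_imp_set_integrable g0)
    moreover have "{..x} \<union> {x<..y} = {..y}" using that by auto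
    ultimately show ?thesis by (simp add: f0_def)
  qed
  have d: "has_density g0 f0" using has_density_lborel[OF g0(1), of f0] f0 by simp
  note f0int = has_density_integrable[OF d]
  have "(LINT x|?\<Lambda>. deriv \<phi> x *\<^sub>R (f x - f0 x)) = 0" if \<phi>: "test_function {0<..<L} \<phi>" for \<phi>
  proof -
    obtain B where B: "\<And>x. \<bar>deriv \<phi> x\<bar> \<le> B" using test_function_bounded[OF \<phi> L] by metis
    have [measurable]: "\<phi> \<in> borel_measurable borel" "g0 \<in> borel_measurable borel"
      using test_functionD(2)[OF \<phi>] borel_measurable_integrable[OF g0(1)]
      by (auto intro: borel_measurable_continuous_onI)
    have "(LINT x|?M. \<phi> x *\<^sub>R g0 x) = (LINT x|lborel. indicator {0<..<L} x *\<^sub>R (\<phi> x *\<^sub>R g0 x))"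
    proof -
      have "?M = density lborel (\<lambda>x. ennreal (indicator {0<..<L} x))" by (simp add: ennreal_indicator)
      then show ?thesis by (simp only:) (subst integral_density, auto)
    qed
    also have "\<dots> = (LINT x|lebesgue. indicator {0<..<L} x *\<^sub>R (\<phi> x *\<^sub>R g0 x))"
      by (rule integral_completion[symmetric]) measurable
    also have "\<dots> = (LINT x|?\<Lambda>. \<phi> x *\<^sub>R g0 x)" by (rule integral_restrict_space[symmetric]) auto
    also have "\<dots> = (LINT x|?\<Lambda>. \<phi> x *\<^sub>R g x)"
    proof (rule integral_cong_AE)
      show "(\<lambda>x. \<phi> x *\<^sub>R g x) \<in> borel_measurable ?\<Lambda>"
        by (intro borel_measurable_scaleR borel_measurable_integrable[OF g] borel_measurable_lebesgue_on) measurable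
      show "(\<lambda>x. \<phi> x *\<^sub>R g0 x) \<in> borel_measurable ?\<Lambda>" by (rule borel_measurable_lebesgue_on) measurable
      show "AE x in ?\<Lambda>. \<phi> x *\<^sub>R g0 x = \<phi> x *\<^sub>R g x" using g0(2) by eventually_elim simp
    qed
    finally have "(LINT x|?\<Lambda>. deriv \<phi> x *\<^sub>R f0 x) = (LINT x|?\<Lambda>. deriv \<phi> x *\<^sub>R f x)"
      using integration_by_parts[OF d \<phi>] fg[OF \<phi>] by simp
    moreover have m: "deriv \<phi> \<in> borel_measurable ?\<Lambda>"
      by (rule continuous_borel_measurable_lebesgue_on[OF test_functionD(3)[OF \<phi>]])
    have "integrable ?\<Lambda> (\<lambda>x. deriv \<phi> x *\<^sub>R f x)" "integrable ?\<Lambda> (\<lambda>x. deriv \<phi> x *\<^sub>R f0 x)"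
      using integrable_bounded_scaleR[OF f m] integrable_bounded_scaleR[OF f0int m] B by blast+
    ultimately show ?thesis by (simp add: scaleR_diff_right)
  qed
  then obtain K where K: "AE x in ?\<Lambda>. f x - f0 x = K"
    using zero_weak_derivative_imp_const[OF L, of "\<lambda>x. f x - f0 x"] f f0int by auto
  have "AE x in ?\<Lambda>. f x = K + f0 x" using K by eventually_elim (auto simp: algebra_simps)
  then show ?thesis using that[OF g0, of "\<lambda>x. K + f0 x"] f0 by simp
qed

lemma indefinite_integral_right_cont:
  fixes g :: "real \<Rightarrow> 'b::euclidean_space"
  assumes "0 < L" "integrable lborel g" "\<And>x y. x \<le> y \<Longrightarrow> f y - f x = (LINT s:{x<..y}|lborel. g s)" "s \<in> {0<..<L}"
  shows "(f \<longlongrightarrow> f s) (at_right s)"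
proof -
  interpret bv_measure "density lborel (indicator {0<..<L})" L "{}" by (rule bv_measure_lborel[OF assms(1)])
  have "has_density g f" using has_density_lborel[OF assms(2), of f] assms(3) by simp
  then show ?thesis using assms(4) by (rule has_density_right_cont)
qed

section \<open>Convergence of the polygonals and of their tangent planes\<close>

lemma inscribed_polygonals_converge:
  fixes F :: "'m::t2_space \<Rightarrow> real^'n" and \<A> :: "'m atlas"
  assumes c: "arc_length_curve F c L"
    and P: "\<And>h. inscribed \<A> F c 0 L (n h) (t h) (\<tau> h) (P h) \<and> t h 0 = 0 \<and> t h (n h) = L \<and>
      \<tau> h 0 = 0 \<and> \<tau> h (n h) = L \<and> const_velocity F (n h) (\<tau> h) (P h)"
    and mod: "(\<lambda>h. modulus F c (n h) (t h)) \<longlonglongrightarrow> 0"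
    and s: "s \<in> {0..L}" and e: "0 < e"
  shows "\<forall>\<^sub>F h in sequentially. \<exists>K. connected K \<and> c s \<in> K \<and> P h s \<in> K \<and> F ` K \<subseteq> ball (F (c s)) e"
proof -
  have L: "0 < L" using c by (simp add: arc_length_curve_def)
  \<comment> \<open>The distance bound will be \<open>4 * \<delta> + \<eta>\<close>; with
    \<open>\<delta> \<le> e / 16\<close> and \<open>\<eta> \<le> e / 4\<close> it stays at most
    \<open>e / 2\<close>. The cap \<open>L / 2\<close> guards the speed of the polygonals.\<close>
  define \<eta> where "\<eta> = min (e / 4) (L / 2)"
  have \<eta>: "0 < \<eta>" "\<eta> \<le> L / 2" "\<eta> \<le> e / 4" using e L by (auto simp: \<eta>_def)
  obtain \<delta>1 where \<delta>1: "0 < \<delta>1" "\<And>n t. 0 < n \<Longrightarrow> t 0 = 0 \<Longrightarrow> t n = L \<Longrightarrow> (\<And>i. i < n \<Longrightarrow> t i < t (Suc i)) \<Longrightarrow>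
    (\<And>i. i < n \<Longrightarrow> t (Suc i) - t i \<le> \<delta>1) \<Longrightarrow> L - \<eta> \<le> (\<Sum>i<n. dist (F (c (t i))) (F (c (t (Suc i)))))"
    by (rule chord_sum_ge[OF c \<eta>(1)]) blast
  define \<delta> where "\<delta> = min \<delta>1 (e / 16)"
  have \<delta>: "0 < \<delta>" "\<delta> \<le> \<delta>1" "\<delta> \<le> e / 16" using \<delta>1(1) e by (auto simp: \<delta>_def)
  obtain \<epsilon> where \<epsilon>: "0 < \<epsilon>" "\<And>n t i. modulus F c n t < ennreal \<epsilon> \<Longrightarrow> i < n \<Longrightarrow> 0 \<le> t i \<Longrightarrow> t (Suc i) \<le> L \<Longrightarrow> t (Suc i) - t i \<le> \<delta>"
    by (rule mesh_le_of_modulus[OF c \<delta>(1)]) blast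
  have "\<forall>\<^sub>F h in sequentially. modulus F c (n h) (t h) < ennreal \<epsilon>"
    using mod by (rule order_tendstoD) (use \<epsilon>(1) in simp)
  then show ?thesis
  proof eventually_elim
    case (elim h)
    have ins: "inscribed \<A> F c 0 L (n h) (t h) (\<tau> h) (P h)" and ends: "t h 0 = 0" "t h (n h) = L" "\<tau> h 0 = 0" "\<tau> h (n h) = L"
      and cv: "const_velocity F (n h) (\<tau> h) (P h)" using P[of h] by auto
    have n: "0 < n h" and tm: "\<And>i. i < n h \<Longrightarrow> t h i < t h (Suc i)"
      using ins by (auto simp: inscribed_def polygonal_def)
    have tI: "0 \<le> t h i" "t h i \<le> L" if "i \<le> n h" for i
      using incseq_upto[of "n h" "t h" 0 i] incseq_upto[of "n h" "t h" i "n h"] tm ends that less_imp_le by auto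
    have mesh: "t h (Suc i) - t h i \<le> \<delta>" if "i < n h" for i
      by (rule \<epsilon>(2)[OF elim that]) (use tI[of i] tI[of "Suc i"] that in auto)
    have chord: "L - \<eta> \<le> (\<Sum>i<n h. dist (F (c (t h i))) (F (c (t h (Suc i)))))"
      using \<delta>(2) by (intro \<delta>1(2)[OF n ends(1,2) tm] order_trans[OF mesh])
    obtain K where K: "connected K" "c s \<in> K" "P h s \<in> K" "F ` K \<subseteq> cball (F (c s)) (4 * \<delta> + \<eta>)"
      using inscribed_polygonal_close[OF c ins ends cv mesh chord \<eta>(2) s] by blast
    have "4 * \<delta> + \<eta> < e" using \<delta>(3) \<eta>(3) e by simp
    then have "F ` K \<subseteq> ball (F (c s)) e" using K(4) by fastforce
    then show ?case using K by blast
  qed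
qed

text \<open>Closeness of \<open>F (q h)\<close> to \<open>F p\<close> alone could mean another sheet
  of the immersion. The connected sets force \<open>q h\<close> into the chart at \<open>p\<close>,
  with converging coordinates; there the derivative of the immersion, applied to one fixed
  coordinate vector \<open>v\<close>, gives the approximating tangent vectors.\<close>

lemma tangent_plane_limit:
  fixes F :: "'m::t2_space \<Rightarrow> real^'n" and \<A> :: "'m atlas"
  assumes S: "closed_immersed_surface \<A> F" and e: "e \<in> tangent_plane \<A> F p"
    and close: "\<And>\<epsilon>. 0 < \<epsilon> \<Longrightarrow> \<forall>\<^sub>F h in sequentially. \<exists>K. connected K \<and> p \<in> K \<and> q h \<in> K \<and> F ` K \<subseteq> ball (F p) \<epsilon>"
  obtains z where "\<forall>\<^sub>F h in sequentially. z h \<in> tangent_plane \<A> F (q h)" "z \<longlonglongrightarrow> e"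
proof -
  obtain D \<phi> x0 v where ch: "(D, \<phi>) \<in> \<A>" "x0 \<in> D" "\<phi> x0 = p" "e = frechet_derivative (F \<circ> \<phi>) (at x0) v"
    using e unfolding tangent_plane_def by blast
  have A: "C3_atlas \<A>" and F: "Ck 3 (F \<circ> \<phi>) D" "inj (frechet_derivative (F \<circ> \<phi>) (at x0))"
    using S ch by (auto simp: closed_immersed_surface_def)
  have D: "open D" "open (\<phi> ` D)" using A ch(1) unfolding C3_atlas_def by blast+
  obtain \<psi> where hom: "homeomorphism D (\<phi> ` D) \<phi> \<psi>" using A ch(1) unfolding C3_atlas_def by blast
  obtain \<rho> k where \<rho>: "0 < \<rho>" "0 < k" "cball x0 \<rho> \<subseteq> D"
    "\<And>x y. x \<in> cball x0 \<rho> \<Longrightarrow> y \<in> cball x0 \<rho> \<Longrightarrow> k * norm (x - y) \<le> norm ((F \<circ> \<phi>) x - (F \<circ> \<phi>) y)"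
    using immersion_locally_bilipschitz[OF F(1) D(1) ch(2) F(2)] by metis
  define x where "x h = \<psi> (q h)" for h
  have in_ball: "\<forall>\<^sub>F h in sequentially. x h \<in> ball x0 r \<and> \<phi> (x h) = q h" if r: "0 < r" "r \<le> \<rho>" for r
  proof -
    have "0 < k * r" using r \<rho>(2) by simp
    from close[OF this] show ?thesis
    proof eventually_elim
      case (elim h)
      then obtain K where K: "connected K" "p \<in> K" "q h \<in> K" "F ` K \<subseteq> ball (F p) (k * r)" by blast
      have sub: "cball x0 r \<subseteq> D" using \<rho>(3) r by (meson order_trans subset_cball)
      have "K \<subseteq> \<phi> ` ball x0 r"
      proof (rule connected_in_chart_ball[OF hom D sub r(1)])
        fix y assume "y \<in> cball x0 r"
        then show "k * norm (y - x0) \<le> norm (F (\<phi> y) - F (\<phi> x0))" using \<rho>(4)[of y x0] r \<rho>(1) by auto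
      qed (use K ch(3) in auto)
      then obtain y where y: "y \<in> ball x0 r" "q h = \<phi> y" using K(3) by blast
      moreover have "y \<in> D" using y(1) sub by auto
      ultimately show ?case using homeomorphism_apply1[OF hom \<open>y \<in> D\<close>] by (simp add: x_def)
    qed
  qed
  have x: "x \<longlonglongrightarrow> x0"
  proof (rule tendstoI)
    fix r :: real assume "0 < r"
    then have "\<forall>\<^sub>F h in sequentially. x h \<in> ball x0 (min r \<rho>) \<and> \<phi> (x h) = q h" by (intro in_ball) (use \<rho>(1) in auto)
    then show "\<forall>\<^sub>F h in sequentially. dist (x h) x0 < r" by eventually_elim (auto simp: dist_commute)
  qed
  have "Ck (Suc (Suc 0)) (\<lambda>y. frechet_derivative (F \<circ> \<phi>) (at y) v) D"
    using F(1) by (simp add: numeral_3_eq_3)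
  then have "continuous_on D (\<lambda>y. frechet_derivative (F \<circ> \<phi>) (at y) v)" by (rule Ck_imp_continuous_on)
  then have "isCont (\<lambda>y. frechet_derivative (F \<circ> \<phi>) (at y) v) x0"
    using D(1) ch(2) by (simp add: continuous_on_eq_continuous_at)
  then have "(\<lambda>h. frechet_derivative (F \<circ> \<phi>) (at (x h)) v) \<longlonglongrightarrow> e"
    unfolding ch(4) using x by (rule isCont_tendsto_compose)
  moreover have "\<forall>\<^sub>F h in sequentially. frechet_derivative (F \<circ> \<phi>) (at (x h)) v \<in> tangent_plane \<A> F (q h)"
    using in_ball[OF \<rho>(1) order_refl]
  proof eventually_elim
    case (elim h)
    then have "x h \<in> D" using \<rho>(3) by auto
    then show ?case using elim by (intro range_subset_tangent_plane[OF ch(1)]) auto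
  qed
  ultimately show ?thesis by (rule that[rotated])
qed

text \<open>The derivatives converge in L1, so a subsequence converges a.e. At almost every point
  each vector of the limit plane is a limit of vectors tangent along the polygonals, to which the
  approximating derivatives are orthogonal, and the scalar products pass to the limit.\<close>

lemma weak_parallel_transport_normal:
  fixes F :: "'m::t2_space \<Rightarrow> real^'n" and \<A> :: "'m atlas"
  assumes S: "closed_immersed_surface \<A> F" and c: "arc_length_curve F c L"
    and X: "weak_parallel_transport \<A> F c L X"
  obtains X0 g where "integrable lborel g" "\<And>x y. x \<le> y \<Longrightarrow> X0 y - X0 x = (LINT s:{x<..y}|lborel. g s)"
    "AE s in lebesgue_on {0<..<L}. X s = X0 s"
    "AE s in lborel. s \<in> {0<..<L} \<longrightarrow> (\<forall>z\<in>tangent_plane \<A> F (c s). g s \<bullet> z = 0)"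
proof -
  let ?I = "{0<..<L}" and ?\<Lambda> = "lebesgue_on {0<..<L}"
  have L: "0 < L" using c by (simp add: arc_length_curve_def)
  obtain n t \<tau> P Xs r where
    P: "\<And>h. inscribed \<A> F c 0 L (n h) (t h) (\<tau> h) (P h) \<and> t h 0 = 0 \<and> t h (n h) = L \<and>
      \<tau> h 0 = 0 \<and> \<tau> h (n h) = L \<and> const_velocity F (n h) (\<tau> h) (P h)"
    and pt: "\<And>h. parallel_transport \<A> F L (P h) (Xs h)"
    and mod: "(\<lambda>h. modulus F c (n h) (t h)) \<longlonglongrightarrow> 0"
    and r: "strict_mono (r :: nat \<Rightarrow> nat)" and W: "W11_tendsto ?I (\<lambda>h. Xs (r h)) X"
    using X unfolding weak_parallel_transport_def by blast
  obtain gs g1 where gs: "\<And>h. weak_deriv ?I (Xs (r h)) (gs h)" and g1: "weak_deriv ?I X g1"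
    and lim: "(\<lambda>h. (LINT x|?\<Lambda>. norm (Xs (r h) x - X x)) + (LINT x|?\<Lambda>. norm (gs h x - g1 x))) \<longlonglongrightarrow> 0"
    using W unfolding W11_tendsto_def by blast
  obtain X0 g where g: "integrable lborel g" "AE x in ?\<Lambda>. g1 x = g x"
    and X0: "\<And>x y. x \<le> y \<Longrightarrow> X0 y - X0 x = (LINT s:{x<..y}|lborel. g s)" "AE x in ?\<Lambda>. X x = X0 x"
    by (rule weak_deriv_representative[OF L g1]) (rule that; assumption)
  have normal: "AE s in ?\<Lambda>. \<forall>z\<in>tangent_plane \<A> F (P (r h) s). gs h s \<bullet> z = 0" for h
  proof -
    obtain f0 g0 where g0: "integrable lborel g0" "AE x in ?\<Lambda>. gs h x = g0 x"
      and f0: "\<And>x y. x \<le> y \<Longrightarrow> f0 y - f0 x = (LINT s:{x<..y}|lborel. g0 s)" "AE x in ?\<Lambda>. Xs (r h) x = f0 x"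
      by (rule weak_deriv_representative[OF L gs[of h]]) (rule that; assumption)
    obtain T where T: "finite T" "\<And>s z. s \<in> {0..L} - T \<Longrightarrow> z \<in> tangent_plane \<A> F (P (r h) s) \<Longrightarrow>
        vector_derivative (Xs (r h)) (at s) \<bullet> z = 0"
      using pt[of "r h"] unfolding parallel_transport_def by blast
    have cont: "continuous_on {0..L} (Xs (r h))" using pt[of "r h"] by (simp add: parallel_transport_def)
    \<comment> \<open>The transport is continuous, so it coincides on the whole interval with its
      representative \<open>f0\<close>; its classical derivative, normal off a finite set, is
      therefore the weak one a.e.\<close>
    have eq: "Xs (r h) s = f0 s" if s: "s \<in> ?I" for s
    proof (rule right_cont_AE_eq[OF f0(2) s])
      have "isCont (Xs (r h)) s" using continuous_on_interior[OF cont, of s] s by simp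
      then show "(Xs (r h) \<longlongrightarrow> Xs (r h) s) (at_right s)"
        unfolding isCont_def by (rule filterlim_mono) (auto simp: at_le)
      show "(f0 \<longlongrightarrow> f0 s) (at_right s)" by (rule indefinite_integral_right_cont[OF L g0(1) f0(1) s])
    qed
    have "AE s in lborel. s \<in> ?I \<longrightarrow> (f0 has_vector_derivative g0 s) (at s)"
      by (rule AE_has_vector_derivative_lborel[OF g0(1)]) (use f0(1) in auto)
    then have "AE s in lebesgue. s \<in> ?I \<longrightarrow> (f0 has_vector_derivative g0 s) (at s)" by (rule AE_completion)
    then have 1: "AE s in ?\<Lambda>. (f0 has_vector_derivative g0 s) (at s)" by (subst AE_restrict_space_iff) auto
    have "T \<in> null_sets lborel" using T(1) by (intro finite_imp_null_set_lborel)
    then have "AE s in lborel. s \<notin> T" by (rule AE_not_in)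
    then have "AE s in lebesgue. s \<notin> T" by (rule AE_completion)
    then have 2: "AE s in ?\<Lambda>. s \<notin> T" by (subst AE_restrict_space_iff) (auto elim: eventually_mono)
    show ?thesis
      using 1 2 g0(2) AE_space[of ?\<Lambda>]
    proof eventually_elim
      case (elim s)
      then have s: "s \<in> ?I" by simp
      have "(Xs (r h) has_vector_derivative g0 s) (at s)"
        by (rule has_vector_derivative_transform_within_open[OF elim(1) _ s]) (auto simp: eq)
      then have "vector_derivative (Xs (r h)) (at s) = gs h s" using elim(3) by (simp add: vector_derivative_at)
      moreover have "s \<in> {0..L} - T" using s elim(2) by auto
      ultimately show ?case using T(2) by metis
    qed
  qed
  have gsi: "integrable ?\<Lambda> (gs h)" "integrable ?\<Lambda> g1" for h using gs[of h] g1 by (auto simp: weak_deriv_def)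
  have "(\<lambda>h. LINT x|?\<Lambda>. norm (gs h x - g1 x)) \<longlonglongrightarrow> 0"
    by (rule tendsto_sandwich[OF _ _ tendsto_const lim])
      (auto intro!: always_eventually Bochner_Integration.integral_nonneg)
  then obtain q where q: "strict_mono q" "AE x in ?\<Lambda>. (\<lambda>h. gs (q h) x - g1 x) \<longlonglongrightarrow> 0"
    using tendsto_L1_AE_subseq[of ?\<Lambda> "\<lambda>h x. gs h x - g1 x"] gsi by auto
  have "AE s in ?\<Lambda>. \<forall>h. \<forall>z\<in>tangent_plane \<A> F (P (r h) s). gs h s \<bullet> z = 0"
    using normal by (simp add: AE_all_countable)
  then have "AE s in ?\<Lambda>. \<forall>z\<in>tangent_plane \<A> F (c s). g s \<bullet> z = 0"
    using q(2) g(2) AE_space[of ?\<Lambda>]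
  proof eventually_elim
    case (elim s)
    have s: "s \<in> {0..L}" using elim(4) by auto
    have rq: "filterlim (\<lambda>h. r (q h)) sequentially sequentially"
      using filterlim_compose[OF filterlim_subseq[OF r] filterlim_subseq[OF q(1)]] .
    show ?case
    proof
      fix z assume z: "z \<in> tangent_plane \<A> F (c s)"
      have close: "\<forall>\<^sub>F h in sequentially. \<exists>K. connected K \<and> c s \<in> K \<and> P (r (q h)) s \<in> K \<and> F ` K \<subseteq> ball (F (c s)) \<epsilon>"
        if "0 < \<epsilon>" for \<epsilon>
        using eventually_compose_filterlim[OF inscribed_polygonals_converge[OF c P mod s that] rq] .
      obtain zs where zs: "\<forall>\<^sub>F h in sequentially. zs h \<in> tangent_plane \<A> F (P (r (q h)) s)" "zs \<longlonglongrightarrow> z"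
        by (rule tangent_plane_limit[OF S z close]) (assumption, rule that)
      have "(\<lambda>h. gs (q h) s) \<longlonglongrightarrow> g1 s" using elim(2) by (rule LIM_zero_cancel)
      then have "(\<lambda>h. gs (q h) s \<bullet> zs h) \<longlonglongrightarrow> g1 s \<bullet> z" using zs(2) by (intro tendsto_inner)
      moreover have "\<forall>\<^sub>F h in sequentially. gs (q h) s \<bullet> zs h = 0" using zs(1) by eventually_elim (use elim(1) in blast)
      ultimately have "(\<lambda>h. 0) \<longlonglongrightarrow> g1 s \<bullet> z" by (rule Lim_transform_eventually)
      then have "g1 s \<bullet> z = 0" by (simp add: LIMSEQ_const_iff)
      then show "g s \<bullet> z = 0" using elim(3) by simp
    qed
  qed
  then have "AE s in lebesgue. s \<in> ?I \<longrightarrow> (\<forall>z\<in>tangent_plane \<A> F (c s). g s \<bullet> z = 0)"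
    by (subst (asm) AE_restrict_space_iff) auto
  then have "AE s in lborel. s \<in> ?I \<longrightarrow> (\<forall>z\<in>tangent_plane \<A> F (c s). g s \<bullet> z = 0)"
    by (simp add: AE_completion_iff)
  then show ?thesis using that[OF g(1) X0] by blast
qed

section \<open>The moving frame along the curve and the conclusion\<close>

lemma conormal_eq_quarter_turn: "conormal F c e1 e2 s = quarter_turn (e1 s) (e2 s) (tantrix F c s)"
  by (simp add: conormal_def quarter_turn_def)

lemma quarter_turn_orthonormal:
  fixes a b v :: "'a::real_inner"
  assumes ab: "norm a = 1" "norm b = 1" "a \<bullet> b = 0" and v: "v = (v \<bullet> a) *\<^sub>R a + (v \<bullet> b) *\<^sub>R b"
  shows "quarter_turn a b v \<bullet> v = 0" "norm (quarter_turn a b v) = norm v"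
    "quarter_turn a b (quarter_turn a b v) = - v"
proof -
  define k l where "k = v \<bullet> a" and "l = v \<bullet> b"
  have vkl: "a \<bullet> v = k" "b \<bullet> v = l" by (simp_all add: k_def l_def inner_commute)
  have J: "quarter_turn a b v = k *\<^sub>R b - l *\<^sub>R a" by (simp add: quarter_turn_def k_def l_def)
  have i: "a \<bullet> a = 1" "b \<bullet> b = 1" "b \<bullet> a = 0" using ab by (auto simp: norm_eq_1 inner_commute)
  show "quarter_turn a b v \<bullet> v = 0"
    by (simp add: J inner_diff_left vkl)
  have "v \<bullet> v = v \<bullet> (k *\<^sub>R a + l *\<^sub>R b)" unfolding k_def l_def using v by (rule arg_cong)
  then have "v \<bullet> v = k * k + l * l" by (simp add: inner_add_right k_def l_def)
  moreover have "quarter_turn a b v \<bullet> quarter_turn a b v = k * k + l * l"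
    using ab(3) i by (simp add: J inner_diff)
  ultimately show "norm (quarter_turn a b v) = norm v" by (simp add: norm_eq_sqrt_inner)
  have "quarter_turn a b v \<bullet> a = - l" "quarter_turn a b v \<bullet> b = k"
    using ab(3) i by (simp_all add: J inner_diff_left)
  then have "quarter_turn a b (quarter_turn a b v) = - (k *\<^sub>R a + l *\<^sub>R b)"
    by (simp add: quarter_turn_def[of a b "quarter_turn a b v"])
  then show "quarter_turn a b (quarter_turn a b v) = - v" using v by (simp add: k_def l_def)
qed

text \<open>The part \<open>w\<close> of the tantrix orthogonal to the tangent plane is a normal
  vector, so it is orthogonal to the velocity as well; being orthogonal both to the tantrix and to
  its tangential part, it vanishes.\<close>

lemma tantrix_AE:
  fixes F :: "'m::t2_space \<Rightarrow> real^'n" and \<A> :: "'m atlas"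
  assumes S: "closed_immersed_surface \<A> F" and c: "arc_length_curve F c L"
    and e: "orienting_frame \<A> F c L e1 e2"
  shows "AE s in lebesgue_on {0<..<L}. norm (tantrix F c s) = 1 \<and>
    tantrix F c s = (tantrix F c s \<bullet> e1 s) *\<^sub>R e1 s + (tantrix F c s \<bullet> e2 s) *\<^sub>R e2 s"
proof -
  have cc: "continuous_on {0..L} c" using c by (simp add: arc_length_curve_def)
  have lip: "norm (F (c s) - F (c r)) \<le> \<bar>s - r\<bar>" if "s \<in> {0..L}" "r \<in> {0..L}" for s r
    using arc_length_curve_lipschitz[OF c, of r s] arc_length_curve_lipschitz[OF c, of s r] that
    by (cases "r \<le> s") (auto simp: dist_norm norm_minus_commute)
  have "AE s in lebesgue. s \<in> {0<..<L} \<longrightarrow> (F \<circ> c has_vector_derivative tantrix F c s) (at s) \<and> norm (tantrix F c s) = 1"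
    using arc_length_curve_unit_speed[OF c] by (rule AE_completion)
  then have "AE s in lebesgue_on {0<..<L}. (F \<circ> c has_vector_derivative tantrix F c s) (at s) \<and> norm (tantrix F c s) = 1"
    by (subst AE_restrict_space_iff) auto
  then show ?thesis
    using AE_space[of "lebesgue_on {0<..<L}"]
  proof eventually_elim
    case (elim s)
    let ?t = "tantrix F c s"
    have s: "s \<in> {0<..<L}" using elim(2) by simp
    have fr: "norm (e1 s) = 1" "norm (e2 s) = 1" "e1 s \<bullet> e2 s = 0" "span {e1 s, e2 s} = tangent_plane \<A> F (c s)"
      using e s unfolding orienting_frame_def by auto
    define w where "w = ?t - ((?t \<bullet> e1 s) *\<^sub>R e1 s + (?t \<bullet> e2 s) *\<^sub>R e2 s)"
    have w1: "w \<bullet> e1 s = 0" "w \<bullet> e2 s = 0"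
      using fr(1,2,3) inner_commute[of "e1 s" "e2 s"] by (simp_all add: w_def inner_diff_left inner_add_left norm_eq_1)
    have "w \<bullet> ?t = 0"
    proof (rule velocity_orthogonal_normal[OF S cc lip s])
      show "(F \<circ> c has_vector_derivative ?t) (at s)" using elim by simp
      fix z assume "z \<in> tangent_plane \<A> F (c s)"
      then have "z = (z \<bullet> e1 s) *\<^sub>R e1 s + (z \<bullet> e2 s) *\<^sub>R e2 s"
        using span_orthonormal_expand[OF fr(1,2,3)] fr(4) by simp
      then show "w \<bullet> z = 0" using w1 by (metis add_0 inner_add_right inner_scaleR_right mult_zero_right)
    qed
    then have "w \<bullet> w = 0" using w1 by (subst (2) w_def) (simp add: inner_diff_right inner_add_right)
    then show ?case using elim by (simp add: w_def)
  qed
qed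

theorem theorem1p2:
  fixes \<A> :: "'m::t2_space atlas"
    and F :: "'m \<Rightarrow> real^'n"
    and c :: "real \<Rightarrow> 'm"
    and L :: real
    and e\<^sub>1 e\<^sub>2 X :: "real \<Rightarrow> real^'n"
    and \<Theta> :: "real \<Rightarrow> real"
  assumes "CARD('n) \<ge> 3"
    and "closed_immersed_surface \<A> F"
    and "arc_length_curve F c L"
    and "total_intrinsic_curvature \<A> F c 0 L < \<infinity>"
    and "orienting_frame \<A> F c L e\<^sub>1 e\<^sub>2"
    and "weak_parallel_transport \<A> F c L X"
    and "optimal_angle_function F c L e\<^sub>1 e\<^sub>2 X \<Theta>"
  shows "let I = {0<..<L}; t = tantrix F c; u = conormal F c e\<^sub>1 e\<^sub>2 in
      total_variation (D_ac I \<Theta>) I = (\<integral>\<^sup>+ s. ennreal \<bar>ae_deriv t s \<bullet> u s\<bar> \<partial>lebesgue_on I) \<and>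
      total_variation (D_cantor I \<Theta>) I = total_variation (D_cantor I t) I \<and>
      total_variation (D_jump I \<Theta>) I = (\<Sum>\<^sub>\<infinity>s\<in>jump_set I t. sphere_dist (rlim t s) (llim t s))"
proof -
  note S = assms(2) and c = assms(3) and e = assms(5)
  let ?I = "{0<..<L}" and ?\<Lambda> = "lebesgue_on {0<..<L}"
  let ?t = "tantrix F c" and ?u = "conormal F c e\<^sub>1 e\<^sub>2"
  let ?J = "\<lambda>s. quarter_turn (e\<^sub>1 s) (e\<^sub>2 s)"
  have L: "0 < L" and cc: "continuous_on {0..L} c" using c by (simp_all add: arc_length_curve_def)
  have lip: "norm (F (c s) - F (c r)) \<le> \<bar>s - r\<bar>" if "s \<in> {0..L}" "r \<in> {0..L}" for s r
    using arc_length_curve_lipschitz[OF c, of r s] arc_length_curve_lipschitz[OF c, of s r] that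
    by (cases "r \<le> s") (auto simp: dist_norm norm_minus_commute)
  have \<Theta>: "BV ?I \<Theta>" "\<And>s. s \<in> jump_set ?I \<Theta> \<Longrightarrow> \<bar>rlim \<Theta> s - llim \<Theta> s\<bar> \<le> pi"
    and X\<Theta>: "AE s in ?\<Lambda>. X s = cos (\<Theta> s) *\<^sub>R ?t s - sin (\<Theta> s) *\<^sub>R ?u s"
    using assms(7) by (auto simp: optimal_angle_function_def angle_function_def)
  have fr: "norm (e\<^sub>1 s) = 1" "norm (e\<^sub>2 s) = 1" "e\<^sub>1 s \<bullet> e\<^sub>2 s = 0" "span {e\<^sub>1 s, e\<^sub>2 s} = tangent_plane \<A> F (c s)"
    if "s \<in> {0..L}" for s using e that unfolding orienting_frame_def by auto
  obtain X0 g where g: "integrable lborel g" "\<And>x y. x \<le> y \<Longrightarrow> X0 y - X0 x = (LINT s:{x<..y}|lborel. g s)"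
    and XX0: "AE s in ?\<Lambda>. X s = X0 s"
    and gn: "AE s in lborel. s \<in> ?I \<longrightarrow> (\<forall>z\<in>tangent_plane \<A> F (c s). g s \<bullet> z = 0)"
    by (rule weak_parallel_transport_normal[OF S c assms(6)]) (rule that; assumption)
  have t_ae: "AE s in ?\<Lambda>. norm (?t s) = 1 \<and> ?t s = (?t s \<bullet> e\<^sub>1 s) *\<^sub>R e\<^sub>1 s + (?t s \<bullet> e\<^sub>2 s) *\<^sub>R e\<^sub>2 s"
    by (rule tantrix_AE[OF S c e])
  \<comment> \<open>The angle function writes \<open>X0\<close> as a rotation of \<open>t\<close> in
    the basis of tantrix and conormal. The turned copy of \<open>X0\<close> follows because the
    quarter turn sends the conormal to \<open>- t\<close>, and inverting the rotation gives back
    both vectors.\<close>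
  have comb: "AE s in ?\<Lambda>. X0 s = cos (\<Theta> s) *\<^sub>R ?t s - sin (\<Theta> s) *\<^sub>R ?u s \<and> norm (X0 s) = 1 \<and>
      X0 s = (X0 s \<bullet> e\<^sub>1 s) *\<^sub>R e\<^sub>1 s + (X0 s \<bullet> e\<^sub>2 s) *\<^sub>R e\<^sub>2 s \<and>
      ?t s = cos (\<Theta> s) *\<^sub>R X0 s + sin (\<Theta> s) *\<^sub>R ?J s (X0 s) \<and>
      ?u s = cos (\<Theta> s) *\<^sub>R ?J s (X0 s) - sin (\<Theta> s) *\<^sub>R X0 s"
    using XX0 X\<Theta> t_ae AE_space[of ?\<Lambda>]
  proof eventually_elim
    case (elim s)
    have s: "s \<in> {0..L}" using elim(4) by auto
    define t u where "t = ?t s" and "u = ?u s"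
    have uJ: "u = ?J s t" by (simp add: u_def t_def conormal_eq_quarter_turn)
    have t1: "norm t = 1" "t = (t \<bullet> e\<^sub>1 s) *\<^sub>R e\<^sub>1 s + (t \<bullet> e\<^sub>2 s) *\<^sub>R e\<^sub>2 s" using elim(3) by (auto simp: t_def)
    note J = quarter_turn_orthonormal[OF fr(1,2,3)[OF s] t1(2)]
    have X: "X0 s = cos (\<Theta> s) *\<^sub>R t - sin (\<Theta> s) *\<^sub>R u" using elim by (simp add: t_def u_def)
    have inn: "t \<bullet> t = 1" "u \<bullet> u = 1" "t \<bullet> u = 0" "u \<bullet> t = 0"
      using t1(1) J(1,2) by (simp_all add: uJ norm_eq_1[symmetric] inner_commute)
    have "X0 s \<bullet> X0 s = 1" using inn by (simp add: X inner_diff flip: power2_eq_square)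
    then have n1: "norm (X0 s) = 1" by (simp add: norm_eq_1)
    have "t \<in> span {e\<^sub>1 s, e\<^sub>2 s}" by (subst t1(2)) (intro span_add span_scale span_base; simp)
    moreover have "u \<in> span {e\<^sub>1 s, e\<^sub>2 s}" unfolding uJ quarter_turn_def by (intro span_diff span_scale span_base) auto
    ultimately have "X0 s \<in> span {e\<^sub>1 s, e\<^sub>2 s}" unfolding X by (intro span_diff span_scale)
    then have X1: "X0 s = (X0 s \<bullet> e\<^sub>1 s) *\<^sub>R e\<^sub>1 s + (X0 s \<bullet> e\<^sub>2 s) *\<^sub>R e\<^sub>2 s" by (rule span_orthonormal_expand[OF fr(1,2,3)[OF s]])
    have "?J s (X0 s) = cos (\<Theta> s) *\<^sub>R ?J s t - sin (\<Theta> s) *\<^sub>R ?J s u"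
      unfolding X by (simp add: quarter_turn_def inner_diff_left algebra_simps)
    then have Y: "?J s (X0 s) = cos (\<Theta> s) *\<^sub>R u + sin (\<Theta> s) *\<^sub>R t" using J(3) by (simp add: uJ)
    have "cos (\<Theta> s) *\<^sub>R X0 s + sin (\<Theta> s) *\<^sub>R ?J s (X0 s) = ((cos (\<Theta> s))\<^sup>2 + (sin (\<Theta> s))\<^sup>2) *\<^sub>R t"
      unfolding Y unfolding X
      by (simp add: algebra_simps power2_eq_square del: sin_cos_squared_add sin_cos_squared_add2 sin_cos_squared_add3)
    moreover have "cos (\<Theta> s) *\<^sub>R ?J s (X0 s) - sin (\<Theta> s) *\<^sub>R X0 s = ((cos (\<Theta> s))\<^sup>2 + (sin (\<Theta> s))\<^sup>2) *\<^sub>R u"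
      unfolding Y unfolding X
      by (simp add: algebra_simps power2_eq_square del: sin_cos_squared_add sin_cos_squared_add2 sin_cos_squared_add3)
    ultimately show ?case using X X1 n1 by (simp add: t_def u_def)
  qed
  have X0_cont: "(X0 \<longlongrightarrow> X0 s) (at_right s)" if "s \<in> ?I" for s
    by (rule indefinite_integral_right_cont[OF L g that])
  have e_cont: "(e\<^sub>1 \<longlongrightarrow> e\<^sub>1 s) (at_right s)" "(e\<^sub>2 \<longlongrightarrow> e\<^sub>2 s) (at_right s)" if s: "s \<in> ?I" for s
  proof -
    have *: "(f \<longlongrightarrow> f s) (at_right s)" if "continuous_on {0..L} f" for f :: "real \<Rightarrow> real^'n"
    proof -
      have "isCont f s" using continuous_on_interior[OF that, of s] s by simp
      then show ?thesis unfolding isCont_def by (rule filterlim_mono) (auto simp: at_le)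
    qed
    show "(e\<^sub>1 \<longlongrightarrow> e\<^sub>1 s) (at_right s)" "(e\<^sub>2 \<longlongrightarrow> e\<^sub>2 s) (at_right s)"
      using e by (auto intro!: * simp: orienting_frame_def)
  qed
  \<comment> \<open>These identities hold a.e. between right-continuous functions, hence at every
    point. A pointwise frame is needed so that its constant scalar products can be
    differentiated.\<close>
  have X0: "norm (X0 s) = 1" "X0 s = (X0 s \<bullet> e\<^sub>1 s) *\<^sub>R e\<^sub>1 s + (X0 s \<bullet> e\<^sub>2 s) *\<^sub>R e\<^sub>2 s" if s: "s \<in> ?I" for s
  proof -
    have "AE s in ?\<Lambda>. norm (X0 s) = 1" using comb by eventually_elim blast
    then show "norm (X0 s) = 1"
      by (rule right_cont_AE_eq[OF _ s]) (intro tendsto_intros X0_cont[OF s])+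
    have "AE s in ?\<Lambda>. X0 s = (X0 s \<bullet> e\<^sub>1 s) *\<^sub>R e\<^sub>1 s + (X0 s \<bullet> e\<^sub>2 s) *\<^sub>R e\<^sub>2 s" using comb by eventually_elim blast
    then show "X0 s = (X0 s \<bullet> e\<^sub>1 s) *\<^sub>R e\<^sub>1 s + (X0 s \<bullet> e\<^sub>2 s) *\<^sub>R e\<^sub>2 s"
      by (rule right_cont_AE_eq[OF _ s]) (intro tendsto_intros X0_cont[OF s] e_cont[OF s])+
  qed
  define Y where "Y s = ?J s (X0 s)" for s
  have on: "norm (X0 s) = 1 \<and> norm (Y s) = 1 \<and> X0 s \<bullet> Y s = 0" if s: "s \<in> ?I" for s
    using quarter_turn_orthonormal[OF fr(1,2,3) X0(2)[OF s]] X0(1)[OF s] s by (auto simp: Y_def inner_commute)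
  obtain K where K: "0 \<le> K" "\<And>s r v. s \<in> {0..L} \<Longrightarrow> r \<in> {0..L} \<Longrightarrow> norm (?J s v - ?J r v) \<le> K * \<bar>s - r\<bar> * norm v"
    by (rule quarter_turn_lipschitz[OF S cc lip e]) (assumption | rule that)+
  define B where "B = norm (X0 0) + (LINT s|lborel. norm (g s))"
  have gB: "norm (X0 y - X0 x) \<le> (LINT s:{x<..y}|lborel. norm (g s))" if "x \<le> y" for x y
    unfolding g(2)[OF that] by (rule set_integral_norm_bound) (auto intro!: integrable_imp_set_integrable g(1))
  have B: "norm (X0 s) \<le> B" if "s \<in> {0..L}" for s
  proof -
    have "norm (X0 s) \<le> norm (X0 0) + norm (X0 s - X0 0)" using norm_triangle_sub[of "X0 s" "X0 0"] by simp
    also have "norm (X0 s - X0 0) \<le> (LINT r:{0<..s}|lborel. norm (g r))" by (rule gB) (use that in auto)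
    also have "\<dots> \<le> (LINT r|lborel. norm (g r))"
      unfolding set_lebesgue_integral_def
      by (rule integral_mono)
        (use integrable_mult_indicator[OF _ integrable_norm[OF g(1)], of "{0<..s}"] g(1) in \<open>auto simp: mult_left_le_one_le\<close>)
    finally show ?thesis by (simp add: B_def)
  qed
  have B0: "0 \<le> B" using B[of 0] L norm_ge_zero[of "X0 0"] by (meson atLeastAtMost_iff less_imp_le order_refl order_trans)
  \<comment> \<open>Increments of \<open>Y\<close> have two sources: the increment of
    \<open>X0\<close>, at most doubled by the turn, and the Lipschitz variation of the turn itself,
    applied to vectors of norm at most \<open>B\<close>.\<close>
  define w where "w s = 2 * norm (g s) + K * B * indicator {0<..L} s" for s :: real
  have ind: "integrable lborel (\<lambda>s. K * B * indicator {0<..L} s)"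
    using L by (intro integrable_mult_right) (auto simp: integrable_indicator_iff)
  have w: "integrable lborel w" "\<And>s. 0 \<le> w s"
    using g(1) ind K(1) B0 by (auto simp: w_def[abs_def])
  have "norm (Y y - Y x) \<le> (LINT s:{x<..y}|lborel. w s)" if xy: "0 \<le> x" "x \<le> y" "y \<le> L" for x y
  proof -
    have "Y y - Y x = ?J y (X0 y - X0 x) + (?J y (X0 x) - ?J x (X0 x))"
      by (simp add: Y_def quarter_turn_diff)
    also have "norm \<dots> \<le> 2 * norm (X0 y - X0 x) + K * \<bar>y - x\<bar> * norm (X0 x)"
    proof (rule norm_triangle_mono)
      show "norm (?J y (X0 y - X0 x)) \<le> 2 * norm (X0 y - X0 x)"
        using norm_quarter_turn_le[of "e\<^sub>1 y" 1 "e\<^sub>2 y"] fr[of y] xy by simp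
      show "norm (?J y (X0 x) - ?J x (X0 x)) \<le> K * \<bar>y - x\<bar> * norm (X0 x)" by (rule K(2)) (use xy in auto)
    qed
    also have "\<dots> \<le> 2 * (LINT s:{x<..y}|lborel. norm (g s)) + K * \<bar>y - x\<bar> * B"
      using gB[OF xy(2)] B[of x] K(1) xy by (intro add_mono mult_left_mono) auto
    also have "\<dots> = (LINT s:{x<..y}|lborel. 2 * norm (g s)) + (LINT s:{x<..y}|lborel. K * B * indicator {0<..L} s)"
    proof -
      have "(LINT s:{x<..y}|lborel. K * B * indicator {0<..L} s) = (LINT s|lborel. K * B * indicator {x<..y} s)"
        unfolding set_lebesgue_integral_def
        by (rule Bochner_Integration.integral_cong) (use xy in \<open>auto simp: indicator_def\<close>)
      also have "\<dots> = K * B * (y - x)" using xy by simp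
      finally show ?thesis using xy by (auto simp: mult_ac)
    qed
    also have "\<dots> = (LINT s:{x<..y}|lborel. w s)"
      unfolding w_def
      by (rule set_integral_add(2)[symmetric]) (use g(1) ind in \<open>auto intro!: integrable_imp_set_integrable\<close>)
    finally show ?thesis .
  qed
  then obtain gY where gY: "integrable lborel gY"
    "\<And>x y. 0 \<le> x \<Longrightarrow> x \<le> y \<Longrightarrow> y \<le> L \<Longrightarrow> Y y - Y x = (LINT s:{x<..y}|lborel. gY s)"
    by (rule dominated_increments[OF w less_imp_le[OF L]]) (assumption | rule that)+
  have DX: "AE s in lborel. s \<in> ?I \<longrightarrow> (X0 has_vector_derivative g s) (at s)"
    by (rule AE_has_vector_derivative_lborel[OF g(1)]) (use g(2) in auto)
  have DY: "AE s in lborel. s \<in> ?I \<longrightarrow> (Y has_vector_derivative gY s) (at s)"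
    by (rule AE_has_vector_derivative_lborel[OF gY(1)]) (use gY(2) in auto)
  \<comment> \<open>The transport makes \<open>g\<close> normal to the whole plane. For
    \<open>gY\<close> the two components in the plane come from differentiating the constant
    products \<open>X0 \<bullet> Y = 0\<close> and \<open>Y \<bullet> Y = 1\<close>.\<close>
  have normal: "AE s in lborel. s \<in> ?I \<longrightarrow> g s \<bullet> X0 s = 0 \<and> g s \<bullet> Y s = 0 \<and> gY s \<bullet> X0 s = 0 \<and> gY s \<bullet> Y s = 0"
    using DX DY gn
  proof eventually_elim
    case (elim s)
    show ?case
    proof
      assume s: "s \<in> ?I"
      then have sI: "s \<in> {0..L}" by auto
      have D: "(X0 has_vector_derivative g s) (at s)" "(Y has_vector_derivative gY s) (at s)" using elim s by auto
      have "X0 s \<in> span {e\<^sub>1 s, e\<^sub>2 s}" by (subst X0(2)[OF s]) (intro span_add span_scale span_base; simp)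
      moreover have "Y s \<in> span {e\<^sub>1 s, e\<^sub>2 s}" unfolding Y_def quarter_turn_def by (intro span_diff span_scale span_base) auto
      ultimately have 1: "g s \<bullet> X0 s = 0" "g s \<bullet> Y s = 0" using elim(3) s fr(4)[OF sI] by auto
      have const: "((\<lambda>r. P r \<bullet> Q r) has_vector_derivative 0) (at s)"
        if "\<And>r. r \<in> ?I \<Longrightarrow> P r \<bullet> Q r = k" for P Q :: "real \<Rightarrow> real^'n" and k
      proof (rule has_vector_derivative_transform_within_open[of "\<lambda>_. k"])
        show "k = P r \<bullet> Q r" if "r \<in> ?I" for r using that \<open>\<And>r. r \<in> ?I \<Longrightarrow> P r \<bullet> Q r = k\<close> by simp
      qed (use s in auto)
      have prod: "((\<lambda>r. P r \<bullet> Q r) has_vector_derivative P s \<bullet> q + p \<bullet> Q s) (at s)"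
        if "(P has_vector_derivative p) (at s)" "(Q has_vector_derivative q) (at s)" for P Q :: "real \<Rightarrow> real^'n" and p q
        using bounded_bilinear.has_vector_derivative[OF bounded_bilinear_inner that] .
      have "X0 s \<bullet> gY s + g s \<bullet> Y s = 0"
        by (rule vector_derivative_unique_at[OF prod[OF D] const]) (use on in auto)
      moreover have "Y s \<bullet> gY s + gY s \<bullet> Y s = 0"
        by (rule vector_derivative_unique_at[OF prod[OF D(2) D(2)] const[where k=1]]) (use on in \<open>auto simp: norm_eq_1\<close>)
      ultimately show "g s \<bullet> X0 s = 0 \<and> g s \<bullet> Y s = 0 \<and> gY s \<bullet> X0 s = 0 \<and> gY s \<bullet> Y s = 0"
        using 1 by (simp add: inner_commute)
    qed
  qed
  have t: "AE s in ?\<Lambda>. ?t s = cos (\<Theta> s) *\<^sub>R X0 s + sin (\<Theta> s) *\<^sub>R Y s"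
    using comb unfolding Y_def by eventually_elim blast
  have u: "AE s in ?\<Lambda>. ?u s = cos (\<Theta> s) *\<^sub>R Y s - sin (\<Theta> s) *\<^sub>R X0 s"
    using comb unfolding Y_def by eventually_elim blast
  have gX': "X0 y - X0 x = (LINT s:{x<..y}|lborel. g s)" if "0 < x" "x \<le> y" "y < L" for x y
    by (rule g(2)[OF that(2)])
  have gY': "Y y - Y x = (LINT s:{x<..y}|lborel. gY s)" if "0 < x" "x \<le> y" "y < L" for x y
    by (rule gY(2)) (use that in auto)
  note main = bv_angle_identities[OF L \<Theta> g(1) gX' gY(1) gY' on normal t u]
  show ?thesis unfolding Let_def using main by blast
qed

end
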